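(* Assume the following. (1) $G\in\mathcal C^{2,6}_b(\mathbb R\times\mathcal P_2(\mathbb R))$ and, for a constant $L_G>0$, $\|\partial_x^{(k)}G\|,\|\partial_x^{(l)}\partial_\mu G\|,\|\partial_x^{(l)}\partial_{\tilde x\mu}G\|\le L_G$ for $k=1,2,3,4$, $l=1,2$. (2) For every $\xi\in\mathbb L^2(\mathcal F_0)$ and $\alpha\in\mathcal A$, the HJB equation with parameter $\mathbf m:=\mathcal L_{X^{\xi,\alpha}}$ has a unique classical solution $u\in C^{1,6}_b([0,T]\times\mathbb R)$, and there is a constant $L^*_T>0$, possibly depending on $T$ but independent of $\xi,\alpha$, with $\|\partial_x^{(k)}u\|\le L^*_T$, $k=1,2,3,4$. (3) The Hamiltonian is separable: $H(x,z,\gamma,\mu)=H_0(x,z,\gamma)+F_0(x,\mu)$ for some $H_0:\mathbb R^3\to\mathbb R$ and $F_0:\mathbb R\times\mathcal P_2(\mathbb R)\to\mathbb R$. (4) (i) $F_0\in\mathcal C^{2,6}_b(\mathbb R\times\mathcal P_2(\mathbb R))$ and, for a constant $L_{F_0}>0$, $\|\partial_x^{(k)}F_0\|,\|\partial_x^{(l)}\partial_\mu F_0\|,\|\partial_x^{(l)}\partial_{\tilde x\mu}F_0\|\le L_{F_0}$ for $k=1,2,3,4$, $l=1,2$. (ii) $H_0\in C^6(\mathbb R^3)$ and, for every $R>0$, all the involved derivatives are bounded when $(z,\gamma)$ is restricted to $D_R$, and there is $L_{H_0}(R)>0$ with $\|\partial^{(k)}_{(x,z,\gamma)}H_0\|_R\le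 L_{H_0}(R)$, $k=1,2,3,4$. (iii) $\partial_\gamma H_0\ge c_0$ for some $c_0>0$. (iv) For every $R>0$ there is $c_R>0$ such that $$\partial^2_{(z,\gamma)}H_0(x,z,\gamma):=\begin{pmatrix}\partial_{zz}H_0&\partial_{z\gamma}H_0\\ \partial_{z\gamma}H_0&\partial_{\gamma\gamma}H_0\end{pmatrix}(x,z,\gamma)\le-c_RI_{2\times2},\qquad\forall(x,z,\gamma)\in\mathbb R\times D_R.$$ (5) $U=G$ and $U=F_0$ satisfy the Lasry-Lions monotonicity condition $\mathbb E[\partial_{x\mu}U(\xi,\mathcal L_\xi,\tilde\xi)\eta\tilde\eta]\ge0$ for all $\xi,\eta\in\mathbb L^2(\mathcal F_T)$, where $(\tilde\xi,\tilde\eta)$ is an independent copy of $(\xi,\eta)$. Let $V\in\mathcal C^{1,4}_b(\Theta)$ be a classical solution of the master equation $$\partial_tV+H_0(x,\partial_xV,\partial_{xx}V)+F_0(x,\mu)+\int_{\mathbb R}\Big[\partial_\mu V(t,x,\mu,\tilde x)\,\partial_zH_0(\tilde x,\partial_xV(t,\tilde x,\mu),\partial_{xx}V(t,\tilde x,\mu))+\partial_{\tilde x\mu}V(t,x,\mu,\tilde x)\,\partial_\gamma H_0(\tilde x,\partial_xV(t,\tilde x,\mu),\partial_{xx}V(t,\tilde x,\mu))\Big]\mu(d\tilde x)=0,$$ $V(T,x,\mu)=G(x,\mu)$. Then for any $t\in[0,T]$: $$\mathbb E\big[\partial_{x\mu}V(t,\xi,\mathcal L_\xi,\tilde\xi)\eta\tilde\eta\big]\ge0\qquad\text{for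 all }\xi,\eta\in\mathbb L^2(\mathcal F_t),$$ and hence $V(t,\cdot)$ satisfies the second-order Lasry-Lions monotonicity condition $$\mathbb E\big[(\eta_1,\eta_2)\,\mathfrak D_\mu V(t,\xi,\mathcal L_\xi,\tilde\xi)\,(\tilde\eta_1,\tilde\eta_2)^\top\big]\ge0\qquad\text{for all }\xi,\eta_1,\eta_2\in\mathbb L^2(\mathcal F_t),$$ where tildes denote (joint) independent copies.
   Context: Setting: all processes are one-dimensional. $T>0$ is fixed; $(\Omega,\mathbb F,\mathbb P)$ is a filtered probability space with a Brownian motion $B$, $\mathcal F_0$ is rich enough to support every probability measure on $\mathbb R$, and $\mathbb F$ is generated by $\mathcal F_0$ and $B$. $\mathcal P_2(\mathbb R)$ is the set of probability measures with finite second moment, with the 2-Wasserstein distance $W_2$; $\mathbb L^2(\mathcal G)$ is the set of square integrable $\mathcal G$-measurable random variables; $\mathcal L_\xi$ is the law of $\xi$. $\Theta:=[0,T]\times\mathbb R\times\mathcal P_2(\mathbb R)$. Independent copies live on a product space and $\mathbb E$ is the expectation there. Derivatives and spaces: for $W_2$-continuous $U:\mathcal P_2(\mathbb R)\to\mathbb R$, the Lions derivative $\partial_\mu U(\mu,\tilde x)$ satisfies $U(\mathcal L_{\xi+\eta})-U(\mathcal L_\xi)=\mathbb E[\partial_\mu U(\mathcal L_\xi,\xi)\eta]+o(\|\eta\|_2)$ for all $\xi,\eta\in\mathbb L^2(\mathcal F_T)$. Write $\partial_{x\mu}=\partial_x\partial_\mu$, $\partial_{\tilde xx\mu}=\partial_{\tilde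 x}\partial_x\partial_\mu$, etc. Let $\Theta^d:=[0,T]\times\mathbb R^d\times\mathcal P_2(\mathbb R)$, and for $U(t,y,\mu)$ on $\Theta^d$ let $\partial_y^{(k)}$ denote $k$-th order derivatives in $y$. For continuous $U$: $U\in\mathcal C^{1,2}(\Theta^d)$ if $\partial_tU,\partial_yU,\partial_{yy}U,\partial_\mu U,\partial_{y\mu}U,\partial_{\tilde x\mu}U$ exist and are continuous; $\mathcal C^{1,4}(\Theta^d)$ is the set of $U\in\mathcal C^{1,2}(\Theta^d)$ with $\partial_yU,\partial_{yy}U\in\mathcal C^{1,2}(\Theta^d)$; $\mathcal C^{2,6}(\Theta^d)$ is the set of $U\in\mathcal C^{1,4}(\Theta^d)$ with $\partial_y^{(k)}U\in\mathcal C^{1,2}(\Theta^d)$ for $k=0,\dots,4$ and $\partial_y^{(k)}\partial_\mu U,\partial_y^{(k)}\partial_{\tilde x\mu}U\in\mathcal C^{1,2}(\Theta^{d+1})$ for $k=0,1,2$ ($\tilde x$ being treated as an additional space variable). A subscript $b$ means that all involved derivatives (not necessarily $U$) are uniformly bounded. For $t$-independent functions write $\mathcal C_b^{k,n}(\mathbb R^d\times\mathcal P_2(\mathbb R))$. $u\in C^{1,6}_b([0,T]\times\mathbb R)$ means $\partial_tu$ and $\partial_x^{(k)}u$, $1\le k\le6$, exist and are bounded and continuous. Matrix: $\mathfrak D_\mu V(t,x,\mu,\tilde x):=\begin{pmatrix}\partial_{x\mu}V&\partial_{\tilde x x\mu}V\\ \partial_{xx\mu}V&\partial_{\tilde x xx\mu}V\end{pmatrix}(t,x,\mu,\tilde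 x)$. Norms: $D_R:=\{(z,\gamma)\in\mathbb R^2:|z|\le R,|\gamma|\le R\}$; $\|\cdot\|$ is the supremum norm; $\|\cdot\|_R$ is the supremum with $(z,\gamma)$ restricted to $D_R$. $\partial^{(k)}_{(x,z,\gamma)}$ denotes all $k$-th order derivatives in $(x,z,\gamma)$. Data: $A\subset\mathbb R$ is the control set, $b,\sigma,F:\mathbb R\times\mathcal P_2(\mathbb R)\times A\to\mathbb R$ and $G:\mathbb R\times\mathcal P_2(\mathbb R)\to\mathbb R$; $b,\sigma$ are bounded and uniformly Lipschitz in $(x,\mu,a)$, $F,G$ are continuous and bounded, $\sigma\ge0$. $\mathcal A$ is the set of $\alpha:[0,T]\times\mathbb R\to A$ continuous in $t$ and uniformly Lipschitz in $x$. The Hamiltonian is $$H(x,z,\gamma,\mu):=\inf_{a\in A}\Big[\tfrac12\sigma^2(x,\mu,a)\gamma+b(x,\mu,a)z+F(x,\mu,a)\Big].$$ For $\xi\in\mathbb L^2(\mathcal F_0)$, $\alpha\in\mathcal A$, $X^{\xi,\alpha}$ solves $X_t=\xi+\int_0^tb(X_s,\mathcal L_{X_s},\alpha(s,X_s))ds+\int_0^t\sigma(X_s,\mathcal L_{X_s},\alpha(s,X_s))dB_s$. The HJB equation with parameter $\mathbf m=\{m_t\}_{0\le t\le T}$ is $\partial_tu+H(x,\partial_xu,\partial_{xx}u,m_t)=0$, $u(T,x)=G(x,m_T)$. *)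

theory Defs
  imports "HOL-Probability.Probability"
begin

definition law :: "'w measure \<Rightarrow> ('w \<Rightarrow> real) \<Rightarrow> real measure" where
  "law M \<xi> = distr M borel \<xi>"

text \<open>A sub-sigma-algebra is represented by a measure of which only the sets matter;
  expectations are always taken under \<^term>\<open>M\<close>.\<close>

definition L2 :: "'w measure \<Rightarrow> 'w measure \<Rightarrow> ('w \<Rightarrow> real) set" where
  "L2 M \<G> = {\<xi>. \<xi> \<in> borel_measurable \<G> \<and> \<xi> \<in> borel_measurable M \<and> integrable M (\<lambda>\<omega>. (\<xi> \<omega>)\<^sup>2)}"

definition norm2 :: "'w measure \<Rightarrow> ('w \<Rightarrow> real) \<Rightarrow> real" where
  "norm2 M \<eta> = sqrt (\<integral>\<omega>. (\<eta> \<omega>)\<^sup>2 \<partial>M)"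

definition P2 :: "real measure set" where
  "P2 = {\<mu>. prob_space \<mu> \<and> sets \<mu> = sets borel \<and> integrable \<mu> (\<lambda>x. x\<^sup>2)}"

definition couplings :: "real measure \<Rightarrow> real measure \<Rightarrow> (real \<times> real) measure set" where
  "couplings \<mu> \<nu> = {\<pi>. prob_space \<pi> \<and> sets \<pi> = sets (borel \<Otimes>\<^sub>M borel)
      \<and> distr \<pi> borel fst = \<mu> \<and> distr \<pi> borel snd = \<nu>}"

definition W2 :: "real measure \<Rightarrow> real measure \<Rightarrow> real" where
  "W2 \<mu> \<nu> = sqrt (INF \<pi>\<in>couplings \<mu> \<nu>. \<integral>p. (fst p - snd p)\<^sup>2 \<partial>\<pi>)"

text \<open>Joint continuity on \<open>S \<times> P2\<close>, where \<^term>\<open>P2\<close> carries the metric \<^term>\<open>W2\<close>.\<close>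

definition cont_P2 :: "'b::metric_space set \<Rightarrow> ('b \<Rightarrow> real measure \<Rightarrow> real) \<Rightarrow> bool" where
  "cont_P2 S f \<longleftrightarrow> (\<forall>y\<in>S. \<forall>\<mu>\<in>P2. \<forall>e>0. \<exists>d>0. \<forall>y'\<in>S. \<forall>\<mu>'\<in>P2.
      dist y y' < d \<and> W2 \<mu> \<mu>' < d \<longrightarrow> dist (f y \<mu>) (f y' \<mu>') < e)"

text \<open>The filtration generated by the initial sigma-algebra \<open>\<G>0\<close> and by \<open>B\<close>,
  with the usual augmentation by null sets.\<close>

definition filt :: "'w measure \<Rightarrow> 'w measure \<Rightarrow> (real \<Rightarrow> 'w \<Rightarrow> real) \<Rightarrow> real \<Rightarrow> 'w measure" where
  "filt M \<G>0 B t = sigma (space M)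
     (sets \<G>0 \<union> (\<Union>s\<in>{0..t}. {B s -` S \<inter> space M |S. S \<in> sets borel}) \<union> null_sets M)"

definition brownian_motion ::
    "'w measure \<Rightarrow> (real \<Rightarrow> 'w measure) \<Rightarrow> real \<Rightarrow> (real \<Rightarrow> 'w \<Rightarrow> real) \<Rightarrow> bool" where
  "brownian_motion M \<F> T B \<longleftrightarrow>
     (\<forall>t\<in>{0..T}. B t \<in> borel_measurable M \<and> B t \<in> borel_measurable (\<F> t))
   \<and> (AE \<omega> in M. B 0 \<omega> = 0)
   \<and> (AE \<omega> in M. continuous_on {0..T} (\<lambda>t. B t \<omega>))
   \<and> (\<forall>s t. 0 \<le> s \<and> s < t \<and> t \<le> T \<longrightarrow>
        distributed M lborel (\<lambda>\<omega>. B t \<omega> - B s \<omega>) (\<lambda>x. ennreal (normal_density 0 (sqrt (t - s)) x))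
      \<and> prob_space.indep_set M (sets (\<F> s))
          {(\<lambda>\<omega>. B t \<omega> - B s \<omega>) -` S \<inter> space M |S. S \<in> sets borel})"

definition filtered_space ::
    "'w measure \<Rightarrow> 'w measure \<Rightarrow> real \<Rightarrow> (real \<Rightarrow> 'w \<Rightarrow> real) \<Rightarrow> bool" where
  "filtered_space M \<G>0 T B \<longleftrightarrow>
     prob_space M \<and> subalgebra M \<G>0
   \<and> (\<forall>\<mu>::real measure. prob_space \<mu> \<and> sets \<mu> = sets borel \<longrightarrow>
        (\<exists>\<xi>\<in>borel_measurable \<G>0. law M \<xi> = \<mu>))
   \<and> brownian_motion M (filt M \<G>0 B) T B"

definition simple_process ::
    "nat \<Rightarrow> (nat \<Rightarrow> real) \<Rightarrow> (nat \<Rightarrow> 'w \<Rightarrow> real) \<Rightarrow> real \<Rightarrow> 'w \<Rightarrow> real" where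
  "simple_process n \<tau> \<phi> t \<omega> = (\<Sum>i<n. \<phi> i \<omega> * indicator {\<tau> i<..\<tau> (Suc i)} t)"

definition simple_integral ::
    "(real \<Rightarrow> 'w \<Rightarrow> real) \<Rightarrow> nat \<Rightarrow> (nat \<Rightarrow> real) \<Rightarrow> (nat \<Rightarrow> 'w \<Rightarrow> real) \<Rightarrow> real \<Rightarrow> 'w \<Rightarrow> real" where
  "simple_integral B n \<tau> \<phi> t \<omega> =
     (\<Sum>i<n. \<phi> i \<omega> * (B (min (\<tau> (Suc i)) t) \<omega> - B (min (\<tau> i) t) \<omega>))"

definition is_simple ::
    "'w measure \<Rightarrow> (real \<Rightarrow> 'w measure) \<Rightarrow> real \<Rightarrow> nat \<Rightarrow> (nat \<Rightarrow> real) \<Rightarrow> (nat \<Rightarrow> 'w \<Rightarrow> real) \<Rightarrow> bool" where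
  "is_simple M \<F> T n \<tau> \<phi> \<longleftrightarrow> (\<forall>i<n. 0 \<le> \<tau> i \<and> \<tau> i \<le> \<tau> (Suc i) \<and> \<tau> (Suc i) \<le> T
      \<and> \<phi> i \<in> borel_measurable (\<F> (\<tau> i)) \<and> bounded (\<phi> i ` space M))"

definition progressive :: "(real \<Rightarrow> 'w measure) \<Rightarrow> real \<Rightarrow> (real \<Rightarrow> 'w \<Rightarrow> real) \<Rightarrow> bool" where
  "progressive \<F> T \<phi> \<longleftrightarrow> (\<forall>t\<in>{0..T}.
      (\<lambda>(s, \<omega>). \<phi> s \<omega>) \<in> borel_measurable (restrict_space borel {0..t} \<Otimes>\<^sub>M \<F> t))"

text \<open>\<open>I\<close> is (a continuous version of) the process \<open>\<integral>\<^sub>0\<^sup>t \<phi> dB\<close>: the mean square limit of the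
  integrals of simple processes that approximate \<open>\<phi>\<close> in mean square.\<close>

definition is_ito_integral ::
    "'w measure \<Rightarrow> (real \<Rightarrow> 'w measure) \<Rightarrow> real \<Rightarrow> (real \<Rightarrow> 'w \<Rightarrow> real)
      \<Rightarrow> (real \<Rightarrow> 'w \<Rightarrow> real) \<Rightarrow> (real \<Rightarrow> 'w \<Rightarrow> real) \<Rightarrow> bool" where
  "is_ito_integral M \<F> T B \<phi> I \<longleftrightarrow>
     progressive \<F> T \<phi>
   \<and> (\<forall>t\<in>{0..T}. I t \<in> borel_measurable (\<F> t))
   \<and> (AE \<omega> in M. continuous_on {0..T} (\<lambda>t. I t \<omega>))
   \<and> (\<exists>n \<tau> \<phi>'. (\<forall>k. is_simple M \<F> T (n k) (\<tau> k) (\<phi>' k))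
        \<and> ((\<lambda>k::nat. \<integral>\<^sup>+\<omega>. (\<integral>\<^sup>+s. ennreal ((simple_process (n k) (\<tau> k) (\<phi>' k) s \<omega> - \<phi> s \<omega>)\<^sup>2)
              * indicator {0..T} s \<partial>lborel) \<partial>M) \<longlonglongrightarrow> 0)
        \<and> (\<forall>t\<in>{0..T}. (\<lambda>k. \<integral>\<^sup>+\<omega>. ennreal ((simple_integral B (n k) (\<tau> k) (\<phi>' k) t \<omega> - I t \<omega>)\<^sup>2) \<partial>M)
              \<longlonglongrightarrow> 0))"

type_synonym coeff = "real \<Rightarrow> real measure \<Rightarrow> real \<Rightarrow> real"

definition controls :: "real \<Rightarrow> real set \<Rightarrow> (real \<Rightarrow> real \<Rightarrow> real) set" where
  "controls T A = {\<alpha>. (\<forall>t\<in>{0..T}. \<forall>x. \<alpha> t x \<in> A)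
      \<and> (\<forall>x. continuous_on {0..T} (\<lambda>t. \<alpha> t x))
      \<and> (\<exists>L. \<forall>t\<in>{0..T}. \<forall>x y. \<bar>\<alpha> t x - \<alpha> t y\<bar> \<le> L * \<bar>x - y\<bar>)}"

definition state_solution ::
    "'w measure \<Rightarrow> (real \<Rightarrow> 'w measure) \<Rightarrow> real \<Rightarrow> (real \<Rightarrow> 'w \<Rightarrow> real) \<Rightarrow> coeff \<Rightarrow> coeff
      \<Rightarrow> ('w \<Rightarrow> real) \<Rightarrow> (real \<Rightarrow> real \<Rightarrow> real) \<Rightarrow> (real \<Rightarrow> 'w \<Rightarrow> real) \<Rightarrow> bool" where
  "state_solution M \<F> T B b \<sigma> \<xi> \<alpha> X \<longleftrightarrow>
     (\<forall>t\<in>{0..T}. X t \<in> L2 M (\<F> t))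
   \<and> (AE \<omega> in M. continuous_on {0..T} (\<lambda>t. X t \<omega>))
   \<and> (\<exists>I. is_ito_integral M \<F> T B (\<lambda>s \<omega>. \<sigma> (X s \<omega>) (law M (X s)) (\<alpha> s (X s \<omega>))) I
        \<and> (AE \<omega> in M. \<forall>t\<in>{0..T}.
             X t \<omega> = \<xi> \<omega> + (LINT s:{0..t}|lborel. b (X s \<omega>) (law M (X s)) (\<alpha> s (X s \<omega>))) + I t \<omega>))"

definition bounded_lipschitz :: "real set \<Rightarrow> coeff \<Rightarrow> bool" where
  "bounded_lipschitz A f \<longleftrightarrow>
     (\<exists>C. \<forall>x. \<forall>\<mu>\<in>P2. \<forall>a\<in>A. \<bar>f x \<mu> a\<bar> \<le> C)
   \<and> (\<exists>L. \<forall>x x'. \<forall>\<mu>\<in>P2. \<forall>\<mu>'\<in>P2. \<forall>a\<in>A. \<forall>a'\<in>A.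
        \<bar>f x \<mu> a - f x' \<mu>' a'\<bar> \<le> L * (\<bar>x - x'\<bar> + W2 \<mu> \<mu>' + \<bar>a - a'\<bar>))"

definition admissible_data ::
    "real set \<Rightarrow> coeff \<Rightarrow> coeff \<Rightarrow> coeff \<Rightarrow> (real \<Rightarrow> real measure \<Rightarrow> real) \<Rightarrow> bool" where
  "admissible_data A b \<sigma> F G \<longleftrightarrow>
     A \<noteq> {}
   \<and> bounded_lipschitz A b \<and> bounded_lipschitz A \<sigma>
   \<and> (\<forall>x. \<forall>\<mu>\<in>P2. \<forall>a\<in>A. 0 \<le> \<sigma> x \<mu> a)
   \<and> cont_P2 (UNIV \<times> A) (\<lambda>(x, a) \<mu>. F x \<mu> a) \<and> (\<exists>C. \<forall>x. \<forall>\<mu>\<in>P2. \<forall>a\<in>A. \<bar>F x \<mu> a\<bar> \<le> C)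
   \<and> cont_P2 UNIV G \<and> (\<exists>C. \<forall>x. \<forall>\<mu>\<in>P2. \<bar>G x \<mu>\<bar> \<le> C)"

definition hamiltonian ::
    "real set \<Rightarrow> coeff \<Rightarrow> coeff \<Rightarrow> coeff \<Rightarrow> real \<Rightarrow> real \<Rightarrow> real \<Rightarrow> real measure \<Rightarrow> real" where
  "hamiltonian A b \<sigma> F x z \<gamma> \<mu> = (INF a\<in>A. 1/2 * (\<sigma> x \<mu> a)\<^sup>2 * \<gamma> + b x \<mu> a * z + F x \<mu> a)"

text \<open>Partial derivatives in a Euclidean space are directional derivatives along basis vectors;
  iterated partial derivatives are indexed by lists of basis vectors, the head being applied last.\<close>

definition pdiff :: "'a::euclidean_space \<Rightarrow> ('a \<Rightarrow> real) \<Rightarrow> 'a \<Rightarrow> real" where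
  "pdiff v f y = deriv (\<lambda>h. f (y + h *\<^sub>R v)) 0"

definition pdiffable :: "'a::euclidean_space \<Rightarrow> ('a \<Rightarrow> real) \<Rightarrow> 'a \<Rightarrow> bool" where
  "pdiffable v f y \<longleftrightarrow> (\<lambda>h. f (y + h *\<^sub>R v)) field_differentiable (at 0)"

definition pdiffs :: "'a::euclidean_space list \<Rightarrow> ('a \<Rightarrow> real) \<Rightarrow> 'a \<Rightarrow> real" where
  "pdiffs vs f = foldr pdiff vs f"

definition Ck :: "nat \<Rightarrow> ('a::euclidean_space \<Rightarrow> real) \<Rightarrow> bool" where
  "Ck n f \<longleftrightarrow> (\<forall>vs. set vs \<subseteq> Basis \<and> length vs \<le> n \<longrightarrow> continuous_on UNIV (pdiffs vs f)
      \<and> (length vs < n \<longrightarrow> (\<forall>v\<in>Basis. \<forall>y. pdiffable v (pdiffs vs f) y)))"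

definition pd :: "'a::euclidean_space \<Rightarrow> ('a \<Rightarrow> real measure \<Rightarrow> real) \<Rightarrow> 'a \<Rightarrow> real measure \<Rightarrow> real" where
  "pd v U = (\<lambda>y \<mu>. pdiff v (\<lambda>y'. U y' \<mu>) y)"

definition pds :: "'a::euclidean_space list \<Rightarrow> ('a \<Rightarrow> real measure \<Rightarrow> real) \<Rightarrow> 'a \<Rightarrow> real measure \<Rightarrow> real" where
  "pds vs U = foldr pd vs U"

definition is_lions_deriv ::
    "'w measure \<Rightarrow> 'w measure \<Rightarrow> (real measure \<Rightarrow> real) \<Rightarrow> (real measure \<Rightarrow> real \<Rightarrow> real) \<Rightarrow> bool" where
  "is_lions_deriv M \<F>\<^sub>T U D \<longleftrightarrow> (\<forall>\<xi>\<in>L2 M \<F>\<^sub>T.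
      (\<forall>\<eta>\<in>L2 M \<F>\<^sub>T. integrable M (\<lambda>\<omega>. D (law M \<xi>) (\<xi> \<omega>) * \<eta> \<omega>))
    \<and> (\<forall>e>0. \<exists>d>0. \<forall>\<eta>\<in>L2 M \<F>\<^sub>T. norm2 M \<eta> < d \<longrightarrow>
         \<bar>U (law M (\<lambda>\<omega>. \<xi> \<omega> + \<eta> \<omega>)) - U (law M \<xi>) - (\<integral>\<omega>. D (law M \<xi>) (\<xi> \<omega>) * \<eta> \<omega> \<partial>M)\<bar>
           \<le> e * norm2 M \<eta>))"

text \<open>The defining expansion determines \<open>\<partial>\<^sub>\<mu>U(\<mu>, \<cdot>)\<close> only \<open>\<mu>\<close>-almost everywhere. As usual,
  \<open>\<partial>\<^sub>\<mu>U\<close> denotes the version that is jointly continuous in \<open>(\<mu>, x')\<close>, which is unique on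
  \<open>P2 \<times> \<real>\<close> because measures of full support are dense.\<close>

definition lions_version ::
    "'w measure \<Rightarrow> 'w measure \<Rightarrow> (real measure \<Rightarrow> real) \<Rightarrow> (real measure \<Rightarrow> real \<Rightarrow> real) \<Rightarrow> bool" where
  "lions_version M \<F>\<^sub>T U D \<longleftrightarrow> is_lions_deriv M \<F>\<^sub>T U D \<and> cont_P2 UNIV (\<lambda>x' \<mu>. D \<mu> x')"

definition lions_deriv ::
    "'w measure \<Rightarrow> 'w measure \<Rightarrow> (real measure \<Rightarrow> real) \<Rightarrow> real measure \<Rightarrow> real \<Rightarrow> real" where
  "lions_deriv M \<F>\<^sub>T U = (SOME D. lions_version M \<F>\<^sub>T U D)"

text \<open>The new variable of the Lions derivative is appended to the space variables:
  \<open>dmu M \<F>\<^sub>T U (y, x') \<mu> = \<partial>\<^sub>\<mu>U(y, \<mu>, x')\<close>. Thus, for real \<open>y\<close>, \<^term>\<open>pd (1, 0)\<close> is the derivative in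
  \<open>y\<close> and \<^term>\<open>pd (0, 1)\<close> the derivative in the new variable.\<close>

definition dmu ::
    "'w measure \<Rightarrow> 'w measure \<Rightarrow> ('a::euclidean_space \<Rightarrow> real measure \<Rightarrow> real) \<Rightarrow> 'a \<times> real \<Rightarrow> real measure \<Rightarrow> real" where
  "dmu M \<F>\<^sub>T U = (\<lambda>(y, x') \<mu>. lions_deriv M \<F>\<^sub>T (U y) \<mu> x')"

definition cont_Theta :: "real \<Rightarrow> (real \<Rightarrow> 'a::euclidean_space \<Rightarrow> real measure \<Rightarrow> real) \<Rightarrow> bool" where
  "cont_Theta T U \<longleftrightarrow> cont_P2 ({0..T} \<times> UNIV) (\<lambda>(t, y). U t y)"

definition bcont_Theta :: "real \<Rightarrow> (real \<Rightarrow> 'a::euclidean_space \<Rightarrow> real measure \<Rightarrow> real) \<Rightarrow> bool" where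
  "bcont_Theta T U \<longleftrightarrow> cont_Theta T U \<and> (\<exists>C. \<forall>t\<in>{0..T}. \<forall>y. \<forall>\<mu>\<in>P2. \<bar>U t y \<mu>\<bar> \<le> C)"

definition pd_exists :: "real \<Rightarrow> 'a::euclidean_space \<Rightarrow> (real \<Rightarrow> 'a \<Rightarrow> real measure \<Rightarrow> real) \<Rightarrow> bool" where
  "pd_exists T v U \<longleftrightarrow> (\<forall>t\<in>{0..T}. \<forall>y. \<forall>\<mu>\<in>P2. pdiffable v (\<lambda>y'. U t y' \<mu>) y)"

definition dt :: "real \<Rightarrow> (real \<Rightarrow> 'a \<Rightarrow> real measure \<Rightarrow> real) \<Rightarrow> real \<Rightarrow> 'a \<Rightarrow> real measure \<Rightarrow> real" where
  "dt T U t y \<mu> = vector_derivative (\<lambda>s. U s y \<mu>) (at t within {0..T})"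

text \<open>The subscript \<open>b\<close>: the derivatives, but not necessarily \<open>U\<close> itself, are bounded. In the last
  line of \<open>C12b\<close>, \<open>v\<close> ranges over the basis of \<open>\<real>\<^sup>d \<times> \<real>\<close>, which covers both
  \<open>\<partial>\<^sub>y\<^sub>\<mu>U\<close> and the derivative of \<open>\<partial>\<^sub>\<mu>U\<close> in its new variable.\<close>

definition C12b ::
    "'w measure \<Rightarrow> 'w measure \<Rightarrow> real \<Rightarrow> (real \<Rightarrow> 'a::euclidean_space \<Rightarrow> real measure \<Rightarrow> real) \<Rightarrow> bool" where
  "C12b M \<F>\<^sub>T T U \<longleftrightarrow>
     cont_Theta T U
   \<and> (\<forall>t\<in>{0..T}. \<forall>y. \<forall>\<mu>\<in>P2. (\<lambda>s. U s y \<mu>) differentiable (at t within {0..T}))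
   \<and> bcont_Theta T (dt T U)
   \<and> (\<forall>v\<in>Basis. pd_exists T v U \<and> bcont_Theta T (\<lambda>t. pd v (U t))
        \<and> (\<forall>w\<in>Basis. pd_exists T w (\<lambda>t. pd v (U t)) \<and> bcont_Theta T (\<lambda>t. pd w (pd v (U t)))))
   \<and> (\<forall>t\<in>{0..T}. \<forall>y. \<exists>D. lions_version M \<F>\<^sub>T (U t y) D)
   \<and> bcont_Theta T (\<lambda>t. dmu M \<F>\<^sub>T (U t))
   \<and> (\<forall>v\<in>Basis. pd_exists T v (\<lambda>t. dmu M \<F>\<^sub>T (U t)) \<and> bcont_Theta T (\<lambda>t. pd v (dmu M \<F>\<^sub>T (U t))))"

definition C14b ::
    "'w measure \<Rightarrow> 'w measure \<Rightarrow> real \<Rightarrow> (real \<Rightarrow> 'a::euclidean_space \<Rightarrow> real measure \<Rightarrow> real) \<Rightarrow> bool" where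
  "C14b M \<F>\<^sub>T T U \<longleftrightarrow>
     (\<forall>vs. set vs \<subseteq> Basis \<and> length vs \<le> 2 \<longrightarrow> C12b M \<F>\<^sub>T T (\<lambda>t. pds vs (U t)))"

definition C26b ::
    "'w measure \<Rightarrow> 'w measure \<Rightarrow> real \<Rightarrow> (real \<Rightarrow> 'a::euclidean_space \<Rightarrow> real measure \<Rightarrow> real) \<Rightarrow> bool" where
  "C26b M \<F>\<^sub>T T U \<longleftrightarrow>
     C14b M \<F>\<^sub>T T U
   \<and> (\<forall>vs. set vs \<subseteq> Basis \<and> length vs \<le> 4 \<longrightarrow> C12b M \<F>\<^sub>T T (\<lambda>t. pds vs (U t)))
   \<and> (\<forall>vs. set vs \<subseteq> Basis \<and> length vs \<le> 2 \<longrightarrow>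
        C12b M \<F>\<^sub>T T (\<lambda>t. pds (map (\<lambda>v. (v, 0)) vs) (dmu M \<F>\<^sub>T (U t)))
      \<and> C12b M \<F>\<^sub>T T (\<lambda>t. pds (map (\<lambda>v. (v, 0)) vs) (pd (0, 1) (dmu M \<F>\<^sub>T (U t)))))"

definition deriv_bounds ::
    "'w measure \<Rightarrow> 'w measure \<Rightarrow> real \<Rightarrow> (real \<Rightarrow> real measure \<Rightarrow> real) \<Rightarrow> bool" where
  "deriv_bounds M \<F>\<^sub>T L U \<longleftrightarrow>
     (\<forall>k\<in>{1..4}. \<forall>x. \<forall>\<mu>\<in>P2. \<bar>(pd 1 ^^ k) U x \<mu>\<bar> \<le> L)
   \<and> (\<forall>l\<in>{1..2}. \<forall>x x'. \<forall>\<mu>\<in>P2.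
        \<bar>(pd (1, 0) ^^ l) (dmu M \<F>\<^sub>T U) (x, x') \<mu>\<bar> \<le> L
      \<and> \<bar>(pd (1, 0) ^^ l) (pd (0, 1) (dmu M \<F>\<^sub>T U)) (x, x') \<mu>\<bar> \<le> L)"

definition C16b :: "real \<Rightarrow> (real \<Rightarrow> real \<Rightarrow> real) \<Rightarrow> bool" where
  "C16b T u \<longleftrightarrow>
     (\<forall>t\<in>{0..T}. \<forall>x. (\<lambda>s. u s x) differentiable (at t within {0..T}))
   \<and> (\<forall>k<6. \<forall>t\<in>{0..T}. \<forall>x. (deriv ^^ k) (u t) field_differentiable (at x))
   \<and> (\<forall>f\<in>insert (\<lambda>(t, x). vector_derivative (\<lambda>s. u s x) (at t within {0..T}))
              ((\<lambda>k (t, x). (deriv ^^ k) (u t) x) ` {1..6}).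
        continuous_on ({0..T} \<times> UNIV) f \<and> bounded (f ` ({0..T} \<times> UNIV)))"

definition hjb_solution ::
    "real \<Rightarrow> (real \<Rightarrow> real \<Rightarrow> real \<Rightarrow> real measure \<Rightarrow> real) \<Rightarrow> (real \<Rightarrow> real measure \<Rightarrow> real)
      \<Rightarrow> (real \<Rightarrow> real measure) \<Rightarrow> (real \<Rightarrow> real \<Rightarrow> real) \<Rightarrow> bool" where
  "hjb_solution T H G m u \<longleftrightarrow>
     (\<forall>t\<in>{0..T}. \<forall>x. vector_derivative (\<lambda>s. u s x) (at t within {0..T})
        + H x (deriv (u t) x) (deriv (deriv (u t)) x) (m t) = 0)
   \<and> (\<forall>x. u T x = G x (m T))"

abbreviation uncurry3 :: "(real \<Rightarrow> real \<Rightarrow> real \<Rightarrow> real) \<Rightarrow> real \<times> real \<times> real \<Rightarrow> real" where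
  "uncurry3 H0 \<equiv> \<lambda>(x, z, \<gamma>). H0 x z \<gamma>"

definition Dz :: "(real \<Rightarrow> real \<Rightarrow> real \<Rightarrow> real) \<Rightarrow> real \<Rightarrow> real \<Rightarrow> real \<Rightarrow> real" where
  "Dz H0 x z \<gamma> = deriv (\<lambda>z'. H0 x z' \<gamma>) z"

definition Dg :: "(real \<Rightarrow> real \<Rightarrow> real \<Rightarrow> real) \<Rightarrow> real \<Rightarrow> real \<Rightarrow> real \<Rightarrow> real" where
  "Dg H0 x z \<gamma> = deriv (\<lambda>\<gamma>'. H0 x z \<gamma>') \<gamma>"

definition hessian_zg :: "(real \<Rightarrow> real \<Rightarrow> real \<Rightarrow> real) \<Rightarrow> real \<Rightarrow> real \<Rightarrow> real \<Rightarrow> real^2^2" where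
  "hessian_zg H0 x z \<gamma> = vector [vector [Dz (Dz H0) x z \<gamma>, Dz (Dg H0) x z \<gamma>],
                                 vector [Dz (Dg H0) x z \<gamma>, Dg (Dg H0) x z \<gamma>]]"

definition loewner_le :: "real^'n^'n \<Rightarrow> real^'n^'n \<Rightarrow> bool" where
  "loewner_le P Q \<longleftrightarrow> (\<forall>v. v \<bullet> (P *v v) \<le> v \<bullet> (Q *v v))"

definition master_solution ::
    "'w measure \<Rightarrow> 'w measure \<Rightarrow> real \<Rightarrow> (real \<Rightarrow> real \<Rightarrow> real \<Rightarrow> real) \<Rightarrow> (real \<Rightarrow> real measure \<Rightarrow> real)
      \<Rightarrow> (real \<Rightarrow> real measure \<Rightarrow> real) \<Rightarrow> (real \<Rightarrow> real \<Rightarrow> real measure \<Rightarrow> real) \<Rightarrow> bool" where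
  "master_solution M \<F>\<^sub>T T H0 F0 G V \<longleftrightarrow>
     (\<forall>t\<in>{0..T}. \<forall>x. \<forall>\<mu>\<in>P2.
        dt T V t x \<mu> + H0 x (pd 1 (V t) x \<mu>) (pd 1 (pd 1 (V t)) x \<mu>) + F0 x \<mu>
      + (\<integral>x'. dmu M \<F>\<^sub>T (V t) (x, x') \<mu>
                 * Dz H0 x' (pd 1 (V t) x' \<mu>) (pd 1 (pd 1 (V t)) x' \<mu>)
             + pd (0, 1) (dmu M \<F>\<^sub>T (V t)) (x, x') \<mu>
                 * Dg H0 x' (pd 1 (V t) x' \<mu>) (pd 1 (pd 1 (V t)) x' \<mu>) \<partial>\<mu>) = 0)
   \<and> (\<forall>x. \<forall>\<mu>\<in>P2. V T x \<mu> = G x \<mu>)"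

text \<open>On the product space \<open>M \<Otimes>\<^sub>M M\<close>, a variable and its independent copy are the compositions
  with \<^const>\<open>fst\<close> and \<^const>\<open>snd\<close>.\<close>

definition lasry_lions ::
    "'w measure \<Rightarrow> 'w measure \<Rightarrow> 'w measure \<Rightarrow> (real \<Rightarrow> real measure \<Rightarrow> real) \<Rightarrow> bool" where
  "lasry_lions M \<F>\<^sub>T \<G> U \<longleftrightarrow> (\<forall>\<xi>\<in>L2 M \<G>. \<forall>\<eta>\<in>L2 M \<G>.
      0 \<le> (\<integral>p. pd (1, 0) (dmu M \<F>\<^sub>T U) (\<xi> (fst p), \<xi> (snd p)) (law M \<xi>)
                * \<eta> (fst p) * \<eta> (snd p) \<partial>(M \<Otimes>\<^sub>M M)))"

definition Dmat ::
    "'w measure \<Rightarrow> 'w measure \<Rightarrow> (real \<Rightarrow> real measure \<Rightarrow> real) \<Rightarrow> real \<Rightarrow> real measure \<Rightarrow> real \<Rightarrow> real^2^2" where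
  "Dmat M \<F>\<^sub>T U x \<mu> x' =
     (let D = dmu M \<F>\<^sub>T U; Dx = pd (1, 0); Dx' = pd (0, 1) in
      vector [vector [Dx D (x, x') \<mu>, Dx' (Dx D) (x, x') \<mu>],
              vector [Dx (Dx D) (x, x') \<mu>, Dx' (Dx (Dx D)) (x, x') \<mu>]])"

definition lasry_lions2 ::
    "'w measure \<Rightarrow> 'w measure \<Rightarrow> 'w measure \<Rightarrow> (real \<Rightarrow> real measure \<Rightarrow> real) \<Rightarrow> bool" where
  "lasry_lions2 M \<F>\<^sub>T \<G> U \<longleftrightarrow> (\<forall>\<xi>\<in>L2 M \<G>. \<forall>\<eta>1\<in>L2 M \<G>. \<forall>\<eta>2\<in>L2 M \<G>.
      0 \<le> (\<integral>p. vector [\<eta>1 (fst p), \<eta>2 (fst p)]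
                \<bullet> (Dmat M \<F>\<^sub>T U (\<xi> (fst p)) (law M \<xi>) (\<xi> (snd p))
                    *v vector [\<eta>1 (snd p), \<eta>2 (snd p)]) \<partial>(M \<Otimes>\<^sub>M M)))"

end

theory Submission
  imports Defs
begin

text \<open>
  For a function \<open>U\<close> put \<open>gap U \<mu> \<nu> = \<integral> (U(x,\<mu>) - U(x,\<nu>)) (\<mu> - \<nu>)(dx)\<close>. Taking \<open>\<mu> = law (\<xi> + \<epsilon> \<eta>)\<close> and
  \<open>\<nu> = law \<xi>\<close> and dividing by \<open>\<epsilon>\<^sup>2\<close>, nonnegativity of the gap yields the first-order monotonicity condition
  as \<open>\<epsilon>\<close> tends to \<open>0\<close>. Conversely, in dimension one, the quantile functions along a mixture
  \<open>(1 - s) \<mu> + s \<nu>\<close> are Lipschitz in \<open>s\<close> once a small uniform component has been added, so that the infinitesimal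
  condition forces the gap to be nonnegative.

  If \<open>m\<^sub>1\<close> and \<open>m\<^sub>2\<close> follow the flows with drift \<open>\<partial>\<^sub>z H\<^sub>0\<close> and squared volatility \<open>2 \<partial>\<^sub>\<gamma> H\<^sub>0\<close>, evaluated at the
  derivatives of \<open>V\<close>, the master equation and the concavity of \<open>H\<^sub>0\<close> in \<open>(z, \<gamma>)\<close>, which is an infimum of affine
  functions, show that \<open>gap (V t) m\<^sub>1 m\<^sub>2\<close> has derivative at most \<open>- gap F\<^sub>0 m\<^sub>1 m\<^sub>2 \<le> 0\<close>; as it is nonnegative at \<open>T\<close>,
  it is nonnegative before. The flow itself is never constructed: one Euler step, in which the Brownian increment
  is replaced by its sign, decreases the gap up to \<open>\<epsilon> h\<close>, and such steps are concatenated up to time \<open>T\<close> by a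
  Brezis-Browder argument, since the states form a Cauchy sequence in \<open>L\<^sup>2\<close>.

  The second-order condition follows from the first-order one by perturbing \<open>\<xi>\<close> with an independent sign.
\<close>

section \<open>Second moments, couplings and the Wasserstein distance\<close>

text \<open>Propagating the gap asks for one derivative of \<open>V\<close> in the measure and two
  in space, whereas propagating the infinitesimal form would mean differentiating the flow in its
  initial state. Since no second derivative in the measure is at hand, an increment of size
  \<open>sqrt h\<close> cannot be expanded to second order along a path of laws; the two opposite
  signs cancel the terms of order \<open>sqrt h\<close>, and comparison with a quadratic polynomial
  recovers the terms of order \<open>h\<close> from first derivatives in the measure and their space
  derivatives. The regularity of \<open>V\<close> concerns the Lions derivatives of \<open>V\<close>
  and of its first two space derivatives, not repeated space derivatives of the Lions derivative, so
  the order of differentiation has to be exchanged before the second-order form can be treated. A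
  Lions derivative is determined by its expansion only almost everywhere; adding an atom of
  vanishing weight turns such identities into pointwise ones. The independent sign is produced in
  law only: the initial sigma-algebra carries every law but need not hold a coin independent of
  given variables, and expectations see nothing but laws.\<close>

lemma integrable_mult_square_integrable:
  fixes X Y :: "'a \<Rightarrow> real"
  assumes [measurable]: "X \<in> borel_measurable N" "Y \<in> borel_measurable N"
    and "integrable N (\<lambda>x. (X x)\<^sup>2)" "integrable N (\<lambda>x. (Y x)\<^sup>2)"
  shows "integrable N (\<lambda>x. X x * Y x)"
proof (rule Bochner_Integration.integrable_bound)
  show "integrable N (\<lambda>x. (X x)\<^sup>2 + (Y x)\<^sup>2)" using assms by simp
  have "\<bar>a * b\<bar> \<le> a\<^sup>2 + b\<^sup>2" for a b :: real
  proof -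
    have "2 * \<bar>a * b\<bar> \<le> a\<^sup>2 + b\<^sup>2" using sum_squares_bound[of "\<bar>a\<bar>" "\<bar>b\<bar>"] by (simp add: abs_mult)
    then show ?thesis using abs_ge_zero[of "a * b"] by linarith
  qed
  then show "AE x in N. norm (X x * Y x) \<le> norm ((X x)\<^sup>2 + (Y x)\<^sup>2)" by simp
qed measurable

lemma integrable_square_add:
  fixes X Y :: "'a \<Rightarrow> real"
  assumes "X \<in> borel_measurable N" "Y \<in> borel_measurable N"
    and "integrable N (\<lambda>x. (X x)\<^sup>2)" "integrable N (\<lambda>x. (Y x)\<^sup>2)"
  shows "integrable N (\<lambda>x. (X x + Y x)\<^sup>2)"
  using integrable_mult_square_integrable[OF assms] assms by (simp add: power2_sum mult.assoc)

lemma norm2_nonneg [simp]: "0 \<le> norm2 N X"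
  by (simp add: norm2_def)

lemma norm2_square: "(norm2 N X)\<^sup>2 = (\<integral>x. (X x)\<^sup>2 \<partial>N)"
  by (simp add: norm2_def)

lemma norm2_scale: "norm2 N (\<lambda>x. c * X x) = \<bar>c\<bar> * norm2 N X"
  by (simp add: norm2_def power_mult_distrib real_sqrt_mult)

text \<open>Cauchy-Schwarz from the nonnegative quadratic
  \<open>t\<^sup>2 * a + 2 * t * c + b\<close>, which is the second moment of
  \<open>t * X x + Y x\<close>.\<close>

lemma integral_mult_le_norm2:
  fixes X Y :: "'a \<Rightarrow> real"
  assumes m: "X \<in> borel_measurable N" "Y \<in> borel_measurable N"
    and i: "integrable N (\<lambda>x. (X x)\<^sup>2)" "integrable N (\<lambda>x. (Y x)\<^sup>2)"
  shows "\<bar>\<integral>x. X x * Y x \<partial>N\<bar> \<le> norm2 N X * norm2 N Y"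
proof -
  define a b c where "a = (\<integral>x. (X x)\<^sup>2 \<partial>N)" "b = (\<integral>x. (Y x)\<^sup>2 \<partial>N)" "c = (\<integral>x. X x * Y x \<partial>N)"
  note iXY = integrable_mult_square_integrable[OF m i]
  have q: "0 \<le> t\<^sup>2 * a + 2 * t * c + b" for t
  proof -
    have "0 \<le> (\<integral>x. (t * X x + Y x)\<^sup>2 \<partial>N)" by simp
    also have "\<dots> = (\<integral>x. t\<^sup>2 * (X x)\<^sup>2 + 2 * t * (X x * Y x) + (Y x)\<^sup>2 \<partial>N)"
      by (simp add: power2_sum power_mult_distrib algebra_simps)
    also have "\<dots> = t\<^sup>2 * a + 2 * t * c + b" using i iXY by (simp add: a_b_c_def)
    finally show ?thesis .
  qed
  have a0: "a \<ge> 0" by (simp add: a_b_c_def)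
  have "c\<^sup>2 \<le> a * b"
  proof (cases "a = 0")
    case True
    have "c = 0"
    proof (rule ccontr)
      assume "c \<noteq> 0"
      \<comment> \<open>With \<open>a = 0\<close> the quadratic takes the value -1 at this
        point.\<close>
      with q[of "-(b + 1) / (2 * c)"] True show False by (simp add: field_simps)
    qed
    then show ?thesis using True by simp
  next
    case False
    with a0 have "a > 0" by simp
    with q[of "- c / a"] show ?thesis by (simp add: field_simps power2_eq_square)
  qed
  then have "\<bar>c\<bar> \<le> sqrt (a * b)" by (rule real_le_rsqrt[of "\<bar>c\<bar>", simplified])
  then show ?thesis by (simp add: norm2_def a_b_c_def real_sqrt_mult)
qed

lemma (in prob_space) integrable_of_square:
  fixes X :: "'a \<Rightarrow> real"
  assumes "X \<in> borel_measurable M" "integrable M (\<lambda>x. (X x)\<^sup>2)"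
  shows "integrable M X"
  using integrable_mult_square_integrable[OF assms(1) _ assms(2), of "\<lambda>_. 1"] by simp

lemma (in prob_space) integral_abs_le_norm2:
  fixes X :: "'a \<Rightarrow> real"
  assumes "X \<in> borel_measurable M" "integrable M (\<lambda>x. (X x)\<^sup>2)"
  shows "(\<integral>x. \<bar>X x\<bar> \<partial>M) \<le> norm2 M X"
proof -
  have "norm2 M (\<lambda>_. 1) = 1" by (simp add: norm2_def prob_space)
  moreover have "norm2 M (\<lambda>x. \<bar>X x\<bar>) = norm2 M X" by (simp add: norm2_def)
  ultimately show ?thesis
    using integral_mult_le_norm2[of "\<lambda>x. \<bar>X x\<bar>" M "\<lambda>_. 1"] assms by simp
qed

section \<open>Laws of random variables and couplings of laws\<close>

lemma space_law [simp]: "space (law N X) = UNIV"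
  and sets_law [simp, measurable_cong]: "sets (law N X) = sets borel"
  by (simp_all add: law_def)

lemma law_P2:
  assumes "prob_space N" "X \<in> borel_measurable N" "integrable N (\<lambda>x. (X x)\<^sup>2)"
  shows "law N X \<in> P2"
  using assms by (auto simp: P2_def law_def intro!: prob_space.prob_space_distr integrable_distr_eq[THEN iffD2])

lemma integral_law:
  fixes f :: "real \<Rightarrow> real"
  assumes "X \<in> borel_measurable N" "f \<in> borel_measurable borel"
  shows "(\<integral>x. f x \<partial>law N X) = (\<integral>\<omega>. f (X \<omega>) \<partial>N)"
  unfolding law_def using assms by (rule integral_distr)

lemma integrable_law_iff:
  fixes f :: "real \<Rightarrow> real"
  assumes "X \<in> borel_measurable N" "f \<in> borel_measurable borel"
  shows "integrable (law N X) f \<longleftrightarrow> integrable N (\<lambda>\<omega>. f (X \<omega>))"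
  unfolding law_def using assms by (rule integrable_distr_eq)

lemma P2D:
  assumes "\<mu> \<in> P2"
  shows "prob_space \<mu>" "sets \<mu> = sets borel" "space \<mu> = UNIV" "integrable \<mu> (\<lambda>x. x\<^sup>2)" "integrable \<mu> (\<lambda>x. x)"
proof -
  show *: "prob_space \<mu>" "sets \<mu> = sets borel" "integrable \<mu> (\<lambda>x. x\<^sup>2)" using assms by (auto simp: P2_def)
  then show "space \<mu> = UNIV" by (metis sets_eq_imp_space_eq space_borel)
  show "integrable \<mu> (\<lambda>x. x)"
    by (rule prob_space.integrable_of_square[OF *(1) _ *(3)]) (simp add: measurable_cong_sets[OF *(2)])
qed

lemma law_id: "sets \<mu> = sets borel \<Longrightarrow> law \<mu> (\<lambda>x. x) = \<mu>"
  unfolding law_def by (rule distr_id2) simp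

lemma couplings_law:
  assumes "prob_space N" "X \<in> borel_measurable N" "Y \<in> borel_measurable N"
  shows "distr N (borel \<Otimes>\<^sub>M borel) (\<lambda>\<omega>. (X \<omega>, Y \<omega>)) \<in> couplings (law N X) (law N Y)"
proof -
  have "distr (distr N (borel \<Otimes>\<^sub>M borel) (\<lambda>\<omega>. (X \<omega>, Y \<omega>))) borel fst = law N X"
    using assms by (subst distr_distr) (auto simp: law_def comp_def)
  moreover have "distr (distr N (borel \<Otimes>\<^sub>M borel) (\<lambda>\<omega>. (X \<omega>, Y \<omega>))) borel snd = law N Y"
    using assms by (subst distr_distr) (auto simp: law_def comp_def)
  ultimately show ?thesis using assms
    by (auto simp: couplings_def intro!: prob_space.prob_space_distr)
qed

lemma W2_law_le:
  assumes "prob_space N" "X \<in> borel_measurable N" "Y \<in> borel_measurable N"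
  shows "W2 (law N X) (law N Y) \<le> norm2 N (\<lambda>\<omega>. X \<omega> - Y \<omega>)"
  unfolding W2_def norm2_def
proof (rule real_sqrt_le_mono)
  have "(\<integral>p. (fst p - snd p)\<^sup>2 \<partial>distr N (borel \<Otimes>\<^sub>M borel) (\<lambda>\<omega>. (X \<omega>, Y \<omega>))) = (\<integral>\<omega>. (X \<omega> - Y \<omega>)\<^sup>2 \<partial>N)"
    using assms by (subst integral_distr) auto
  then show "(INF \<pi>\<in>couplings (law N X) (law N Y). \<integral>p. (fst p - snd p)\<^sup>2 \<partial>\<pi>) \<le> (\<integral>\<omega>. (X \<omega> - Y \<omega>)\<^sup>2 \<partial>N)"
    by (intro cINF_lower2[OF _ couplings_law[OF assms]] bdd_belowI2[of _ 0]) auto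
qed

lemma couplingsD:
  assumes "\<pi> \<in> couplings \<mu> \<nu>"
  shows "prob_space \<pi>" "sets \<pi> = sets (borel \<Otimes>\<^sub>M borel)" "law \<pi> fst = \<mu>" "law \<pi> snd = \<nu>"
    "fst \<in> borel_measurable \<pi>" "snd \<in> borel_measurable \<pi>"
  using assms by (auto simp: couplings_def law_def cong: measurable_cong_sets)

text \<open>Independence always gives a coupling, so the infimum in \<open>W2\<close> runs over a
  nonempty set; over an empty set its value would be arbitrary.\<close>

lemma pair_in_couplings:
  assumes "\<mu> \<in> P2" "\<nu> \<in> P2"
  shows "\<mu> \<Otimes>\<^sub>M \<nu> \<in> couplings \<mu> \<nu>"
proof -
  note P = P2D[OF assms(1)] P2D[OF assms(2)]
  interpret \<mu>: prob_space \<mu> by fact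
  interpret \<nu>: prob_space \<nu> by fact
  interpret pair_prob_space \<mu> \<nu> ..
  have "distr (\<mu> \<Otimes>\<^sub>M \<nu>) borel fst = distr (\<mu> \<Otimes>\<^sub>M \<nu>) \<mu> fst" using P by (intro distr_cong) auto
  also have "\<dots> = \<mu>" by (rule \<nu>.distr_pair_fst)
  finally have 1: "distr (\<mu> \<Otimes>\<^sub>M \<nu>) borel fst = \<mu>" .
  have "distr (\<mu> \<Otimes>\<^sub>M \<nu>) borel snd = distr (\<mu> \<Otimes>\<^sub>M \<nu>) \<nu> snd" using P by (intro distr_cong) auto
  also have "\<dots> = distr (distr (\<nu> \<Otimes>\<^sub>M \<mu>) (\<mu> \<Otimes>\<^sub>M \<nu>) (\<lambda>(x, y). (y, x))) \<nu> snd"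
    using distr_pair_swap by simp
  also have "\<dots> = distr (\<nu> \<Otimes>\<^sub>M \<mu>) \<nu> fst"
    by (subst distr_distr) (auto intro!: distr_cong)
  also have "\<dots> = \<nu>" by (rule \<mu>.distr_pair_fst)
  finally have 2: "distr (\<mu> \<Otimes>\<^sub>M \<nu>) borel snd = \<nu>" .
  show ?thesis unfolding couplings_def
    by (intro CollectI conjI prob_space_axioms sets_pair_measure_cong[OF P(2) P(7)] 1 2)
qed

lemma W2_nonneg:
  assumes "\<mu> \<in> P2" "\<nu> \<in> P2"
  shows "0 \<le> W2 \<mu> \<nu>"
proof -
  have "0 \<le> (INF \<pi>\<in>couplings \<mu> \<nu>. \<integral>p. (fst p - snd p)\<^sup>2 \<partial>\<pi>)"
    using pair_in_couplings[OF assms] by (intro cINF_greatest) auto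
  then show ?thesis by (simp add: W2_def)
qed

text \<open>A nearly optimal coupling is enough for the estimates that follow, so existence of an
  optimal plan is never at issue.\<close>

lemma coupling_of_P2:
  assumes "\<mu> \<in> P2" "\<nu> \<in> P2" "W2 \<mu> \<nu> < r"
  obtains \<pi> where "\<pi> \<in> couplings \<mu> \<nu>" "norm2 \<pi> (\<lambda>p. fst p - snd p) < r"
proof -
  note ne = pair_in_couplings[OF assms(1,2)]
  have r: "r > 0" using assms(3) W2_nonneg[OF assms(1,2)] by linarith
  then have "(INF \<pi>\<in>couplings \<mu> \<nu>. \<integral>p. (fst p - snd p)\<^sup>2 \<partial>\<pi>) < r\<^sup>2"
    using assms(3) real_le_rsqrt[of r] unfolding W2_def by (meson not_less)
  then obtain \<pi> where "\<pi> \<in> couplings \<mu> \<nu>" "(\<integral>p. (fst p - snd p)\<^sup>2 \<partial>\<pi>) < r\<^sup>2"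
    using ne cINF_less_iff[OF _ bdd_belowI2[of "couplings \<mu> \<nu>" 0 "\<lambda>\<pi>. \<integral>p. (fst p - snd p)\<^sup>2 \<partial>\<pi>"], of "r\<^sup>2"] by force
  moreover from this r have "sqrt (\<integral>p. (fst p - snd p)\<^sup>2 \<partial>\<pi>) < r"
    by (intro real_less_lsqrt) auto
  ultimately show thesis using that by (auto simp: norm2_def)
qed

text \<open>Under any coupling the integrals differ by at most \<open>C\<close> times the mean
  distance, hence by at most \<open>C\<close> times the mean square distance; letting the coupling
  approach the infimum gives \<open>W2\<close>.\<close>

lemma integral_diff_le_W2:
  assumes mu: "\<mu> \<in> P2" "\<nu> \<in> P2" and lip: "\<And>x y. \<bar>\<phi> x - \<phi> y\<bar> \<le> C * \<bar>x - y\<bar>" 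
    and phi: "\<phi> \<in> borel_measurable borel" "integrable \<mu> \<phi>" "integrable \<nu> \<phi>"
  shows "\<bar>(\<integral>x. \<phi> x \<partial>\<mu>) - (\<integral>x. \<phi> x \<partial>\<nu>)\<bar> \<le> C * W2 \<mu> \<nu>"
proof -
  have C: "C \<ge> 0" using lip[of 0 1] by simp
  show ?thesis
  proof (rule field_le_epsilon)
    fix e :: real assume "e > 0"
    \<comment> \<open>The slack \<open>e / (C + 1)\<close> costs at most \<open>e\<close> after
      multiplication by \<open>C\<close>, also when \<open>C\<close> is 0.\<close>
    define r where "r = W2 \<mu> \<nu> + e / (C + 1)"
    have "W2 \<mu> \<nu> < r" using C \<open>e > 0\<close> by (auto simp: r_def)
    from coupling_of_P2[OF mu this] obtain \<pi> where pi: "\<pi> \<in> couplings \<mu> \<nu>" "norm2 \<pi> (\<lambda>p. fst p - snd p) < r" .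
    note D = couplingsD[OF pi(1)]
    interpret prob_space \<pi> by fact
    have i2: "integrable \<pi> (\<lambda>p. (fst p)\<^sup>2)" "integrable \<pi> (\<lambda>p. (snd p)\<^sup>2)"
      using P2D(4)[OF mu(1)] P2D(4)[OF mu(2)]
      unfolding D(3,4)[symmetric] by (simp_all add: integrable_law_iff D(5,6))
    have i4: "integrable \<pi> (\<lambda>p. \<phi> (fst p))" "integrable \<pi> (\<lambda>p. \<phi> (snd p))"
      using phi(2,3) unfolding D(3,4)[symmetric] integrable_law_iff[OF D(5) phi(1)] integrable_law_iff[OF D(6) phi(1)] by auto
    have "(\<integral>x. \<phi> x \<partial>\<mu>) = (\<integral>p. \<phi> (fst p) \<partial>\<pi>)" "(\<integral>x. \<phi> x \<partial>\<nu>) = (\<integral>p. \<phi> (snd p) \<partial>\<pi>)"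
      unfolding D(3,4)[symmetric] by (simp_all add: integral_law D(5,6) phi(1))
    moreover have i3: "integrable \<pi> (\<lambda>p. (fst p - snd p)\<^sup>2)"
      using integrable_square_add[OF D(5), of "\<lambda>p. - snd p"] D i2 by simp
    ultimately have "\<bar>(\<integral>x. \<phi> x \<partial>\<mu>) - (\<integral>x. \<phi> x \<partial>\<nu>)\<bar> = \<bar>\<integral>p. \<phi> (fst p) - \<phi> (snd p) \<partial>\<pi>\<bar>" using i4 by simp
    also have "\<dots> \<le> (\<integral>p. C * \<bar>fst p - snd p\<bar> \<partial>\<pi>)"
    proof (rule order_trans[OF integral_abs_bound], rule integral_mono)
      have "integrable \<pi> (\<lambda>p. fst p - snd p)" using i3 D(5,6) by (rule_tac integrable_of_square) auto
      then show "integrable \<pi> (\<lambda>p. C * \<bar>fst p - snd p\<bar>)" by simp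
    qed (use i4 lip in auto)
    also have "\<dots> \<le> C * norm2 \<pi> (\<lambda>p. fst p - snd p)"
      using integral_abs_le_norm2[OF _ i3] D C by (simp add: mult_left_mono)
    also have "\<dots> \<le> C * r" using pi C by (intro mult_left_mono) auto
    also have "\<dots> \<le> C * W2 \<mu> \<nu> + e" using C \<open>e > 0\<close> by (auto simp: r_def field_simps)
    finally show "\<bar>(\<integral>x. \<phi> x \<partial>\<mu>) - (\<integral>x. \<phi> x \<partial>\<nu>)\<bar> \<le> C * W2 \<mu> \<nu> + e" .
  qed
qed

section \<open>Monotonicity gap and mixtures of measures\<close>

definition mono_gap :: "(real \<Rightarrow> real measure \<Rightarrow> real) \<Rightarrow> real measure \<Rightarrow> real measure \<Rightarrow> real" where
  "mono_gap U \<mu> \<nu> = (\<integral>x. U x \<mu> - U x \<nu> \<partial>\<mu>) - (\<integral>x. U x \<mu> - U x \<nu> \<partial>\<nu>)"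

lemma cont_P2_tendsto:
  assumes "cont_P2 S f" "y \<in> S" "\<And>n::nat. yn n \<in> S" "yn \<longlonglongrightarrow> y"
    and "\<mu> \<in> P2" "\<And>n. \<mu>n n \<in> P2" "(\<lambda>n. W2 \<mu> (\<mu>n n)) \<longlonglongrightarrow> 0"
  shows "(\<lambda>n. f (yn n) (\<mu>n n)) \<longlonglongrightarrow> f y \<mu>"
proof (rule metric_LIMSEQ_I)
  fix e :: real assume "0 < e"
  then obtain d where d: "d > 0" and *: "\<And>y' \<mu>'. y' \<in> S \<Longrightarrow> \<mu>' \<in> P2 \<Longrightarrow> dist y y' < d \<Longrightarrow> W2 \<mu> \<mu>' < d \<Longrightarrow> dist (f y \<mu>) (f y' \<mu>') < e"
    using assms(1)[unfolded cont_P2_def, rule_format, OF assms(2,5) \<open>0 < e\<close>] by blast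
  have "\<forall>\<^sub>F n in sequentially. dist (yn n) y < d"
    using tendstoD[OF assms(4) d] .
  moreover have "\<forall>\<^sub>F n in sequentially. W2 \<mu> (\<mu>n n) < d"
    using order_tendstoD(2)[OF assms(7) d] .
  ultimately have "\<forall>\<^sub>F n in sequentially. dist (f (yn n) (\<mu>n n)) (f y \<mu>) < e"
  proof eventually_elim
    case (elim n)
    with *[OF assms(3)[of n] assms(6)[of n]] show ?case by (simp add: dist_commute)
  qed
  then show "\<exists>no. \<forall>n\<ge>no. dist (f (yn n) (\<mu>n n)) (f y \<mu>) < e"
    by (simp add: eventually_sequentially)
qed

lemma W2_law_tendsto:
  assumes "prob_space N" "X \<in> borel_measurable N" "\<And>n. Xn n \<in> borel_measurable N"
    and "integrable N (\<lambda>\<omega>. (X \<omega>)\<^sup>2)" "\<And>n. integrable N (\<lambda>\<omega>. (Xn n \<omega>)\<^sup>2)"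
    and "(\<lambda>n. norm2 N (\<lambda>\<omega>. X \<omega> - Xn n \<omega>)) \<longlonglongrightarrow> 0"
  shows "(\<lambda>n::nat. W2 (law N X) (law N (Xn n))) \<longlonglongrightarrow> 0"
proof (rule tendsto_sandwich[OF _ _ tendsto_const assms(6)])
  show "\<forall>\<^sub>F n in sequentially. 0 \<le> W2 (law N X) (law N (Xn n))"
    by (intro always_eventually allI W2_nonneg law_P2 assms)
  show "\<forall>\<^sub>F n in sequentially. W2 (law N X) (law N (Xn n)) \<le> norm2 N (\<lambda>\<omega>. X \<omega> - Xn n \<omega>)"
    by (intro always_eventually allI W2_law_le assms)
qed

text \<open>Lipschitz functions grow linearly, and second moments control first ones. This supplies
  integrability for functions of which only the derivatives are bounded.\<close>

lemma lipschitz_P2: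
  fixes \<phi> :: "real \<Rightarrow> real"
  assumes lip: "\<And>x y. \<bar>\<phi> x - \<phi> y\<bar> \<le> C * \<bar>x - y\<bar>" and mu: "\<mu> \<in> P2"
  shows "\<phi> \<in> borel_measurable borel" "integrable \<mu> \<phi>"
proof -
  have "C-lipschitz_on UNIV \<phi>"
    using lip lip[of 0 1] by (intro lipschitz_onI) (auto simp: dist_real_def)
  then show m: "\<phi> \<in> borel_measurable borel"
    by (intro borel_measurable_continuous_onI lipschitz_on_continuous_on)
  interpret prob_space \<mu> by (rule P2D[OF mu])
  have C: "C \<ge> 0" using lip[of 0 1] by simp
  show "integrable \<mu> \<phi>"
  proof (rule Bochner_Integration.integrable_bound)
    show "integrable \<mu> (\<lambda>x. \<bar>\<phi> 0\<bar> + C * \<bar>x\<bar>)" using P2D(5)[OF mu] by simp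
    have "\<bar>\<phi> x\<bar> \<le> \<bar>\<phi> 0\<bar> + C * \<bar>x\<bar>" for x using lip[of x 0] by simp
    then have "norm (\<phi> x) \<le> norm (\<bar>\<phi> 0\<bar> + C * \<bar>x\<bar>)" for x using order_trans[OF _ abs_ge_self[of "\<bar>\<phi> 0\<bar> + C * \<bar>x\<bar>"]] by simp
    then show "AE x in \<mu>. norm (\<phi> x) \<le> norm (\<bar>\<phi> 0\<bar> + C * \<bar>x\<bar>)" by simp
  qed (use m P2D(2)[OF mu] in \<open>simp cong: measurable_cong_sets\<close>)
qed

text \<open>Integrand and measure move together. With the measure fixed at \<open>\<mu>\<close>,
  dominated convergence applies; exchanging \<open>\<mu>\<close> for \<open>\<mu>n n\<close> costs
  at most \<open>C * W2 \<mu> (\<mu>n n)\<close>, because the Lipschitz constant is common to all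
  \<open>n\<close>.\<close>

lemma integral_tendsto_W2:
  fixes u :: "real \<Rightarrow> real" and un :: "nat \<Rightarrow> real \<Rightarrow> real"
  assumes mu: "\<mu> \<in> P2" "\<And>n. \<mu>n n \<in> P2" "(\<lambda>n. W2 \<mu> (\<mu>n n)) \<longlonglongrightarrow> 0"
    and lip: "\<And>n x y. \<bar>un n x - un n y\<bar> \<le> C * \<bar>x - y\<bar>"
    and lim: "\<And>x. (\<lambda>n. un n x) \<longlonglongrightarrow> u x"
  shows "(\<lambda>n. \<integral>x. un n x \<partial>\<mu>n n) \<longlonglongrightarrow> (\<integral>x. u x \<partial>\<mu>)"
proof -
  have ulip: "\<bar>u x - u y\<bar> \<le> C * \<bar>x - y\<bar>" for x y
    using tendsto_rabs[OF tendsto_diff[OF lim lim]] by (rule LIMSEQ_le_const2) (use lip in auto)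
  have C: "C \<ge> 0" using ulip[of 0 1] by simp
  interpret prob_space \<mu> by (rule P2D[OF mu(1)])
  \<comment> \<open>Convergence at the single point 0 bounds all values there; with the Lipschitz
    bound this yields a dominating function of linear growth.\<close>
  obtain K where K: "\<And>n. \<bar>un n 0\<bar> \<le> K"
    using convergent_imp_Bseq[OF convergentI[OF lim[of 0]]] by (auto simp: Bseq_def)
  have 1: "(\<lambda>n. \<integral>x. un n x \<partial>\<mu>) \<longlonglongrightarrow> (\<integral>x. u x \<partial>\<mu>)"
  proof (rule integral_dominated_convergence)
    show "integrable \<mu> (\<lambda>x. K + C * \<bar>x\<bar>)" using P2D(5)[OF mu(1)] by simp
    have "\<bar>un n x\<bar> \<le> K + C * \<bar>x\<bar>" for x n using lip[of n x 0] K[of n] by simp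
    then show "AE x in \<mu>. norm (un n x) \<le> K + C * \<bar>x\<bar>" for n by simp
  qed (use lim lipschitz_P2(1)[OF ulip mu(1)] lipschitz_P2(1)[OF lip mu(1)] P2D(2)[OF mu(1)] in \<open>auto cong: measurable_cong_sets\<close>)
  have W0: "(\<lambda>n. C * W2 \<mu> (\<mu>n n)) \<longlonglongrightarrow> C * 0" by (intro tendsto_intros mu)
  have "\<bar>(\<integral>x. un n x \<partial>\<mu>) - (\<integral>x. un n x \<partial>\<mu>n n)\<bar> \<le> C * W2 \<mu> (\<mu>n n)" for n
    by (rule integral_diff_le_W2[OF mu(1,2) lip lipschitz_P2(1)[OF lip mu(1)] lipschitz_P2(2)[OF lip mu(1)] lipschitz_P2(2)[OF lip mu(2)]])
  then have "\<forall>\<^sub>F n in sequentially. norm ((\<integral>x. un n x \<partial>\<mu>) - (\<integral>x. un n x \<partial>\<mu>n n)) \<le> C * W2 \<mu> (\<mu>n n)"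
    by (simp only: real_norm_def eventually_True)
  then have 2: "(\<lambda>n. (\<integral>x. un n x \<partial>\<mu>) - (\<integral>x. un n x \<partial>\<mu>n n)) \<longlonglongrightarrow> 0"
    by (rule Lim_null_comparison) (use W0 in simp)
  show ?thesis using tendsto_diff[OF 1 2] by simp
qed

text \<open>The functions may depend on \<open>n\<close>, so that time can vary together with both
  measures.\<close>

lemma mono_gap_tendsto:
  fixes U :: "real \<Rightarrow> real measure \<Rightarrow> real"
  assumes mu: "\<mu> \<in> P2" "\<And>n. \<mu>n n \<in> P2" "(\<lambda>n. W2 \<mu> (\<mu>n n)) \<longlonglongrightarrow> 0"
    and nu: "\<nu> \<in> P2" "\<And>n. \<nu>n n \<in> P2" "(\<lambda>n. W2 \<nu> (\<nu>n n)) \<longlonglongrightarrow> 0"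
    and lip: "\<And>n x y m. m \<in> P2 \<Longrightarrow> \<bar>Uk n x m - Uk n y m\<bar> \<le> C * \<bar>x - y\<bar>"
    and lim: "\<And>x. (\<lambda>n. Uk n x (\<mu>n n)) \<longlonglongrightarrow> U x \<mu>" "\<And>x. (\<lambda>n. Uk n x (\<nu>n n)) \<longlonglongrightarrow> U x \<nu>"
  shows "(\<lambda>n::nat. mono_gap (Uk n) (\<mu>n n) (\<nu>n n)) \<longlonglongrightarrow> mono_gap U \<mu> \<nu>"
proof -
  have *: "\<bar>Uk n x (\<mu>n n) - Uk n x (\<nu>n n) - (Uk n y (\<mu>n n) - Uk n y (\<nu>n n))\<bar> \<le> 2 * C * \<bar>x - y\<bar>" for n x y
    using lip[OF mu(2), of n x n y] lip[OF nu(2), of n x n y] by linarith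
  show ?thesis unfolding mono_gap_def
    by (intro tendsto_diff[OF integral_tendsto_W2[OF mu *] integral_tendsto_W2[OF nu *]] tendsto_diff lim)
qed

section \<open>Mixtures realised by a coin flip\<close>

lemma distr_pair_snd:
  assumes "prob_space M" "prob_space N"
  shows "distr (M \<Otimes>\<^sub>M N) N snd = N"
proof -
  interpret M: prob_space M by fact
  interpret N: prob_space N by fact
  interpret pair_prob_space M N ..
  have "distr (M \<Otimes>\<^sub>M N) N snd = distr (distr (N \<Otimes>\<^sub>M M) (M \<Otimes>\<^sub>M N) (\<lambda>(x, y). (y, x))) N snd"
    using distr_pair_swap by simp
  also have "\<dots> = distr (N \<Otimes>\<^sub>M M) N fst"
    by (subst distr_distr) (auto intro!: distr_cong)
  also have "\<dots> = N" by (rule M.distr_pair_fst)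
  finally show ?thesis .
qed

lemma bernoulli_pair:
  fixes f :: "bool \<Rightarrow> 'a \<Rightarrow> real"
  assumes "prob_space N" and f: "\<And>c. integrable N (f c)" and p: "p \<in> {0..1}"
  shows "integrable (measure_pmf (bernoulli_pmf p) \<Otimes>\<^sub>M N) (\<lambda>z. f (fst z) (snd z))" (is ?A)
    and "(\<integral>z. f (fst z) (snd z) \<partial>(measure_pmf (bernoulli_pmf p) \<Otimes>\<^sub>M N)) = p * (\<integral>x. f True x \<partial>N) + (1 - p) * (\<integral>x. f False x \<partial>N)" (is ?B)
proof -
  interpret N: prob_space N by fact
  interpret P: pair_prob_space "measure_pmf (bernoulli_pmf p)" N ..
  have m: "(\<lambda>z. f (fst z) (snd z)) \<in> borel_measurable (measure_pmf (bernoulli_pmf p) \<Otimes>\<^sub>M N)"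
  proof -
    have "(\<lambda>z. f (fst z) (snd z)) \<in> borel_measurable (count_space UNIV \<Otimes>\<^sub>M N)"
      by (rule measurable_pair_measure_countable1) (use f in auto)
    also have "borel_measurable (count_space UNIV \<Otimes>\<^sub>M N) = borel_measurable (measure_pmf (bernoulli_pmf p) \<Otimes>\<^sub>M N)"
      by (intro measurable_cong_sets sets_pair_measure_cong) auto
    finally show ?thesis .
  qed
  show A: ?A
  proof (rule P.Fubini_integrable[OF m])
    show "integrable (measure_pmf (bernoulli_pmf p)) (\<lambda>x. \<integral>y. norm (f (fst (x, y)) (snd (x, y))) \<partial>N)"
      by (rule integrable_measure_pmf_finite) simp
  qed (use f in auto)
  show ?B using P.integral_fst'[OF A] p by (simp add: integral_bernoulli_pmf mult.commute)
qed

text \<open>The mixture \<open>(1 - p) \<mu> + p \<nu>\<close>, built as the law of a variable: a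
  coin with success probability \<open>p\<close> chooses between two independent coordinates. In
  this form a coupling with \<open>\<mu>\<close> can be read off.\<close>

definition mix :: "real \<Rightarrow> real measure \<Rightarrow> real measure \<Rightarrow> real measure" where
  "mix p \<mu> \<nu> = law (measure_pmf (bernoulli_pmf p) \<Otimes>\<^sub>M (\<mu> \<Otimes>\<^sub>M \<nu>)) (\<lambda>z. if fst z then snd (snd z) else fst (snd z))"

lemma P2_pair:
  fixes f :: "real \<Rightarrow> real"
  assumes "\<mu> \<in> P2" "\<nu> \<in> P2" and f: "f \<in> borel_measurable borel"
  shows "prob_space (\<mu> \<Otimes>\<^sub>M \<nu>)" "fst \<in> borel_measurable (\<mu> \<Otimes>\<^sub>M \<nu>)" "snd \<in> borel_measurable (\<mu> \<Otimes>\<^sub>M \<nu>)"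
    "integrable (\<mu> \<Otimes>\<^sub>M \<nu>) (\<lambda>z. f (fst z)) \<longleftrightarrow> integrable \<mu> f" "(\<integral>z. f (fst z) \<partial>(\<mu> \<Otimes>\<^sub>M \<nu>)) = (\<integral>x. f x \<partial>\<mu>)"
    "integrable (\<mu> \<Otimes>\<^sub>M \<nu>) (\<lambda>z. f (snd z)) \<longleftrightarrow> integrable \<nu> f" "(\<integral>z. f (snd z) \<partial>(\<mu> \<Otimes>\<^sub>M \<nu>)) = (\<integral>x. f x \<partial>\<nu>)"
proof -
  note D = couplingsD[OF pair_in_couplings[OF assms(1,2)]]
  show "prob_space (\<mu> \<Otimes>\<^sub>M \<nu>)" "fst \<in> borel_measurable (\<mu> \<Otimes>\<^sub>M \<nu>)" "snd \<in> borel_measurable (\<mu> \<Otimes>\<^sub>M \<nu>)" by fact+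
  show "integrable (\<mu> \<Otimes>\<^sub>M \<nu>) (\<lambda>z. f (fst z)) \<longleftrightarrow> integrable \<mu> f" "(\<integral>z. f (fst z) \<partial>(\<mu> \<Otimes>\<^sub>M \<nu>)) = (\<integral>x. f x \<partial>\<mu>)"
    using integrable_law_iff[OF D(5) f] integral_law[OF D(5) f] unfolding D(3) by auto
  show "integrable (\<mu> \<Otimes>\<^sub>M \<nu>) (\<lambda>z. f (snd z)) \<longleftrightarrow> integrable \<nu> f" "(\<integral>z. f (snd z) \<partial>(\<mu> \<Otimes>\<^sub>M \<nu>)) = (\<integral>x. f x \<partial>\<nu>)"
    using integrable_law_iff[OF D(6) f] integral_law[OF D(6) f] unfolding D(4) by auto
qed

context
  fixes \<mu> \<nu> :: "real measure" and p :: real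
  assumes mu: "\<mu> \<in> P2" and nu: "\<nu> \<in> P2" and p: "p \<in> {0..1}"
begin

interpretation pair_prob_space "measure_pmf (bernoulli_pmf p)" "\<mu> \<Otimes>\<^sub>M \<nu>"
proof -
  interpret prob_space "\<mu> \<Otimes>\<^sub>M \<nu>" by (rule P2_pair[OF mu nu, of "\<lambda>x. x"]) simp
  show "pair_prob_space (measure_pmf (bernoulli_pmf p)) (\<mu> \<Otimes>\<^sub>M \<nu>)" ..
qed

lemma mix_choice_measurable:
  "(\<lambda>z. if fst z then snd (snd z) else fst (snd z)) \<in> borel_measurable (measure_pmf (bernoulli_pmf p) \<Otimes>\<^sub>M (\<mu> \<Otimes>\<^sub>M \<nu>))"
proof -
  have [measurable]: "snd \<in> borel_measurable (\<mu> \<Otimes>\<^sub>M \<nu>)" "fst \<in> borel_measurable (\<mu> \<Otimes>\<^sub>M \<nu>)"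
    using P2_pair(2,3)[OF mu nu, of "\<lambda>x. x"] by auto
  show ?thesis by measurable
qed

lemma
  fixes f :: "real \<Rightarrow> real"
  assumes f: "f \<in> borel_measurable borel" "integrable \<mu> f" "integrable \<nu> f"
  shows integrable_mix: "integrable (mix p \<mu> \<nu>) f" 
    and integral_mix: "(\<integral>x. f x \<partial>mix p \<mu> \<nu>) = (1 - p) * (\<integral>x. f x \<partial>\<mu>) + p * (\<integral>x. f x \<partial>\<nu>)"
proof -
  note P = P2_pair[OF mu nu f(1)]
  have i: "integrable (\<mu> \<Otimes>\<^sub>M \<nu>) (\<lambda>z. if c then f (snd z) else f (fst z))" for c :: bool
    using P(4,6) f by (cases c) auto
  note B = bernoulli_pair[where f="\<lambda>c z. if c then f (snd z) else f (fst z)", OF P(1) i p]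
  have eq: "f (if fst z then snd (snd z) else fst (snd z)) = (if fst z then f (snd (snd z)) else f (fst (snd z)))" for z :: "bool \<times> real \<times> real"
    by simp
  show "integrable (mix p \<mu> \<nu>) f"
    using B(1) unfolding mix_def integrable_law_iff[OF mix_choice_measurable f(1)] eq .
  show "(\<integral>x. f x \<partial>mix p \<mu> \<nu>) = (1 - p) * (\<integral>x. f x \<partial>\<mu>) + p * (\<integral>x. f x \<partial>\<nu>)"
    using B(2) P(5,7) unfolding mix_def integral_law[OF mix_choice_measurable f(1)] eq by simp
qed

lemma prob_space_mix: "prob_space (mix p \<mu> \<nu>)"
  unfolding mix_def law_def by (rule prob_space_distr[OF mix_choice_measurable])

lemma mix_P2: "mix p \<mu> \<nu> \<in> P2"
proof -
  have "integrable (mix p \<mu> \<nu>) (\<lambda>x. x\<^sup>2)"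
    by (rule integrable_mix[OF _ P2D(4)[OF mu] P2D(4)[OF nu]]) simp
  moreover have "sets (mix p \<mu> \<nu>) = sets borel" by (simp add: mix_def)
  ultimately show ?thesis using prob_space_mix by (simp add: P2_def)
qed

lemma measure_mix:
  assumes "S \<in> sets borel"
  shows "measure (mix p \<mu> \<nu>) S = (1 - p) * measure \<mu> S + p * measure \<nu> S"
proof -
  interpret \<mu>: prob_space \<mu> by (rule P2D[OF mu])
  interpret \<nu>: prob_space \<nu> by (rule P2D[OF nu])
  interpret m: prob_space "mix p \<mu> \<nu>" by (rule prob_space_mix)
  have "(\<integral>x. indicator S x \<partial>mix p \<mu> \<nu>) = (1 - p) * (\<integral>x. indicator S x \<partial>\<mu>) + p * (\<integral>x. indicator S x \<partial>\<nu>)"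
    using assms P2D(2)[OF mu] P2D(2)[OF nu] by (intro integral_mix integrable_real_indicator) (auto simp: \<mu>.emeasure_eq_measure \<nu>.emeasure_eq_measure)
  moreover have "S \<in> sets (mix p \<mu> \<nu>)" using assms by (simp add: mix_def)
  ultimately show ?thesis using assms P2D(2)[OF mu] P2D(2)[OF nu] by simp
qed

text \<open>The first coordinate and the chosen one differ only when the coin selects the second, so
  this coupling costs \<open>p\<close> times the cost of the independent coupling.\<close>

lemma W2_mix_le: "W2 \<mu> (mix p \<mu> \<nu>) \<le> sqrt (p * (\<integral>z. (fst z - snd z)\<^sup>2 \<partial>(\<mu> \<Otimes>\<^sub>M \<nu>)))"
proof -
  note P = P2_pair[OF mu nu, of "\<lambda>x. x\<^sup>2", OF borel_measurable_power[OF measurable_ident_sets[OF refl]]]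
  have [measurable]: "snd \<in> borel_measurable (\<mu> \<Otimes>\<^sub>M \<nu>)" "fst \<in> borel_measurable (\<mu> \<Otimes>\<^sub>M \<nu>)"
    using P(2,3) by auto
  let ?N = "measure_pmf (bernoulli_pmf p) \<Otimes>\<^sub>M (\<mu> \<Otimes>\<^sub>M \<nu>)"
  have "law ?N (\<lambda>z. fst (snd z)) = distr (distr ?N (\<mu> \<Otimes>\<^sub>M \<nu>) snd) borel fst"
    unfolding law_def by (subst distr_distr) (auto simp: comp_def)
  also have "distr ?N (\<mu> \<Otimes>\<^sub>M \<nu>) snd = \<mu> \<Otimes>\<^sub>M \<nu>"
    by (rule distr_pair_snd[OF measure_pmf.prob_space_axioms P(1)])
  also have "distr (\<mu> \<Otimes>\<^sub>M \<nu>) borel fst = \<mu>"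
    using couplingsD(3)[OF pair_in_couplings[OF mu nu]] by (simp add: law_def)
  finally have 1: "law ?N (\<lambda>z. fst (snd z)) = \<mu>" .
  have "W2 \<mu> (mix p \<mu> \<nu>) \<le> norm2 ?N (\<lambda>z. fst (snd z) - (if fst z then snd (snd z) else fst (snd z)))"
    unfolding mix_def by (subst 1[symmetric], rule W2_law_le[OF prob_space_axioms _ mix_choice_measurable]) measurable
  also have "(\<lambda>z. (fst (snd z) - (if fst z then snd (snd z) else fst (snd z)))\<^sup>2) = (\<lambda>z. if fst z then (fst (snd z) - snd (snd z))\<^sup>2 else (0::real))"
    by (auto simp: fun_eq_iff)
  then have "norm2 ?N (\<lambda>z. fst (snd z) - (if fst z then snd (snd z) else fst (snd z))) = 
      sqrt (p * (\<integral>z. (fst z - snd z)\<^sup>2 \<partial>(\<mu> \<Otimes>\<^sub>M \<nu>)))"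
  proof -
    have "integrable (\<mu> \<Otimes>\<^sub>M \<nu>) (\<lambda>z. (fst z)\<^sup>2)" "integrable (\<mu> \<Otimes>\<^sub>M \<nu>) (\<lambda>z. (snd z)\<^sup>2)"
      using P P2D[OF mu] P2D[OF nu] by auto
    then have "integrable (\<mu> \<Otimes>\<^sub>M \<nu>) (\<lambda>z. (fst z - snd z)\<^sup>2)"
      using integrable_square_add[of fst "\<mu> \<Otimes>\<^sub>M \<nu>" "\<lambda>z. - snd z"] by simp
    then have i: "integrable (\<mu> \<Otimes>\<^sub>M \<nu>) (\<lambda>z. if c then (fst z - snd z)\<^sup>2 else 0)" for c :: bool by (cases c) auto
    show ?thesis unfolding norm2_def \<open>_ = (\<lambda>z. if fst z then _ z else 0)\<close>
      using bernoulli_pair(2)[where f="\<lambda>c z. if c then (fst z - snd z)\<^sup>2 else 0", OF P(1) i p] by simp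
  qed
  finally show ?thesis .
qed

end

section \<open>The filtered space and paths of Lions derivatives\<close>

lemma W2_self: "\<mu> \<in> P2 \<Longrightarrow> W2 \<mu> \<mu> = 0"
proof -
  assume mu: "\<mu> \<in> P2"
  have "W2 (law \<mu> (\<lambda>x. x)) (law \<mu> (\<lambda>x. x)) \<le> norm2 \<mu> (\<lambda>x. x - x)"
    by (rule W2_law_le[OF P2D(1)[OF mu]]) (simp_all add: measurable_ident_sets[OF P2D(2)[OF mu]])
  then show ?thesis using W2_nonneg[OF mu mu] by (simp add: law_id[OF P2D(2)[OF mu]] norm2_def)
qed

lemma cont_P2_continuous_on:
  assumes "cont_P2 S f" "\<mu> \<in> P2"
  shows "continuous_on S (\<lambda>y. f y \<mu>)"
  using cont_P2_tendsto[OF assms(1) _ _ _ assms(2), of _ _ "\<lambda>_. \<mu>"]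
  by (auto simp: continuous_on_sequentially comp_def assms(2) W2_self)

section \<open>Square integrable variables on the filtered space\<close>

locale mfg_space =
  fixes M :: "'w measure" and \<G>0 :: "'w measure" and B :: "real \<Rightarrow> 'w \<Rightarrow> real" and T :: real
  assumes T: "0 < T" and filtered: "filtered_space M \<G>0 T B"
begin

abbreviation "\<F> \<equiv> filt M \<G>0 B"

sublocale prob_space M
  using filtered by (simp add: filtered_space_def)

lemma subalgebra_G0: "subalgebra M \<G>0"
  using filtered by (simp add: filtered_space_def)

lemma B_measurable: "t \<in> {0..T} \<Longrightarrow> B t \<in> borel_measurable M"
  using filtered by (simp add: filtered_space_def brownian_motion_def)

lemma sets_filt: "sets (\<F> t) = sigma_sets (space M) (sets \<G>0 \<union> (\<Union>s\<in>{0..t}. {B s -` S \<inter> space M |S. S \<in> sets borel}) \<union> null_sets M)"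
proof -
  have "sets \<G>0 \<subseteq> Pow (space M)" using sets.space_closed[of \<G>0] subalgebra_G0 by (auto simp: subalgebra_def)
  moreover have "null_sets M \<subseteq> Pow (space M)" using sets.sets_into_space by (auto simp: null_sets_def)
  ultimately show ?thesis unfolding filt_def by (intro sets_measure_of) auto
qed

lemma space_filt [simp]: "space (\<F> t) = space M"
  unfolding filt_def by (rule space_measure_of_conv)

lemma subalgebra_filt: "t \<in> {0..T} \<Longrightarrow> subalgebra M (\<F> t)"
  unfolding subalgebra_def sets_filt
  using subalgebra_G0 B_measurable
  by (auto simp: subalgebra_def intro!: sets.sigma_sets_subset measurable_sets)

lemma filt_mono: "s \<le> t \<Longrightarrow> sets (\<F> s) \<subseteq> sets (\<F> t)"
  unfolding sets_filt by (intro sigma_sets_mono' Un_mono UN_mono order_refl) auto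

lemma G0_subset_filt: "sets \<G>0 \<subseteq> sets (\<F> t)"
  unfolding sets_filt by auto

lemma measurable_filt_mono: "s \<le> t \<Longrightarrow> f \<in> measurable (\<F> s) N \<Longrightarrow> f \<in> measurable (\<F> t) N"
  using filt_mono[of s t] by (auto simp: measurable_def)

lemma measurable_filt: "t \<in> {0..T} \<Longrightarrow> f \<in> measurable (\<F> t) N \<Longrightarrow> f \<in> measurable M N"
  using measurable_from_subalg[OF subalgebra_filt] .

lemma measurable_G0_filt: "f \<in> measurable \<G>0 N \<Longrightarrow> f \<in> measurable (\<F> t) N"
  using G0_subset_filt[of t] subalgebra_G0 by (auto simp: measurable_def subalgebra_def)

abbreviation "LF t \<equiv> L2 M (\<F> t)"

lemma LF_iff: "t \<in> {0..T} \<Longrightarrow> X \<in> LF t \<longleftrightarrow> X \<in> borel_measurable (\<F> t) \<and> integrable M (\<lambda>\<omega>. (X \<omega>)\<^sup>2)"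
  using measurable_filt by (auto simp: L2_def)

lemma LFD:
  assumes "X \<in> LF t"
  shows "X \<in> borel_measurable (\<F> t)" "X \<in> borel_measurable M" "integrable M (\<lambda>\<omega>. (X \<omega>)\<^sup>2)" "integrable M X" "law M X \<in> P2"
proof -
  show *: "X \<in> borel_measurable (\<F> t)" "X \<in> borel_measurable M" "integrable M (\<lambda>\<omega>. (X \<omega>)\<^sup>2)"
    using assms by (auto simp: L2_def)
  show "integrable M X" by (rule integrable_of_square[OF *(2,3)])
  show "law M X \<in> P2" by (rule law_P2[OF prob_space_axioms *(2,3)])
qed

lemma LF_mono: "s \<le> t \<Longrightarrow> X \<in> LF s \<Longrightarrow> X \<in> LF t"
  using measurable_filt_mono by (auto simp: L2_def)

lemma LF_add: "X \<in> LF t \<Longrightarrow> Y \<in> LF t \<Longrightarrow> (\<lambda>\<omega>. X \<omega> + Y \<omega>) \<in> LF t"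
  using integrable_square_add[of X M Y] by (auto simp: L2_def)

lemma LF_scale: "X \<in> LF t \<Longrightarrow> (\<lambda>\<omega>. c * X \<omega>) \<in> LF t"
  by (auto simp: L2_def power_mult_distrib)

lemma LF_diff: "X \<in> LF t \<Longrightarrow> Y \<in> LF t \<Longrightarrow> (\<lambda>\<omega>. X \<omega> - Y \<omega>) \<in> LF t"
  using LF_add[OF _ LF_scale[of Y t "-1"], of X] by simp

lemma LF_bounded_mult:
  assumes "t \<in> {0..T}" "X \<in> LF t" "f \<in> borel_measurable (\<F> t)" "\<And>\<omega>. \<omega> \<in> space M \<Longrightarrow> \<bar>f \<omega>\<bar> \<le> K"
  shows "(\<lambda>\<omega>. f \<omega> * X \<omega>) \<in> LF t"
proof -
  have f: "f \<in> borel_measurable M" using measurable_filt assms by blast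
  have "integrable M (\<lambda>\<omega>. (f \<omega> * X \<omega>)\<^sup>2)"
  proof (rule Bochner_Integration.integrable_bound)
    show "integrable M (\<lambda>\<omega>. K\<^sup>2 * (X \<omega>)\<^sup>2)" using LFD[OF assms(2)] by simp
    have "(f \<omega>)\<^sup>2 \<le> K\<^sup>2" if "\<omega> \<in> space M" for \<omega>
      using assms(4)[OF that] by (metis abs_ge_zero power2_abs power_mono)
    then show "AE \<omega> in M. norm ((f \<omega> * X \<omega>)\<^sup>2) \<le> norm (K\<^sup>2 * (X \<omega>)\<^sup>2)"
      by (auto simp: power_mult_distrib abs_mult intro!: mult_right_mono)
  qed (use f LFD[OF assms(2)] in auto)
  then show ?thesis using assms LFD[OF assms(2)] by (subst LF_iff) auto
qed

lemma LF_const: "t \<in> {0..T} \<Longrightarrow> (\<lambda>_. c) \<in> LF t"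
  by (auto simp: L2_def)

text \<open>The variable is known at the initial time, hence at every time; the starting states of
  the flow are obtained this way at an arbitrary \<open>t\<close>.\<close>

lemma realize_P2:
  assumes "\<mu> \<in> P2"
  obtains \<xi> where "\<xi> \<in> borel_measurable \<G>0" "law M \<xi> = \<mu>" "\<And>t. t \<in> {0..T} \<Longrightarrow> \<xi> \<in> LF t"
proof -
  obtain \<xi> where \<xi>: "\<xi> \<in> borel_measurable \<G>0" "law M \<xi> = \<mu>"
    using filtered P2D(1,2)[OF assms] unfolding filtered_space_def by blast
  have m: "\<xi> \<in> borel_measurable M" using \<xi>(1) by (rule measurable_from_subalg[OF subalgebra_G0])
  have "integrable M (\<lambda>\<omega>. (\<xi> \<omega>)\<^sup>2)"
    using P2D(4)[OF assms] integrable_law_iff[OF m, of "\<lambda>x. x\<^sup>2"] \<xi>(2) by simp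
  then have "\<xi> \<in> LF t" if "t \<in> {0..T}" for t
    unfolding LF_iff[OF that] using measurable_G0_filt[OF \<xi>(1)] by blast
  then show thesis by (rule that[OF \<xi>])
qed

lemma T_in [simp]: "T \<in> {0..T}" "0 \<in> {0..T}"
  using T by auto

text \<open>The defining expansion at the base point \<open>\<xi> + \<theta> \<eta>\<close>, with
  increments \<open>h \<eta>\<close>, is a derivative along a line. Mean value theorems of one real
  variable thereby become available for functions of measures.\<close>

lemma lions_path:
  assumes "is_lions_deriv M (\<F> T) U D" and xi: "\<xi> \<in> LF T" and eta: "\<eta> \<in> LF T"
  shows "((\<lambda>\<theta>. U (law M (\<lambda>\<omega>. \<xi> \<omega> + \<theta> * \<eta> \<omega>))) has_real_derivative
     (\<integral>\<omega>. D (law M (\<lambda>\<omega>. \<xi> \<omega> + \<theta> * \<eta> \<omega>)) (\<xi> \<omega> + \<theta> * \<eta> \<omega>) * \<eta> \<omega> \<partial>M)) (at \<theta>)"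
    (is "(?f has_real_derivative ?d) _")
  unfolding DERIV_def LIM_eq
proof (intro allI impI)
  fix r :: real assume r: "r > 0"
  define n where "n = norm2 M \<eta>"
  have n: "n \<ge> 0" by (simp add: n_def)
  let ?x = "\<lambda>\<omega>. \<xi> \<omega> + \<theta> * \<eta> \<omega>"
  have x: "?x \<in> LF T" by (intro LF_add xi LF_scale eta)
  \<comment> \<open>Here \<open>n + 1\<close> replaces \<open>n\<close> to cover a direction of norm
    zero, and the factor 2 makes the final estimate strict.\<close>
  define e where "e = r / (2 * (n + 1))"
  have e: "e > 0" using r n by (simp add: e_def)
  obtain d where d: "d > 0" and *: "\<And>\<zeta>. \<zeta> \<in> LF T \<Longrightarrow> norm2 M \<zeta> < d \<Longrightarrow>
      \<bar>U (law M (\<lambda>\<omega>. ?x \<omega> + \<zeta> \<omega>)) - U (law M ?x) - (\<integral>\<omega>. D (law M ?x) (?x \<omega>) * \<zeta> \<omega> \<partial>M)\<bar> \<le> e * norm2 M \<zeta>"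
    using conjunct2[OF assms(1)[unfolded is_lions_deriv_def, rule_format, OF x], rule_format, OF e] by blast
  show "\<exists>s>0. \<forall>x. x \<noteq> 0 \<and> norm (x - 0) < s \<longrightarrow> norm ((?f (\<theta> + x) - ?f \<theta>) / x - ?d) < r"
  proof (intro exI conjI allI impI)
    show "d / (n + 1) > 0" using d n by simp
    fix h :: real assume h: "h \<noteq> 0 \<and> norm (h - 0) < d / (n + 1)"
    have "norm2 M (\<lambda>\<omega>. h * \<eta> \<omega>) = \<bar>h\<bar> * n" by (simp add: norm2_scale n_def)
    moreover have "\<bar>h\<bar> * n < d"
    proof -
      have "\<bar>h\<bar> * n \<le> \<bar>h\<bar> * (n + 1)" by (simp add: mult_left_mono)
      also have "\<dots> < d" using h n by (simp add: field_simps)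
      finally show ?thesis .
    qed
    ultimately have b: "\<bar>U (law M (\<lambda>\<omega>. ?x \<omega> + h * \<eta> \<omega>)) - U (law M ?x) - (\<integral>\<omega>. D (law M ?x) (?x \<omega>) * (h * \<eta> \<omega>) \<partial>M)\<bar> \<le> e * (\<bar>h\<bar> * n)"
      using *[OF LF_scale[OF eta], of h] by simp
    have "(\<lambda>\<omega>. ?x \<omega> + h * \<eta> \<omega>) = (\<lambda>\<omega>. \<xi> \<omega> + (\<theta> + h) * \<eta> \<omega>)" by (simp add: algebra_simps)
    moreover have "(\<integral>\<omega>. D (law M ?x) (?x \<omega>) * (h * \<eta> \<omega>) \<partial>M) = h * ?d"
      by (simp add: mult.left_commute)
    ultimately have "\<bar>?f (\<theta> + h) - ?f \<theta> - h * ?d\<bar> \<le> e * (\<bar>h\<bar> * n)" using b by simp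
    then have "\<bar>?f (\<theta> + h) - ?f \<theta> - h * ?d\<bar> / \<bar>h\<bar> \<le> e * n"
      using h by (simp add: field_simps)
    moreover have "(?f (\<theta> + h) - ?f \<theta>) / h - ?d = (?f (\<theta> + h) - ?f \<theta> - h * ?d) / h"
      using h by (simp add: field_simps)
    moreover have "e * n < r"
    proof -
      have "e * n = r * (n / (2 * (n + 1)))" by (simp add: e_def)
      also have "\<dots> < r * 1" using r n by (intro mult_strict_left_mono) (auto simp: field_simps)
      finally show ?thesis by simp
    qed
    ultimately show "norm ((?f (\<theta> + h) - ?f \<theta>) / h - ?d) < r" by (simp add: abs_divide)
  qed
qed

text \<open>\<open>D\<close>, \<open>D1\<close> and \<open>D2\<close> stand for \<open>\<partial>\<^sub>\<mu>U\<close> and its derivatives in \<open>x\<close> and in the new variable.\<close>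

definition regular ::
  "(real \<Rightarrow> real measure \<Rightarrow> real) \<Rightarrow> (real \<times> real \<Rightarrow> real measure \<Rightarrow> real) \<Rightarrow> (real \<times> real \<Rightarrow> real measure \<Rightarrow> real)
    \<Rightarrow> (real \<times> real \<Rightarrow> real measure \<Rightarrow> real) \<Rightarrow> real \<Rightarrow> bool" where
  "regular U D D1 D2 C \<longleftrightarrow>
     (\<forall>y. is_lions_deriv M (\<F> T) (U y) (\<lambda>\<mu> x'. D (y, x') \<mu>))
   \<and> (\<forall>\<mu>\<in>P2. \<forall>y x'. ((\<lambda>y. D (y, x') \<mu>) has_real_derivative D1 (y, x') \<mu>) (at y)
        \<and> ((\<lambda>x'. D (y, x') \<mu>) has_real_derivative D2 (y, x') \<mu>) (at x'))
   \<and> cont_P2 UNIV D \<and> cont_P2 UNIV D1 \<and> cont_P2 UNIV D2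
   \<and> (\<forall>z. \<forall>\<mu>\<in>P2. \<bar>D z \<mu>\<bar> \<le> C \<and> \<bar>D1 z \<mu>\<bar> \<le> C \<and> \<bar>D2 z \<mu>\<bar> \<le> C)"

text \<open>The directions vary with \<open>n\<close>; the common dominating function
  \<open>Y\<close> keeps their norms bounded, so the factors \<open>\<epsilon> n\<close>
  decide.\<close>

lemma W2_perturb_tendsto:
  assumes "\<xi> \<in> LF T" "\<And>n. \<eta> n \<in> LF T" "Y \<in> borel_measurable M" "integrable M (\<lambda>\<omega>. (Y \<omega>)\<^sup>2)"
    and "\<And>n \<omega>. \<omega> \<in> space M \<Longrightarrow> \<bar>\<eta> n \<omega>\<bar> \<le> Y \<omega>" "\<epsilon> \<longlonglongrightarrow> 0"
  shows "(\<lambda>n. W2 (law M \<xi>) (law M (\<lambda>\<omega>. \<xi> \<omega> + \<epsilon> n * \<eta> n \<omega>))) \<longlonglongrightarrow> 0"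
proof (rule W2_law_tendsto[OF prob_space_axioms])
  have "norm2 M (\<eta> n) \<le> norm2 M Y" for n
    unfolding norm2_def
  proof (intro real_sqrt_le_mono integral_mono LFD(3)[OF assms(2)] assms(4))
    show "(\<eta> n \<omega>)\<^sup>2 \<le> (Y \<omega>)\<^sup>2" if "\<omega> \<in> space M" for \<omega>
      using power_mono[OF assms(5)[OF that] abs_ge_zero, of n 2] by simp
  qed
  moreover have "norm2 M (\<lambda>\<omega>. \<xi> \<omega> - (\<xi> \<omega> + \<epsilon> n * \<eta> n \<omega>)) = \<bar>\<epsilon> n\<bar> * norm2 M (\<eta> n)" for n
    using norm2_scale[of M "- \<epsilon> n" "\<eta> n"] by simp
  ultimately have "norm (norm2 M (\<lambda>\<omega>. \<xi> \<omega> - (\<xi> \<omega> + \<epsilon> n * \<eta> n \<omega>))) \<le> \<bar>\<epsilon> n\<bar> * norm2 M Y" for n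
    by (simp add: mult_left_mono)
  then have "\<forall>\<^sub>F n in sequentially. norm (norm2 M (\<lambda>\<omega>. \<xi> \<omega> - (\<xi> \<omega> + \<epsilon> n * \<eta> n \<omega>))) \<le> \<bar>\<epsilon> n\<bar> * norm2 M Y" by simp
  moreover have "(\<lambda>n. \<bar>\<epsilon> n\<bar> * norm2 M Y) \<longlonglongrightarrow> 0"
    using tendsto_mult_left_zero[OF tendsto_rabs_zero[OF assms(6)]] .
  ultimately show "(\<lambda>n. norm2 M (\<lambda>\<omega>. \<xi> \<omega> - (\<xi> \<omega> + \<epsilon> n * \<eta> n \<omega>))) \<longlonglongrightarrow> 0"
    by (rule Lim_null_comparison)
  show "\<xi> \<in> borel_measurable M" "integrable M (\<lambda>\<omega>. (\<xi> \<omega>)\<^sup>2)" by (rule LFD[OF assms(1)])+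
  show "(\<lambda>\<omega>. \<xi> \<omega> + \<epsilon> n * \<eta> n \<omega>) \<in> borel_measurable M" "integrable M (\<lambda>\<omega>. (\<xi> \<omega> + \<epsilon> n * \<eta> n \<omega>)\<^sup>2)" for n
    by (rule LFD[OF LF_add[OF assms(1) LF_scale[OF assms(2)]]])+
qed

end

section \<open>From the gap to the infinitesimal condition\<close>

text \<open>No order between \<open>a\<close> and \<open>b\<close> is assumed, and the mean point is
  located by its distance to \<open>a\<close>, which is what limit arguments use.\<close>

lemma mvt_real:
  fixes f :: "real \<Rightarrow> real"
  assumes "\<And>x. (f has_real_derivative f' x) (at x)"
  obtains z where "\<bar>z - a\<bar> \<le> \<bar>b - a\<bar>" "f b - f a = f' z * (b - a)"
proof (cases a b rule: linorder_cases)
  case less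
  from MVT2[OF this, of f f'] assms that show ?thesis by (force simp: mult.commute)
next
  case greater
  from MVT2[OF this, of f f'] assms obtain z where "b < z" "z < a" "f a - f b = (a - b) * f' z" by blast
  then show ?thesis by (intro that[of z]) (auto simp: algebra_simps)
qed (auto intro: that[of a])

context mfg_space
begin

lemma regularD:
  assumes "regular U D D1 D2 C"
  shows "is_lions_deriv M (\<F> T) (U y) (\<lambda>\<mu> x'. D (y, x') \<mu>)"
    and "\<mu> \<in> P2 \<Longrightarrow> ((\<lambda>y. D (y, x') \<mu>) has_real_derivative D1 (y, x') \<mu>) (at y)"
    and "\<mu> \<in> P2 \<Longrightarrow> ((\<lambda>x'. D (y, x') \<mu>) has_real_derivative D2 (y, x') \<mu>) (at x')"
    and "cont_P2 UNIV D" "cont_P2 UNIV D1" "cont_P2 UNIV D2"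
    and "\<mu> \<in> P2 \<Longrightarrow> \<bar>D z \<mu>\<bar> \<le> C" "\<mu> \<in> P2 \<Longrightarrow> \<bar>D1 z \<mu>\<bar> \<le> C" "\<mu> \<in> P2 \<Longrightarrow> \<bar>D2 z \<mu>\<bar> \<le> C"
  using assms unfolding regular_def by blast+

lemma cont_P2_borel:
  assumes "cont_P2 UNIV f" "\<mu> \<in> P2"
  shows "(\<lambda>z. f z \<mu>) \<in> borel_measurable borel"
  by (rule borel_measurable_continuous_onI[OF cont_P2_continuous_on[OF assms]])

text \<open>The gap is the mean of a double increment of \<open>U\<close>, once in space and once in
  the measure; two mean value theorems turn it into \<open>(\<epsilon> n)\<^sup>2\<close> times a
  mean of \<open>D1\<close> at nearby arguments. The directions vary with \<open>n\<close> under a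
  common dominating function, so that difference quotients of quantile curves can be
  inserted.\<close>

lemma gap_asymptotics:
  fixes U :: "real \<Rightarrow> real measure \<Rightarrow> real"
  assumes reg: "regular U D D1 D2 C"
    and lip: "\<And>m x y. m \<in> P2 \<Longrightarrow> \<bar>U x m - U y m\<bar> \<le> L * \<bar>x - y\<bar>"
    and xi: "\<xi> \<in> LF T" and eta: "\<And>n. \<eta> n \<in> LF T"
    and Y: "Y \<in> borel_measurable M" "integrable M (\<lambda>\<omega>. (Y \<omega>)\<^sup>2)" "\<And>n \<omega>. \<omega> \<in> space M \<Longrightarrow> \<bar>\<eta> n \<omega>\<bar> \<le> Y \<omega>"
    and eps: "\<And>n. \<epsilon> n > 0" "\<epsilon> \<longlonglongrightarrow> 0"
  shows "(\<lambda>n. mono_gap U (law M (\<lambda>\<omega>. \<xi> \<omega> + \<epsilon> n * \<eta> n \<omega>)) (law M \<xi>) / (\<epsilon> n)\<^sup>2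
     - (\<integral>p. D1 (\<xi> (fst p), \<xi> (snd p)) (law M \<xi>) * \<eta> n (fst p) * \<eta> n (snd p) \<partial>(M \<Otimes>\<^sub>M M))) \<longlonglongrightarrow> 0"
proof -
  note R = regularD[OF reg]
  define \<mu> where "\<mu> = law M \<xi>"
  define X where "X n \<omega> = \<xi> \<omega> + \<epsilon> n * \<eta> n \<omega>" for n \<omega>
  define W where "W n x = U x (law M (X n)) - U x \<mu>" for n x
  define J where "J n \<omega> = (\<integral>\<omega>'. D1 (\<xi> \<omega>, \<xi> \<omega>') \<mu> * \<eta> n \<omega> * \<eta> n \<omega>' \<partial>M)" for n \<omega>
  define Rn where "Rn n \<omega> = (W n (X n \<omega>) - W n (\<xi> \<omega>)) / (\<epsilon> n)\<^sup>2 - J n \<omega>" for n \<omega>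
  interpret PP: pair_prob_space M M ..
  have mu: "\<mu> \<in> P2" unfolding \<mu>_def by (rule LFD(5)[OF xi])
  have X: "X n \<in> LF T" for n unfolding X_def by (intro LF_add LF_scale xi eta)
  have lX: "law M (X n) \<in> P2" for n by (rule LFD(5)[OF X])
  note [measurable] = LFD(2)[OF xi] LFD(2)[OF eta] LFD(2)[OF X] Y(1) cont_P2_borel[OF R(5) mu]
  have iY: "integrable M Y" by (rule integrable_of_square[OF Y(1,2)])
  have C0: "0 \<le> C" using R(8)[OF mu, of 0] by linarith
  have Y0: "0 \<le> Y \<omega>" if "\<omega> \<in> space M" for \<omega> using Y(3)[OF that, of 0] by linarith
  have Wlip: "\<bar>W n x - W n y\<bar> \<le> (2 * L) * \<bar>x - y\<bar>" for n x y
    using lip[of "law M (X n)" x y, OF lX] lip[of \<mu> x y, OF mu] unfolding W_def by linarith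
  have Wm: "W n \<in> borel_measurable borel" and WX: "integrable M (\<lambda>\<omega>. W n (X n \<omega>))" and Wxi: "integrable M (\<lambda>\<omega>. W n (\<xi> \<omega>))" for n
  proof -
    show 1: "W n \<in> borel_measurable borel" by (rule lipschitz_P2(1)[OF Wlip mu])
    show "integrable M (\<lambda>\<omega>. W n (X n \<omega>))"
      using lipschitz_P2(2)[OF Wlip lX, of n n] by (subst (asm) integrable_law_iff[OF LFD(2)[OF X] 1])
    show "integrable M (\<lambda>\<omega>. W n (\<xi> \<omega>))"
      using lipschitz_P2(2)[OF Wlip mu, of n] unfolding \<mu>_def by (subst (asm) integrable_law_iff[OF LFD(2)[OF xi] 1])
  qed
  have gap: "mono_gap U (law M (X n)) \<mu> = (\<integral>\<omega>. W n (X n \<omega>) - W n (\<xi> \<omega>) \<partial>M)" for n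
  proof -
    have "mono_gap U (law M (X n)) \<mu> = (\<integral>x. W n x \<partial>law M (X n)) - (\<integral>x. W n x \<partial>\<mu>)" by (simp add: mono_gap_def W_def)
    also have "(\<integral>x. W n x \<partial>law M (X n)) = (\<integral>\<omega>. W n (X n \<omega>) \<partial>M)" by (rule integral_law[OF LFD(2)[OF X] Wm])
    also have "(\<integral>x. W n x \<partial>\<mu>) = (\<integral>\<omega>. W n (\<xi> \<omega>) \<partial>M)" unfolding \<mu>_def by (rule integral_law[OF LFD(2)[OF xi] Wm])
    finally show ?thesis using WX Wxi by simp
  qed
  have Jb: "\<bar>D1 z \<mu> * \<eta> n \<omega> * \<eta> n \<omega>'\<bar> \<le> C * Y \<omega> * Y \<omega>'" if "\<omega> \<in> space M" "\<omega>' \<in> space M" for z n \<omega> \<omega>'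
    unfolding abs_mult using R(8)[OF mu, of z] Y(3)[OF that(1), of n] Y(3)[OF that(2), of n] C0 Y0[OF that(1)] Y0[OF that(2)]
    by (intro mult_mono) auto
  have iJ: "integrable (M \<Otimes>\<^sub>M M) (\<lambda>p. D1 (\<xi> (fst p), \<xi> (snd p)) \<mu> * \<eta> n (fst p) * \<eta> n (snd p))" for n
  proof (rule Bochner_Integration.integrable_bound)
    show "integrable (M \<Otimes>\<^sub>M M) (\<lambda>p. C * Y (fst p) * Y (snd p))"
    proof (rule PP.Fubini_integrable)
      show "integrable M (\<lambda>x. \<integral>y. norm (C * Y (fst (x, y)) * Y (snd (x, y))) \<partial>M)"
        using iY by (simp add: abs_mult)
    qed (use iY in auto)
    show "AE p in M \<Otimes>\<^sub>M M. norm (D1 (\<xi> (fst p), \<xi> (snd p)) \<mu> * \<eta> n (fst p) * \<eta> n (snd p)) \<le> norm (C * Y (fst p) * Y (snd p))"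
      by (rule AE_I2) (auto simp: space_pair_measure intro: order_trans[OF Jb abs_ge_self])
  qed measurable
  have J: "integrable M (J n)" "(\<integral>p. D1 (\<xi> (fst p), \<xi> (snd p)) \<mu> * \<eta> n (fst p) * \<eta> n (snd p) \<partial>(M \<Otimes>\<^sub>M M)) = (\<integral>\<omega>. J n \<omega> \<partial>M)" for n
    using PP.integral_fst'[OF iJ] PP.integrable_fst'[OF iJ] by (simp_all add: J_def[abs_def])
  have main: "mono_gap U (law M (X n)) \<mu> / (\<epsilon> n)\<^sup>2
     - (\<integral>p. D1 (\<xi> (fst p), \<xi> (snd p)) \<mu> * \<eta> n (fst p) * \<eta> n (snd p) \<partial>(M \<Otimes>\<^sub>M M)) = (\<integral>\<omega>. Rn n \<omega> \<partial>M)" for n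
    unfolding gap J(2) Rn_def using WX Wxi J(1) by simp
  \<comment> \<open>For a fixed outer sample point the error is an inner integral of some
    \<open>A\<close> that vanishes in the limit and is dominated by an integrable product. Dominated
    convergence is used for the inner integral and again for the outer one.\<close>
  have key: "\<exists>A. (\<forall>\<omega>'\<in>space M. \<forall>n. \<bar>A n \<omega>'\<bar> \<le> 2 * C * Y \<omega> * Y \<omega>') \<and> (\<forall>\<omega>'\<in>space M. (\<lambda>n. A n \<omega>') \<longlonglongrightarrow> 0)
       \<and> (\<forall>n. A n \<in> borel_measurable M) \<and> (\<forall>n. Rn n \<omega> = (\<integral>\<omega>'. A n \<omega>' \<partial>M))" if w: "\<omega> \<in> space M" for \<omega>
  proof -
    let ?x = "\<xi> \<omega>"
    let ?y = "\<lambda>n. X n \<omega>"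
    let ?m = "\<lambda>n \<theta>. law M (\<lambda>\<omega>. \<xi> \<omega> + \<theta> * (\<epsilon> n * \<eta> n \<omega>))"
    have se: "(\<lambda>\<omega>. \<epsilon> n * \<eta> n \<omega>) \<in> LF T" for n by (intro LF_scale eta)
    have m: "(\<lambda>\<omega>. \<xi> \<omega> + \<theta> * (\<epsilon> n * \<eta> n \<omega>)) \<in> LF T" for n \<theta> by (intro LF_add LF_scale xi eta)
    have mP: "?m n \<theta> \<in> P2" for n \<theta> by (rule LFD(5)[OF m])
    have Dm: "(\<lambda>z. D z (?m n \<theta>)) \<in> borel_measurable borel" for n \<theta> by (rule cont_P2_borel[OF R(4) mP])
    let ?I = "\<lambda>n c \<theta>. \<integral>\<omega>'. D (c, \<xi> \<omega>' + \<theta> * (\<epsilon> n * \<eta> n \<omega>')) (?m n \<theta>) * (\<epsilon> n * \<eta> n \<omega>') \<partial>M"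
    \<comment> \<open>The mean value theorem is applied to the difference of the two paths, so that
      both space points share one \<open>\<theta>\<close>.\<close>
    have "\<forall>n. \<exists>\<theta>. 0 < \<theta> \<and> \<theta> < 1 \<and> W n (?y n) - W n ?x = ?I n (?y n) \<theta> - ?I n ?x \<theta>"
    proof
      fix n
      from MVT2[OF zero_less_one DERIV_diff[OF lions_path[OF R(1) xi se, of "?y n"] lions_path[OF R(1) xi se, of ?x]], of n n]
      obtain \<theta> where "0 < \<theta>" "\<theta> < 1" 
        "U (?y n) (?m n 1) - U ?x (?m n 1) - (U (?y n) (?m n 0) - U ?x (?m n 0)) = (1 - 0) * (?I n (?y n) \<theta> - ?I n ?x \<theta>)" by blast
      moreover have "?m n 1 = law M (X n)" "?m n 0 = \<mu>" by (simp_all add: X_def[abs_def] \<mu>_def)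
      ultimately show "\<exists>\<theta>. 0 < \<theta> \<and> \<theta> < 1 \<and> W n (?y n) - W n ?x = ?I n (?y n) \<theta> - ?I n ?x \<theta>"
        by (intro exI[of _ \<theta>]) (simp add: W_def)
    qed
    from choice[OF this] obtain \<theta> where th': "\<forall>n. 0 < \<theta> n \<and> \<theta> n < 1 \<and> W n (?y n) - W n ?x = ?I n (?y n) (\<theta> n) - ?I n ?x (\<theta> n)" ..
    then have th: "0 < \<theta> n" "\<theta> n < 1" and W: "W n (?y n) - W n ?x = ?I n (?y n) (\<theta> n) - ?I n ?x (\<theta> n)" for n by simp_all
    define x' where "x' n \<omega>' = \<xi> \<omega>' + \<theta> n * (\<epsilon> n * \<eta> n \<omega>')" for n \<omega>'
    define m' where "m' n = ?m n (\<theta> n)" for n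
    define A where "A n \<omega>' = ((D (?y n, x' n \<omega>') (m' n) - D (?x, x' n \<omega>') (m' n)) / \<epsilon> n - D1 (?x, \<xi> \<omega>') \<mu> * \<eta> n \<omega>) * \<eta> n \<omega>'" for n \<omega>'
    have m'x: "law M (x' n) = m' n" for n by (simp add: m'_def x'_def[abs_def])
    have m'P: "m' n \<in> P2" for n unfolding m'_def by (rule mP)
    have [measurable]: "x' n \<in> borel_measurable M" for n unfolding x'_def by measurable
    have [measurable]: "(\<lambda>z. D z (m' n)) \<in> borel_measurable borel" for n unfolding m'_def by (rule Dm)
    have Am: "A n \<in> borel_measurable M" for n unfolding A_def by measurable
    have iD: "integrable M (\<lambda>\<omega>'. D (c, x' n \<omega>') (m' n) * \<eta> n \<omega>')" for c n
    proof (rule Bochner_Integration.integrable_bound)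
      show "integrable M (\<lambda>\<omega>'. C * Y \<omega>')" using iY by simp
      show "AE \<omega>' in M. norm (D (c, x' n \<omega>') (m' n) * \<eta> n \<omega>') \<le> norm (C * Y \<omega>')"
      proof (rule AE_I2)
        fix \<omega>' assume w': "\<omega>' \<in> space M"
        show "norm (D (c, x' n \<omega>') (m' n) * \<eta> n \<omega>') \<le> norm (C * Y \<omega>')"
          unfolding real_norm_def abs_mult using C0 Y0[OF w'] Y(3)[OF w', of n] R(7)[OF m'P, of _ n] by (intro mult_mono) auto
      qed
    qed measurable
    have iD1: "integrable M (\<lambda>\<omega>'. D1 (?x, \<xi> \<omega>') \<mu> * \<eta> n \<omega> * \<eta> n \<omega>')" for n
    proof (rule Bochner_Integration.integrable_bound)
      show "integrable M (\<lambda>\<omega>'. C * Y \<omega> * Y \<omega>')" using iY by simp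
      show "AE \<omega>' in M. norm (D1 (?x, \<xi> \<omega>') \<mu> * \<eta> n \<omega> * \<eta> n \<omega>') \<le> norm (C * Y \<omega> * Y \<omega>')"
        by (rule AE_I2) (auto intro: order_trans[OF Jb[OF w] abs_ge_self])
    qed measurable
    have RA: "Rn n \<omega> = (\<integral>\<omega>'. A n \<omega>' \<partial>M)" for n
    proof -
      have "(\<integral>\<omega>'. A n \<omega>' \<partial>M) = (\<integral>\<omega>'. (D (?y n, x' n \<omega>') (m' n) * \<eta> n \<omega>' - D (?x, x' n \<omega>') (m' n) * \<eta> n \<omega>') / \<epsilon> n - D1 (?x, \<xi> \<omega>') \<mu> * \<eta> n \<omega> * \<eta> n \<omega>' \<partial>M)"
        unfolding A_def by (simp add: algebra_simps diff_divide_distrib)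
      also have "\<dots> = ((\<integral>\<omega>'. D (?y n, x' n \<omega>') (m' n) * \<eta> n \<omega>' \<partial>M) - (\<integral>\<omega>'. D (?x, x' n \<omega>') (m' n) * \<eta> n \<omega>' \<partial>M)) / \<epsilon> n - J n \<omega>"
        unfolding J_def using iD iD1 by simp
      also have "(\<integral>\<omega>'. D (?y n, x' n \<omega>') (m' n) * \<eta> n \<omega>' \<partial>M) - (\<integral>\<omega>'. D (?x, x' n \<omega>') (m' n) * \<eta> n \<omega>' \<partial>M) = (W n (?y n) - W n ?x) / \<epsilon> n"
        unfolding W x'_def[symmetric] m'_def[symmetric] using eps(1)[of n] by (simp add: field_simps mult.left_commute[of _ "\<epsilon> n"] m'x)
      finally show ?thesis by (simp add: Rn_def power2_eq_square)
    qed
    \<comment> \<open>The mean point may depend on the sample point in a non-measurable way;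
      measurability of \<open>A\<close> was read off its definition as a difference
      quotient.\<close>
    have "\<exists>z. \<bar>z - ?x\<bar> \<le> \<bar>\<epsilon> n * \<eta> n \<omega>\<bar> \<and> A n \<omega>' = (D1 (z, x' n \<omega>') (m' n) - D1 (?x, \<xi> \<omega>') \<mu>) * \<eta> n \<omega> * \<eta> n \<omega>'" for n \<omega>'
    proof -
      obtain z where z: "\<bar>z - ?x\<bar> \<le> \<bar>?y n - ?x\<bar>" "D (?y n, x' n \<omega>') (m' n) - D (?x, x' n \<omega>') (m' n) = D1 (z, x' n \<omega>') (m' n) * (?y n - ?x)"
        using mvt_real[OF R(2)[OF m'P]] by blast
      have "?y n - ?x = \<epsilon> n * \<eta> n \<omega>" by (simp add: X_def)
      with z eps(1)[of n] show ?thesis by (intro exI[of _ z]) (simp add: A_def algebra_simps)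
    qed
    then have "\<forall>n. \<forall>\<omega>'. \<exists>z. \<bar>z - ?x\<bar> \<le> \<bar>\<epsilon> n * \<eta> n \<omega>\<bar> \<and> A n \<omega>' = (D1 (z, x' n \<omega>') (m' n) - D1 (?x, \<xi> \<omega>') \<mu>) * \<eta> n \<omega> * \<eta> n \<omega>'" by simp
    from choice[OF allI[OF choice[OF spec[OF this]]]] obtain z where z': "\<forall>n. \<forall>\<omega>'. \<bar>z n \<omega>' - ?x\<bar> \<le> \<bar>\<epsilon> n * \<eta> n \<omega>\<bar> \<and> A n \<omega>' = (D1 (z n \<omega>', x' n \<omega>') (m' n) - D1 (?x, \<xi> \<omega>') \<mu>) * \<eta> n \<omega> * \<eta> n \<omega>'" ..
    then have z: "\<bar>z n \<omega>' - ?x\<bar> \<le> \<bar>\<epsilon> n * \<eta> n \<omega>\<bar>" 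
      and Az: "A n \<omega>' = (D1 (z n \<omega>', x' n \<omega>') (m' n) - D1 (?x, \<xi> \<omega>') \<mu>) * \<eta> n \<omega> * \<eta> n \<omega>'" for n \<omega>' by blast+
    have e0: "(\<lambda>n. \<bar>\<epsilon> n\<bar> * c) \<longlonglongrightarrow> 0" for c
      using tendsto_mult_left_zero[OF tendsto_rabs_zero[OF eps(2)]] .
    have zlim: "(\<lambda>n. z n \<omega>') \<longlonglongrightarrow> ?x" for \<omega>'
    proof (rule Lim_transform2[OF tendsto_const], rule Lim_null_comparison[OF _ e0[of "Y \<omega>"]])
      show "\<forall>\<^sub>F n in sequentially. norm (?x - z n \<omega>') \<le> \<bar>\<epsilon> n\<bar> * Y \<omega>"
      proof (intro always_eventually allI)
        fix n
        have "\<bar>\<epsilon> n * \<eta> n \<omega>\<bar> \<le> \<bar>\<epsilon> n\<bar> * Y \<omega>" unfolding abs_mult by (intro mult_left_mono Y w) auto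
        then show "norm (?x - z n \<omega>') \<le> \<bar>\<epsilon> n\<bar> * Y \<omega>" using z[of n \<omega>'] by (simp add: abs_minus_commute)
      qed
    qed
    have te: "\<bar>\<theta> n * (\<epsilon> n * \<eta> n \<omega>')\<bar> \<le> \<bar>\<epsilon> n\<bar> * Y \<omega>'" if "\<omega>' \<in> space M" for n \<omega>'
      using mult_mono[of "\<bar>\<theta> n\<bar>" 1 "\<bar>\<epsilon> n\<bar> * \<bar>\<eta> n \<omega>'\<bar>" "\<bar>\<epsilon> n\<bar> * Y \<omega>'"] th[of n] Y(3)[OF that, of n] 
      by (simp add: abs_mult mult_left_mono)
    have xlim: "(\<lambda>n. x' n \<omega>') \<longlonglongrightarrow> \<xi> \<omega>'" if "\<omega>' \<in> space M" for \<omega>'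
    proof (rule Lim_transform2[OF tendsto_const], rule Lim_null_comparison[OF _ e0[of "Y \<omega>'"]])
      show "\<forall>\<^sub>F n in sequentially. norm (\<xi> \<omega>' - x' n \<omega>') \<le> \<bar>\<epsilon> n\<bar> * Y \<omega>'"
        using te[OF that] by (auto simp: x'_def intro!: always_eventually)
    qed
    have "(\<lambda>n. \<theta> n * \<epsilon> n) \<longlonglongrightarrow> 0"
    proof (rule Lim_null_comparison[OF _ e0[of 1]], intro always_eventually allI)
      fix n show "norm (\<theta> n * \<epsilon> n) \<le> \<bar>\<epsilon> n\<bar> * 1"
        using mult_right_mono[of "\<bar>\<theta> n\<bar>" 1 "\<bar>\<epsilon> n\<bar>"] th[of n] by (simp add: abs_mult)
    qed
    from W2_perturb_tendsto[OF xi eta Y this] have mlim: "(\<lambda>n. W2 \<mu> (m' n)) \<longlonglongrightarrow> 0"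
      by (simp add: \<mu>_def m'_def mult.assoc)
    have Alim: "(\<lambda>n. A n \<omega>') \<longlonglongrightarrow> 0" if w': "\<omega>' \<in> space M" for \<omega>'
    proof (rule Lim_null_comparison[where g = "\<lambda>n. \<bar>D1 (z n \<omega>', x' n \<omega>') (m' n) - D1 (?x, \<xi> \<omega>') \<mu>\<bar> * (Y \<omega> * Y \<omega>')"])
      have "(\<lambda>n. D1 (z n \<omega>', x' n \<omega>') (m' n)) \<longlonglongrightarrow> D1 (?x, \<xi> \<omega>') \<mu>"
        by (rule cont_P2_tendsto[OF R(5) _ _ tendsto_Pair[OF zlim xlim[OF w']] mu m'P mlim]) auto
      from tendsto_mult_left_zero[OF tendsto_rabs_zero[OF LIM_zero[OF this]]]
      show "(\<lambda>n. \<bar>D1 (z n \<omega>', x' n \<omega>') (m' n) - D1 (?x, \<xi> \<omega>') \<mu>\<bar> * (Y \<omega> * Y \<omega>')) \<longlonglongrightarrow> 0" .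
      show "\<forall>\<^sub>F n in sequentially. norm (A n \<omega>') \<le> \<bar>D1 (z n \<omega>', x' n \<omega>') (m' n) - D1 (?x, \<xi> \<omega>') \<mu>\<bar> * (Y \<omega> * Y \<omega>')"
      proof (intro always_eventually allI)
        fix n
        show "norm (A n \<omega>') \<le> \<bar>D1 (z n \<omega>', x' n \<omega>') (m' n) - D1 (?x, \<xi> \<omega>') \<mu>\<bar> * (Y \<omega> * Y \<omega>')"
          unfolding Az real_norm_def abs_mult mult.assoc
          using Y(3)[OF w, of n] Y(3)[OF w', of n] Y0[OF w] Y0[OF w'] by (intro mult_left_mono mult_mono) auto
      qed
    qed
    have Ab: "\<bar>A n \<omega>'\<bar> \<le> 2 * C * Y \<omega> * Y \<omega>'" if w': "\<omega>' \<in> space M" for n \<omega>'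
      unfolding Az abs_mult
      using Y(3)[OF w, of n] Y(3)[OF w', of n] Y0[OF w] Y0[OF w'] R(8)[OF m'P, of "(z n \<omega>', x' n \<omega>')" n] R(8)[OF mu, of "(?x, \<xi> \<omega>')"] C0
      by (intro mult_mono) auto
    show ?thesis using RA Am Alim Ab by (intro exI[of _ A]) auto
  qed
  have Rlim: "(\<lambda>n. Rn n \<omega>) \<longlonglongrightarrow> 0" and Rb: "\<bar>Rn n \<omega>\<bar> \<le> 2 * C * Y \<omega> * (\<integral>\<omega>'. Y \<omega>' \<partial>M)" if w: "\<omega> \<in> space M" for n \<omega>
  proof -
    from key[OF w] obtain A where Ab: "\<And>n \<omega>'. \<omega>' \<in> space M \<Longrightarrow> \<bar>A n \<omega>'\<bar> \<le> 2 * C * Y \<omega> * Y \<omega>'" 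
      and Alim: "\<And>\<omega>'. \<omega>' \<in> space M \<Longrightarrow> (\<lambda>n. A n \<omega>') \<longlonglongrightarrow> 0"
      and Am: "\<And>n. A n \<in> borel_measurable M" and RA: "\<And>n. Rn n \<omega> = (\<integral>\<omega>'. A n \<omega>' \<partial>M)" by blast
    have "(\<lambda>n. \<integral>\<omega>'. A n \<omega>' \<partial>M) \<longlonglongrightarrow> (\<integral>\<omega>'. 0 \<partial>M)"
      by (rule integral_dominated_convergence[where w="\<lambda>\<omega>'. 2 * C * Y \<omega> * Y \<omega>'"])
         (use Ab Alim Am iY in auto)
    then show "(\<lambda>n. Rn n \<omega>) \<longlonglongrightarrow> 0" by (simp add: RA)
    have "\<bar>\<integral>\<omega>'. A n \<omega>' \<partial>M\<bar> \<le> (\<integral>\<omega>'. 2 * C * Y \<omega> * Y \<omega>' \<partial>M)"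
    proof (rule order_trans[OF integral_abs_bound], rule integral_mono')
      show "integrable M (\<lambda>\<omega>'. 2 * C * Y \<omega> * Y \<omega>')" using iY by simp
      show "0 \<le> 2 * C * Y \<omega> * Y \<omega>'" if "\<omega>' \<in> space M" for \<omega>' using C0 Y0[OF w] Y0[OF that] by simp
    qed (rule Ab)
    then show "\<bar>Rn n \<omega>\<bar> \<le> 2 * C * Y \<omega> * (\<integral>\<omega>'. Y \<omega>' \<partial>M)" by (simp add: RA)
  qed
  have "(\<lambda>n. \<integral>\<omega>. Rn n \<omega> \<partial>M) \<longlonglongrightarrow> (\<integral>\<omega>. 0 \<partial>M)"
  proof (rule integral_dominated_convergence[where w="\<lambda>\<omega>. 2 * C * Y \<omega> * (\<integral>\<omega>'. Y \<omega>' \<partial>M)"])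
    show "Rn n \<in> borel_measurable M" for n
      unfolding Rn_def using borel_measurable_integrable[OF WX] borel_measurable_integrable[OF Wxi] borel_measurable_integrable[OF J(1)] by measurable
    show "integrable M (\<lambda>\<omega>. 2 * C * Y \<omega> * (\<integral>\<omega>'. Y \<omega>' \<partial>M))" using iY by simp
  qed (use Rlim Rb in auto)
  then show ?thesis unfolding main[symmetric] \<mu>_def X_def by simp
qed

end

section \<open>From the infinitesimal condition to the gap\<close>

text \<open>Each element of the chain is followed by one whose \<open>t\<close> is at least the
  midpoint between the present value and every value still reachable. An upper bound
  \<open>y\<close> of the chain is then terminal: a step from \<open>y\<close> to some
  \<open>z\<close> with larger \<open>t\<close> would make \<open>z\<close> reachable from every
  element, while \<open>t z - t (s n)\<close> halves at each index.\<close>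

lemma brezis_browder:
  fixes R :: "'a \<Rightarrow> 'a \<Rightarrow> bool" and t :: "'a \<Rightarrow> real"
  assumes trans: "\<And>x y z. R x y \<Longrightarrow> R y z \<Longrightarrow> R x z"
    and refl: "\<And>x y. R x y \<Longrightarrow> R y y"
    and mono: "\<And>x y. R x y \<Longrightarrow> t x \<le> t y" and bound: "\<And>x y. R x y \<Longrightarrow> t y \<le> b"
    and chain: "\<And>s. (\<And>n::nat. R (s n) (s (Suc n))) \<Longrightarrow> \<exists>y. \<forall>n. R (s n) y"
    and step: "\<And>x. R x0 x \<Longrightarrow> t x < b \<Longrightarrow> \<exists>y. R x y \<and> t x < t y"
    and start: "R x0 x0"
  shows "\<exists>y. R x0 y \<and> t y = b"
proof -
  have next_ex: "\<exists>y. R x y \<and> (\<forall>z. R x z \<longrightarrow> (t x + t z) / 2 \<le> t y)" if x: "R x0 x" for x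
  proof -
    define S where "S = Sup (t ` {z. R x z})"
    have bdd: "bdd_above (t ` {z. R x z})" using bound by (intro bdd_aboveI2[of _ _ b]) auto
    have le: "t z \<le> S" if "R x z" for z unfolding S_def using that by (intro cSup_upper bdd) auto
    show ?thesis
    proof (cases "S \<le> t x")
      case True
      then have "(t x + t z) / 2 \<le> t x" if "R x z" for z using le[OF that] by simp
      then show ?thesis using refl[OF x] by blast
    next
      case False
      then have "(t x + S) / 2 < S" by simp
      then obtain y where y: "R x y" "(t x + S) / 2 < t y"
        using less_cSup_iff[OF _ bdd, of "(t x + S) / 2"] refl[OF x] unfolding S_def by auto
      have "(t x + t z) / 2 \<le> t y" if "R x z" for z using le[OF that] y(2) by simp
      then show ?thesis using y(1) by blast
    qed
  qed
  define s where "s = rec_nat x0 (\<lambda>_ x. SOME y. R x y \<and> (\<forall>z. R x z \<longrightarrow> (t x + t z) / 2 \<le> t y))"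
  have s0: "s 0 = x0" and sSuc: "s (Suc n) = (SOME y. R (s n) y \<and> (\<forall>z. R (s n) z \<longrightarrow> (t (s n) + t z) / 2 \<le> t y))" for n
    by (simp_all add: s_def)
  have sx: "R x0 (s n)" for n
  proof (induction n)
    case (Suc n)
    from someI_ex[OF next_ex[OF Suc]] show ?case unfolding sSuc by (intro trans[OF Suc]) simp
  qed (simp add: s0 start)
  have s: "R (s n) (s (Suc n))" "R (s n) z \<Longrightarrow> (t (s n) + t z) / 2 \<le> t (s (Suc n))" for n z
    using someI_ex[OF next_ex[OF sx[of n]]] unfolding sSuc by simp_all
  from chain[of s] s(1) obtain y where y: "\<And>n. R (s n) y" by blast
  have xy: "R x0 y" using y[of 0] by (simp add: s0)
  have "t y = b"
  proof (rule ccontr)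
    assume "t y \<noteq> b"
    with bound[OF xy] have "t y < b" by simp
    from step[OF xy this] obtain z where z: "R y z" "t y < t z" by blast
    have d: "t z - t (s n) \<le> (t z - t x0) * (1/2) ^ n" for n
    proof (induction n)
      case (Suc n)
      have "t z - t (s (Suc n)) \<le> (t z - t (s n)) / 2" using s(2)[OF trans[OF y z(1)], of n] by (simp add: field_simps)
      also have "\<dots> \<le> (t z - t x0) * (1/2) ^ Suc n" using Suc by simp
      finally show ?case .
    qed (simp add: s0)
    have "(\<lambda>n. (t z - t x0) * (1/2::real) ^ n) \<longlonglongrightarrow> (t z - t x0) * 0" by (intro tendsto_intros) simp
    moreover have "t z - t y \<le> (t z - t x0) * (1/2) ^ n" for n using d[of n] mono[OF y[of n]] by simp
    ultimately have "t z - t y \<le> 0" using LIMSEQ_le_const by fastforce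
    with z(2) show False by simp
  qed
  with xy show ?thesis by blast
qed

text \<open>At each point one forward step of slope at least \<open>- e\<close> is demanded, not a
  bound for all small steps; a limit of difference quotients along one sequence provides such a
  step. Concatenated up to 1 the steps cost at most \<open>e\<close>, and continuity carries the
  inequality through limits of increasing times.\<close>

lemma lower_derivative_nonneg_imp_le:
  fixes f :: "real \<Rightarrow> real"
  assumes cont: "continuous_on {0..1} f"
    and step: "\<And>s e. 0 \<le> s \<Longrightarrow> s < 1 \<Longrightarrow> 0 < e \<Longrightarrow> \<exists>h>0. s + h \<le> 1 \<and> - (e * h) \<le> f (s + h) - f s"
  shows "f 0 \<le> f 1"
proof (rule field_le_epsilon)
  fix e :: real assume e: "e > 0"
  define R where "R s s' \<longleftrightarrow> 0 \<le> s \<and> s \<le> s' \<and> s' \<le> 1 \<and> - (e * (s' - s)) \<le> f s' - f s" for s s'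
  have "\<exists>y. R 0 y \<and> y = 1"
  proof (rule brezis_browder[where t="\<lambda>x. x"])
    show "R x z" if "R x y" "R y z" for x y z using that by (auto simp: R_def algebra_simps)
    show "\<exists>y. R x y \<and> x < y" if "R 0 x" "x < 1" for x
    proof -
      from that have "0 \<le> x" by (simp add: R_def)
      from step[OF this that(2) e] obtain h where "h > 0" "x + h \<le> 1" "- (e * h) \<le> f (x + h) - f x" by blast
      then show ?thesis using that by (intro exI[of _ "x + h"]) (auto simp: R_def)
    qed
    fix s :: "nat \<Rightarrow> real" assume s: "\<And>n. R (s n) (s (Suc n))"
    have inc: "incseq s" using s by (intro incseq_SucI) (auto simp: R_def)
    have s01: "s n \<in> {0..1}" for n using s[of n] by (auto simp: R_def)
    obtain l where l: "s \<longlonglongrightarrow> l" "\<And>n. s n \<le> l" using incseq_convergent[OF inc, of 1] s01 by auto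
    have "l \<le> 1" using LIMSEQ_le_const2[OF l(1), of 1] s01 by auto
    moreover have "0 \<le> l" using order_trans[OF _ l(2)[of 0], of 0] s01[of 0] by simp
    ultimately have l01: "l \<in> {0..1}" by simp
    have fl: "(\<lambda>n. f (s n)) \<longlonglongrightarrow> f l" by (rule continuous_on_tendsto_compose[OF cont l(1) l01]) (use s01 in auto)
    have Rn: "- (e * (s m - s n)) \<le> f (s m) - f (s n)" if "n \<le> m" for n m using that
    proof (induction m rule: dec_induct)
      case (step m) then show ?case using s[of m] by (auto simp: R_def algebra_simps)
    qed simp
    have "- (e * (l - s n)) \<le> f l - f (s n)" for n
    proof (rule LIMSEQ_le)
      show "(\<lambda>m. - (e * (s m - s n))) \<longlonglongrightarrow> - (e * (l - s n))" "(\<lambda>m. f (s m) - f (s n)) \<longlonglongrightarrow> f l - f (s n)"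
        by (intro tendsto_intros l fl)+
    qed (use Rn in blast)
    then show "\<exists>y. \<forall>n. R (s n) y" using l(2) l01 s01 by (intro exI[of _ l]) (auto simp: R_def)
  qed (auto simp: R_def)
  then show "f 0 \<le> f 1 + e" by (auto simp: R_def)
qed

section \<open>Both directions between the gap and the infinitesimal form; quantile curves along
  mixtures\<close>

context mfg_space
begin

lemma mono_gap_imp_lasry_lions:
  assumes reg: "regular U D D1 D2 C"
    and lip: "\<And>m x y. m \<in> P2 \<Longrightarrow> \<bar>U x m - U y m\<bar> \<le> L * \<bar>x - y\<bar>"
    and gap: "\<And>\<mu> \<nu>. \<mu> \<in> P2 \<Longrightarrow> \<nu> \<in> P2 \<Longrightarrow> 0 \<le> mono_gap U \<mu> \<nu>"
    and xi: "\<xi> \<in> LF T" and eta: "\<eta> \<in> LF T"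
  shows "0 \<le> (\<integral>p. D1 (\<xi> (fst p), \<xi> (snd p)) (law M \<xi>) * \<eta> (fst p) * \<eta> (snd p) \<partial>(M \<Otimes>\<^sub>M M))" (is "0 \<le> ?I")
proof -
  let ?g = "\<lambda>n. mono_gap U (law M (\<lambda>\<omega>. \<xi> \<omega> + inverse (real (Suc n)) * \<eta> \<omega>)) (law M \<xi>) / (inverse (real (Suc n)))\<^sup>2"
  have "(\<lambda>n. ?g n - ?I) \<longlonglongrightarrow> 0"
  proof (rule gap_asymptotics[OF reg lip xi, where Y="\<lambda>\<omega>. \<bar>\<eta> \<omega>\<bar>"])
    show "(\<lambda>n. inverse (real (Suc n))) \<longlonglongrightarrow> 0" by (rule LIMSEQ_inverse_real_of_nat)
  qed (use LFD[OF eta] eta in auto)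
  then have "?g \<longlonglongrightarrow> ?I" by (simp add: LIM_zero_iff)
  moreover have "0 \<le> ?g n" for n
    by (intro divide_nonneg_nonneg gap LFD(5)[OF LF_add[OF xi LF_scale[OF eta]]] LFD(5)[OF xi]) simp
  ultimately show ?thesis using LIMSEQ_le_const[of ?g ?I 0] by blast
qed

text \<open>One uniform variable drives all laws through their quantile functions. Distribution
  functions that differ by at most \<open>\<bar>s - s'\<bar>\<close> and have slope at least
  \<open>c\<close> on the support are brought above each other by a horizontal shift of
  \<open>\<bar>s - s'\<bar> / c\<close>.\<close>

lemma quantile_coupling:
  assumes mu: "\<And>s. s \<in> {0..1} \<Longrightarrow> \<mu> s \<in> P2" and c: "c > 0"
    and supp: "\<And>s. s \<in> {0..1} \<Longrightarrow> measure (\<mu> s) {-R..R} = 1"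
    and slope: "\<And>s x y. s \<in> {0..1} \<Longrightarrow> -R \<le> x \<Longrightarrow> x \<le> y \<Longrightarrow> y \<le> R \<Longrightarrow> c * (y - x) \<le> measure (\<mu> s) {x<..y}"
    and close: "\<And>s s' x. s \<in> {0..1} \<Longrightarrow> s' \<in> {0..1} \<Longrightarrow> \<bar>cdf (\<mu> s) x - cdf (\<mu> s') x\<bar> \<le> \<bar>s - s'\<bar>"
  obtains X where "\<And>s. s \<in> {0..1} \<Longrightarrow> X s \<in> LF T" "\<And>s. s \<in> {0..1} \<Longrightarrow> law M (X s) = \<mu> s"
    "\<And>s s' \<omega>. s \<in> {0..1} \<Longrightarrow> s' \<in> {0..1} \<Longrightarrow> \<bar>X s \<omega> - X s' \<omega>\<bar> \<le> \<bar>s - s'\<bar> / c"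
proof -
  let ?\<Omega> = "restrict_space lborel {0<..<1::real}"
  have "prob_space (distr ?\<Omega> borel (\<lambda>x. x))"
    by (rule prob_space.prob_space_distr)
       (auto simp: space_restrict_space emeasure_restrict_space intro!: prob_spaceI measurable_restrict_space1)
  then obtain V where V: "V \<in> borel_measurable \<G>0" "law M V = distr ?\<Omega> borel (\<lambda>x. x)"
    using filtered unfolding filtered_space_def by force
  have VM: "V \<in> borel_measurable M" using V(1) by (rule measurable_from_subalg[OF subalgebra_G0])
  have cd: "cdf_distribution (\<mu> s)" if "s \<in> {0..1}" for s
    unfolding cdf_distribution_def real_distribution_def real_distribution_axioms_def
    using P2D(1,2,3)[OF mu[OF that]] by simp
  \<comment> \<open>Outside the open unit interval, where quantiles may be infinite, the value is 0
    for every \<open>s\<close>. The Lipschitz bound in \<open>s\<close> then holds at every sample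
    point and not just almost surely.\<close>
  define q where "q s u = (if u \<in> {0<..<1} then right_continuous_mono.I (cdf (\<mu> s)) u else 0)" for s and u :: real
  have rc: "right_continuous_mono (cdf (\<mu> s)) 0 1" if "s \<in> {0..1}" for s
  proof -
    interpret S: cdf_distribution "\<mu> s" by (rule cd[OF that])
    show ?thesis by (rule S.right_continuous_mono_axioms)
  qed
  have ps: "u \<le> cdf (\<mu> s) x \<longleftrightarrow> q s u \<le> x" if "s \<in> {0..1}" "u \<in> {0<..<1}" for s u x
    using right_continuous_mono.pseudoinverse[OF rc[OF that(1)], of u x] that(2) by (simp add: q_def)
  have qm: "q s \<in> borel_measurable borel" if "s \<in> {0..1}" for s
  proof -
    interpret S: cdf_distribution "\<mu> s" by (rule cd[OF that])
    show ?thesis using S.measurable_CI unfolding q_def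
      by (subst (asm) measurable_restrict_space_iff[where c=0]) auto
  qed
  have lq: "law M (\<lambda>\<omega>. q s (V \<omega>)) = \<mu> s" if s: "s \<in> {0..1}" for s
  proof -
    interpret S: cdf_distribution "\<mu> s" by (rule cd[OF that])
    have "law M (\<lambda>\<omega>. q s (V \<omega>)) = distr (law M V) borel (q s)"
      unfolding law_def by (subst distr_distr[OF qm[OF s] VM]) (simp add: comp_def)
    also have "\<dots> = distr ?\<Omega> borel (q s)"
      unfolding V(2) by (subst distr_distr[OF qm[OF s]]) (auto simp: comp_def intro!: measurable_restrict_space1)
    also have "\<dots> = distr ?\<Omega> borel S.I"
      by (rule distr_cong) (auto simp: q_def space_restrict_space)
    also have "\<dots> = \<mu> s" by (rule S.distr_I_eq_M)
    finally show ?thesis .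
  qed
  have one: "q s' u \<le> q s u + \<bar>s - s'\<bar> / c" if s: "s \<in> {0..1}" "s' \<in> {0..1}" and u: "u \<in> {0<..<1}" for s s' u
  proof -
    interpret S: cdf_distribution "\<mu> s" by (rule cd[OF s(1)])
    interpret S': cdf_distribution "\<mu> s'" by (rule cd[OF s(2)])
    define x d where "x = q s u" "d = \<bar>s - s'\<bar> / c"
    have d0: "d \<ge> 0" using c by (simp add: x_d_def)
    have ux: "u \<le> cdf (\<mu> s) x" using ps[OF s(1) u, of x] by (simp add: x_d_def)
    \<comment> \<open>Quantile function and \<open>cdf\<close> form a Galois connection, so it
      suffices that the second distribution function has reached the level \<open>u\<close> at the
      shifted point.\<close>
    have "u \<le> cdf (\<mu> s') (x + d)"
    proof (cases "x + d \<ge> R")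
      case True
      have "1 \<le> cdf (\<mu> s') (x + d)" unfolding cdf_def supp[OF s(2), symmetric]
        using True by (intro S'.finite_measure_mono) auto
      then show ?thesis using u by simp
    next
      case False
      have "x \<ge> -R"
      proof (rule ccontr)
        assume "\<not> x \<ge> -R"
        then have "S.prob {..x} + S.prob {-R..R} = S.prob ({..x} \<union> {-R..R})"
          by (intro S.finite_measure_Union[symmetric]) auto
        also have "\<dots> \<le> 1" by (rule S.prob_le_1)
        finally have "S.prob {..x} \<le> 0" using supp[OF s(1)] by simp
        then show False using ux u by (simp add: cdf_def)
      qed
      then have "c * d \<le> S.prob {x<..x + d}" using slope[OF s(1), of x "x + d"] False d0 by simp
      also have "\<dots> = cdf (\<mu> s) (x + d) - cdf (\<mu> s) x"
        using S.cdf_diff_eq[of x "x + d"] d0 by (cases "d = 0") auto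
      finally have "cdf (\<mu> s) x + \<bar>s - s'\<bar> \<le> cdf (\<mu> s) (x + d)" using c by (simp add: x_d_def)
      then show ?thesis using close[OF s, of "x + d"] ux by linarith
    qed
    then show ?thesis using ps[OF s(2) u, of "x + d"] by (simp add: x_d_def)
  qed
  show thesis
  proof (rule that[of "\<lambda>s \<omega>. q s (V \<omega>)"])
    fix s :: real assume s: "s \<in> {0..1}"
    show "law M (\<lambda>\<omega>. q s (V \<omega>)) = \<mu> s" by (rule lq[OF s])
    have m: "(\<lambda>\<omega>. q s (V \<omega>)) \<in> borel_measurable M" using qm[OF s] VM by simp
    have "integrable M (\<lambda>\<omega>. (q s (V \<omega>))\<^sup>2)"
      using P2D(4)[OF mu[OF s]] unfolding lq[OF s, symmetric] by (subst (asm) integrable_law_iff[OF m]) auto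
    then show "(\<lambda>\<omega>. q s (V \<omega>)) \<in> LF T"
      unfolding LF_iff[OF T_in(1)] using measurable_G0_filt[OF V(1)] qm[OF s] by simp
  next
    fix s s' :: real and \<omega> assume s: "s \<in> {0..1}" "s' \<in> {0..1}"
    show "\<bar>q s (V \<omega>) - q s' (V \<omega>)\<bar> \<le> \<bar>s - s'\<bar> / c"
    proof (cases "V \<omega> \<in> {0<..<1}")
      case True
      then show ?thesis using one[OF s True] one[OF s(2,1) True] by (simp add: abs_minus_commute)
    qed (use c in \<open>auto simp: q_def\<close>)
  qed
qed

text \<open>Since \<open>m s' - m s\<close> is a multiple of \<open>\<nu> - \<mu>\<close>, the gap
  between two mixtures is \<open>(s' - s) * (f s' - f s)\<close>. Its sign is thus a matter of
  monotonicity of the real function \<open>f\<close>, whose difference quotients are asymptotically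
  quadratic forms that the infinitesimal condition controls.\<close>

lemma mono_gap_nonneg_of_slope:
  assumes reg: "regular U D D1 D2 C" and cont: "cont_P2 UNIV U"
    and lip: "\<And>m x y. m \<in> P2 \<Longrightarrow> \<bar>U x m - U y m\<bar> \<le> L * \<bar>x - y\<bar>"
    and LL: "\<And>\<xi> \<eta>. \<xi> \<in> LF T \<Longrightarrow> \<eta> \<in> LF T \<Longrightarrow>
       0 \<le> (\<integral>p. D1 (\<xi> (fst p), \<xi> (snd p)) (law M \<xi>) * \<eta> (fst p) * \<eta> (snd p) \<partial>(M \<Otimes>\<^sub>M M))"
    and mu: "\<mu> \<in> P2" and nu: "\<nu> \<in> P2" and c: "c > 0"
    and supp: "measure \<mu> {-R..R} = 1" "measure \<nu> {-R..R} = 1"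
    and slope: "\<And>x y. -R \<le> x \<Longrightarrow> x \<le> y \<Longrightarrow> y \<le> R \<Longrightarrow> c * (y - x) \<le> measure \<mu> {x<..y}"
      "\<And>x y. -R \<le> x \<Longrightarrow> x \<le> y \<Longrightarrow> y \<le> R \<Longrightarrow> c * (y - x) \<le> measure \<nu> {x<..y}"
  shows "0 \<le> mono_gap U \<nu> \<mu>"
proof -
  define m where "m s = mix s \<mu> \<nu>" for s
  have mP: "m s \<in> P2" if "s \<in> {0..1}" for s unfolding m_def by (rule mix_P2[OF mu nu that])
  interpret \<mu>: prob_space \<mu> by (rule P2D(1)[OF mu])
  interpret \<nu>: prob_space \<nu> by (rule P2D(1)[OF nu])
  obtain X where X: "\<And>s. s \<in> {0..1} \<Longrightarrow> X s \<in> LF T" and lX: "\<And>s. s \<in> {0..1} \<Longrightarrow> law M (X s) = m s"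
    and XL: "\<And>s s' \<omega>. s \<in> {0..1} \<Longrightarrow> s' \<in> {0..1} \<Longrightarrow> \<bar>X s \<omega> - X s' \<omega>\<bar> \<le> \<bar>s - s'\<bar> / c"
  proof (rule quantile_coupling[of m c R])
    fix s :: real assume s: "s \<in> {0..1}"
    show "m s \<in> P2" by (rule mP[OF s])
    show "measure (m s) {-R..R} = 1" unfolding m_def by (subst measure_mix[OF mu nu s]) (auto simp: supp)
    fix x y assume xy: "-R \<le> x" "x \<le> y" "y \<le> R"
    have "c * (y - x) = (1 - s) * (c * (y - x)) + s * (c * (y - x))" by (simp add: algebra_simps)
    also have "\<dots> \<le> (1 - s) * measure \<mu> {x<..y} + s * measure \<nu> {x<..y}"
      using slope[OF xy] s by (intro add_mono mult_left_mono) auto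
    finally show "c * (y - x) \<le> measure (m s) {x<..y}" unfolding m_def by (subst measure_mix[OF mu nu s]) auto
  next
    fix s s' x :: real assume s: "s \<in> {0..1}" "s' \<in> {0..1}"
    have "cdf (m s) x - cdf (m s') x = (s - s') * (measure \<nu> {..x} - measure \<mu> {..x})"
      unfolding m_def cdf_def by (subst (1 2) measure_mix[OF mu nu]) (use s in \<open>auto simp: algebra_simps\<close>)
    also have "\<bar>\<dots>\<bar> \<le> \<bar>s - s'\<bar> * 1"
    proof -
      have "\<bar>measure \<nu> {..x} - measure \<mu> {..x}\<bar> \<le> 1"
        using \<mu>.prob_le_1[of "{..x}"] \<nu>.prob_le_1[of "{..x}"] measure_nonneg[of \<mu> "{..x}"] measure_nonneg[of \<nu> "{..x}"]
        unfolding abs_le_iff by linarith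
      then show ?thesis unfolding abs_mult by (intro mult_left_mono) auto
    qed
    finally show "\<bar>cdf (m s) x - cdf (m s') x\<bar> \<le> \<bar>s - s'\<bar>" by simp
  qed (use c in auto)
  define f where "f s = (\<integral>x. U x (m s) \<partial>\<nu>) - (\<integral>x. U x (m s) \<partial>\<mu>)" for s
  have gap: "mono_gap U (m s') (m s) = (s' - s) * (f s' - f s)" if s: "s \<in> {0..1}" "s' \<in> {0..1}" for s s'
  proof -
    have l: "\<bar>(U x (m s') - U x (m s)) - (U y (m s') - U y (m s))\<bar> \<le> (2 * L) * \<bar>x - y\<bar>" for x y
      using lip[OF mP[OF s(1)], of x y] lip[OF mP[OF s(2)], of x y] by linarith
    have i: "(\<integral>x. U x (m s') - U x (m s) \<partial>m r) = (1 - r) * (\<integral>x. U x (m s') - U x (m s) \<partial>\<mu>) + r * (\<integral>x. U x (m s') - U x (m s) \<partial>\<nu>)"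
      if "r \<in> {0..1}" for r
      unfolding m_def[of r] by (rule integral_mix[OF mu nu that lipschitz_P2(1)[OF l mu] lipschitz_P2(2)[OF l mu] lipschitz_P2(2)[OF l nu]])
    note I = lipschitz_P2(2)[OF lip[OF mP[OF s(1)]] mu] lipschitz_P2(2)[OF lip[OF mP[OF s(2)]] mu]
      lipschitz_P2(2)[OF lip[OF mP[OF s(1)]] nu] lipschitz_P2(2)[OF lip[OF mP[OF s(2)]] nu]
    show ?thesis unfolding mono_gap_def i[OF s(1)] i[OF s(2)] f_def by (simp add: I algebra_simps)
  qed
  have W2m: "(\<lambda>n. W2 (m s) (m (sn n))) \<longlonglongrightarrow> 0" if s: "s \<in> {0..1}" "\<And>n. sn n \<in> {0..1}" "sn \<longlonglongrightarrow> s" for s and sn :: "nat \<Rightarrow> real"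
    unfolding lX[OF s(1), symmetric] lX[OF s(2), symmetric]
  proof (rule W2_law_tendsto[OF prob_space_axioms])
    show "(\<lambda>n. norm2 M (\<lambda>\<omega>. X s \<omega> - X (sn n) \<omega>)) \<longlonglongrightarrow> 0"
    proof (rule Lim_null_comparison)
      show "\<forall>\<^sub>F n in sequentially. norm (norm2 M (\<lambda>\<omega>. X s \<omega> - X (sn n) \<omega>)) \<le> \<bar>s - sn n\<bar> / c"
      proof (intro always_eventually allI)
        fix n
        have "(\<integral>\<omega>. (X s \<omega> - X (sn n) \<omega>)\<^sup>2 \<partial>M) \<le> (\<integral>\<omega>. (\<bar>s - sn n\<bar> / c)\<^sup>2 \<partial>M)"
        proof (rule integral_mono')
          fix \<omega> show "(X s \<omega> - X (sn n) \<omega>)\<^sup>2 \<le> (\<bar>s - sn n\<bar> / c)\<^sup>2"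
            using power_mono[OF XL[OF s(1,2)] abs_ge_zero, of \<omega> n 2] by simp
        qed auto
        then have "norm2 M (\<lambda>\<omega>. X s \<omega> - X (sn n) \<omega>) \<le> sqrt ((\<bar>s - sn n\<bar> / c)\<^sup>2)"
          unfolding norm2_def by (intro real_sqrt_le_mono) (simp add: prob_space)
        then show "norm (norm2 M (\<lambda>\<omega>. X s \<omega> - X (sn n) \<omega>)) \<le> \<bar>s - sn n\<bar> / c" using c by simp
      qed
      have "(\<lambda>n. \<bar>s - sn n\<bar> / c) \<longlonglongrightarrow> \<bar>s - s\<bar> / c" using c by (intro tendsto_intros s) auto
      then show "(\<lambda>n. \<bar>s - sn n\<bar> / c) \<longlonglongrightarrow> 0" by simp
    qed
    show "X s \<in> borel_measurable M" "integrable M (\<lambda>\<omega>. (X s \<omega>)\<^sup>2)" by (rule LFD[OF X[OF s(1)]])+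
    show "X (sn n) \<in> borel_measurable M" "integrable M (\<lambda>\<omega>. (X (sn n) \<omega>)\<^sup>2)" for n by (rule LFD[OF X[OF s(2)]])+
  qed
  have "f 0 \<le> f 1"
  proof (rule lower_derivative_nonneg_imp_le)
    show "continuous_on {0..1} f"
      unfolding continuous_on_sequentially
    proof (intro allI ballI impI, elim conjE)
      fix sn s assume s: "s \<in> {0..1}" "\<forall>n. sn n \<in> {0..1::real}" "sn \<longlonglongrightarrow> s"
      then have sn: "sn n \<in> {0..1}" for n by simp
      have lim: "(\<lambda>n. U x (m (sn n))) \<longlonglongrightarrow> U x (m s)" for x
        by (rule cont_P2_tendsto[OF cont _ _ tendsto_const mP[OF s(1)] mP[OF sn] W2m[OF s(1) sn s(3)]]) auto
      have "(\<lambda>n. W2 \<mu> \<mu>) \<longlonglongrightarrow> 0" "(\<lambda>n. W2 \<nu> \<nu>) \<longlonglongrightarrow> 0" by (simp_all add: W2_self[OF mu] W2_self[OF nu])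
      from integral_tendsto_W2[OF mu mu this(1) lip[OF mP[OF sn]] lim] integral_tendsto_W2[OF nu nu this(2) lip[OF mP[OF sn]] lim]
      show "(f \<circ> sn) \<longlonglongrightarrow> f s" unfolding f_def comp_def by (intro tendsto_diff)
    qed
  next
    fix s e :: real assume s: "0 \<le> s" "s < 1" and e: "0 < e"
    \<comment> \<open>The steps keep \<open>s + h n\<close> inside the unit interval; at
      \<open>n = 0\<close> the end point 1 is reached exactly.\<close>
    define h where "h n = (1 - s) / (real (Suc n))" for n
    have h0: "h n > 0" and s01: "s \<in> {0..1}" and sh: "s + h n \<in> {0..1}" for n
      using s mult_left_le_one_le[of "real n" s] by (auto simp: h_def divide_simps) (simp add: algebra_simps add_nonneg_nonneg)
    \<comment> \<open>Difference quotients of the quantile curve, bounded by \<open>1 / c\<close>.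
      No limit of them as \<open>n\<close> grows is claimed; the sign of the quadratic form at each
      of them is what counts.\<close>
    define \<eta> where "\<eta> n \<omega> = inverse (h n) * (X (s + h n) \<omega> - X s \<omega>)" for n \<omega>
    have eta: "\<eta> n \<in> LF T" for n unfolding \<eta>_def by (intro LF_scale LF_diff X s01 sh)
    have hl: "h \<longlonglongrightarrow> 0" unfolding h_def by (rule LIMSEQ_Suc[OF lim_const_over_n])
    have eb: "\<bar>\<eta> n \<omega>\<bar> \<le> 1 / c" for n \<omega>
    proof -
      have "\<bar>\<eta> n \<omega>\<bar> \<le> inverse (h n) * (\<bar>s + h n - s\<bar> / c)"
        unfolding \<eta>_def abs_mult using h0[of n] XL[OF sh s01, of n \<omega>] by (intro mult_mono) auto
      also have "\<dots> = 1 / c" using h0[of n] by simp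
      finally show ?thesis .
    qed
    have "(\<lambda>\<omega>. X s \<omega> + h n * \<eta> n \<omega>) = X (s + h n)" for n
      using h0[of n] by (simp add: \<eta>_def fun_eq_iff field_simps)
    then have g: "mono_gap U (law M (\<lambda>\<omega>. X s \<omega> + h n * \<eta> n \<omega>)) (law M (X s)) / (h n)\<^sup>2 = (f (s + h n) - f s) / h n" for n
      using h0[of n] by (simp add: lX[OF s01] lX[OF sh] gap[OF s01 sh] power2_eq_square)
    let ?I = "\<lambda>n. \<integral>p. D1 (X s (fst p), X s (snd p)) (law M (X s)) * \<eta> n (fst p) * \<eta> n (snd p) \<partial>(M \<Otimes>\<^sub>M M)"
    have "(\<lambda>n. (f (s + h n) - f s) / h n - ?I n) \<longlonglongrightarrow> 0"
      using gap_asymptotics[where \<eta>=\<eta> and Y="\<lambda>_. 1 / c", OF reg lip X[OF s01] eta _ _ eb h0 hl] unfolding g by simp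
    from order_tendstoD(1)[OF this, of "-e"] e have "\<forall>\<^sub>F n in sequentially. - e < (f (s + h n) - f s) / h n - ?I n" by simp
    then obtain n where n: "- e < (f (s + h n) - f s) / h n - ?I n" using eventually_happens'[OF sequentially_bot] by blast
    have "0 \<le> ?I n" by (rule LL[OF X[OF s01] eta])
    with n have "- e < (f (s + h n) - f s) / h n" by linarith
    then have "- (e * h n) \<le> f (s + h n) - f s" using h0[of n] by (simp add: field_simps)
    then show "\<exists>h>0. s + h \<le> 1 \<and> - (e * h) \<le> f (s + h) - f s" using h0[of n] sh[of n] by (intro exI[of _ "h n"]) auto
  qed
  moreover have "mono_gap U (m 1) (m 0) = f 1 - f 0" using gap[of 0 1] by simp
  moreover have "m 0 = \<mu>" "m 1 = \<nu>"
  proof -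
    show "m 0 = \<mu>"
    proof (rule measure_eqI)
      show "sets (m 0) = sets \<mu>" using P2D(2)[OF mu] P2D(2)[OF mP[of 0]] by simp
      interpret m: prob_space "m 0" by (rule P2D(1)[OF mP]) simp
      fix S assume "S \<in> sets (m 0)"
      then have S: "S \<in> sets borel" using P2D(2)[OF mP[of 0]] by simp
      show "emeasure (m 0) S = emeasure \<mu> S"
        unfolding m.emeasure_eq_measure \<mu>.emeasure_eq_measure unfolding m_def by (subst measure_mix[OF mu nu _ S]) auto
    qed
    show "m 1 = \<nu>"
    proof (rule measure_eqI)
      show "sets (m 1) = sets \<nu>" using P2D(2)[OF nu] P2D(2)[OF mP[of 1]] by simp
      interpret m: prob_space "m 1" by (rule P2D(1)[OF mP]) simp
      fix S assume "S \<in> sets (m 1)"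
      then have S: "S \<in> sets borel" using P2D(2)[OF mP[of 1]] by simp
      show "emeasure (m 1) S = emeasure \<nu> S"
        unfolding m.emeasure_eq_measure \<nu>.emeasure_eq_measure unfolding m_def by (subst measure_mix[OF mu nu _ S]) auto
    qed
  qed
  ultimately show ?thesis by simp
qed

text \<open>Two approximations create the slope condition: clamping gives bounded support, and a
  uniform component of weight \<open>p n\<close> contributes the slope \<open>p n / (2 * R)\<close>.
  Both converge in \<open>W2\<close>, along which the gap is continuous.\<close>

lemma lasry_lions_imp_mono_gap:
  assumes reg: "regular U D D1 D2 C" and cont: "cont_P2 UNIV U"
    and lip: "\<And>m x y. m \<in> P2 \<Longrightarrow> \<bar>U x m - U y m\<bar> \<le> L * \<bar>x - y\<bar>"
    and LL: "\<And>\<xi> \<eta>. \<xi> \<in> LF T \<Longrightarrow> \<eta> \<in> LF T \<Longrightarrow>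
       0 \<le> (\<integral>p. D1 (\<xi> (fst p), \<xi> (snd p)) (law M \<xi>) * \<eta> (fst p) * \<eta> (snd p) \<partial>(M \<Otimes>\<^sub>M M))"
    and mu: "\<mu> \<in> P2" and nu: "\<nu> \<in> P2"
  shows "0 \<le> mono_gap U \<nu> \<mu>"
proof -
  have lim: "(\<lambda>n. U x (mn n)) \<longlonglongrightarrow> U x m" if "m \<in> P2" "\<And>n. mn n \<in> P2" "(\<lambda>n. W2 m (mn n)) \<longlonglongrightarrow> 0" for x m and mn :: "nat \<Rightarrow> real measure"
    by (rule cont_P2_tendsto[OF cont _ _ tendsto_const that]) auto
  have bounded: "0 \<le> mono_gap U \<nu> \<mu>" if mu: "\<mu> \<in> P2" and nu: "\<nu> \<in> P2" and supp: "measure \<mu> {-R..R} = 1" "measure \<nu> {-R..R} = 1" and R: "R > 0"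
    for \<mu> \<nu> and R :: real
  proof -
    define u where "u = uniform_measure lborel {-R..R}"
    have up: "prob_space u" unfolding u_def using R by (intro prob_space_uniform_measure) auto
    have su: "sets u = sets borel" by (simp add: u_def)
    have mu_u: "measure u S = measure lborel ({-R..R} \<inter> S) / (2 * R)" if "S \<in> sets borel" for S
      unfolding u_def using R that by (subst measure_uniform_measure) auto
    interpret u: prob_space u by (rule up)
    have uP: "u \<in> P2"
    proof -
      have "AE x in u. norm (x\<^sup>2) \<le> R\<^sup>2"
        unfolding u_def using R by (subst AE_uniform_measure) (auto simp: abs_square_le_1[symmetric] abs_le_square_iff[symmetric])
      then have "integrable u (\<lambda>x. x\<^sup>2)"
        by (rule u.integrable_const_bound) (simp add: measurable_cong_sets[OF su])
      then show ?thesis using up su by (simp add: P2_def)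
    qed
    define p where "p n = inverse (real (Suc n))" for n
    have p: "p n \<in> {0..1}" "p n > 0" for n by (auto simp: p_def inverse_le_1_iff)
    have pl: "p \<longlonglongrightarrow> 0" unfolding p_def by (rule LIMSEQ_inverse_real_of_nat)
    have Wl: "(\<lambda>n. W2 m (mix (p n) m u)) \<longlonglongrightarrow> 0" if m: "m \<in> P2" for m
    proof (rule tendsto_sandwich[OF _ _ tendsto_const])
      show "\<forall>\<^sub>F n in sequentially. 0 \<le> W2 m (mix (p n) m u)"
        by (intro always_eventually allI W2_nonneg m mix_P2 uP p)
      show "\<forall>\<^sub>F n in sequentially. W2 m (mix (p n) m u) \<le> sqrt (p n * (\<integral>z. (fst z - snd z)\<^sup>2 \<partial>(m \<Otimes>\<^sub>M u)))"
        by (intro always_eventually allI W2_mix_le m uP p)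
      have "(\<lambda>n. sqrt (p n * (\<integral>z. (fst z - snd z)\<^sup>2 \<partial>(m \<Otimes>\<^sub>M u)))) \<longlonglongrightarrow> sqrt (0 * (\<integral>z. (fst z - snd z)\<^sup>2 \<partial>(m \<Otimes>\<^sub>M u)))"
        by (intro tendsto_intros pl)
      then show "(\<lambda>n. sqrt (p n * (\<integral>z. (fst z - snd z)\<^sup>2 \<partial>(m \<Otimes>\<^sub>M u)))) \<longlonglongrightarrow> 0" by simp
    qed
    have uR: "measure u {-R..R} = 1" by (subst mu_u) (use R in auto)
    have sl: "p n / (2 * R) * (y - x) \<le> measure (mix (p n) m u) {x<..y}" if m: "m \<in> P2" and xy: "-R \<le> x" "x \<le> y" "y \<le> R" for m n x y
    proof -
      have "{-R..R} \<inter> {x<..y} = {x<..y}" using xy by auto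
      then have "measure u {x<..y} = (y - x) / (2 * R)" using xy by (subst mu_u) auto
      then show ?thesis using p[of n] by (subst measure_mix[OF m uP p(1)]) auto
    qed
    have "0 \<le> mono_gap U (mix (p n) \<nu> u) (mix (p n) \<mu> u)" for n
      by (rule mono_gap_nonneg_of_slope[OF reg cont lip LL mix_P2[OF mu uP p(1)] mix_P2[OF nu uP p(1)], where c="p n / (2 * R)" and R=R])
         (use p[of n] R sl[OF mu] sl[OF nu] in \<open>auto simp: measure_mix[OF mu uP p(1)] measure_mix[OF nu uP p(1)] supp uR\<close>)
    moreover have "(\<lambda>n. mono_gap U (mix (p n) \<nu> u) (mix (p n) \<mu> u)) \<longlonglongrightarrow> mono_gap U \<nu> \<mu>"
      by (rule mono_gap_tendsto[OF nu mix_P2[OF nu uP p(1)] Wl[OF nu] mu mix_P2[OF mu uP p(1)] Wl[OF mu] lip lim[OF nu mix_P2[OF nu uP p(1)] Wl[OF nu]] lim[OF mu mix_P2[OF mu uP p(1)] Wl[OF mu]]])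
    ultimately show ?thesis using LIMSEQ_le_const[of _ "mono_gap U \<nu> \<mu>" 0] by blast
  qed
  \<comment> \<open>The clamping interval starts with half-width 1 instead of 0, so the uniform law
    on it always exists.\<close>
  define cl where "cl n x = max (- real (Suc n)) (min (real (Suc n)) x)" for n x
  have clm [measurable]: "cl n \<in> borel_measurable borel" for n unfolding cl_def by measurable
  have cl_le: "\<bar>cl n x\<bar> \<le> \<bar>x\<bar>" "\<bar>x - cl n x\<bar> \<le> \<bar>x\<bar>" for n x by (auto simp: cl_def)
  have P: "law m (cl n) \<in> P2" "measure (law m (cl n)) {- real (Suc n)..real (Suc n)} = 1" "(\<lambda>n. W2 m (law m (cl n))) \<longlonglongrightarrow> 0" if m: "m \<in> P2" for m n
  proof -
    interpret m: prob_space m by (rule P2D(1)[OF m])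
    note sm [measurable_cong] = P2D(2)[OF m]
    have cm: "cl n \<in> borel_measurable m" for n by measurable
    have ic: "integrable m (\<lambda>x. (cl n x)\<^sup>2)" for n
      by (rule Bochner_Integration.integrable_bound[OF P2D(4)[OF m]]) (auto simp: cl_le abs_le_square_iff[symmetric])
    show "law m (cl n) \<in> P2" by (rule law_P2[OF P2D(1)[OF m] cm ic])
    have "cl n -` {- real (Suc n)..real (Suc n)} \<inter> space m = space m" by (auto simp: cl_def)
    then show "measure (law m (cl n)) {- real (Suc n)..real (Suc n)} = 1"
      unfolding law_def by (subst measure_distr[OF cm]) (auto simp: m.prob_space)
    have "(\<lambda>n. W2 (law m (\<lambda>x. x)) (law m (cl n))) \<longlonglongrightarrow> 0"
    proof (rule W2_law_tendsto[OF P2D(1)[OF m] _ cm P2D(4)[OF m] ic])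
      have "(\<lambda>n. \<integral>x. (x - cl n x)\<^sup>2 \<partial>m) \<longlonglongrightarrow> (\<integral>x. 0 \<partial>m)"
      proof (rule integral_dominated_convergence[where w="\<lambda>x. x\<^sup>2"])
        have "\<forall>\<^sub>F n in sequentially. (x - cl n x)\<^sup>2 = 0" for x
        proof (rule eventually_sequentiallyI)
          fix n assume "nat \<lceil>\<bar>x\<bar>\<rceil> \<le> n"
          then have "\<bar>x\<bar> \<le> real (Suc n)" by linarith
          then show "(x - cl n x)\<^sup>2 = 0" by (auto simp: cl_def)
        qed
        then show "AE x in m. (\<lambda>n. (x - cl n x)\<^sup>2) \<longlonglongrightarrow> 0" by (intro AE_I2 tendsto_eventually)
        show "AE x in m. norm ((x - cl n x)\<^sup>2) \<le> x\<^sup>2" for n by (simp add: cl_le abs_le_square_iff[symmetric])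
      qed (use P2D(4)[OF m] in measurable)
      then show "(\<lambda>n. norm2 m (\<lambda>x. x - cl n x)) \<longlonglongrightarrow> 0" unfolding norm2_def using tendsto_real_sqrt by fastforce
    qed measurable
    then show "(\<lambda>n. W2 m (law m (cl n))) \<longlonglongrightarrow> 0" by (simp only: law_id[OF P2D(2)[OF m]])
  qed
  have "0 \<le> mono_gap U (law \<nu> (cl n)) (law \<mu> (cl n))" for n
    by (rule bounded[OF P(1)[OF mu] P(1)[OF nu] P(2)[OF mu] P(2)[OF nu]]) simp
  moreover have "(\<lambda>n. mono_gap U (law \<nu> (cl n)) (law \<mu> (cl n))) \<longlonglongrightarrow> mono_gap U \<nu> \<mu>"
    by (rule mono_gap_tendsto[OF nu P(1)[OF nu] P(3)[OF nu] mu P(1)[OF mu] P(3)[OF mu] lip lim[OF nu P(1)[OF nu] P(3)[OF nu]] lim[OF mu P(1)[OF mu] P(3)[OF mu]]])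
  ultimately show ?thesis using LIMSEQ_le_const[of _ "mono_gap U \<nu> \<mu>" 0] by blast
qed

end

section \<open>Two-point Euler steps\<close>

text \<open>Second-order information from a single derivative: comparing \<open>g\<close> with the
  polynomial \<open>P * \<theta> + Q * \<theta>\<^sup>2\<close> leaves \<open>G \<theta>\<close>
  against \<open>P + 2 * \<theta> * Q\<close> at one unknown \<open>\<theta>\<close>. The same
  factor \<open>2 * \<theta>\<close> arises from two-point increments, so the main terms match
  whatever that \<open>\<theta>\<close> is.\<close>

lemma quadratic_mvt:
  fixes g :: "real \<Rightarrow> real"
  assumes "\<And>\<theta>. (g has_real_derivative G \<theta>) (at \<theta>)"
  shows "\<exists>\<theta>. 0 < \<theta> \<and> \<theta> < 1 \<and> g 1 - g 0 - (P + Q) = G \<theta> - (P + 2 * \<theta> * Q)"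
proof -
  have "((\<lambda>\<theta>. g \<theta> - (P * \<theta> + Q * \<theta>\<^sup>2)) has_real_derivative (G \<theta> - (P + 2 * \<theta> * Q))) (at \<theta>)" for \<theta>
    by (auto intro!: derivative_eq_intros assms)
  from MVT2[OF zero_less_one this] obtain \<theta> where "0 < \<theta>" "\<theta> < 1"
    "g 1 - (P * 1 + Q * 1\<^sup>2) - (g 0 - (P * 0 + Q * 0\<^sup>2)) = (1 - 0) * (G \<theta> - (P + 2 * \<theta> * Q))" by blast
  then show ?thesis by (intro exI[of _ \<theta>]) simp
qed

text \<open>The two-point increments \<open>h \<beta> \<plusminus> sqrt (2 h \<alpha>)\<close> stand in for an Euler step with
  drift \<open>\<beta>\<close> and squared volatility \<open>2 \<alpha>\<close>.\<close>

definition two_point :: "real \<Rightarrow> real \<Rightarrow> real \<Rightarrow> real \<Rightarrow> (real \<Rightarrow> real) \<Rightarrow> real \<Rightarrow> real" where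
  "two_point h \<beta> \<alpha> \<theta> f x =
     (f (x + \<theta> * (h * \<beta> + sqrt (2 * h * \<alpha>))) * (h * \<beta> + sqrt (2 * h * \<alpha>))
    + f (x + \<theta> * (h * \<beta> - sqrt (2 * h * \<alpha>))) * (h * \<beta> - sqrt (2 * h * \<alpha>))) / 2"

text \<open>The square root parts carry opposite signs, so they combine to \<open>r / 2\<close>
  times an increment of \<open>f\<close> over the distance \<open>2 * \<theta> * r\<close>. With
  \<open>r\<^sup>2 = 2 * h * \<alpha>\<close> this is of order \<open>h\<close>, and division by
  \<open>h\<close> leaves a drift average and a term in \<open>f'\<close>.\<close>

lemma two_point_eq:
  assumes f: "\<And>y. (f has_real_derivative f' y) (at y)" and h: "h > 0" and \<alpha>: "\<alpha> \<ge> 0" and \<theta>: "\<theta> \<in> {0..1}"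
  obtains z where "\<bar>z - (x + \<theta> * (h * \<beta> - sqrt (2 * h * \<alpha>)))\<bar> \<le> 2 * sqrt (2 * h * \<alpha>)"
    "two_point h \<beta> \<alpha> \<theta> f x / h = \<beta> * ((f (x + \<theta> * (h * \<beta> + sqrt (2 * h * \<alpha>))) + f (x + \<theta> * (h * \<beta> - sqrt (2 * h * \<alpha>)))) / 2) + 2 * \<theta> * \<alpha> * f' z"
proof -
  define r where "r = sqrt (2 * h * \<alpha>)"
  have r: "r \<ge> 0" "r\<^sup>2 = 2 * h * \<alpha>" using h \<alpha> by (auto simp: r_def)
  obtain z where z: "\<bar>z - (x + \<theta> * (h * \<beta> - r))\<bar> \<le> \<bar>x + \<theta> * (h * \<beta> + r) - (x + \<theta> * (h * \<beta> - r))\<bar>"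
    "f (x + \<theta> * (h * \<beta> + r)) - f (x + \<theta> * (h * \<beta> - r)) = f' z * (x + \<theta> * (h * \<beta> + r) - (x + \<theta> * (h * \<beta> - r)))"
    by (rule mvt_real[OF f])
  have d: "x + \<theta> * (h * \<beta> + r) - (x + \<theta> * (h * \<beta> - r)) = 2 * \<theta> * r" by (simp add: algebra_simps)
  have "\<bar>2 * \<theta> * r\<bar> \<le> 2 * r" using \<theta> r(1) mult_right_mono[of \<theta> 1 r] by (simp add: abs_mult)
  then have "\<bar>z - (x + \<theta> * (h * \<beta> - r))\<bar> \<le> 2 * r" using z(1) d by simp
  moreover have "two_point h \<beta> \<alpha> \<theta> f x / h = \<beta> * ((f (x + \<theta> * (h * \<beta> + r)) + f (x + \<theta> * (h * \<beta> - r))) / 2) + 2 * \<theta> * \<alpha> * f' z"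
  proof -
    have "two_point h \<beta> \<alpha> \<theta> f x = h * \<beta> * ((f (x + \<theta> * (h * \<beta> + r)) + f (x + \<theta> * (h * \<beta> - r))) / 2) + r / 2 * (f (x + \<theta> * (h * \<beta> + r)) - f (x + \<theta> * (h * \<beta> - r)))"
      unfolding two_point_def r_def[symmetric] by (simp add: field_simps)
    also have "r / 2 * (f (x + \<theta> * (h * \<beta> + r)) - f (x + \<theta> * (h * \<beta> - r))) = r\<^sup>2 * \<theta> * f' z"
      unfolding z(2) d by (simp add: power2_eq_square)
    finally show ?thesis unfolding r(2) using h by (simp add: field_simps)
  qed
  ultimately show thesis using that unfolding r_def by blast
qed

text \<open>The drift average contributes \<open>K * C\<close> and the term
  \<open>2 * \<theta> * \<alpha> * f' z\<close> contributes \<open>2 * K * C\<close>.\<close>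

lemma two_point_bound:
  assumes f: "\<And>y. (f has_real_derivative f' y) (at y)" and h: "h > 0" and \<alpha>: "\<alpha> \<ge> 0" "\<alpha> \<le> K" and \<theta>: "\<theta> \<in> {0..1}"
    and b: "\<And>y. \<bar>f y\<bar> \<le> C" "\<And>y. \<bar>f' y\<bar> \<le> C" and \<beta>: "\<bar>\<beta>\<bar> \<le> K"
  shows "\<bar>two_point h \<beta> \<alpha> \<theta> f x / h\<bar> \<le> 3 * K * C"
proof -
  obtain z where "two_point h \<beta> \<alpha> \<theta> f x / h = \<beta> * ((f (x + \<theta> * (h * \<beta> + sqrt (2 * h * \<alpha>))) + f (x + \<theta> * (h * \<beta> - sqrt (2 * h * \<alpha>)))) / 2) + 2 * \<theta> * \<alpha> * f' z"
    (is "_ = \<beta> * ?m + _") using two_point_eq[OF f h \<alpha>(1) \<theta>] by blast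
  moreover have "\<bar>(p + q) / 2\<bar> \<le> C" if "\<bar>p\<bar> \<le> C" "\<bar>q\<bar> \<le> C" for p q :: real
    using that by (auto simp: abs_le_iff)
  from this[OF b(1) b(1)] have "\<bar>?m\<bar> \<le> C" .
  then have "\<bar>\<beta> * ?m\<bar> \<le> K * C" unfolding abs_mult using \<beta> by (intro mult_mono) auto
  moreover have "\<bar>2 * \<theta> * \<alpha> * f' z\<bar> \<le> 2 * 1 * K * C"
    unfolding abs_mult using \<theta> \<alpha> b(2)[of z] by (intro mult_mono) auto
  ultimately show ?thesis by linarith
qed

text \<open>The \<open>\<theta> n\<close> are mean points in the unit interval that need not
  converge; the limit is therefore stated as a vanishing difference that still contains
  \<open>\<theta> n\<close>. Convergence along every sequence \<open>y\<close> tending to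
  \<open>x\<close> allows \<open>f n\<close> to carry a changing law.\<close>

lemma two_point_limit:
  fixes f f' :: "nat \<Rightarrow> real \<Rightarrow> real"
  assumes f: "\<And>n y. (f n has_real_derivative f' n y) (at y)" and h: "\<And>n. h n > 0" "h \<longlonglongrightarrow> 0" and \<alpha>: "\<alpha> \<ge> 0" 
    and \<theta>: "\<And>n. \<theta> n \<in> {0..1}"
    and lim: "\<And>y. y \<longlonglongrightarrow> x \<Longrightarrow> (\<lambda>n. f n (y n)) \<longlonglongrightarrow> d" "\<And>y. y \<longlonglongrightarrow> x \<Longrightarrow> (\<lambda>n. f' n (y n)) \<longlonglongrightarrow> d'"
  shows "(\<lambda>n. two_point (h n) \<beta> \<alpha> (\<theta> n) (f n) x / h n - (\<beta> * d + 2 * \<theta> n * (\<alpha> * d'))) \<longlonglongrightarrow> 0"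
proof -
  let ?r = "\<lambda>n. sqrt (2 * h n * \<alpha>)"
  let ?u = "\<lambda>n. x + \<theta> n * (h n * \<beta> + ?r n)" and ?d = "\<lambda>n. x + \<theta> n * (h n * \<beta> - ?r n)"
  have "\<forall>n. \<exists>z. \<bar>z - ?d n\<bar> \<le> 2 * ?r n \<and> two_point (h n) \<beta> \<alpha> (\<theta> n) (f n) x / h n = \<beta> * ((f n (?u n) + f n (?d n)) / 2) + 2 * \<theta> n * \<alpha> * f' n z"
    using two_point_eq[OF f h(1) \<alpha> \<theta>] by blast
  from choice[OF this] obtain z where z: "\<And>n. \<bar>z n - ?d n\<bar> \<le> 2 * ?r n" 
    and e: "\<And>n. two_point (h n) \<beta> \<alpha> (\<theta> n) (f n) x / h n = \<beta> * ((f n (?u n) + f n (?d n)) / 2) + 2 * \<theta> n * \<alpha> * f' n (z n)" by blast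
  have "(\<lambda>n. sqrt (2 * h n * \<alpha>)) \<longlonglongrightarrow> sqrt (2 * 0 * \<alpha>)" by (intro tendsto_intros h)
  then have r0: "?r \<longlonglongrightarrow> 0" by simp
  have hb: "(\<lambda>n. h n * \<beta>) \<longlonglongrightarrow> 0" using tendsto_mult_left_zero[OF h(2)] .
  have small: "(\<lambda>n. x + \<theta> n * v n) \<longlonglongrightarrow> x" if "v \<longlonglongrightarrow> 0" for v
  proof -
    have "(\<lambda>n. \<theta> n * v n) \<longlonglongrightarrow> 0"
    proof (rule Lim_null_comparison[OF _ tendsto_rabs_zero[OF that]], intro always_eventually allI)
      fix n show "norm (\<theta> n * v n) \<le> \<bar>v n\<bar>"
        using mult_right_mono[of "\<bar>\<theta> n\<bar>" 1 "\<bar>v n\<bar>"] \<theta>[of n] by (simp add: abs_mult)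
    qed
    from tendsto_add[OF tendsto_const[of x] this] show ?thesis by simp
  qed
  have u: "?u \<longlonglongrightarrow> x" using small[of "\<lambda>n. h n * \<beta> + ?r n"] tendsto_add[OF hb r0] by simp
  have d: "?d \<longlonglongrightarrow> x" using small[of "\<lambda>n. h n * \<beta> - ?r n"] tendsto_diff[OF hb r0] by simp
  have "(\<lambda>n. z n - ?d n) \<longlonglongrightarrow> 0"
    by (rule Lim_null_comparison[where g="\<lambda>n. 2 * ?r n"]) (use z tendsto_mult_right_zero[OF r0] in auto)
  from tendsto_add[OF this d] have zl: "z \<longlonglongrightarrow> x" by simp
  have 1: "(\<lambda>n. \<beta> * ((f n (?u n) + f n (?d n)) / 2)) \<longlonglongrightarrow> \<beta> * ((d + d) / 2)"
    by (intro tendsto_intros lim u d) simp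
  have 2: "(\<lambda>n. 2 * \<theta> n * \<alpha> * (f' n (z n) - d')) \<longlonglongrightarrow> 0"
  proof (rule Lim_null_comparison[where g="\<lambda>n. 2 * \<alpha> * \<bar>f' n (z n) - d'\<bar>"], intro always_eventually allI)
    fix n
    show "norm (2 * \<theta> n * \<alpha> * (f' n (z n) - d')) \<le> 2 * \<alpha> * \<bar>f' n (z n) - d'\<bar>"
      unfolding real_norm_def abs_mult using \<theta>[of n] \<alpha> mult_right_mono[of "\<theta> n" 1 \<alpha>] by (intro mult_right_mono) auto
    show "(\<lambda>n. 2 * \<alpha> * \<bar>f' n (z n) - d'\<bar>) \<longlonglongrightarrow> 0"
      by (intro tendsto_mult_right_zero tendsto_rabs_zero LIM_zero lim zl)
  qed
  have "(\<lambda>n. (\<beta> * ((f n (?u n) + f n (?d n)) / 2) - \<beta> * ((d + d) / 2)) + 2 * \<theta> n * \<alpha> * (f' n (z n) - d')) \<longlonglongrightarrow> 0 + 0"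
    by (intro tendsto_add 2 LIM_zero 1)
  then show ?thesis unfolding e by (simp add: algebra_simps)
qed

section \<open>The sign of a Brownian increment as a fair coin\<close>

context mfg_space
begin

definition up :: "real \<Rightarrow> real \<Rightarrow> 'w set" where
  "up s s' = {\<omega> \<in> space M. 0 < B s' \<omega> - B s \<omega>}"

context
  fixes s s' :: real
  assumes s: "0 \<le> s" "s < s'" "s' \<le> T"
begin

lemma sets_up: "up s s' \<in> sets (\<F> s')"
proof -
  have b: "B s \<in> borel_measurable (\<F> s')" "B s' \<in> borel_measurable (\<F> s')"
    using filtered s measurable_filt_mono[of s s' "B s"] unfolding filtered_space_def brownian_motion_def by auto
  then have "{\<omega> \<in> space (\<F> s'). 0 < B s' \<omega> - B s \<omega>} \<in> sets (\<F> s')" by measurable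
  then show ?thesis by (simp add: up_def)
qed

lemma sets_up_M [measurable]: "up s s' \<in> sets M"
  using sets_up subalgebra_filt[of s'] s by (auto simp: subalgebra_def)

text \<open>The centred normal density is symmetric, so both signs are equally likely, and the value
  0 has probability zero.\<close>

lemma prob_up: "prob (up s s') = 1 / 2"
proof -
  let ?I = "\<lambda>\<omega>. B s' \<omega> - B s \<omega>"
  let ?g = "\<lambda>x. ennreal (normal_density 0 (sqrt (s' - s)) x)"
  have D: "distributed M lborel ?I ?g"
    using filtered s unfolding filtered_space_def brownian_motion_def by blast
  have [measurable]: "?I \<in> borel_measurable M" using distributed_measurable[OF D] by simp
  have E: "emeasure M (?I -` S \<inter> space M) = (\<integral>\<^sup>+x. ?g x * indicator S x \<partial>lborel)" if "S \<in> sets borel" for S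
    using distributed_emeasure[OF D, of S] that by simp
  have "(\<integral>\<^sup>+x. ?g x * indicator {..<0} x \<partial>lborel) = (\<integral>\<^sup>+x. ?g (0 + -1 * x) * indicator {..<0} (0 + -1 * x) \<partial>lborel)"
    by (subst nn_integral_real_affine[of _ "-1" 0]) auto
  also have "\<dots> = (\<integral>\<^sup>+x. ?g x * indicator {0<..} x \<partial>lborel)"
    by (intro nn_integral_cong) (auto simp: normal_density_def indicator_def)
  finally have neg: "emeasure M (?I -` {..<0} \<inter> space M) = emeasure M (?I -` {0<..} \<inter> space M)" by (simp add: E)
  have zero: "emeasure M (?I -` {0} \<inter> space M) = 0"
  proof -
    have "AE x in lborel. ?g x * indicator {0} x = 0" using AE_lborel_singleton[of 0] by eventually_elim auto
    then show ?thesis by (subst E) (auto simp: nn_integral_0_iff_AE)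
  qed
  have "prob (?I -` {0<..} \<inter> space M) + prob (?I -` {..<0} \<inter> space M) + prob (?I -` {0} \<inter> space M) = prob (space M)"
    by (subst finite_measure_Union[symmetric], simp, simp, force)+ (auto intro!: arg_cong[where f=prob])
  moreover have "up s s' = ?I -` {0<..} \<inter> space M" by (auto simp: up_def)
  ultimately show ?thesis using neg zero by (simp add: measure_def[of M] emeasure_space_1)
qed

lemma integral_up:
  fixes Y :: "'w \<Rightarrow> real"
  assumes Y: "Y \<in> borel_measurable (\<F> s)" "integrable M Y"
  shows "(\<integral>\<omega>. indicator (up s s') \<omega> * Y \<omega> \<partial>M) = (\<integral>\<omega>. Y \<omega> \<partial>M) / 2"
proof -
  let ?I = "\<lambda>\<omega>. B s' \<omega> - B s \<omega>"
  have ind: "indep_set (sets (\<F> s)) {?I -` S \<inter> space M |S. S \<in> sets borel}"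
    using filtered s unfolding filtered_space_def brownian_motion_def by blast
  have I[measurable]: "?I \<in> borel_measurable M" using B_measurable[of s] B_measurable[of s'] s by simp
  have YM: "Y \<in> borel_measurable M" using Y(2) by simp
  \<comment> \<open>Independence is given for two set systems; both are stable under intersection,
    so it extends to the sigma-algebras they generate.\<close>
  have ind2: "indep_set (sigma_sets (space M) (sets (\<F> s))) (sigma_sets (space M) {?I -` S \<inter> space M |S. S \<in> sets borel})"
  proof (rule indep_set_sigma_sets[OF ind])
    show "Int_stable (sets (\<F> s))" by (rule sets.Int_stable)
    show "Int_stable {?I -` S \<inter> space M |S. S \<in> sets borel}"
    proof (rule Int_stableI, clarify)
      fix S S' :: "real set" assume "S \<in> sets borel" "S' \<in> sets borel"
      then show "\<exists>Sa. ?I -` S \<inter> space M \<inter> (?I -` S' \<inter> space M) = ?I -` Sa \<inter> space M \<and> Sa \<in> sets borel"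
        by (intro exI[of _ "S \<inter> S'"]) auto
    qed
  qed
  have "indep_var borel Y borel ?I"
    unfolding indep_var_eq
  proof (intro conjI YM I)
    have "sigma_sets (space M) {Y -` A \<inter> space M |A. A \<in> sets borel} \<subseteq> sigma_sets (space M) (sets (\<F> s))"
      using measurable_sets[OF Y(1)] by (intro sigma_sets_mono') auto
    then show "indep_set (sigma_sets (space M) {Y -` A \<inter> space M |A. A \<in> sets borel}) (sigma_sets (space M) {?I -` A \<inter> space M |A. A \<in> sets borel})"
      using ind2 unfolding indep_sets2_eq by blast
  qed
  from indep_var_compose[OF this, of "\<lambda>x. x" borel "indicator {0<..} :: real \<Rightarrow> real" borel]
  have "indep_var borel Y borel (\<lambda>\<omega>. indicator {0<..} (?I \<omega>) :: real)" by (simp add: comp_def)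
  from indep_var_lebesgue_integral[OF this Y(2)]
  have "(\<integral>\<omega>. Y \<omega> * indicator {0<..} (?I \<omega>) \<partial>M) = (\<integral>\<omega>. Y \<omega> \<partial>M) * (\<integral>\<omega>. indicator {0<..} (?I \<omega>) \<partial>M)"
    by (simp add: integrable_const_bound[where B=1])
  moreover have "(\<integral>\<omega>. indicator {0<..} (?I \<omega>) \<partial>M) = (\<integral>\<omega>. indicator (up s s') \<omega> \<partial>M :: real)"
    by (intro Bochner_Integration.integral_cong) (auto simp: up_def indicator_def)
  moreover have "(\<integral>\<omega>. Y \<omega> * indicator {0<..} (?I \<omega>) \<partial>M) = (\<integral>\<omega>. indicator (up s s') \<omega> * Y \<omega> \<partial>M)"
    by (intro Bochner_Integration.integral_cong) (auto simp: up_def indicator_def)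
  ultimately show ?thesis using prob_up by simp
qed

lemma integral_coin:
  fixes Y Z :: "'w \<Rightarrow> real"
  assumes Y: "Y \<in> borel_measurable (\<F> s)" "integrable M Y" and Z: "Z \<in> borel_measurable (\<F> s)" "integrable M Z"
  shows "(\<integral>\<omega>. (if \<omega> \<in> up s s' then Y \<omega> else Z \<omega>) \<partial>M) = (\<integral>\<omega>. (Y \<omega> + Z \<omega>) / 2 \<partial>M)"
proof -
  have e: "(\<lambda>\<omega>. if \<omega> \<in> up s s' then Y \<omega> else Z \<omega>) = (\<lambda>\<omega>. indicator (up s s') \<omega> * Y \<omega> + (Z \<omega> - indicator (up s s') \<omega> * Z \<omega>))"
    by (auto simp: fun_eq_iff)
  have i: "integrable M (\<lambda>\<omega>. indicator (up s s') \<omega> * Y \<omega>)" "integrable M (\<lambda>\<omega>. indicator (up s s') \<omega> * Z \<omega>)"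
    using integrable_mult_indicator[OF sets_up_M Y(2)] integrable_mult_indicator[OF sets_up_M Z(2)] by simp_all
  show "(\<integral>\<omega>. (if \<omega> \<in> up s s' then Y \<omega> else Z \<omega>) \<partial>M) = (\<integral>\<omega>. (Y \<omega> + Z \<omega>) / 2 \<partial>M)"
  proof -
    have "(\<integral>\<omega>. indicator (up s s') \<omega> * Y \<omega> + (Z \<omega> - indicator (up s s') \<omega> * Z \<omega>) \<partial>M)
      = (\<integral>\<omega>. indicator (up s s') \<omega> * Y \<omega> \<partial>M) + ((\<integral>\<omega>. Z \<omega> \<partial>M) - (\<integral>\<omega>. indicator (up s s') \<omega> * Z \<omega> \<partial>M))"
      using i Z(2) by simp
    also have "\<dots> = (\<integral>\<omega>. (Y \<omega> + Z \<omega>) / 2 \<partial>M)"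
      unfolding integral_up[OF Y] integral_up[OF Z] using Y(2) Z(2) by simp
    finally show ?thesis unfolding e .
  qed
qed

end

definition euler_step :: "(real \<Rightarrow> real) \<Rightarrow> (real \<Rightarrow> real) \<Rightarrow> real \<Rightarrow> real \<Rightarrow> ('w \<Rightarrow> real) \<Rightarrow> 'w \<Rightarrow> real" where
  "euler_step b a s h X \<omega> = (if \<omega> \<in> up s (s + h) then h * b (X \<omega>) + sqrt (2 * h * a (X \<omega>)) else h * b (X \<omega>) - sqrt (2 * h * a (X \<omega>)))"

section \<open>Moments and laws after a single Euler step\<close>

context
  fixes b a :: "real \<Rightarrow> real" and K s :: real and X :: "'w \<Rightarrow> real"
  assumes b: "b \<in> borel_measurable borel" "\<And>x. \<bar>b x\<bar> \<le> K"
    and a: "a \<in> borel_measurable borel" "\<And>x. 0 \<le> a x" "\<And>x. a x \<le> K"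
    and s: "0 \<le> s" and X: "X \<in> LF s"
begin

text \<open>The bound does not involve the sample point, so the increment is square integrable and
  vanishes uniformly as \<open>h\<close> tends to 0.\<close>

lemma euler_step_bound:
  assumes "0 < h"
  shows "\<bar>euler_step b a s h X \<omega>\<bar> \<le> h * K + sqrt (2 * h * K)"
proof -
  have 1: "\<bar>h * b (X \<omega>)\<bar> \<le> h * K" unfolding abs_mult using assms b(2) by (intro mult_mono) auto
  have 2: "0 \<le> sqrt (2 * h * a (X \<omega>))" "sqrt (2 * h * a (X \<omega>)) \<le> sqrt (2 * h * K)" using assms a(2,3) by auto
  have "\<bar>p + q\<bar> \<le> P + Q \<and> \<bar>p - q\<bar> \<le> P + Q" if "\<bar>p\<bar> \<le> P" "0 \<le> q" "q \<le> Q" for p q P Q :: real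
    using that by arith
  from this[OF 1 2] show ?thesis unfolding euler_step_def by (cases "\<omega> \<in> up s (s + h)") simp_all
qed

context
  fixes h :: real
  assumes h: "0 < h" "s + h \<le> T"
begin

lemma step_times: "0 \<le> s" "s < s + h" "s + h \<le> T" "s \<in> {0..T}" "s + h \<in> {0..T}"
  using s h by auto

lemma state_measurable [measurable]: "X \<in> borel_measurable (\<F> s)" "X \<in> borel_measurable M" "X \<in> borel_measurable (\<F> (s + h))"
  using LFD[OF X] measurable_filt_mono[OF less_imp_le[OF step_times(2)]] by auto

lemma euler_step_measurable: "euler_step b a s h X \<in> borel_measurable (\<F> (s + h))"
proof -
  note [measurable] = b(1) a(1) 
  have [measurable]: "up s (s + h) \<in> sets (\<F> (s + h))" by (rule sets_up[OF step_times(1-3)])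
  show ?thesis unfolding euler_step_def by measurable
qed

lemma euler_step_LF: "euler_step b a s h X \<in> LF (s + h)"
proof -
  have "(\<lambda>\<omega>. euler_step b a s h X \<omega> * 1) \<in> LF (s + h)"
    by (rule LF_bounded_mult[OF step_times(5) LF_const[OF step_times(5)] euler_step_measurable euler_step_bound[OF h(1)]])
  then show ?thesis by simp
qed

lemma integral_euler_step:
  fixes g :: "real \<Rightarrow> real \<Rightarrow> real"
  assumes g: "(\<lambda>(x, e). g x e) \<in> borel_measurable (borel \<Otimes>\<^sub>M borel)"
    and i: "\<And>c. c \<in> {-1, 1} \<Longrightarrow> integrable M (\<lambda>\<omega>. g (X \<omega>) (h * b (X \<omega>) + c * sqrt (2 * h * a (X \<omega>))))"
  shows "(\<integral>\<omega>. g (X \<omega>) (euler_step b a s h X \<omega>) \<partial>M) =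
      (\<integral>\<omega>. (g (X \<omega>) (h * b (X \<omega>) + sqrt (2 * h * a (X \<omega>))) + g (X \<omega>) (h * b (X \<omega>) - sqrt (2 * h * a (X \<omega>)))) / 2 \<partial>M)"
proof -
  note [measurable] = b(1) a(1)
  have m: "(\<lambda>\<omega>. g (X \<omega>) (h * b (X \<omega>) + c * sqrt (2 * h * a (X \<omega>)))) \<in> borel_measurable (\<F> s)" for c
  proof -
    have "(\<lambda>\<omega>. (X \<omega>, h * b (X \<omega>) + c * sqrt (2 * h * a (X \<omega>)))) \<in> measurable (\<F> s) (borel \<Otimes>\<^sub>M borel)" by measurable
    from measurable_compose[OF this g] show ?thesis by simp
  qed
  have e: "g (X \<omega>) (euler_step b a s h X \<omega>) = (if \<omega> \<in> up s (s + h) then g (X \<omega>) (h * b (X \<omega>) + 1 * sqrt (2 * h * a (X \<omega>))) else g (X \<omega>) (h * b (X \<omega>) + (-1) * sqrt (2 * h * a (X \<omega>))))" for \<omega>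
    by (simp add: euler_step_def)
  show "(\<integral>\<omega>. g (X \<omega>) (euler_step b a s h X \<omega>) \<partial>M) =
      (\<integral>\<omega>. (g (X \<omega>) (h * b (X \<omega>) + sqrt (2 * h * a (X \<omega>))) + g (X \<omega>) (h * b (X \<omega>) - sqrt (2 * h * a (X \<omega>)))) / 2 \<partial>M)"
    unfolding e by (subst integral_coin[OF step_times(1-3) m i m i]) auto
qed

end

section \<open>Expansions as the step size tends to zero\<close>

context
  fixes h :: "nat \<Rightarrow> real"
  assumes h: "\<And>n. 0 < h n" "\<And>n. s + h n \<le> T" "h \<longlonglongrightarrow> 0"
begin

lemma state_LF_T: "X \<in> LF T"
  using LF_mono[OF _ X, of T] h(1)[of 0] h(2)[of 0] by linarith

lemma euler_step_LF_T: "euler_step b a s (h n) X \<in> LF T"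
  by (rule LF_mono[OF h(2) euler_step_LF[OF h(1,2)]])

lemma euler_law_tendsto:
  assumes \<theta>: "\<And>n. \<theta> n \<in> {0..1}"
  shows "(\<lambda>n. W2 (law M X) (law M (\<lambda>\<omega>. X \<omega> + \<theta> n * euler_step b a s (h n) X \<omega>))) \<longlonglongrightarrow> 0"
proof (rule W2_law_tendsto[OF prob_space_axioms])
  let ?r = "\<lambda>n. h n * K + sqrt (2 * h n * K)"
  have "?r \<longlonglongrightarrow> 0 * K + sqrt (2 * 0 * K)" by (intro tendsto_intros h)
  then have r: "?r \<longlonglongrightarrow> 0" by simp
  have e: "\<bar>\<theta> n * euler_step b a s (h n) X \<omega>\<bar> \<le> ?r n" for n \<omega>
  proof -
    have "\<bar>\<theta> n\<bar> * \<bar>euler_step b a s (h n) X \<omega>\<bar> \<le> 1 * (h n * K + sqrt (2 * h n * K))"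
      using \<theta>[of n] by (intro mult_mono euler_step_bound[OF h(1)]) auto
    then show ?thesis by (simp add: abs_mult)
  qed
  show "(\<lambda>n. norm2 M (\<lambda>\<omega>. X \<omega> - (X \<omega> + \<theta> n * euler_step b a s (h n) X \<omega>))) \<longlonglongrightarrow> 0"
  proof (rule Lim_null_comparison[OF _ r], intro always_eventually allI)
    fix n
    have "(\<integral>\<omega>. (X \<omega> - (X \<omega> + \<theta> n * euler_step b a s (h n) X \<omega>))\<^sup>2 \<partial>M) \<le> (\<integral>\<omega>. (?r n)\<^sup>2 \<partial>M)"
    proof (rule integral_mono')
      show "(X \<omega> - (X \<omega> + \<theta> n * euler_step b a s (h n) X \<omega>))\<^sup>2 \<le> (?r n)\<^sup>2" for \<omega>
        using power_mono[OF e abs_ge_zero, of n \<omega> 2] by simp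
    qed auto
    then have "norm2 M (\<lambda>\<omega>. X \<omega> - (X \<omega> + \<theta> n * euler_step b a s (h n) X \<omega>)) \<le> sqrt ((?r n)\<^sup>2)"
      unfolding norm2_def by (intro real_sqrt_le_mono) (simp add: prob_space)
    also have "\<dots> = ?r n" using order_trans[OF abs_ge_zero e[of n]] by simp
    finally show "norm (norm2 M (\<lambda>\<omega>. X \<omega> - (X \<omega> + \<theta> n * euler_step b a s (h n) X \<omega>))) \<le> ?r n" by simp
  qed
  show "X \<in> borel_measurable M" "integrable M (\<lambda>\<omega>. (X \<omega>)\<^sup>2)" by (rule LFD[OF X])+
  show "(\<lambda>\<omega>. X \<omega> + \<theta> n * euler_step b a s (h n) X \<omega>) \<in> borel_measurable M" "integrable M (\<lambda>\<omega>. (X \<omega> + \<theta> n * euler_step b a s (h n) X \<omega>)\<^sup>2)" for n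
    by (rule LFD[OF LF_add[OF state_LF_T LF_scale[OF euler_step_LF_T]]])+
qed

text \<open>With \<open>f\<close> a Lions derivative, the left-hand side is the derivative along the
  step. Averaging over the coin turns it into an expression in the state at time \<open>s\<close>
  alone.\<close>

lemma integral_euler_two_point:
  fixes f :: "real \<Rightarrow> real"
  assumes f: "f \<in> borel_measurable borel" "\<And>x. \<bar>f x\<bar> \<le> C"
  shows "(\<integral>\<omega>. f (X \<omega> + \<theta> * euler_step b a s (h n) X \<omega>) * euler_step b a s (h n) X \<omega> \<partial>M) = (\<integral>\<omega>. two_point (h n) (b (X \<omega>)) (a (X \<omega>)) \<theta> f (X \<omega>) \<partial>M)"
  unfolding two_point_def
proof (rule integral_euler_step[OF h(1,2), where g="\<lambda>x e. f (x + \<theta> * e) * e"])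
  note [measurable] = f(1) b(1) a(1) LFD(2)[OF X]
  show "(\<lambda>(x, e). f (x + \<theta> * e) * e) \<in> borel_measurable (borel \<Otimes>\<^sub>M borel)" by measurable
  fix c :: real assume c: "c \<in> {-1, 1}"
  show "integrable M (\<lambda>\<omega>. f (X \<omega> + \<theta> * (h n * b (X \<omega>) + c * sqrt (2 * h n * a (X \<omega>)))) * (h n * b (X \<omega>) + c * sqrt (2 * h n * a (X \<omega>))))"
  proof (rule integrable_const_bound[where B="C * (h n * K + sqrt (2 * h n * K))"], rule AE_I2)
    fix \<omega>
    have C: "0 \<le> C" using f(2)[of 0] by linarith
    have 1: "\<bar>h n * b (X \<omega>)\<bar> \<le> h n * K" unfolding abs_mult using h(1)[of n] b(2) by (intro mult_mono) auto
    have 2: "\<bar>c * sqrt (2 * h n * a (X \<omega>))\<bar> \<le> sqrt (2 * h n * K)" using h(1)[of n] a(2,3) c by (auto simp: abs_mult)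
    have "\<bar>h n * b (X \<omega>) + c * sqrt (2 * h n * a (X \<omega>))\<bar> \<le> h n * K + sqrt (2 * h n * K)"
      using abs_triangle_ineq[of "h n * b (X \<omega>)" "c * sqrt (2 * h n * a (X \<omega>))"] 1 2 by linarith
    then show "norm (f (X \<omega> + \<theta> * (h n * b (X \<omega>) + c * sqrt (2 * h n * a (X \<omega>)))) * (h n * b (X \<omega>) + c * sqrt (2 * h n * a (X \<omega>)))) \<le> C * (h n * K + sqrt (2 * h n * K))"
      unfolding real_norm_def abs_mult using C by (intro mult_mono f(2)) auto
  qed measurable
qed

lemma two_point_measurable:
  assumes [measurable]: "f \<in> borel_measurable borel"
  shows "(\<lambda>\<omega>. two_point (h n) (b (X \<omega>)) (a (X \<omega>)) \<theta> f (X \<omega>)) \<in> borel_measurable M"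
proof -
  note [measurable] = b(1) a(1) LFD(2)[OF X]
  show ?thesis unfolding two_point_def by measurable
qed

text \<open>The new law is reached along the line \<open>X + \<theta> * euler_step\<close>, whose
  derivative is a mean of two-point expressions of \<open>D\<close>. Subtracting the quadratic with
  coefficients \<open>h n * P\<close> and \<open>h n * Q\<close> isolates the drift and the
  diffusion contribution. The space point \<open>y n\<close> is allowed to move, because the result
  will be evaluated at states that move with the step.\<close>

lemma
  assumes reg: "regular U D D1 D2 C"
  shows measure_step_bound: "\<bar>(U x (law M (\<lambda>\<omega>. X \<omega> + euler_step b a s (h n) X \<omega>)) - U x (law M X)) / h n\<bar> \<le> 3 * K * C"
    and measure_step_tendsto: "y \<longlonglongrightarrow> x \<Longrightarrow> (\<lambda>n. (U (y n) (law M (\<lambda>\<omega>. X \<omega> + euler_step b a s (h n) X \<omega>)) - U (y n) (law M X)) / h n)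
      \<longlonglongrightarrow> (\<integral>\<omega>. b (X \<omega>) * D (x, X \<omega>) (law M X) + a (X \<omega>) * D2 (x, X \<omega>) (law M X) \<partial>M)"
proof -
  note R = regularD[OF reg]
  let ?m = "\<lambda>n \<theta>. law M (\<lambda>\<omega>. X \<omega> + \<theta> * euler_step b a s (h n) X \<omega>)"
  have m: "(\<lambda>\<omega>. X \<omega> + \<theta> * euler_step b a s (h n) X \<omega>) \<in> LF T" for n \<theta> by (intro LF_add state_LF_T LF_scale euler_step_LF_T)
  have mP: "?m n \<theta> \<in> P2" for n \<theta> by (rule LFD(5)[OF m])
  have mu: "law M X \<in> P2" by (rule LFD(5)[OF X])
  have K0: "0 \<le> K" using b(2)[of 0] by linarith
  have C0: "0 \<le> C" using R(7)[OF mu, of 0] by linarith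
  define G where "G n x \<theta> = (\<integral>\<omega>. two_point (h n) (b (X \<omega>)) (a (X \<omega>)) \<theta> (\<lambda>x'. D (x, x') (?m n \<theta>)) (X \<omega>) \<partial>M)" for n x \<theta>
  have Dm: "(\<lambda>x'. D (x, x') m) \<in> borel_measurable borel" if "m \<in> P2" for x m
    using cont_P2_borel[OF R(4) that] by measurable
  have der: "((\<lambda>\<theta>. U x (?m n \<theta>)) has_real_derivative G n x \<theta>) (at \<theta>)" for n x \<theta>
    using lions_path[OF R(1) state_LF_T euler_step_LF_T, of x n \<theta>] unfolding G_def integral_euler_two_point[OF Dm[OF mP] R(7)[OF mP]] .
  have tb: "\<bar>two_point (h n) (b (X \<omega>)) (a (X \<omega>)) \<theta> (\<lambda>x'. D (c, x') (?m n \<theta>)) (X \<omega>) / h n\<bar> \<le> 3 * K * C" if "\<theta> \<in> {0..1}" for n c \<theta> \<omega>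
    by (rule two_point_bound[OF R(3)[OF mP] h(1) a(2,3) that R(7)[OF mP] R(9)[OF mP] b(2)])
  have e1: "?m n 1 = law M (\<lambda>\<omega>. X \<omega> + euler_step b a s (h n) X \<omega>)" "?m n 0 = law M X" for n by simp_all
  show "\<bar>(U x (law M (\<lambda>\<omega>. X \<omega> + euler_step b a s (h n) X \<omega>)) - U x (law M X)) / h n\<bar> \<le> 3 * K * C"
  proof -
    from MVT2[OF zero_less_one der[of x n]] obtain \<theta> where \<theta>: "0 < \<theta>" "\<theta> < 1" "U x (?m n 1) - U x (?m n 0) = (1 - 0) * G n x \<theta>" by blast
    have "\<bar>G n x \<theta> / h n\<bar> = \<bar>\<integral>\<omega>. two_point (h n) (b (X \<omega>)) (a (X \<omega>)) \<theta> (\<lambda>x'. D (x, x') (?m n \<theta>)) (X \<omega>) / h n \<partial>M\<bar>"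
      by (simp add: G_def)
    also have "\<dots> \<le> (\<integral>\<omega>. 3 * K * C \<partial>M)"
      by (rule order_trans[OF integral_abs_bound], rule integral_mono') (use \<theta> tb K0 C0 in auto)
    finally show ?thesis using \<theta>(3) by (simp add: e1 prob_space)
  qed
  assume y: "y \<longlonglongrightarrow> x"
  define P where "P = (\<integral>\<omega>. b (X \<omega>) * D (x, X \<omega>) (law M X) \<partial>M)"
  define Q where "Q = (\<integral>\<omega>. a (X \<omega>) * D2 (x, X \<omega>) (law M X) \<partial>M)"
  note [measurable] = b(1) a(1) LFD(2)[OF X] cont_P2_borel[OF R(4) mu] cont_P2_borel[OF R(6) mu]
  have iP: "integrable M (\<lambda>\<omega>. b (X \<omega>) * D (x, X \<omega>) (law M X))"
  proof (rule integrable_const_bound[where B="K * C"], rule AE_I2)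
    show "norm (b (X \<omega>) * D (x, X \<omega>) (law M X)) \<le> K * C" for \<omega>
      unfolding real_norm_def abs_mult using K0 by (intro mult_mono b R(7)[OF mu]) auto
  qed measurable
  have iQ: "integrable M (\<lambda>\<omega>. a (X \<omega>) * D2 (x, X \<omega>) (law M X))"
  proof (rule integrable_const_bound[where B="K * C"], rule AE_I2)
    show "norm (a (X \<omega>) * D2 (x, X \<omega>) (law M X)) \<le> K * C" for \<omega>
      unfolding real_norm_def abs_mult using K0 a by (intro mult_mono R(9)[OF mu]) auto
  qed measurable
  have "\<forall>n. \<exists>\<theta>. 0 < \<theta> \<and> \<theta> < 1 \<and> U (y n) (?m n 1) - U (y n) (?m n 0) - (h n * P + h n * Q) = G n (y n) \<theta> - (h n * P + 2 * \<theta> * (h n * Q))"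
    using quadratic_mvt[OF der] by blast
  from choice[OF this] obtain \<theta> where \<theta>: "\<forall>n. 0 < \<theta> n \<and> \<theta> n < 1 \<and> U (y n) (?m n 1) - U (y n) (?m n 0) - (h n * P + h n * Q) = G n (y n) (\<theta> n) - (h n * P + 2 * \<theta> n * (h n * Q))" ..
  then have \<theta>01: "\<theta> n \<in> {0..1}" for n by (simp add: less_imp_le)
  let ?tp = "\<lambda>n \<omega>. two_point (h n) (b (X \<omega>)) (a (X \<omega>)) (\<theta> n) (\<lambda>x'. D (y n, x') (?m n (\<theta> n))) (X \<omega>) / h n"
  let ?lim = "\<lambda>n \<omega>. b (X \<omega>) * D (x, X \<omega>) (law M X) + 2 * \<theta> n * (a (X \<omega>) * D2 (x, X \<omega>) (law M X))"
  have tpm: "?tp n \<in> borel_measurable M" for n using two_point_measurable[OF Dm[OF mP]] by measurable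
  have itp: "integrable M (?tp n)" for n
    by (rule integrable_const_bound[where B="3 * K * C"]) (use tb \<theta>01 tpm in auto)
  have eq: "(U (y n) (?m n 1) - U (y n) (?m n 0)) / h n - (P + Q) = (\<integral>\<omega>. ?tp n \<omega> - ?lim n \<omega> \<partial>M)" for n
  proof -
    have "(U (y n) (?m n 1) - U (y n) (?m n 0)) / h n - (P + Q) = (U (y n) (?m n 1) - U (y n) (?m n 0) - (h n * P + h n * Q)) / h n"
      using h(1)[of n] by (simp add: field_simps)
    also have "\<dots> = (G n (y n) (\<theta> n) - (h n * P + 2 * \<theta> n * (h n * Q))) / h n" using \<theta> by simp
    also have "\<dots> = G n (y n) (\<theta> n) / h n - (P + 2 * \<theta> n * Q)" using h(1)[of n] by (simp add: field_simps)
    also have "G n (y n) (\<theta> n) / h n = (\<integral>\<omega>. ?tp n \<omega> \<partial>M)" by (simp add: G_def)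
    also have "P + 2 * \<theta> n * Q = (\<integral>\<omega>. ?lim n \<omega> \<partial>M)" unfolding P_def Q_def using iP iQ by simp
    finally show ?thesis using itp iP iQ by simp
  qed
  have "(\<lambda>n. \<integral>\<omega>. ?tp n \<omega> - ?lim n \<omega> \<partial>M) \<longlonglongrightarrow> (\<integral>\<omega>. 0 \<partial>M)"
  proof (rule integral_dominated_convergence[where w="\<lambda>_. 6 * K * C"])
    show "AE \<omega> in M. (\<lambda>n. ?tp n \<omega> - ?lim n \<omega>) \<longlonglongrightarrow> 0"
    proof (rule AE_I2)
      fix \<omega>
      show "(\<lambda>n. ?tp n \<omega> - ?lim n \<omega>) \<longlonglongrightarrow> 0"
      proof (rule two_point_limit[OF R(3)[OF mP] h(1,3) a(2) \<theta>01])
        fix z assume z: "z \<longlonglongrightarrow> X \<omega>"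
        show "(\<lambda>n. D (y n, z n) (?m n (\<theta> n))) \<longlonglongrightarrow> D (x, X \<omega>) (law M X)"
          by (rule cont_P2_tendsto[OF R(4) _ _ tendsto_Pair[OF y z] mu mP euler_law_tendsto[OF \<theta>01]]) auto
        show "(\<lambda>n. D2 (y n, z n) (?m n (\<theta> n))) \<longlonglongrightarrow> D2 (x, X \<omega>) (law M X)"
          by (rule cont_P2_tendsto[OF R(6) _ _ tendsto_Pair[OF y z] mu mP euler_law_tendsto[OF \<theta>01]]) auto
      qed
    qed
    show "AE \<omega> in M. norm (?tp n \<omega> - ?lim n \<omega>) \<le> 6 * K * C" for n
    proof (rule AE_I2)
      fix \<omega>
      have "\<bar>b (X \<omega>) * D (x, X \<omega>) (law M X)\<bar> \<le> K * C"
        unfolding abs_mult using K0 by (intro mult_mono b R(7)[OF mu]) auto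
      moreover have "\<bar>2 * \<theta> n * (a (X \<omega>) * D2 (x, X \<omega>) (law M X))\<bar> \<le> 2 * 1 * (K * C)"
        unfolding abs_mult using K0 a \<theta>01[of n] by (intro mult_mono R(9)[OF mu]) auto
      moreover have "\<bar>?tp n \<omega>\<bar> \<le> 3 * K * C" by (rule tb[OF \<theta>01])
      ultimately show "norm (?tp n \<omega> - ?lim n \<omega>) \<le> 6 * K * C"
        unfolding real_norm_def by linarith
    qed
    show "(\<lambda>\<omega>. ?tp n \<omega> - ?lim n \<omega>) \<in> borel_measurable M" for n using tpm by measurable
  qed auto
  then have "(\<lambda>n. (U (y n) (?m n 1) - U (y n) (?m n 0)) / h n - (P + Q)) \<longlonglongrightarrow> 0" unfolding eq by simp
  then have "(\<lambda>n. (U (y n) (?m n 1) - U (y n) (?m n 0)) / h n) \<longlonglongrightarrow> P + Q" by (simp add: LIM_zero_iff)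
  then show "(\<lambda>n. (U (y n) (law M (\<lambda>\<omega>. X \<omega> + euler_step b a s (h n) X \<omega>)) - U (y n) (law M X)) / h n)
      \<longlonglongrightarrow> (\<integral>\<omega>. b (X \<omega>) * D (x, X \<omega>) (law M X) + a (X \<omega>) * D2 (x, X \<omega>) (law M X) \<partial>M)"
    using iP iQ by (simp add: e1 P_def Q_def)
qed

text \<open>The generator with drift \<open>b\<close> and squared volatility \<open>2 a\<close>
  acting on a fixed test function. Once the coin is averaged out, the expansion is a statement about
  real functions at each sample point, and \<open>3 * K * C\<close> dominates the quotients.\<close>

lemma test_step_tendsto:
  fixes W W' W'' :: "real \<Rightarrow> real"
  assumes W: "\<And>x. (W has_real_derivative W' x) (at x)" "\<And>x. (W' has_real_derivative W'' x) (at x)"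
    and bd: "\<And>x. \<bar>W' x\<bar> \<le> C" "\<And>x. \<bar>W'' x\<bar> \<le> C" and cont: "continuous_on UNIV W''"
  shows "(\<lambda>n. ((\<integral>\<omega>. W (X \<omega> + euler_step b a s (h n) X \<omega>) \<partial>M) - (\<integral>\<omega>. W (X \<omega>) \<partial>M)) / h n)
    \<longlonglongrightarrow> (\<integral>\<omega>. b (X \<omega>) * W' (X \<omega>) + a (X \<omega>) * W'' (X \<omega>) \<partial>M)"
proof -
  have mu: "law M X \<in> P2" by (rule LFD(5)[OF X])
  have cW: "continuous_on UNIV W" "continuous_on UNIV W'"
    by (rule DERIV_continuous_on[OF has_field_derivative_at_within[OF W(1)]], rule DERIV_continuous_on[OF has_field_derivative_at_within[OF W(2)]])
  note [measurable] = b(1) a(1) LFD(2)[OF X] borel_measurable_continuous_onI[OF cW(1)] borel_measurable_continuous_onI[OF cW(2)] borel_measurable_continuous_onI[OF cont]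
  have K0: "0 \<le> K" using b(2)[of 0] by linarith
  have C0: "0 \<le> C" using bd(1)[of 0] by linarith
  have lip: "\<bar>W x - W y\<bar> \<le> C * \<bar>x - y\<bar>" for x y
  proof -
    obtain z where "W x - W y = W' z * (x - y)" using mvt_real[OF W(1), of y x] by blast
    then show ?thesis using bd(1)[of z] by (simp add: abs_mult mult_right_mono)
  qed
  have iW: "integrable M (\<lambda>\<omega>. W (Y \<omega>))" if "Y \<in> LF T" for Y
    using lipschitz_P2(2)[OF lip LFD(5)[OF that]] by (subst (asm) integrable_law_iff[OF LFD(2)[OF that]]) auto
  define p where "p n \<omega> = (W (X \<omega> + (h n * b (X \<omega>) + sqrt (2 * h n * a (X \<omega>)))) + W (X \<omega> + (h n * b (X \<omega>) - sqrt (2 * h n * a (X \<omega>))))) / 2" for n \<omega>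
  have i1: "integrable M (\<lambda>\<omega>. W (X \<omega> + (h n * b (X \<omega>) + c * sqrt (2 * h n * a (X \<omega>)))))" if "c \<in> {-1, 1}" for n and c :: real
  proof (rule iW, rule LF_add[OF state_LF_T])
    have "(\<lambda>\<omega>. (h n * b (X \<omega>) + c * sqrt (2 * h n * a (X \<omega>))) * 1) \<in> LF T"
    proof (rule LF_bounded_mult[OF T_in(1) LF_const[OF T_in(1)], where K="h n * K + sqrt (2 * h n * K)"])
      note [measurable] = LFD(1)[OF state_LF_T]
      show "(\<lambda>\<omega>. h n * b (X \<omega>) + c * sqrt (2 * h n * a (X \<omega>))) \<in> borel_measurable (\<F> T)" by measurable
      fix \<omega>
      have 1: "\<bar>h n * b (X \<omega>)\<bar> \<le> h n * K" unfolding abs_mult using h(1)[of n] b(2) by (intro mult_mono) auto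
      have 2: "\<bar>c * sqrt (2 * h n * a (X \<omega>))\<bar> \<le> sqrt (2 * h n * K)" using h(1)[of n] a(2,3) that by (auto simp: abs_mult)
      show "\<bar>h n * b (X \<omega>) + c * sqrt (2 * h n * a (X \<omega>))\<bar> \<le> h n * K + sqrt (2 * h n * K)"
        using abs_triangle_ineq[of "h n * b (X \<omega>)" "c * sqrt (2 * h n * a (X \<omega>))"] 1 2 by linarith
    qed
    then show "(\<lambda>\<omega>. h n * b (X \<omega>) + c * sqrt (2 * h n * a (X \<omega>))) \<in> LF T" by simp
  qed
  have ip: "integrable M (p n)" for n
    using i1[of 1 n] i1[of "-1" n] unfolding p_def by simp
  have eq: "((\<integral>\<omega>. W (X \<omega> + euler_step b a s (h n) X \<omega>) \<partial>M) - (\<integral>\<omega>. W (X \<omega>) \<partial>M)) / h n = (\<integral>\<omega>. (p n \<omega> - W (X \<omega>)) / h n \<partial>M)" for n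
  proof -
    have "(\<integral>\<omega>. W (X \<omega> + euler_step b a s (h n) X \<omega>) \<partial>M) = (\<integral>\<omega>. p n \<omega> \<partial>M)"
      unfolding p_def by (rule integral_euler_step[OF h(1,2), where g="\<lambda>x e. W (x + e)"]) (use i1 in auto)
    then show ?thesis using ip iW[OF state_LF_T] by simp
  qed
  \<comment> \<open>\<open>P\<close> and \<open>Q\<close> stay arbitrary: with both equal to 0 the
    uniform bound results, with the drift and diffusion terms the limit.\<close>
  have mvt: "\<exists>\<theta>. 0 < \<theta> \<and> \<theta> < 1 \<and> p n \<omega> - W (X \<omega>) - (P + Q) = two_point (h n) (b (X \<omega>)) (a (X \<omega>)) \<theta> W' (X \<omega>) - (P + 2 * \<theta> * Q)" for n \<omega> P Q
  proof -
    have "((\<lambda>\<theta>. (W (X \<omega> + \<theta> * (h n * b (X \<omega>) + sqrt (2 * h n * a (X \<omega>)))) + W (X \<omega> + \<theta> * (h n * b (X \<omega>) - sqrt (2 * h n * a (X \<omega>))))) / 2)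
      has_real_derivative two_point (h n) (b (X \<omega>)) (a (X \<omega>)) \<theta> W' (X \<omega>)) (at \<theta>)" for \<theta>
      unfolding two_point_def by (auto intro!: derivative_eq_intros DERIV_chain2[OF W(1)])
    from quadratic_mvt[OF this, of P Q] show ?thesis by (simp add: p_def)
  qed
  let ?l = "\<lambda>\<omega>. b (X \<omega>) * W' (X \<omega>) + a (X \<omega>) * W'' (X \<omega>)"
  have lim: "(\<lambda>n. (p n \<omega> - W (X \<omega>)) / h n) \<longlonglongrightarrow> ?l \<omega>" for \<omega>
  proof -
    define P where "P = b (X \<omega>) * W' (X \<omega>)"
    define Q where "Q = a (X \<omega>) * W'' (X \<omega>)"
    have "\<forall>n. \<exists>\<theta>. 0 < \<theta> \<and> \<theta> < 1 \<and> p n \<omega> - W (X \<omega>) - (h n * P + h n * Q) = two_point (h n) (b (X \<omega>)) (a (X \<omega>)) \<theta> W' (X \<omega>) - (h n * P + 2 * \<theta> * (h n * Q))"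
      using mvt by blast
    from choice[OF this] obtain \<theta> where \<theta>: "\<forall>n. 0 < \<theta> n \<and> \<theta> n < 1 \<and> p n \<omega> - W (X \<omega>) - (h n * P + h n * Q) = two_point (h n) (b (X \<omega>)) (a (X \<omega>)) (\<theta> n) W' (X \<omega>) - (h n * P + 2 * \<theta> n * (h n * Q))" ..
    then have \<theta>01: "\<theta> n \<in> {0..1}" for n by (simp add: less_imp_le)
    have "(p n \<omega> - W (X \<omega>)) / h n - (P + Q) = two_point (h n) (b (X \<omega>)) (a (X \<omega>)) (\<theta> n) W' (X \<omega>) / h n - (P + 2 * \<theta> n * Q)" for n
    proof -
      have "(p n \<omega> - W (X \<omega>)) / h n - (P + Q) = (p n \<omega> - W (X \<omega>) - (h n * P + h n * Q)) / h n" using h(1)[of n] by (simp add: field_simps)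
      also have "\<dots> = (two_point (h n) (b (X \<omega>)) (a (X \<omega>)) (\<theta> n) W' (X \<omega>) - (h n * P + 2 * \<theta> n * (h n * Q))) / h n" using \<theta> by simp
      also have "\<dots> = two_point (h n) (b (X \<omega>)) (a (X \<omega>)) (\<theta> n) W' (X \<omega>) / h n - (P + 2 * \<theta> n * Q)" using h(1)[of n] by (simp add: field_simps)
      finally show ?thesis .
    qed
    moreover have "(\<lambda>n. two_point (h n) (b (X \<omega>)) (a (X \<omega>)) (\<theta> n) W' (X \<omega>) / h n - (b (X \<omega>) * W' (X \<omega>) + 2 * \<theta> n * (a (X \<omega>) * W'' (X \<omega>)))) \<longlonglongrightarrow> 0"
      by (rule two_point_limit[OF W(2) h(1,3) a(2) \<theta>01]) 
         (use continuous_on_tendsto_compose[OF cW(2)] continuous_on_tendsto_compose[OF cont] in auto)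
    ultimately have "(\<lambda>n. (p n \<omega> - W (X \<omega>)) / h n - (P + Q)) \<longlonglongrightarrow> 0" by (simp only: P_def[symmetric] Q_def[symmetric])
    then show ?thesis by (simp add: LIM_zero_iff P_def Q_def)
  qed
  have bound: "\<bar>(p n \<omega> - W (X \<omega>)) / h n\<bar> \<le> 3 * K * C" for n \<omega>
  proof -
    from mvt[of n \<omega> 0 0] obtain \<theta> where "0 < \<theta>" "\<theta> < 1" "p n \<omega> - W (X \<omega>) = two_point (h n) (b (X \<omega>)) (a (X \<omega>)) \<theta> W' (X \<omega>)" by auto
    then show ?thesis using two_point_bound[OF W(2) h(1) a(2,3) _ bd b(2), of \<theta> n] by simp
  qed
  show ?thesis unfolding eq
  proof (rule integral_dominated_convergence[where w="\<lambda>_. 3 * K * C"])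
    show "(\<lambda>\<omega>. (p n \<omega> - W (X \<omega>)) / h n) \<in> borel_measurable M" for n unfolding p_def by measurable
  qed (use lim bound in auto)
qed

text \<open>Convergence of \<open>k n\<close> along all convergent sequences of arguments absorbs
  the displacement of the state; convergence at fixed points would not.\<close>

lemma integral_euler_tendsto:
  fixes k :: "nat \<Rightarrow> real \<Rightarrow> real"
  assumes k: "\<And>n. k n \<in> borel_measurable borel" "\<And>n x. \<bar>k n x\<bar> \<le> C"
    and lim: "\<And>y x. y \<longlonglongrightarrow> x \<Longrightarrow> (\<lambda>n. k n (y n)) \<longlonglongrightarrow> l x"
  shows "(\<lambda>n. \<integral>\<omega>. k n (X \<omega> + euler_step b a s (h n) X \<omega>) \<partial>M) \<longlonglongrightarrow> (\<integral>\<omega>. l (X \<omega>) \<partial>M)"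
proof (rule integral_dominated_convergence[where w="\<lambda>_. C"])
  note [measurable] = k(1) LFD(2)[OF X] LFD(2)[OF euler_step_LF_T]
  show "(\<lambda>\<omega>. k n (X \<omega> + euler_step b a s (h n) X \<omega>)) \<in> borel_measurable M" for n by measurable
  have "l \<in> borel_measurable borel"
    by (rule borel_measurable_LIMSEQ_real[OF lim[OF tendsto_const] k(1)])
  then show "(\<lambda>\<omega>. l (X \<omega>)) \<in> borel_measurable M" by measurable
  let ?r = "\<lambda>n. h n * K + sqrt (2 * h n * K)"
  have "?r \<longlonglongrightarrow> 0 * K + sqrt (2 * 0 * K)" by (intro tendsto_intros h)
  then have r: "?r \<longlonglongrightarrow> 0" by simp
  have "(\<lambda>n. X \<omega> + euler_step b a s (h n) X \<omega>) \<longlonglongrightarrow> X \<omega> + 0" for \<omega>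
    by (intro tendsto_add tendsto_const Lim_null_comparison[OF _ r] always_eventually allI)
       (simp only: real_norm_def euler_step_bound[OF h(1)])
  then show "AE \<omega> in M. (\<lambda>n. k n (X \<omega> + euler_step b a s (h n) X \<omega>)) \<longlonglongrightarrow> l (X \<omega>)" using lim by simp
qed (use k in auto)

end

end

end

section \<open>Square-integrable states evolving in time\<close>

context mfg_space
begin

text \<open>Increments of the convergent sequence \<open>z\<close> dominate squared distances, so
  the states are Cauchy. A subsequence converges almost surely by the criterion for absolute means,
  and Fatou's lemma upgrades this to mean square convergence of the whole sequence.\<close>

lemma LF_complete:
  assumes X: "\<And>n. X n \<in> LF t" and t: "t \<in> {0..T}"
    and cauchy: "\<And>m n. n \<le> m \<Longrightarrow> (\<integral>\<omega>. (X m \<omega> - X n \<omega>)\<^sup>2 \<partial>M) \<le> z m - z n" and z: "z \<longlonglongrightarrow> l"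
  obtains Y where "Y \<in> LF t" "(\<lambda>n. norm2 M (\<lambda>\<omega>. X n \<omega> - Y \<omega>)) \<longlonglongrightarrow> 0"
proof -
  have zm: "z n \<le> z m" if "n \<le> m" for n m
    using order_trans[OF integral_nonneg_AE cauchy[OF that]] by simp
  have zl: "z n \<le> l" for n by (rule LIMSEQ_le_const[OF z]) (use zm in blast)
  have D: "(\<lambda>\<omega>. X m \<omega> - X n \<omega>) \<in> LF t" for m n by (rule LF_diff[OF X X])
  have L1: "(\<integral>\<omega>. norm (X m \<omega> - X n \<omega>) \<partial>M) \<le> sqrt (l - z n)" if "n \<le> m" for m n
  proof -
    have "(\<integral>\<omega>. norm (X m \<omega> - X n \<omega>) \<partial>M) \<le> norm2 M (\<lambda>\<omega>. X m \<omega> - X n \<omega>)"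
      using integral_abs_le_norm2[OF LFD(2,3)[OF D]] by simp
    also have "\<dots> \<le> sqrt (l - z n)" unfolding norm2_def using cauchy[OF that] zl[of m] by simp
    finally show ?thesis .
  qed
  obtain r where r: "strict_mono r" "AE \<omega> in M. Cauchy (\<lambda>i. X (r i) \<omega>)"
  proof (rule cauchy_L1_AE_cauchy_subseq[of M X])
    show "integrable M (X n)" for n by (rule LFD(4)[OF X])
    fix e :: real assume e: "0 < e"
    have "(\<lambda>n. sqrt (l - z n)) \<longlonglongrightarrow> sqrt (l - l)" by (intro tendsto_intros z)
    then have "(\<lambda>n. sqrt (l - z n)) \<longlonglongrightarrow> 0" by simp
    from order_tendstoD(2)[OF this e] obtain N where N: "\<And>n. n \<ge> N \<Longrightarrow> sqrt (l - z n) < e"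
      by (auto simp: eventually_sequentially)
    have "(\<integral>\<omega>. norm (X i \<omega> - X j \<omega>) \<partial>M) < e" if "i \<ge> N" "j \<ge> N" for i j
    proof (cases "i \<le> j")
      case True
      with L1[OF True] N[OF that(1)] show ?thesis by (simp add: abs_minus_commute)
    next
      case False
      with L1[of j i] N[OF that(2)] show ?thesis by simp
    qed
    then show "\<exists>N. \<forall>i\<ge>N. \<forall>j\<ge>N. (\<integral>\<omega>. norm (X i \<omega> - X j \<omega>) \<partial>M) < e" by blast
  qed blast
  \<comment> \<open>The pointwise \<open>lim\<close>, whatever its value where the subsequence
    diverges, is measurable for the sigma-algebra of time \<open>t\<close>.\<close>
  define Y where "Y \<omega> = lim (\<lambda>i. X (r i) \<omega>)" for \<omega>
  have Ym: "Y \<in> borel_measurable (\<F> t)" unfolding Y_def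
    by (rule borel_measurable_lim_metric) (rule LFD(1)[OF X])
  have YM: "Y \<in> borel_measurable M" by (rule measurable_filt[OF t Ym])
  have lim: "AE \<omega> in M. (\<lambda>i. X (r i) \<omega>) \<longlonglongrightarrow> Y \<omega>"
    using r(2) by eventually_elim (simp add: Y_def real_Cauchy_convergent convergent_LIMSEQ_iff[symmetric])
  have fatou: "integrable M (\<lambda>\<omega>. (X n \<omega> - Y \<omega>)\<^sup>2)" "(\<integral>\<omega>. (X n \<omega> - Y \<omega>)\<^sup>2 \<partial>M) \<le> l - z n" for n
  proof -
    have m: "(\<lambda>\<omega>. ennreal ((X n \<omega> - X (r i) \<omega>)\<^sup>2)) \<in> borel_measurable M" for i
      by (rule measurable_compose[OF borel_measurable_power[OF LFD(2)[OF D]] measurable_ennreal])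
    have "(\<integral>\<^sup>+\<omega>. ennreal ((X n \<omega> - Y \<omega>)\<^sup>2) \<partial>M) = (\<integral>\<^sup>+\<omega>. liminf (\<lambda>i. ennreal ((X n \<omega> - X (r i) \<omega>)\<^sup>2)) \<partial>M)"
    proof (rule nn_integral_cong_AE)
      show "AE \<omega> in M. ennreal ((X n \<omega> - Y \<omega>)\<^sup>2) = liminf (\<lambda>i. ennreal ((X n \<omega> - X (r i) \<omega>)\<^sup>2))"
        using lim
      proof eventually_elim
        case (elim \<omega>)
        have "(\<lambda>i. ennreal ((X n \<omega> - X (r i) \<omega>)\<^sup>2)) \<longlonglongrightarrow> ennreal ((X n \<omega> - Y \<omega>)\<^sup>2)"
          by (intro tendsto_ennrealI tendsto_intros elim)
        then show ?case by (rule lim_imp_Liminf[OF sequentially_bot, symmetric])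
      qed
    qed
    also have "\<dots> \<le> liminf (\<lambda>i. \<integral>\<^sup>+\<omega>. ennreal ((X n \<omega> - X (r i) \<omega>)\<^sup>2) \<partial>M)"
      by (rule nn_integral_liminf[OF m])
    also have "\<dots> \<le> liminf (\<lambda>i. ennreal (l - z n))"
    proof (rule Liminf_mono, rule eventually_sequentiallyI)
      fix i assume i: "n \<le> i"
      then have ri: "n \<le> r i" using seq_suble[OF r(1), of i] by simp
      have "(\<integral>\<^sup>+\<omega>. ennreal ((X n \<omega> - X (r i) \<omega>)\<^sup>2) \<partial>M) = ennreal (\<integral>\<omega>. (X n \<omega> - X (r i) \<omega>)\<^sup>2 \<partial>M)"
        by (rule nn_integral_eq_integral[OF LFD(3)[OF D]]) simp
      also have "\<dots> \<le> ennreal (l - z n)"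
        using cauchy[OF ri] zl[of "r i"] by (intro ennreal_leI) (simp add: power2_commute)
      finally show "(\<integral>\<^sup>+\<omega>. ennreal ((X n \<omega> - X (r i) \<omega>)\<^sup>2) \<partial>M) \<le> ennreal (l - z n)" .
    qed
    also have "\<dots> = ennreal (l - z n)" by (simp add: Liminf_const)
    finally have le: "(\<integral>\<^sup>+\<omega>. ennreal ((X n \<omega> - Y \<omega>)\<^sup>2) \<partial>M) \<le> ennreal (l - z n)" .
    show i: "integrable M (\<lambda>\<omega>. (X n \<omega> - Y \<omega>)\<^sup>2)"
    proof (rule integrableI_nonneg)
      show "(\<lambda>\<omega>. (X n \<omega> - Y \<omega>)\<^sup>2) \<in> borel_measurable M"
        by (intro borel_measurable_power borel_measurable_diff LFD(2)[OF X] YM)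
      show "(\<integral>\<^sup>+\<omega>. ennreal ((X n \<omega> - Y \<omega>)\<^sup>2) \<partial>M) < \<infinity>" by (rule le_less_trans[OF le]) simp
    qed simp
    show "(\<integral>\<omega>. (X n \<omega> - Y \<omega>)\<^sup>2 \<partial>M) \<le> l - z n"
      using le zl[of n] unfolding nn_integral_eq_integral[OF i AE_I2[OF zero_le_power2]] by (simp add: ennreal_le_iff)
  qed
  have "(\<lambda>\<omega>. X 0 \<omega> - Y \<omega>) \<in> LF t" unfolding LF_iff[OF t]
    by (intro conjI borel_measurable_diff LFD(1)[OF X] Ym fatou(1))
  from LF_diff[OF X[of 0] this] have "Y \<in> LF t" by simp
  moreover have "(\<lambda>n. norm2 M (\<lambda>\<omega>. X n \<omega> - Y \<omega>)) \<longlonglongrightarrow> 0"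
  proof (rule Lim_null_comparison[where g="\<lambda>n. sqrt (l - z n)"])
    show "\<forall>\<^sub>F n in sequentially. norm (norm2 M (\<lambda>\<omega>. X n \<omega> - Y \<omega>)) \<le> sqrt (l - z n)"
      using fatou(2) by (simp add: norm2_def)
    have "(\<lambda>n. sqrt (l - z n)) \<longlonglongrightarrow> sqrt (l - l)" by (intro tendsto_intros z)
    then show "(\<lambda>n. sqrt (l - z n)) \<longlonglongrightarrow> 0" by simp
  qed
  ultimately show thesis by (rule that)
qed

lemma L2_limits:
  assumes X: "\<And>n. X n \<in> LF t" and Y: "Y \<in> LF t" and lim: "(\<lambda>n. norm2 M (\<lambda>\<omega>. X n \<omega> - Y \<omega>)) \<longlonglongrightarrow> 0" and Z: "Z \<in> LF t"
  shows "(\<lambda>n. \<integral>\<omega>. X n \<omega> * Z \<omega> \<partial>M) \<longlonglongrightarrow> (\<integral>\<omega>. Y \<omega> * Z \<omega> \<partial>M)"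
    and "(\<lambda>n. \<integral>\<omega>. (X n \<omega>)\<^sup>2 \<partial>M) \<longlonglongrightarrow> (\<integral>\<omega>. (Y \<omega>)\<^sup>2 \<partial>M)"
    and "(\<lambda>n. W2 (law M Y) (law M (X n))) \<longlonglongrightarrow> 0"
proof -
  have i: "integrable M (\<lambda>\<omega>. U \<omega> * W \<omega>)" if "U \<in> LF t" "W \<in> LF t" for U W
    by (rule integrable_mult_square_integrable[OF LFD(2)[OF that(1)] LFD(2)[OF that(2)] LFD(3)[OF that(1)] LFD(3)[OF that(2)]])
  have D: "(\<lambda>\<omega>. X n \<omega> - Y \<omega>) \<in> LF t" for n by (rule LF_diff[OF X Y])
  have *: "(\<lambda>n. \<integral>\<omega>. X n \<omega> * Z \<omega> \<partial>M) \<longlonglongrightarrow> (\<integral>\<omega>. Y \<omega> * Z \<omega> \<partial>M)" if Z: "Z \<in> LF t" for Z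
  proof (rule LIM_zero_cancel, rule Lim_null_comparison[OF _ tendsto_mult_left_zero[OF lim, of "norm2 M Z"]], intro always_eventually allI)
    fix n
    have "(\<integral>\<omega>. X n \<omega> * Z \<omega> \<partial>M) - (\<integral>\<omega>. Y \<omega> * Z \<omega> \<partial>M) = (\<integral>\<omega>. (X n \<omega> - Y \<omega>) * Z \<omega> \<partial>M)"
      using i[OF X Z] i[OF Y Z] by (simp add: left_diff_distrib)
    also have "\<bar>\<dots>\<bar> \<le> norm2 M (\<lambda>\<omega>. X n \<omega> - Y \<omega>) * norm2 M Z"
      by (rule integral_mult_le_norm2[OF LFD(2)[OF D] LFD(2)[OF Z] LFD(3)[OF D] LFD(3)[OF Z]])
    finally show "norm ((\<integral>\<omega>. X n \<omega> * Z \<omega> \<partial>M) - (\<integral>\<omega>. Y \<omega> * Z \<omega> \<partial>M)) \<le> norm2 M (\<lambda>\<omega>. X n \<omega> - Y \<omega>) * norm2 M Z" by simp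
  qed
  show "(\<lambda>n. \<integral>\<omega>. X n \<omega> * Z \<omega> \<partial>M) \<longlonglongrightarrow> (\<integral>\<omega>. Y \<omega> * Z \<omega> \<partial>M)" by (rule *[OF Z])
  have e: "(\<integral>\<omega>. (X n \<omega>)\<^sup>2 \<partial>M) = (norm2 M (\<lambda>\<omega>. X n \<omega> - Y \<omega>))\<^sup>2 + (2 * (\<integral>\<omega>. X n \<omega> * Y \<omega> \<partial>M) - (\<integral>\<omega>. (Y \<omega>)\<^sup>2 \<partial>M))" for n
  proof -
    have "(\<integral>\<omega>. (X n \<omega>)\<^sup>2 \<partial>M) = (\<integral>\<omega>. (X n \<omega> - Y \<omega>)\<^sup>2 + (2 * (X n \<omega> * Y \<omega>) - (Y \<omega>)\<^sup>2) \<partial>M)"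
      by (intro Bochner_Integration.integral_cong) (auto simp: power2_diff)
    then show ?thesis using LFD(3)[OF D] LFD(3)[OF Y] i[OF X Y] by (simp add: norm2_square)
  qed
  have "(\<lambda>n. (norm2 M (\<lambda>\<omega>. X n \<omega> - Y \<omega>))\<^sup>2 + (2 * (\<integral>\<omega>. X n \<omega> * Y \<omega> \<partial>M) - (\<integral>\<omega>. (Y \<omega>)\<^sup>2 \<partial>M)))
    \<longlonglongrightarrow> 0\<^sup>2 + (2 * (\<integral>\<omega>. Y \<omega> * Y \<omega> \<partial>M) - (\<integral>\<omega>. (Y \<omega>)\<^sup>2 \<partial>M))"
    by (intro tendsto_intros lim *[OF Y])
  then show "(\<lambda>n. \<integral>\<omega>. (X n \<omega>)\<^sup>2 \<partial>M) \<longlonglongrightarrow> (\<integral>\<omega>. (Y \<omega>)\<^sup>2 \<partial>M)"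
    unfolding e[symmetric] by (simp add: power2_eq_square)
  have "norm2 M (\<lambda>\<omega>. Y \<omega> - X n \<omega>) = norm2 M (\<lambda>\<omega>. X n \<omega> - Y \<omega>)" for n by (simp add: norm2_def power2_commute)
  then show "(\<lambda>n. W2 (law M Y) (law M (X n))) \<longlonglongrightarrow> 0"
    by (intro W2_law_tendsto[OF prob_space_axioms LFD(2)[OF Y] LFD(2)[OF X] LFD(3)[OF Y] LFD(3)[OF X]]) (simp add: lim)
qed

text \<open>The relation satisfied by the states of an Ito process with bounded coefficients at two
  times; unlike the process itself, it is closed under \<open>L\<^sup>2\<close> limits and needs no stochastic integral.\<close>

definition evolves :: "real \<Rightarrow> real \<Rightarrow> real \<Rightarrow> ('w \<Rightarrow> real) \<Rightarrow> real \<Rightarrow> ('w \<Rightarrow> real) \<Rightarrow> bool" where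
  "evolves K \<kappa> s X s' X' \<longleftrightarrow> 0 \<le> s \<and> s \<le> s' \<and> s' \<le> T \<and> X \<in> LF s \<and> X' \<in> LF s'
     \<and> (\<forall>Y\<in>LF s. \<bar>\<integral>\<omega>. (X' \<omega> - X \<omega>) * Y \<omega> \<partial>M\<bar> \<le> K * (s' - s) * norm2 M Y)
     \<and> 1 + (\<integral>\<omega>. (X' \<omega>)\<^sup>2 \<partial>M) \<le> exp (\<kappa> * (s' - s)) * (1 + (\<integral>\<omega>. (X \<omega>)\<^sup>2 \<partial>M))"

lemma evolves_refl: "0 \<le> s \<Longrightarrow> s \<le> T \<Longrightarrow> X \<in> LF s \<Longrightarrow> evolves K \<kappa> s X s X"
  by (simp add: evolves_def)

lemma LF_integrable_mult:
  assumes "U \<in> LF t" "W \<in> LF t"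
  shows "integrable M (\<lambda>\<omega>. U \<omega> * W \<omega>)"
  by (rule integrable_mult_square_integrable[OF LFD(2)[OF assms(1)] LFD(2)[OF assms(2)] LFD(3)[OF assms(1)] LFD(3)[OF assms(2)]])

text \<open>Test variables known at \<open>s\<close> are also known at \<open>s'\<close>, so the
  drift bounds add up, while the moment bounds multiply to a single exponential.\<close>

lemma evolves_trans:
  assumes 1: "evolves K \<kappa> s X s' X'" and 2: "evolves K \<kappa> s' X' s'' X''"
  shows "evolves K \<kappa> s X s'' X''"
proof -
  have s: "0 \<le> s" "s \<le> s'" "s' \<le> s''" "s'' \<le> T" and X: "X \<in> LF s" "X' \<in> LF s'" "X'' \<in> LF s''"
    using 1 2 by (auto simp: evolves_def)
  have X2: "X \<in> LF s''" "X' \<in> LF s''" using LF_mono[OF _ X(1), of s''] LF_mono[OF _ X(2), of s''] s by auto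
  have "\<bar>\<integral>\<omega>. (X'' \<omega> - X \<omega>) * Y \<omega> \<partial>M\<bar> \<le> K * (s'' - s) * norm2 M Y" if Y: "Y \<in> LF s" for Y
  proof -
    have Y': "Y \<in> LF s'" "Y \<in> LF s''" using LF_mono[OF _ Y] s by auto
    have "(\<integral>\<omega>. (X'' \<omega> - X \<omega>) * Y \<omega> \<partial>M) = (\<integral>\<omega>. (X'' \<omega> - X' \<omega>) * Y \<omega> + (X' \<omega> - X \<omega>) * Y \<omega> \<partial>M)"
      by (intro Bochner_Integration.integral_cong) (auto simp: algebra_simps)
    also have "\<dots> = (\<integral>\<omega>. (X'' \<omega> - X' \<omega>) * Y \<omega> \<partial>M) + (\<integral>\<omega>. (X' \<omega> - X \<omega>) * Y \<omega> \<partial>M)"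
      by (intro Bochner_Integration.integral_add LF_integrable_mult[OF LF_diff[OF X(3) X2(2)] Y'(2)] LF_integrable_mult[OF LF_diff[OF X2(2,1)] Y'(2)])
    also have "\<bar>\<dots>\<bar> \<le> K * (s'' - s') * norm2 M Y + K * (s' - s) * norm2 M Y"
      using 1 2 Y Y'(1) unfolding evolves_def by (intro order_trans[OF abs_triangle_ineq] add_mono) auto
    finally show ?thesis by (simp add: algebra_simps)
  qed
  moreover have "1 + (\<integral>\<omega>. (X'' \<omega>)\<^sup>2 \<partial>M) \<le> exp (\<kappa> * (s'' - s)) * (1 + (\<integral>\<omega>. (X \<omega>)\<^sup>2 \<partial>M))"
  proof -
    have "1 + (\<integral>\<omega>. (X'' \<omega>)\<^sup>2 \<partial>M) \<le> exp (\<kappa> * (s'' - s')) * (1 + (\<integral>\<omega>. (X' \<omega>)\<^sup>2 \<partial>M))" using 2 by (simp add: evolves_def)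
    also have "\<dots> \<le> exp (\<kappa> * (s'' - s')) * (exp (\<kappa> * (s' - s)) * (1 + (\<integral>\<omega>. (X \<omega>)\<^sup>2 \<partial>M)))"
      using 1 by (intro mult_left_mono) (simp_all add: evolves_def)
    also have "\<dots> = exp (\<kappa> * (s'' - s)) * (1 + (\<integral>\<omega>. (X \<omega>)\<^sup>2 \<partial>M))"
      by (simp add: exp_add[symmetric] algebra_simps)
    finally show ?thesis .
  qed
  ultimately show ?thesis using s X by (simp add: evolves_def)
qed

text \<open>Expanding the square, the mean of \<open>(X m - X n)\<^sup>2\<close> is the increase of
  the second moments minus twice the pairing of \<open>X m - X n\<close> with \<open>X n\<close>.
  The drift condition bounds the pairing and the moment condition makes the second moments converge;
  this is how the states are Cauchy although no path connects them.\<close>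

lemma evolves_chain:
  assumes ev: "\<And>n. evolves K \<kappa> (s n) (X n) (s (Suc n)) (X (Suc n))" and sl: "s \<longlonglongrightarrow> t" and K: "0 \<le> K"
  obtains Y where "\<And>n. evolves K \<kappa> (s n) (X n) t Y" "(\<lambda>n. norm2 M (\<lambda>\<omega>. X n \<omega> - Y \<omega>)) \<longlonglongrightarrow> 0"
proof -
  have ev2: "evolves K \<kappa> (s n) (X n) (s m) (X m)" if "n \<le> m" for n m
    using that
  proof (induction m rule: dec_induct)
    case base show ?case using ev[of n] by (intro evolves_refl) (auto simp: evolves_def)
  next
    case (step m) show ?case by (rule evolves_trans[OF step(3) ev])
  qed
  have sm: "s n \<le> s m" if "n \<le> m" for n m using ev2[OF that] by (simp add: evolves_def)
  have sn: "0 \<le> s n" "s n \<le> T" "X n \<in> LF (s n)" for n using ev[of n] by (auto simp: evolves_def)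
  have st: "s n \<le> t" for n by (rule LIMSEQ_le_const[OF sl]) (use sm in blast)
  have t: "t \<in> {0..T}" using LIMSEQ_le_const2[OF sl, of T] sn(2) order_trans[OF sn(1) st[of 0]] by auto
  have X: "X n \<in> LF t" for n by (rule LF_mono[OF st sn(3)])
  define q where "q n = 1 + (\<integral>\<omega>. (X n \<omega>)\<^sup>2 \<partial>M)" for n
  have q1: "1 \<le> q n" for n by (simp add: q_def)
  \<comment> \<open>Discounting by the exponential rate makes the moments decrease, and they are
    nonnegative.\<close>
  have "decseq (\<lambda>n. exp (- \<kappa> * s n) * q n)"
  proof (rule decseq_SucI)
    fix n
    have "q (Suc n) \<le> exp (\<kappa> * (s (Suc n) - s n)) * q n" using ev[of n] by (simp add: evolves_def q_def)
    then have "exp (- \<kappa> * s (Suc n)) * q (Suc n) \<le> exp (- \<kappa> * s (Suc n)) * (exp (\<kappa> * (s (Suc n) - s n)) * q n)" by simp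
    also have "\<dots> = exp (- \<kappa> * s n) * q n" by (simp add: mult.assoc[symmetric] exp_add[symmetric] algebra_simps)
    finally show "exp (- \<kappa> * s (Suc n)) * q (Suc n) \<le> exp (- \<kappa> * s n) * q n" .
  qed
  moreover have "0 \<le> exp (- \<kappa> * s n) * q n" for n using q1[of n] by simp
  ultimately obtain L where L: "(\<lambda>n. exp (- \<kappa> * s n) * q n) \<longlonglongrightarrow> L" using decseq_convergent[of _ 0] by metis
  have "(\<lambda>n. exp (\<kappa> * s n) * (exp (- \<kappa> * s n) * q n)) \<longlonglongrightarrow> exp (\<kappa> * t) * L" by (intro tendsto_intros L sl)
  then have ql: "q \<longlonglongrightarrow> exp (\<kappa> * t) * L" by (simp add: mult.assoc[symmetric] exp_add[symmetric])
  then obtain Bq where Bq: "\<And>n. \<bar>q n\<bar> \<le> Bq" using convergent_imp_Bseq[OF convergentI[OF ql]] by (auto simp: Bseq_def)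
  define b where "b = sqrt Bq"
  have nb: "norm2 M (X n) \<le> b" for n
    unfolding norm2_def b_def using Bq[of n] by (intro real_sqrt_le_mono) (simp add: q_def)
  \<comment> \<open>The drift budget \<open>2 * K * b * s n\<close> is added to the moments, so that
    increments of \<open>z\<close> bound the squared distances.\<close>
  define z where "z n = q n + 2 * K * b * s n" for n
  have zl: "z \<longlonglongrightarrow> exp (\<kappa> * t) * L + 2 * K * b * t" unfolding z_def by (intro tendsto_intros ql sl)
  have cauchy: "(\<integral>\<omega>. (X m \<omega> - X n \<omega>)\<^sup>2 \<partial>M) \<le> z m - z n" if nm: "n \<le> m" for m n
  proof -
    have "(\<integral>\<omega>. (X m \<omega> - X n \<omega>)\<^sup>2 \<partial>M) = (\<integral>\<omega>. (X m \<omega>)\<^sup>2 - (X n \<omega>)\<^sup>2 - 2 * ((X m \<omega> - X n \<omega>) * X n \<omega>) \<partial>M)"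
      by (intro Bochner_Integration.integral_cong) (auto simp: power2_eq_square algebra_simps)
    also have "\<dots> = q m - q n - 2 * (\<integral>\<omega>. (X m \<omega> - X n \<omega>) * X n \<omega> \<partial>M)"
      using LFD(3)[OF X] LF_integrable_mult[OF LF_diff[OF X X] X] by (simp add: q_def)
    also have "\<bar>\<integral>\<omega>. (X m \<omega> - X n \<omega>) * X n \<omega> \<partial>M\<bar> \<le> K * (s m - s n) * norm2 M (X n)"
      using ev2[OF nm] sn(3)[of n] by (simp add: evolves_def)
    then have "q m - q n - 2 * (\<integral>\<omega>. (X m \<omega> - X n \<omega>) * X n \<omega> \<partial>M) \<le> q m - q n + 2 * (K * (s m - s n) * norm2 M (X n))" by linarith
    also have "\<dots> \<le> q m - q n + 2 * (K * (s m - s n) * b)"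
      using K sm[OF nm] nb[of n] by (intro add_left_mono mult_left_mono) auto
    finally show ?thesis by (simp add: z_def algebra_simps)
  qed
  obtain Y where Y: "Y \<in> LF t" "(\<lambda>n. norm2 M (\<lambda>\<omega>. X n \<omega> - Y \<omega>)) \<longlonglongrightarrow> 0"
    by (rule LF_complete[OF X t cauchy zl])
  have "evolves K \<kappa> (s n) (X n) t Y" for n
    unfolding evolves_def
  proof (intro conjI ballI)
    show "0 \<le> s n" "s n \<le> t" "t \<le> T" "X n \<in> LF (s n)" "Y \<in> LF t" using sn st t Y by auto
    fix Z assume Z: "Z \<in> LF (s n)"
    have Zt: "Z \<in> LF t" by (rule LF_mono[OF st Z])
    have "(\<lambda>m. \<bar>(\<integral>\<omega>. X m \<omega> * Z \<omega> \<partial>M) - (\<integral>\<omega>. X n \<omega> * Z \<omega> \<partial>M)\<bar>) \<longlonglongrightarrow> \<bar>(\<integral>\<omega>. Y \<omega> * Z \<omega> \<partial>M) - (\<integral>\<omega>. X n \<omega> * Z \<omega> \<partial>M)\<bar>"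
      by (intro tendsto_intros L2_limits(1)[OF X Y Zt])
    moreover have "(\<lambda>m. K * (s m - s n) * norm2 M Z) \<longlonglongrightarrow> K * (t - s n) * norm2 M Z" by (intro tendsto_intros sl)
    moreover have "\<bar>(\<integral>\<omega>. X m \<omega> * Z \<omega> \<partial>M) - (\<integral>\<omega>. X n \<omega> * Z \<omega> \<partial>M)\<bar> \<le> K * (s m - s n) * norm2 M Z" if "n \<le> m" for m
    proof -
      have "(\<integral>\<omega>. (X m \<omega> - X n \<omega>) * Z \<omega> \<partial>M) = (\<integral>\<omega>. X m \<omega> * Z \<omega> \<partial>M) - (\<integral>\<omega>. X n \<omega> * Z \<omega> \<partial>M)"
        using LF_integrable_mult[OF X Zt] by (simp add: left_diff_distrib)
      moreover have "\<bar>\<integral>\<omega>. (X m \<omega> - X n \<omega>) * Z \<omega> \<partial>M\<bar> \<le> K * (s m - s n) * norm2 M Z"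
        using ev2[OF that] Z by (simp add: evolves_def)
      ultimately show ?thesis by simp
    qed
    ultimately have "\<bar>(\<integral>\<omega>. Y \<omega> * Z \<omega> \<partial>M) - (\<integral>\<omega>. X n \<omega> * Z \<omega> \<partial>M)\<bar> \<le> K * (t - s n) * norm2 M Z"
      by - (rule LIMSEQ_le, assumption, assumption, blast)
    then show "\<bar>\<integral>\<omega>. (Y \<omega> - X n \<omega>) * Z \<omega> \<partial>M\<bar> \<le> K * (t - s n) * norm2 M Z"
      using LF_integrable_mult[OF X Zt] LF_integrable_mult[OF Y(1) Zt] by (simp add: left_diff_distrib)
  next
    have "(\<lambda>m. 1 + (\<integral>\<omega>. (X m \<omega>)\<^sup>2 \<partial>M)) \<longlonglongrightarrow> 1 + (\<integral>\<omega>. (Y \<omega>)\<^sup>2 \<partial>M)"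
      by (intro tendsto_intros L2_limits(2)[OF X Y Y(1)])
    moreover have "(\<lambda>m. exp (\<kappa> * (s m - s n)) * (1 + (\<integral>\<omega>. (X n \<omega>)\<^sup>2 \<partial>M))) \<longlonglongrightarrow> exp (\<kappa> * (t - s n)) * (1 + (\<integral>\<omega>. (X n \<omega>)\<^sup>2 \<partial>M))"
      by (intro tendsto_intros sl)
    moreover have "1 + (\<integral>\<omega>. (X m \<omega>)\<^sup>2 \<partial>M) \<le> exp (\<kappa> * (s m - s n)) * (1 + (\<integral>\<omega>. (X n \<omega>)\<^sup>2 \<partial>M))" if "n \<le> m" for m
      using ev2[OF that] by (simp add: evolves_def)
    ultimately show "1 + (\<integral>\<omega>. (Y \<omega>)\<^sup>2 \<partial>M) \<le> exp (\<kappa> * (t - s n)) * (1 + (\<integral>\<omega>. (X n \<omega>)\<^sup>2 \<partial>M))"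
      by - (rule LIMSEQ_le, assumption, assumption, blast)
  qed
  then show thesis using Y(2) by (rule that)
qed

text \<open>In the rate, \<open>3 * K\<close> collects \<open>K\<close> from the cross term
  \<open>2 * x * \<beta> \<le> K * (1 + x\<^sup>2)\<close> and \<open>2 * K\<close> from the squared
  volatility; \<open>T * K\<^sup>2\<close> bounds \<open>h * \<beta>\<^sup>2\<close>, as
  \<open>h\<close> is at most \<open>T\<close>. In pairings with variables known at \<open>s\<close>
  the sign averages out and leaves the drift alone.\<close>

lemma evolves_euler_step:
  assumes b: "b \<in> borel_measurable borel" "\<And>x. \<bar>b x\<bar> \<le> K"
    and a: "a \<in> borel_measurable borel" "\<And>x. 0 \<le> a x" "\<And>x. a x \<le> K"
    and s: "0 \<le> s" and X: "X \<in> LF s" and h: "0 < h" "s + h \<le> T"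
  shows "evolves K (3 * K + T * K\<^sup>2) s X (s + h) (\<lambda>\<omega>. X \<omega> + euler_step b a s h X \<omega>)"
proof -
  let ?e = "euler_step b a s h X"
  note E = euler_step_LF[OF b a s X h]
  have sT: "s \<in> {0..T}" using s h by auto
  have K: "0 \<le> K" using b(2)[of 0] by linarith
  have Xh: "X \<in> LF (s + h)" using LF_mono[OF _ X, of "s + h"] h by simp
  let ?r = "\<lambda>\<omega>. sqrt (2 * h * a (X \<omega>))"
  have bm: "(\<lambda>\<omega>. b (X \<omega>)) \<in> borel_measurable (\<F> s)" by (rule measurable_compose[OF LFD(1)[OF X] b(1)])
  have "(\<lambda>x. sqrt (2 * h * a x)) \<in> borel_measurable borel" using a(1) by simp
  from measurable_compose[OF LFD(1)[OF X] this] have rm: "?r \<in> borel_measurable (\<F> s)" .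
  have rb: "\<bar>?r \<omega>\<bar> \<le> sqrt (2 * h * K)" for \<omega> using h a by auto
  have bL: "(\<lambda>\<omega>. h * b (X \<omega>)) \<in> LF s" 
    using LF_scale[OF LF_bounded_mult[OF sT LF_const[OF sT, of 1] bm b(2)], of h] by simp
  have rL: "?r \<in> LF s" using LF_bounded_mult[OF sT LF_const[OF sT, of 1] rm rb] by simp
  have "\<bar>\<integral>\<omega>. (X \<omega> + ?e \<omega> - X \<omega>) * Y \<omega> \<partial>M\<bar> \<le> K * (s + h - s) * norm2 M Y" if Y: "Y \<in> LF s" for Y
  proof -
    have P: "(\<lambda>\<omega>. h * b (X \<omega>) + ?r \<omega>) \<in> LF s" and Q: "(\<lambda>\<omega>. h * b (X \<omega>) - ?r \<omega>) \<in> LF s" 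
      by (rule LF_add[OF bL rL], rule LF_diff[OF bL rL])
    have e: "?e \<omega> * Y \<omega> = (if \<omega> \<in> up s (s + h) then (h * b (X \<omega>) + ?r \<omega>) * Y \<omega> else (h * b (X \<omega>) - ?r \<omega>) * Y \<omega>)" for \<omega>
      by (simp add: euler_step_def)
    have "(\<integral>\<omega>. ?e \<omega> * Y \<omega> \<partial>M) = (\<integral>\<omega>. ((h * b (X \<omega>) + ?r \<omega>) * Y \<omega> + (h * b (X \<omega>) - ?r \<omega>) * Y \<omega>) / 2 \<partial>M)"
      unfolding e
      using integral_coin[OF s _ h(2) borel_measurable_times[OF LFD(1)[OF P] LFD(1)[OF Y]] LF_integrable_mult[OF P Y]
        borel_measurable_times[OF LFD(1)[OF Q] LFD(1)[OF Y]] LF_integrable_mult[OF Q Y]] h(1) by simp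
    also have "\<dots> = (\<integral>\<omega>. h * b (X \<omega>) * Y \<omega> \<partial>M)"
      by (intro Bochner_Integration.integral_cong) (auto simp: field_simps)
    also have "\<bar>\<dots>\<bar> \<le> (\<integral>\<omega>. h * K * \<bar>Y \<omega>\<bar> \<partial>M)"
    proof (rule order_trans[OF integral_abs_bound], rule integral_mono')
      show "integrable M (\<lambda>\<omega>. h * K * \<bar>Y \<omega>\<bar>)" using LFD(4)[OF Y] by simp
      show "\<bar>h * b (X \<omega>) * Y \<omega>\<bar> \<le> h * K * \<bar>Y \<omega>\<bar>" for \<omega>
        unfolding abs_mult using h b(2)[of "X \<omega>"] by (intro mult_right_mono mult_mono) auto
    qed (use h K in auto)
    also have "\<dots> \<le> h * K * norm2 M Y"
      using integral_abs_le_norm2[OF LFD(2,3)[OF Y]] h K by (simp add: mult_left_mono)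
    finally show ?thesis by (simp add: mult.commute)
  qed
  moreover have "1 + (\<integral>\<omega>. (X \<omega> + ?e \<omega>)\<^sup>2 \<partial>M) \<le> exp ((3 * K + T * K\<^sup>2) * (s + h - s)) * (1 + (\<integral>\<omega>. (X \<omega>)\<^sup>2 \<partial>M))"
  proof -
    have P: "(\<lambda>\<omega>. X \<omega> + (h * b (X \<omega>) + ?r \<omega>)) \<in> LF s" and Q: "(\<lambda>\<omega>. X \<omega> + (h * b (X \<omega>) - ?r \<omega>)) \<in> LF s" 
      by (rule LF_add[OF X LF_add[OF bL rL]], rule LF_add[OF X LF_diff[OF bL rL]])
    have e: "(X \<omega> + ?e \<omega>)\<^sup>2 = (if \<omega> \<in> up s (s + h) then (X \<omega> + (h * b (X \<omega>) + ?r \<omega>))\<^sup>2 else (X \<omega> + (h * b (X \<omega>) - ?r \<omega>))\<^sup>2)" for \<omega>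
      by (simp add: euler_step_def)
    have "(\<integral>\<omega>. (X \<omega> + ?e \<omega>)\<^sup>2 \<partial>M) = (\<integral>\<omega>. ((X \<omega> + (h * b (X \<omega>) + ?r \<omega>))\<^sup>2 + (X \<omega> + (h * b (X \<omega>) - ?r \<omega>))\<^sup>2) / 2 \<partial>M)"
      unfolding e
      using integral_coin[OF s _ h(2) borel_measurable_power[OF LFD(1)[OF P]] LFD(3)[OF P]
        borel_measurable_power[OF LFD(1)[OF Q]] LFD(3)[OF Q]] h(1) by simp
    also have "\<dots> \<le> (\<integral>\<omega>. (X \<omega>)\<^sup>2 + h * (3 * K + T * K\<^sup>2) + h * K * (X \<omega>)\<^sup>2 \<partial>M)"
    proof (rule integral_mono)
      show "integrable M (\<lambda>\<omega>. ((X \<omega> + (h * b (X \<omega>) + ?r \<omega>))\<^sup>2 + (X \<omega> + (h * b (X \<omega>) - ?r \<omega>))\<^sup>2) / 2)"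
        using LFD(3)[OF P] LFD(3)[OF Q] by simp
      show "integrable M (\<lambda>\<omega>. (X \<omega>)\<^sup>2 + h * (3 * K + T * K\<^sup>2) + h * K * (X \<omega>)\<^sup>2)" using LFD(3)[OF X] by simp
      fix \<omega>
      define x \<beta> r where "x = X \<omega>" "\<beta> = b (X \<omega>)" "r = ?r \<omega>"
      have r2: "r\<^sup>2 = 2 * h * a (X \<omega>)" using h a by (simp add: x_\<beta>_r_def)
      have "((x + (h * \<beta> + r))\<^sup>2 + (x + (h * \<beta> - r))\<^sup>2) / 2 = x\<^sup>2 + h * (2 * x * \<beta>) + h * (h * \<beta>\<^sup>2) + r\<^sup>2"
        by (simp add: power2_eq_square field_simps)
      moreover have "2 * x * \<beta> \<le> K * (1 + x\<^sup>2)"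
      proof -
        have "2 * x * \<beta> \<le> \<bar>2 * x\<bar> * \<bar>\<beta>\<bar>" by (simp add: abs_mult[symmetric])
        also have "\<dots> \<le> (1 + x\<^sup>2) * K"
        proof (intro mult_mono)
          show "\<bar>2 * x\<bar> \<le> 1 + x\<^sup>2" using sum_squares_bound[of "\<bar>x\<bar>" 1] by (simp add: abs_mult)
        qed (use b in \<open>auto simp: x_\<beta>_r_def\<close>)
        finally show ?thesis by (simp add: mult.commute)
      qed
      moreover have "h * \<beta>\<^sup>2 \<le> T * K\<^sup>2"
      proof (intro mult_mono)
        show "\<beta>\<^sup>2 \<le> K\<^sup>2" using power_mono[OF b(2) abs_ge_zero, of "X \<omega>" 2] by (simp add: x_\<beta>_r_def)
      qed (use h s T in auto)
      moreover have "r\<^sup>2 \<le> h * (2 * K)" unfolding r2 using h a by simp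
      moreover have "h * (2 * x * \<beta>) \<le> h * (K * (1 + x\<^sup>2))" "h * (h * \<beta>\<^sup>2) \<le> h * (T * K\<^sup>2)"
        using h calculation(2,3) by (auto intro: mult_left_mono)
      ultimately have "((x + (h * \<beta> + r))\<^sup>2 + (x + (h * \<beta> - r))\<^sup>2) / 2 \<le> x\<^sup>2 + h * (K * (1 + x\<^sup>2)) + h * (T * K\<^sup>2) + h * (2 * K)" by linarith
      also have "\<dots> = x\<^sup>2 + h * (3 * K + T * K\<^sup>2) + h * K * x\<^sup>2" by (simp add: algebra_simps)
      finally show "((X \<omega> + (h * b (X \<omega>) + ?r \<omega>))\<^sup>2 + (X \<omega> + (h * b (X \<omega>) - ?r \<omega>))\<^sup>2) / 2 \<le> (X \<omega>)\<^sup>2 + h * (3 * K + T * K\<^sup>2) + h * K * (X \<omega>)\<^sup>2"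
        by (simp add: x_\<beta>_r_def)
    qed
    also have "\<dots> = (\<integral>\<omega>. (X \<omega>)\<^sup>2 \<partial>M) + h * (3 * K + T * K\<^sup>2) + h * K * (\<integral>\<omega>. (X \<omega>)\<^sup>2 \<partial>M)"
      using LFD(3)[OF X] by (simp add: prob_space)
    finally have "1 + (\<integral>\<omega>. (X \<omega> + ?e \<omega>)\<^sup>2 \<partial>M) \<le> 1 + (\<integral>\<omega>. (X \<omega>)\<^sup>2 \<partial>M) + h * (3 * K + T * K\<^sup>2) + h * K * (\<integral>\<omega>. (X \<omega>)\<^sup>2 \<partial>M)" by simp
    also have "\<dots> \<le> (1 + (3 * K + T * K\<^sup>2) * h) * (1 + (\<integral>\<omega>. (X \<omega>)\<^sup>2 \<partial>M))"
    proof -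
      have "h * K * (\<integral>\<omega>. (X \<omega>)\<^sup>2 \<partial>M) \<le> h * (3 * K + T * K\<^sup>2) * (\<integral>\<omega>. (X \<omega>)\<^sup>2 \<partial>M)"
        using h K T by (intro mult_right_mono mult_left_mono) auto
      then show ?thesis by (simp add: algebra_simps)
    qed
    also have "\<dots> \<le> exp ((3 * K + T * K\<^sup>2) * h) * (1 + (\<integral>\<omega>. (X \<omega>)\<^sup>2 \<partial>M))"
      by (intro mult_right_mono exp_ge_add_one_self) simp
    finally show ?thesis by simp
  qed
  ultimately show ?thesis using s h X LF_add[OF Xh E] by (simp add: evolves_def)
qed

end

section \<open>Decay of the gap along the flow of the master equation\<close>

text \<open>The hypotheses in the form in which the decay argument meets them: the Hamiltonian
  enters through a supergradient inequality with slopes \<open>Hz\<close> and \<open>Hg\<close>,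
  these slopes are bounded where \<open>V'\<close> and \<open>V''\<close> take their values, and
  monotonicity of the running and terminal data is expressed by the gap.\<close>

locale master_flow = mfg_space M \<G>0 B T
  for M :: "'w measure" and \<G>0 :: "'w measure" and B :: "real \<Rightarrow> 'w \<Rightarrow> real" and T :: real +
  fixes V V' V'' Vt :: "real \<Rightarrow> real \<Rightarrow> real measure \<Rightarrow> real"
    and D D1 D2 :: "real \<Rightarrow> real \<times> real \<Rightarrow> real measure \<Rightarrow> real"
    and H Hz Hg :: "real \<Rightarrow> real \<Rightarrow> real \<Rightarrow> real" and F0 :: "real \<Rightarrow> real measure \<Rightarrow> real" and C K L :: real
  assumes reg: "\<And>t. t \<in> {0..T} \<Longrightarrow> regular (V t) (D t) (D1 t) (D2 t) C"
    and cont_V: "cont_P2 ({0..T} \<times> UNIV) (\<lambda>(t, x). V t x)"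
    and Vx: "\<And>t \<mu> x. t \<in> {0..T} \<Longrightarrow> \<mu> \<in> P2 \<Longrightarrow> ((\<lambda>x. V t x \<mu>) has_real_derivative V' t x \<mu>) (at x)"
    and Vxx: "\<And>t \<mu> x. t \<in> {0..T} \<Longrightarrow> \<mu> \<in> P2 \<Longrightarrow> ((\<lambda>x. V' t x \<mu>) has_real_derivative V'' t x \<mu>) (at x)"
    and Vb: "\<And>t \<mu> x. t \<in> {0..T} \<Longrightarrow> \<mu> \<in> P2 \<Longrightarrow> \<bar>V' t x \<mu>\<bar> \<le> C \<and> \<bar>V'' t x \<mu>\<bar> \<le> C \<and> \<bar>Vt t x \<mu>\<bar> \<le> C"
    and Vc: "\<And>t \<mu>. t \<in> {0..T} \<Longrightarrow> \<mu> \<in> P2 \<Longrightarrow> continuous_on UNIV (\<lambda>x. V'' t x \<mu>)"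
    and Vt: "\<And>t \<mu> x. t \<in> {0..T} \<Longrightarrow> \<mu> \<in> P2 \<Longrightarrow> ((\<lambda>t. V t x \<mu>) has_real_derivative Vt t x \<mu>) (at t within {0..T})"
    and cont_Vt: "cont_P2 ({0..T} \<times> UNIV) (\<lambda>(t, x). Vt t x)"
    and H_concave: "\<And>x z1 g1 z2 g2. H x z2 g2 \<le> H x z1 g1 + Hz x z1 g1 * (z2 - z1) + Hg x z1 g1 * (g2 - g1)"
    and H_cont: "continuous_on UNIV (\<lambda>(x, z, g). Hz x z g)" "continuous_on UNIV (\<lambda>(x, z, g). Hg x z g)"
    and H_bound: "\<And>x z g. \<bar>z\<bar> \<le> C \<Longrightarrow> \<bar>g\<bar> \<le> C \<Longrightarrow> \<bar>Hz x z g\<bar> \<le> K \<and> 0 \<le> Hg x z g \<and> Hg x z g \<le> K"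
    and master: "\<And>t x \<mu>. t \<in> {0..T} \<Longrightarrow> \<mu> \<in> P2 \<Longrightarrow> Vt t x \<mu> + H x (V' t x \<mu>) (V'' t x \<mu>) + F0 x \<mu>
        + (\<integral>x'. D t (x, x') \<mu> * Hz x' (V' t x' \<mu>) (V'' t x' \<mu>) + D2 t (x, x') \<mu> * Hg x' (V' t x' \<mu>) (V'' t x' \<mu>) \<partial>\<mu>) = 0"
    and F0_lip: "\<And>m x y. m \<in> P2 \<Longrightarrow> \<bar>F0 x m - F0 y m\<bar> \<le> L * \<bar>x - y\<bar>"
    and F0_mono: "\<And>\<mu> \<nu>. \<mu> \<in> P2 \<Longrightarrow> \<nu> \<in> P2 \<Longrightarrow> 0 \<le> mono_gap F0 \<mu> \<nu>"
    and terminal: "\<And>\<mu> \<nu>. \<mu> \<in> P2 \<Longrightarrow> \<nu> \<in> P2 \<Longrightarrow> 0 \<le> mono_gap (V T) \<mu> \<nu>"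
begin

definition drift :: "real \<Rightarrow> real measure \<Rightarrow> real \<Rightarrow> real" where
  "drift t \<mu> x = Hz x (V' t x \<mu>) (V'' t x \<mu>)"

text \<open>Half of the squared volatility, in accordance with the role of \<open>\<alpha>\<close>
  in the two-point increments.\<close>

definition diffusion :: "real \<Rightarrow> real measure \<Rightarrow> real \<Rightarrow> real" where
  "diffusion t \<mu> x = Hg x (V' t x \<mu>) (V'' t x \<mu>)"

lemma V'_continuous: "t \<in> {0..T} \<Longrightarrow> \<mu> \<in> P2 \<Longrightarrow> continuous_on UNIV (\<lambda>x. V' t x \<mu>)"
  by (rule DERIV_continuous_on[OF has_field_derivative_at_within[OF Vxx]])

lemma V_lipschitz: "t \<in> {0..T} \<Longrightarrow> \<mu> \<in> P2 \<Longrightarrow> \<bar>V t x \<mu> - V t y \<mu>\<bar> \<le> C * \<bar>x - y\<bar>"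
proof -
  assume a: "t \<in> {0..T}" "\<mu> \<in> P2"
  obtain z where "V t x \<mu> - V t y \<mu> = V' t z \<mu> * (x - y)" using mvt_real[OF Vx[OF a], of y x] by blast
  then show ?thesis using Vb[OF a, of z] by (simp add: abs_mult mult_right_mono)
qed

lemma coefficients:
  assumes "t \<in> {0..T}" "\<mu> \<in> P2"
  shows "drift t \<mu> \<in> borel_measurable borel" "\<And>x. \<bar>drift t \<mu> x\<bar> \<le> K"
    "diffusion t \<mu> \<in> borel_measurable borel" "\<And>x. 0 \<le> diffusion t \<mu> x" "\<And>x. diffusion t \<mu> x \<le> K"
proof -
  have c: "continuous_on UNIV (\<lambda>x. (x, V' t x \<mu>, V'' t x \<mu>))"
    by (intro continuous_intros V'_continuous[OF assms] Vc[OF assms])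
  have "continuous_on UNIV (drift t \<mu>)" "continuous_on UNIV (diffusion t \<mu>)"
    using continuous_on_compose2[OF H_cont(1) c] continuous_on_compose2[OF H_cont(2) c] by (simp_all add: drift_def[abs_def] diffusion_def[abs_def])
  then show "drift t \<mu> \<in> borel_measurable borel" "diffusion t \<mu> \<in> borel_measurable borel"
    by (auto intro: borel_measurable_continuous_onI)
  show "\<bar>drift t \<mu> x\<bar> \<le> K" "0 \<le> diffusion t \<mu> x" "diffusion t \<mu> x \<le> K" for x
    using H_bound[of "V' t x \<mu>" "V'' t x \<mu>" x] Vb[OF assms, of x] unfolding drift_def diffusion_def by auto
qed

lemma gap_tendsto:
  assumes s: "\<And>n. s n \<in> {0..T}" "s \<longlonglongrightarrow> t" "t \<in> {0..T}"
    and mu: "\<mu> \<in> P2" "\<And>n. \<mu>n n \<in> P2" "(\<lambda>n. W2 \<mu> (\<mu>n n)) \<longlonglongrightarrow> 0"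
    and nu: "\<nu> \<in> P2" "\<And>n. \<nu>n n \<in> P2" "(\<lambda>n. W2 \<nu> (\<nu>n n)) \<longlonglongrightarrow> 0"
  shows "(\<lambda>n::nat. mono_gap (V (s n)) (\<mu>n n) (\<nu>n n)) \<longlonglongrightarrow> mono_gap (V t) \<mu> \<nu>"
proof (rule mono_gap_tendsto[OF mu nu V_lipschitz[OF s(1)]])
  fix x :: real
  have l: "(\<lambda>n. (s n, x)) \<longlonglongrightarrow> (t, x)" by (intro tendsto_Pair s tendsto_const)
  show "(\<lambda>n. V (s n) x (\<mu>n n)) \<longlonglongrightarrow> V t x \<mu>"
    using cont_P2_tendsto[OF cont_V _ _ l mu] s by simp
  show "(\<lambda>n. V (s n) x (\<nu>n n)) \<longlonglongrightarrow> V t x \<nu>"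
    using cont_P2_tendsto[OF cont_V _ _ l nu] s by simp
qed

section \<open>One step of the flow from a given time, and the derivative of the gap\<close>

context
  fixes s :: real and h :: "nat \<Rightarrow> real"
  assumes s: "0 \<le> s" and h: "\<And>n. 0 < h n" "\<And>n. s + h n \<le> T" "h \<longlonglongrightarrow> 0"
begin

lemma times_in_range: "s \<in> {0..T}" "s + h n \<in> {0..T}"
  using s h(1)[of n] h(2)[of n] by auto

definition next_state :: "('w \<Rightarrow> real) \<Rightarrow> nat \<Rightarrow> 'w \<Rightarrow> real" where
  "next_state X n \<omega> = X \<omega> + euler_step (drift s (law M X)) (diffusion s (law M X)) s (h n) X \<omega>"

lemma next_state:
  assumes X: "X \<in> LF s"
  shows "next_state X n \<in> LF T" "law M (next_state X n) \<in> P2" "(\<lambda>n. W2 (law M X) (law M (next_state X n))) \<longlonglongrightarrow> 0"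
    "evolves K (3 * K + T * K\<^sup>2) s X (s + h n) (next_state X n)"
proof -
  note c = coefficients[OF times_in_range(1) LFD(5)[OF X]]
  show 1: "next_state X n \<in> LF T" unfolding next_state_def
    by (rule LF_add[OF state_LF_T[OF c s X h] euler_step_LF_T[OF c s X h]])
  show "law M (next_state X n) \<in> P2" by (rule LFD(5)[OF 1])
  show "(\<lambda>n. W2 (law M X) (law M (next_state X n))) \<longlonglongrightarrow> 0"
    using euler_law_tendsto[OF c s X h, of "\<lambda>_. 1"] by (simp add: next_state_def[abs_def])
  show "evolves K (3 * K + T * K\<^sup>2) s X (s + h n) (next_state X n)"
    using evolves_euler_step[OF c s X h(1,2)] by (simp add: next_state_def[abs_def])
qed

text \<open>\<open>rate\<close> is the time derivative of \<open>V t x\<close> along the flow of laws; the master equation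
  identifies it.\<close>

definition rate :: "('w \<Rightarrow> real) \<Rightarrow> real \<Rightarrow> real" where
  "rate X x = - H x (V' s x (law M X)) (V'' s x (law M X)) - F0 x (law M X)"

text \<open>The increment is split into a time increment at the new law, treated by the mean value
  theorem in time, and a measure increment at the old time, treated by the Euler expansion. The
  master equation replaces the sum of the two limits by \<open>rate\<close>.\<close>

lemma V_along_flow:
  assumes X: "X \<in> LF s"
  shows "y \<longlonglongrightarrow> x \<Longrightarrow> (\<lambda>n. (V (s + h n) (y n) (law M (next_state X n)) - V s (y n) (law M X)) / h n) \<longlonglongrightarrow> rate X x"
    and "\<bar>(V (s + h n) x (law M (next_state X n)) - V s x (law M X)) / h n\<bar> \<le> C + 3 * K * C"
proof -
  let ?m = "\<lambda>n. law M (next_state X n)" and ?\<mu> = "law M X"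
  note c = coefficients[OF times_in_range(1) LFD(5)[OF X]]
  note mP = next_state(2)[OF X] and mu = LFD(5)[OF X]
  have time: "\<exists>\<tau>. s < \<tau> \<and> \<tau> < s + h n \<and> V (s + h n) x (?m n) - V s x (?m n) = Vt \<tau> x (?m n) * h n" for n x
  proof -
    have "\<exists>\<tau>\<in>{s<..<s + h n}. V (s + h n) x (?m n) - V s x (?m n) = Vt \<tau> x (?m n) * (s + h n - s)"
    proof (rule mvt_simple)
      fix t assume t: "s \<le> t" "t \<le> s + h n"
      then have tT: "t \<in> {0..T}" using s h(2)[of n] by auto
      show "((\<lambda>t. V t x (?m n)) has_derivative (*) (Vt t x (?m n))) (at t within {s..s + h n})"
        using Vt[OF tT mP[of n], of x] s h(2)[of n] unfolding has_field_derivative_def by (rule_tac has_derivative_subset) auto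
    qed (use h in simp)
    then show ?thesis by auto
  qed
  have split: "(V (s + h n) x (?m n) - V s x ?\<mu>) / h n = (V (s + h n) x (?m n) - V s x (?m n)) / h n + (V s x (?m n) - V s x ?\<mu>) / h n" for n x
    by (simp add: add_divide_distrib[symmetric])
  have mb: "\<bar>(V s x (?m n) - V s x ?\<mu>) / h n\<bar> \<le> 3 * K * C" for x n
    using measure_step_bound[OF c s X h reg[OF times_in_range(1)], of x n] by (simp add: next_state_def[abs_def])
  show "\<bar>(V (s + h n) x (?m n) - V s x ?\<mu>) / h n\<bar> \<le> C + 3 * K * C"
  proof -
    from time[of n x] obtain \<tau> where \<tau>: "s < \<tau>" "\<tau> < s + h n" "V (s + h n) x (?m n) - V s x (?m n) = Vt \<tau> x (?m n) * h n" by blast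
    have "\<tau> \<in> {0..T}" using \<tau> s h(2)[of n] by auto
    from Vb[OF this mP[of n], of x] have "\<bar>(V (s + h n) x (?m n) - V s x (?m n)) / h n\<bar> \<le> C"
      using h(1)[of n] unfolding \<tau>(3) by simp
    with mb[of x n] show ?thesis unfolding split by linarith
  qed
  assume y: "y \<longlonglongrightarrow> x"
  have "\<forall>n. \<exists>\<tau>. s < \<tau> \<and> \<tau> < s + h n \<and> V (s + h n) (y n) (?m n) - V s (y n) (?m n) = Vt \<tau> (y n) (?m n) * h n"
    using time by blast
  from choice[OF this] obtain \<tau> where \<tau>: "\<forall>n. s < \<tau> n \<and> \<tau> n < s + h n \<and> V (s + h n) (y n) (?m n) - V s (y n) (?m n) = Vt (\<tau> n) (y n) (?m n) * h n" ..
  have \<tau>T: "\<tau> n \<in> {0..T}" for n using \<tau>[rule_format, of n] s h(2)[of n] by auto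
  have \<tau>l: "\<tau> \<longlonglongrightarrow> s"
  proof (rule tendsto_sandwich[OF _ _ tendsto_const])
    have "(\<lambda>n. s + h n) \<longlonglongrightarrow> s + 0" by (intro tendsto_intros h)
    then show "(\<lambda>n. s + h n) \<longlonglongrightarrow> s" by simp
  qed (use \<tau> in \<open>auto intro!: always_eventually less_imp_le\<close>)
  have "(\<lambda>n. case (\<tau> n, y n) of (t, x) \<Rightarrow> Vt t x (?m n)) \<longlonglongrightarrow> (case (s, x) of (t, x) \<Rightarrow> Vt t x ?\<mu>)"
    using cont_P2_tendsto[OF cont_Vt _ _ tendsto_Pair[OF \<tau>l y] mu mP next_state(3)[OF X]] \<tau>T times_in_range(1) by simp
  then have 1: "(\<lambda>n. (V (s + h n) (y n) (?m n) - V s (y n) (?m n)) / h n) \<longlonglongrightarrow> Vt s x ?\<mu>"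
    using \<tau> h(1) by (simp add: less_imp_neq[OF h(1), symmetric])
  have 2: "(\<lambda>n. (V s (y n) (?m n) - V s (y n) ?\<mu>) / h n) \<longlonglongrightarrow> (\<integral>\<omega>. drift s ?\<mu> (X \<omega>) * D s (x, X \<omega>) ?\<mu> + diffusion s ?\<mu> (X \<omega>) * D2 s (x, X \<omega>) ?\<mu> \<partial>M)"
    using measure_step_tendsto[OF c s X h reg[OF times_in_range(1)] y] by (simp add: next_state_def[abs_def])
  have "Vt s x ?\<mu> + (\<integral>\<omega>. drift s ?\<mu> (X \<omega>) * D s (x, X \<omega>) ?\<mu> + diffusion s ?\<mu> (X \<omega>) * D2 s (x, X \<omega>) ?\<mu> \<partial>M) = rate X x"
  proof -
    note R = regularD[OF reg[OF times_in_range(1)]]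
    note [measurable] = c(1,3) cont_P2_borel[OF R(4) mu] cont_P2_borel[OF R(6) mu]
    have "(\<integral>\<omega>. drift s ?\<mu> (X \<omega>) * D s (x, X \<omega>) ?\<mu> + diffusion s ?\<mu> (X \<omega>) * D2 s (x, X \<omega>) ?\<mu> \<partial>M) =
       (\<integral>x'. drift s ?\<mu> x' * D s (x, x') ?\<mu> + diffusion s ?\<mu> x' * D2 s (x, x') ?\<mu> \<partial>?\<mu>)"
      by (rule integral_law[OF LFD(2)[OF X], symmetric]) measurable
    then show ?thesis using master[OF times_in_range(1) mu, of x] by (simp add: rate_def drift_def diffusion_def mult.commute)
  qed
  then show "(\<lambda>n. (V (s + h n) (y n) (?m n) - V s (y n) ?\<mu>) / h n) \<longlonglongrightarrow> rate X x"
    unfolding split using tendsto_add[OF 1 2] by simp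
qed

text \<open>The gap integrates \<open>W\<close> against the difference of the laws, so its
  derivative collects the change \<open>l\<close> of \<open>W\<close> and the two generators acting
  on \<open>W\<close>. Under the first law concavity bounds the sum by \<open>- f\<close> from
  above; under the second law, with the roles exchanged, the same inequality bounds it by
  \<open>- f\<close> from below. What remains is at most minus the gap of \<open>F0\<close>.\<close>

lemma gap_derivative:
  assumes X: "X \<in> LF s" and Y: "Y \<in> LF s"
  obtains l where "l \<le> 0"
    "(\<lambda>n. (mono_gap (V (s + h n)) (law M (next_state X n)) (law M (next_state Y n)) - mono_gap (V s) (law M X) (law M Y)) / h n) \<longlonglongrightarrow> l"
proof -
  let ?\<mu> = "law M X" and ?\<nu> = "law M Y"
  let ?mn = "\<lambda>n. law M (next_state X n)" and ?nn = "\<lambda>n. law M (next_state Y n)"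
  note mu = LFD(5)[OF X] and nu = LFD(5)[OF Y]
  note mP = next_state(2)[OF X] and nP = next_state(2)[OF Y]
  note cX = coefficients[OF times_in_range(1) mu] and cY = coefficients[OF times_in_range(1) nu]
  define W where "W x = V s x ?\<mu> - V s x ?\<nu>" for x
  define W' where "W' x = V' s x ?\<mu> - V' s x ?\<nu>" for x
  define W'' where "W'' x = V'' s x ?\<mu> - V'' s x ?\<nu>" for x
  define Wn where "Wn n x = V (s + h n) x (?mn n) - V (s + h n) x (?nn n)" for n x
  define k where "k n x = (Wn n x - W x) / h n" for n x
  define l where "l x = rate X x - rate Y x" for x
  have W1: "(W has_real_derivative W' x) (at x)" for x
    unfolding W_def W'_def by (intro DERIV_diff Vx[OF times_in_range(1)] mu nu)
  have W2: "(W' has_real_derivative W'' x) (at x)" for x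
    unfolding W'_def W''_def by (intro DERIV_diff Vxx[OF times_in_range(1)] mu nu)
  have Wb: "\<bar>W' x\<bar> \<le> 2 * C" "\<bar>W'' x\<bar> \<le> 2 * C" for x
    using Vb[OF times_in_range(1) mu, of x] Vb[OF times_in_range(1) nu, of x] unfolding W'_def W''_def by linarith+
  have Wc: "continuous_on UNIV W''" unfolding W''_def by (intro continuous_intros Vc[OF times_in_range(1)] mu nu)
  have Wl: "\<bar>W x - W y\<bar> \<le> (2 * C) * \<bar>x - y\<bar>" for x y
    using V_lipschitz[OF times_in_range(1) mu, of x y] V_lipschitz[OF times_in_range(1) nu, of x y] unfolding W_def by linarith
  have Wnl: "\<bar>Wn n x - Wn n y\<bar> \<le> (2 * C) * \<bar>x - y\<bar>" for n x y
    using V_lipschitz[OF times_in_range(2) mP, of n x n y] V_lipschitz[OF times_in_range(2) nP, of n x n y] unfolding Wn_def by linarith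
  have klim: "(\<lambda>n. k n (y n)) \<longlonglongrightarrow> l x" if "y \<longlonglongrightarrow> x" for y x
  proof -
    have "k n x = (V (s + h n) x (?mn n) - V s x ?\<mu>) / h n - (V (s + h n) x (?nn n) - V s x ?\<nu>) / h n" for n x
      by (simp add: k_def Wn_def W_def diff_divide_distrib)
    then show ?thesis unfolding l_def using tendsto_diff[OF V_along_flow(1)[OF X that] V_along_flow(1)[OF Y that]] by simp
  qed
  have kb: "\<bar>k n x\<bar> \<le> 2 * (C + 3 * K * C)" for n x
  proof -
    have "k n x = (V (s + h n) x (?mn n) - V s x ?\<mu>) / h n - (V (s + h n) x (?nn n) - V s x ?\<nu>) / h n"
      by (simp add: k_def Wn_def W_def diff_divide_distrib)
    also have "\<bar>\<dots>\<bar> \<le> (C + 3 * K * C) + (C + 3 * K * C)"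
      by (rule order_trans[OF abs_triangle_ineq4 add_mono[OF V_along_flow(2)[OF X] V_along_flow(2)[OF Y]]])
    finally show ?thesis by (simp add: algebra_simps)
  qed
  have lb: "\<bar>l x\<bar> \<le> 2 * (C + 3 * K * C)" for x
    by (rule LIMSEQ_le_const2[OF tendsto_rabs[OF klim[OF tendsto_const]]]) (use kb in blast)
  have Wm: "W \<in> borel_measurable borel" "Wn n \<in> borel_measurable borel" for n
    using lipschitz_P2(1)[OF Wl mu] lipschitz_P2(1)[OF Wnl mu] by auto
  have km: "k n \<in> borel_measurable borel" for n unfolding k_def using Wm by measurable
  have lm: "l \<in> borel_measurable borel" by (rule borel_measurable_LIMSEQ_real[OF klim[OF tendsto_const] km])
  have W''m: "W'' \<in> borel_measurable borel" and W'm: "W' \<in> borel_measurable borel"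
    using Wc DERIV_continuous_on[OF has_field_derivative_at_within[OF W2]] by (auto intro: borel_measurable_continuous_onI)
  have iL: "integrable M (\<lambda>\<omega>. f (Z \<omega>))" if "Z \<in> LF T" "\<And>x y. \<bar>f x - f y\<bar> \<le> c * \<bar>x - y\<bar>" for Z f c
    using lipschitz_P2(2)[OF that(2) LFD(5)[OF that(1)]] 
    by (subst (asm) integrable_law_iff[OF LFD(2)[OF that(1)] lipschitz_P2(1)[OF that(2) mu]])
  have law_int: "(\<integral>x. f x \<partial>law M Z) = (\<integral>\<omega>. f (Z \<omega>) \<partial>M)" if "Z \<in> LF T" "f \<in> borel_measurable borel" for Z and f :: "real \<Rightarrow> real"
    by (rule integral_law[OF LFD(2)[OF that(1)] that(2)])
  have XT: "X \<in> LF T" "Y \<in> LF T" using LF_mono[OF _ X, of T] LF_mono[OF _ Y, of T] times_in_range(1) by auto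
  note NX = next_state(1)[OF X] and NY = next_state(1)[OF Y]
  \<comment> \<open>Taking the change \<open>k n\<close> at the new state, and the old function
    \<open>W\<close> at both states, splits the quotient exactly into two terms with known
    limits.\<close>
  have part: "((\<integral>\<omega>. Wn n (N \<omega>) \<partial>M) - (\<integral>\<omega>. W (Z \<omega>) \<partial>M)) / h n = (\<integral>\<omega>. k n (N \<omega>) \<partial>M) + ((\<integral>\<omega>. W (N \<omega>) \<partial>M) - (\<integral>\<omega>. W (Z \<omega>) \<partial>M)) / h n"
    if "N \<in> LF T" for N Z n
    using iL[OF that Wl] iL[OF that Wnl, of n] by (simp add: k_def diff_divide_distrib)
  have gap_n: "(mono_gap (V (s + h n)) (?mn n) (?nn n) - mono_gap (V s) ?\<mu> ?\<nu>) / h n =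
     ((\<integral>\<omega>. k n (next_state X n \<omega>) \<partial>M) + ((\<integral>\<omega>. W (next_state X n \<omega>) \<partial>M) - (\<integral>\<omega>. W (X \<omega>) \<partial>M)) / h n)
   - ((\<integral>\<omega>. k n (next_state Y n \<omega>) \<partial>M) + ((\<integral>\<omega>. W (next_state Y n \<omega>) \<partial>M) - (\<integral>\<omega>. W (Y \<omega>) \<partial>M)) / h n)" for n
  proof -
    have 1: "mono_gap (V s) ?\<mu> ?\<nu> = (\<integral>\<omega>. W (X \<omega>) \<partial>M) - (\<integral>\<omega>. W (Y \<omega>) \<partial>M)"
      unfolding mono_gap_def W_def[symmetric] law_int[OF XT(1) Wm(1)] law_int[OF XT(2) Wm(1)] ..
    have 2: "mono_gap (V (s + h n)) (?mn n) (?nn n) = (\<integral>\<omega>. Wn n (next_state X n \<omega>) \<partial>M) - (\<integral>\<omega>. Wn n (next_state Y n \<omega>) \<partial>M)"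
      unfolding mono_gap_def Wn_def[symmetric] law_int[OF NX Wm(2)] law_int[OF NY Wm(2)] ..
    show ?thesis unfolding part[OF NX, symmetric] part[OF NY, symmetric] 1 2 by (simp add: diff_divide_distrib)
  qed
  have limX: "(\<lambda>n. (\<integral>\<omega>. k n (next_state X n \<omega>) \<partial>M) + ((\<integral>\<omega>. W (next_state X n \<omega>) \<partial>M) - (\<integral>\<omega>. W (X \<omega>) \<partial>M)) / h n)
     \<longlonglongrightarrow> (\<integral>\<omega>. l (X \<omega>) \<partial>M) + (\<integral>\<omega>. drift s ?\<mu> (X \<omega>) * W' (X \<omega>) + diffusion s ?\<mu> (X \<omega>) * W'' (X \<omega>) \<partial>M)"
    unfolding next_state_def
    by (intro tendsto_add integral_euler_tendsto[OF cX s X h km kb klim] test_step_tendsto[OF cX s X h W1 W2 Wb Wc])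
  have limY: "(\<lambda>n. (\<integral>\<omega>. k n (next_state Y n \<omega>) \<partial>M) + ((\<integral>\<omega>. W (next_state Y n \<omega>) \<partial>M) - (\<integral>\<omega>. W (Y \<omega>) \<partial>M)) / h n)
     \<longlonglongrightarrow> (\<integral>\<omega>. l (Y \<omega>) \<partial>M) + (\<integral>\<omega>. drift s ?\<nu> (Y \<omega>) * W' (Y \<omega>) + diffusion s ?\<nu> (Y \<omega>) * W'' (Y \<omega>) \<partial>M)"
    unfolding next_state_def
    by (intro tendsto_add integral_euler_tendsto[OF cY s Y h km kb klim] test_step_tendsto[OF cY s Y h W1 W2 Wb Wc])
  define f where "f x = F0 x ?\<mu> - F0 x ?\<nu>" for x
  have fl: "\<bar>f x - f y\<bar> \<le> (2 * L) * \<bar>x - y\<bar>" for x y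
    using F0_lip[OF mu, of x y] F0_lip[OF nu, of x y] unfolding f_def by linarith
  have fm: "f \<in> borel_measurable borel" by (rule lipschitz_P2(1)[OF fl mu])
  have il: "integrable M (\<lambda>\<omega>. l (Z \<omega>))" if "Z \<in> LF T" for Z
    by (rule integrable_const_bound[where B="2 * (C + 3 * K * C)", OF AE_I2 measurable_compose[OF LFD(2)[OF that] lm]])
       (simp only: real_norm_def lb)
  have C0: "0 \<le> C" and K0: "0 \<le> K" using Vb[OF times_in_range(1) mu, of 0] cX(2)[of 0] by linarith+
  have ib: "integrable M (\<lambda>\<omega>. b (Z \<omega>) * W' (Z \<omega>) + a (Z \<omega>) * W'' (Z \<omega>))" 
    if Z: "Z \<in> LF T" and c: "b \<in> borel_measurable borel" "\<And>x. \<bar>b x\<bar> \<le> K" "a \<in> borel_measurable borel" "\<And>x. 0 \<le> a x" "\<And>x. a x \<le> K" for Z a b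
  proof (rule integrable_const_bound[where B="K * (2 * C) + K * (2 * C)"])
    have "(\<lambda>x. b x * W' x + a x * W'' x) \<in> borel_measurable borel" using c W'm W''m by measurable
    from measurable_compose[OF LFD(2)[OF Z] this] show "(\<lambda>\<omega>. b (Z \<omega>) * W' (Z \<omega>) + a (Z \<omega>) * W'' (Z \<omega>)) \<in> borel_measurable M" .
    have "\<bar>b x * W' x\<bar> \<le> K * (2 * C)" "\<bar>a x * W'' x\<bar> \<le> K * (2 * C)" for x
      unfolding abs_mult using c Wb K0 by (auto intro!: mult_mono)
    then have "\<bar>b x * W' x + a x * W'' x\<bar> \<le> K * (2 * C) + K * (2 * C)" for x
      by (intro order_trans[OF abs_triangle_ineq] add_mono)
    then show "AE \<omega> in M. norm (b (Z \<omega>) * W' (Z \<omega>) + a (Z \<omega>) * W'' (Z \<omega>)) \<le> K * (2 * C) + K * (2 * C)" by simp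
  qed
  have leX: "(\<integral>\<omega>. l (X \<omega>) \<partial>M) + (\<integral>\<omega>. drift s ?\<mu> (X \<omega>) * W' (X \<omega>) + diffusion s ?\<mu> (X \<omega>) * W'' (X \<omega>) \<partial>M) \<le> (\<integral>\<omega>. - f (X \<omega>) \<partial>M)"
  proof -
    \<comment> \<open>The tangent is taken at the derivatives belonging to \<open>?\<mu>\<close> and
      compared at those belonging to \<open>?\<nu>\<close>; the values of \<open>H\<close> in
      \<open>l\<close> are then absorbed and \<open>- f x\<close> is left.\<close>
    have "l x + (drift s ?\<mu> x * W' x + diffusion s ?\<mu> x * W'' x) \<le> - f x" for x
      using H_concave[of x "V' s x ?\<nu>" "V'' s x ?\<nu>" "V' s x ?\<mu>" "V'' s x ?\<mu>"]
      unfolding l_def rate_def drift_def diffusion_def W'_def W''_def f_def by (simp add: algebra_simps)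
    then have "(\<integral>\<omega>. l (X \<omega>) + (drift s ?\<mu> (X \<omega>) * W' (X \<omega>) + diffusion s ?\<mu> (X \<omega>) * W'' (X \<omega>)) \<partial>M) \<le> (\<integral>\<omega>. - f (X \<omega>) \<partial>M)"
      by (intro integral_mono Bochner_Integration.integrable_add il[OF XT(1)] ib[OF XT(1) cX] Bochner_Integration.integrable_minus iL[OF XT(1) fl])
    then show ?thesis using il[OF XT(1)] ib[OF XT(1) cX] by simp
  qed
  have leY: "(\<integral>\<omega>. - f (Y \<omega>) \<partial>M) \<le> (\<integral>\<omega>. l (Y \<omega>) \<partial>M) + (\<integral>\<omega>. drift s ?\<nu> (Y \<omega>) * W' (Y \<omega>) + diffusion s ?\<nu> (Y \<omega>) * W'' (Y \<omega>) \<partial>M)"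
  proof -
    have "- f x \<le> l x + (drift s ?\<nu> x * W' x + diffusion s ?\<nu> x * W'' x)" for x
      using H_concave[of x "V' s x ?\<mu>" "V'' s x ?\<mu>" "V' s x ?\<nu>" "V'' s x ?\<nu>"]
      unfolding l_def rate_def drift_def diffusion_def W'_def W''_def f_def by (simp add: algebra_simps)
    then have "(\<integral>\<omega>. - f (Y \<omega>) \<partial>M) \<le> (\<integral>\<omega>. l (Y \<omega>) + (drift s ?\<nu> (Y \<omega>) * W' (Y \<omega>) + diffusion s ?\<nu> (Y \<omega>) * W'' (Y \<omega>)) \<partial>M)"
      by (intro integral_mono Bochner_Integration.integrable_add il[OF XT(2)] ib[OF XT(2) cY] Bochner_Integration.integrable_minus iL[OF XT(2) fl])
    then show ?thesis using il[OF XT(2)] ib[OF XT(2) cY] by simp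
  qed
  have "0 \<le> mono_gap F0 ?\<mu> ?\<nu>" by (rule F0_mono[OF mu nu])
  also have "mono_gap F0 ?\<mu> ?\<nu> = (\<integral>\<omega>. f (X \<omega>) \<partial>M) - (\<integral>\<omega>. f (Y \<omega>) \<partial>M)"
    unfolding mono_gap_def f_def[symmetric] law_int[OF XT(1) fm] law_int[OF XT(2) fm] ..
  finally have F: "0 \<le> (\<integral>\<omega>. f (X \<omega>) \<partial>M) - (\<integral>\<omega>. f (Y \<omega>) \<partial>M)" .
  show thesis
  proof (rule that)
    show "(\<lambda>n. (mono_gap (V (s + h n)) (?mn n) (?nn n) - mono_gap (V s) ?\<mu> ?\<nu>) / h n) \<longlonglongrightarrow>
       ((\<integral>\<omega>. l (X \<omega>) \<partial>M) + (\<integral>\<omega>. drift s ?\<mu> (X \<omega>) * W' (X \<omega>) + diffusion s ?\<mu> (X \<omega>) * W'' (X \<omega>) \<partial>M))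
     - ((\<integral>\<omega>. l (Y \<omega>) \<partial>M) + (\<integral>\<omega>. drift s ?\<nu> (Y \<omega>) * W' (Y \<omega>) + diffusion s ?\<nu> (Y \<omega>) * W'' (Y \<omega>) \<partial>M))"
      unfolding gap_n by (rule tendsto_diff[OF limX limY])
  qed (use leX leY F in simp)
qed

end

text \<open>The order for the maximality principle: a pair of states with a common time, whose gap
  may grow by \<open>e\<close> per unit of time. The slack is proportional to elapsed time, hence
  additive along chains.\<close>

definition state_le :: "real \<Rightarrow> real \<times> ('w \<Rightarrow> real) \<times> ('w \<Rightarrow> real) \<Rightarrow> real \<times> ('w \<Rightarrow> real) \<times> ('w \<Rightarrow> real) \<Rightarrow> bool" where
  "state_le e = (\<lambda>(s, X, Y) (s', X', Y'). evolves K (3 * K + T * K\<^sup>2) s X s' X' \<and> evolves K (3 * K + T * K\<^sup>2) s Y s' Y'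
     \<and> mono_gap (V s') (law M X') (law M Y') - mono_gap (V s) (law M X) (law M Y) \<le> e * (s' - s))"

theorem mono_gap_V_nonneg:
  assumes t: "t \<in> {0..T}" and mu: "\<mu> \<in> P2" and nu: "\<nu> \<in> P2"
  shows "0 \<le> mono_gap (V t) \<mu> \<nu>"
proof (rule field_le_epsilon)
  fix e' :: real assume e': "0 < e'"
  \<comment> \<open>Over a time span of at most \<open>T\<close> the accumulated slack is at most
    \<open>e'\<close>.\<close>
  define e where "e = e' / T"
  have e: "0 < e" using e' T by (simp add: e_def)
  let ?\<kappa> = "3 * K + T * K\<^sup>2"
  have K0: "0 \<le> K" using coefficients(2)[OF t mu, of 0] by linarith
  obtain X where X: "law M X = \<mu>" "X \<in> LF t" using realize_P2[OF mu] t by metis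
  obtain Y where Y: "law M Y = \<nu>" "Y \<in> LF t" using realize_P2[OF nu] t by metis
  have "\<exists>y. state_le e (t, X, Y) y \<and> fst y = T"
  proof (rule brezis_browder[where t=fst])
    show "state_le e x z" if "state_le e x y" "state_le e y z" for x y z
      using that evolves_trans[of K ?\<kappa> "fst x" "fst (snd x)" "fst y" "fst (snd y)" "fst z" "fst (snd z)"]
        evolves_trans[of K ?\<kappa> "fst x" "snd (snd x)" "fst y" "snd (snd y)" "fst z" "snd (snd z)"]
      by (auto simp: state_le_def algebra_simps split: prod.splits)
    show "state_le e y y" if "state_le e x y" for x y
      using that by (auto simp: state_le_def evolves_def split: prod.splits)
    show "fst x \<le> fst y" "fst y \<le> T" if "state_le e x y" for x y
      using that by (auto simp: state_le_def evolves_def split: prod.splits)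
    show "state_le e (t, X, Y) (t, X, Y)"
      using t X Y by (auto simp: state_le_def intro!: evolves_refl)
  next
    \<comment> \<open>Upper bounds of chains: the times increase to a limit, both states converge in
      mean square to states at that time, and continuity of the gap in time and laws preserves the
      slack inequality.\<close>
    fix S assume S: "\<And>n. state_le e (S n) (S (Suc n))"
    define s A A' where "s n = fst (S n)" and "A n = fst (snd (S n))" and "A' n = snd (snd (S n))" for n
    have evA: "evolves K ?\<kappa> (s n) (A n) (s (Suc n)) (A (Suc n))" and evA': "evolves K ?\<kappa> (s n) (A' n) (s (Suc n)) (A' (Suc n))"
      and g: "mono_gap (V (s (Suc n))) (law M (A (Suc n))) (law M (A' (Suc n))) - mono_gap (V (s n)) (law M (A n)) (law M (A' n)) \<le> e * (s (Suc n) - s n)" for n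
      using S[of n] by (auto simp: state_le_def s_def A_def A'_def split: prod.splits)
    have sT: "s n \<in> {0..T}" "A n \<in> LF (s n)" "A' n \<in> LF (s n)" for n using evA[of n] evA'[of n] by (auto simp: evolves_def)
    have "incseq s" using evA by (intro incseq_SucI) (simp add: evolves_def)
    then obtain l where l: "s \<longlonglongrightarrow> l" "\<And>n. s n \<le> l" using incseq_convergent[of s T] sT(1) by auto
    have lT: "l \<in> {0..T}" using LIMSEQ_le_const2[OF l(1), of T] sT(1) order_trans[OF _ l(2)[of 0], of 0] by auto
    obtain Z where Z: "\<And>n. evolves K ?\<kappa> (s n) (A n) l Z" "(\<lambda>n. norm2 M (\<lambda>\<omega>. A n \<omega> - Z \<omega>)) \<longlonglongrightarrow> 0"
      by (rule evolves_chain[OF evA l(1) K0]) blast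
    obtain Z' where Z': "\<And>n. evolves K ?\<kappa> (s n) (A' n) l Z'" "(\<lambda>n. norm2 M (\<lambda>\<omega>. A' n \<omega> - Z' \<omega>)) \<longlonglongrightarrow> 0"
      by (rule evolves_chain[OF evA' l(1) K0]) blast
    have ZL: "Z \<in> LF l" "Z' \<in> LF l" using Z(1)[of 0] Z'(1)[of 0] by (auto simp: evolves_def)
    have AL: "A n \<in> LF l" "A' n \<in> LF l" for n using LF_mono[OF l(2) sT(2)] LF_mono[OF l(2) sT(3)] by auto
    let ?g = "\<lambda>n. mono_gap (V (s n)) (law M (A n)) (law M (A' n))"
    have gl: "?g \<longlonglongrightarrow> mono_gap (V l) (law M Z) (law M Z')"
      by (rule gap_tendsto[OF sT(1) l(1) lT LFD(5)[OF ZL(1)] LFD(5)[OF AL(1)] L2_limits(3)[OF AL(1) ZL(1) Z(2) ZL(1)]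
            LFD(5)[OF ZL(2)] LFD(5)[OF AL(2)] L2_limits(3)[OF AL(2) ZL(2) Z'(2) ZL(2)]])
    have gm: "?g m - ?g n \<le> e * (s m - s n)" if "n \<le> m" for n m
      using that
    proof (induction m rule: dec_induct)
      case (step m) then show ?case using g[of m] by (simp add: algebra_simps)
    qed simp
    have "mono_gap (V l) (law M Z) (law M Z') - ?g n \<le> e * (l - s n)" for n
    proof (rule LIMSEQ_le)
      show "(\<lambda>m. ?g m - ?g n) \<longlonglongrightarrow> mono_gap (V l) (law M Z) (law M Z') - ?g n" by (intro tendsto_intros gl)
      show "(\<lambda>m. e * (s m - s n)) \<longlonglongrightarrow> e * (l - s n)" by (intro tendsto_intros l)
    qed (use gm in blast)
    note gZ = this
    have "state_le e (S n) (l, Z, Z')" for n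
      using Z(1)[of n] Z'(1)[of n] gZ[of n] by (cases "S n") (simp add: state_le_def s_def A_def A'_def)
    then show "\<exists>y. \<forall>n. state_le e (S n) y" by blast
  next
    \<comment> \<open>Strict progress before \<open>T\<close>: the difference quotients of the gap
      have a limit at most 0, so one of the small steps has a quotient below
      \<open>e\<close>.\<close>
    fix x assume x: "state_le e (t, X, Y) x" "fst x < T"
    obtain s A A' where xe: "x = (s, A, A')" by (cases x)
    have s: "0 \<le> s" "s < T" and A: "A \<in> LF s" "A' \<in> LF s" using x unfolding xe by (auto simp: state_le_def evolves_def)
    define h where "h n = (T - s) / real (Suc n)" for n
    have h: "0 < h n" "s + h n \<le> T" for n
    proof -
      show "0 < h n" using s by (simp add: h_def)
      have "h n \<le> (T - s) / 1" unfolding h_def using s by (intro divide_left_mono) auto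
      then show "s + h n \<le> T" by simp
    qed
    have hl: "h \<longlonglongrightarrow> 0" unfolding h_def by (rule LIMSEQ_Suc[OF lim_const_over_n])
    obtain l where l: "l \<le> 0" "(\<lambda>n. (mono_gap (V (s + h n)) (law M (next_state s h A n)) (law M (next_state s h A' n)) - mono_gap (V s) (law M A) (law M A')) / h n) \<longlonglongrightarrow> l"
      by (rule gap_derivative[OF s(1) h hl A])
    have "\<forall>\<^sub>F n in sequentially. (mono_gap (V (s + h n)) (law M (next_state s h A n)) (law M (next_state s h A' n)) - mono_gap (V s) (law M A) (law M A')) / h n < e"
      by (rule order_tendstoD(2)[OF l(2)]) (use l(1) e in simp)
    then obtain n where "(mono_gap (V (s + h n)) (law M (next_state s h A n)) (law M (next_state s h A' n)) - mono_gap (V s) (law M A) (law M A')) / h n < e"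
      using eventually_happens'[OF sequentially_bot] by blast
    then have "mono_gap (V (s + h n)) (law M (next_state s h A n)) (law M (next_state s h A' n)) - mono_gap (V s) (law M A) (law M A') \<le> e * h n"
      using h(1)[of n] by (simp add: field_simps)
    then have "state_le e x (s + h n, next_state s h A n, next_state s h A' n)"
      using next_state(4)[OF s(1) h hl A(1), of n] next_state(4)[OF s(1) h hl A(2), of n] by (simp add: state_le_def xe)
    then show "\<exists>y. state_le e x y \<and> fst x < fst y" using h(1)[of n] by (intro exI conjI) (auto simp: xe)
  qed
  then obtain Z Z' where Z: "state_le e (t, X, Y) (T, Z, Z')" by auto
  then have ZL: "Z \<in> LF T" "Z' \<in> LF T" by (auto simp: state_le_def evolves_def)
  have "0 \<le> mono_gap (V T) (law M Z) (law M Z')" by (rule terminal[OF LFD(5)[OF ZL(1)] LFD(5)[OF ZL(2)]])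
  also have "\<dots> \<le> mono_gap (V t) \<mu> \<nu> + e * (T - t)" using Z X Y by (simp add: state_le_def)
  also have "e * (T - t) \<le> e * T" using e t by simp
  also have "e * T = e'" using T by (simp add: e_def)
  finally show "0 \<le> mono_gap (V t) \<mu> \<nu> + e'" by simp
qed

end

section \<open>Regularity and symmetry of mixed derivatives\<close>

lemma pdiffable_DERIV: "pdiffable v f y \<Longrightarrow> ((\<lambda>h. f (y + h *\<^sub>R v)) has_real_derivative pdiff v f y) (at 0)"
  by (simp add: pdiffable_def pdiff_def DERIV_deriv_iff_field_differentiable)

lemma pdiffable_real:
  fixes f :: "real \<Rightarrow> real"
  assumes "pdiffable 1 f y"
  shows "(f has_real_derivative pdiff 1 f y) (at y)"
  using pdiffable_DERIV[OF assms] DERIV_shift[of f "pdiff 1 f y" 0 y] by (simp add: add.commute)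

lemma pdiffable_fst:
  fixes f :: "real \<times> 'b::euclidean_space \<Rightarrow> real"
  assumes "pdiffable (1, 0) f (x, x')"
  shows "((\<lambda>x. f (x, x')) has_real_derivative pdiff (1, 0) f (x, x')) (at x)"
  using pdiffable_DERIV[OF assms] DERIV_shift[of "\<lambda>x. f (x, x')" "pdiff (1, 0) f (x, x')" 0 x] by (simp add: add.commute)

lemma pdiffable_snd:
  fixes f :: "'b::euclidean_space \<times> real \<Rightarrow> real"
  assumes "pdiffable (0, 1) f (x, x')"
  shows "((\<lambda>x'. f (x, x')) has_real_derivative pdiff (0, 1) f (x, x')) (at x')"
  using pdiffable_DERIV[OF assms] DERIV_shift[of "\<lambda>x'. f (x, x')" "pdiff (0, 1) f (x, x')" 0 x'] by (simp add: add.commute)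

lemma pd_cong: "(\<And>y. U y \<mu> = W y \<mu>) \<Longrightarrow> pd v U y \<mu> = pd v W y \<mu>"
  by (simp add: pd_def)

lemma cont_Theta_slice:
  assumes "cont_Theta T f" "t \<in> {0..T}"
  shows "cont_P2 UNIV (f t)"
  unfolding cont_P2_def
proof (intro ballI allI impI)
  fix y \<mu> and e :: real assume mu: "\<mu> \<in> P2" and e: "0 < e"
  from assms(1)[unfolded cont_Theta_def cont_P2_def, rule_format, of "(t, y)", OF _ mu e] assms(2)
  obtain d where d: "d > 0" "\<And>y' \<mu>'. y' \<in> {0..T} \<times> UNIV \<Longrightarrow> \<mu>' \<in> P2 \<Longrightarrow> dist (t, y) y' < d \<and> W2 \<mu> \<mu>' < d \<Longrightarrow> dist (case (t, y) of (t, y) \<Rightarrow> f t y \<mu>) (case y' of (t, y) \<Rightarrow> f t y \<mu>') < e" by auto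
  show "\<exists>d>0. \<forall>y'\<in>UNIV. \<forall>\<mu>'\<in>P2. dist y y' < d \<and> W2 \<mu> \<mu>' < d \<longrightarrow> dist (f t y \<mu>) (f t y' \<mu>') < e"
    using d(1) d(2)[of "(t, _)"] assms(2) by (intro exI[of _ d]) (auto simp: dist_Pair_Pair)
qed

section \<open>Consequences of the regularity classes and the exchange of space and Lions
  derivatives\<close>

context mfg_space
begin

lemma C12b_regular:
  fixes U :: "real \<Rightarrow> real \<Rightarrow> real measure \<Rightarrow> real"
  assumes "C12b M (\<F> T) T U"
  obtains C where "\<And>t. t \<in> {0..T} \<Longrightarrow> regular (U t) (dmu M (\<F> T) (U t)) (pd (1, 0) (dmu M (\<F> T) (U t))) (pd (0, 1) (dmu M (\<F> T) (U t))) C"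
proof -
  let ?D = "\<lambda>t. dmu M (\<F> T) (U t)"
  have B: "(1, 0) \<in> (Basis :: (real \<times> real) set)" "(0, 1) \<in> (Basis :: (real \<times> real) set)" by (auto simp: Basis_prod_def)
  have lv: "\<exists>D. lions_version M (\<F> T) (U t y) D" if "t \<in> {0..T}" for t y using assms that unfolding C12b_def by blast
  have d0: "bcont_Theta T ?D" using assms unfolding C12b_def by blast
  have "\<forall>v\<in>Basis. pd_exists T v ?D \<and> bcont_Theta T (\<lambda>t. pd v (?D t))" using assms unfolding C12b_def by blast
  from this[rule_format, OF B(1)] this[rule_format, OF B(2)]
  have p1: "pd_exists T (1, 0) ?D" and d1: "bcont_Theta T (\<lambda>t. pd (1, 0) (?D t))"
    and p2: "pd_exists T (0, 1) ?D" and d2: "bcont_Theta T (\<lambda>t. pd (0, 1) (?D t))" by simp_all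
  obtain C0 where C0: "\<And>t y \<mu>. t \<in> {0..T} \<Longrightarrow> \<mu> \<in> P2 \<Longrightarrow> \<bar>?D t y \<mu>\<bar> \<le> C0" using d0 unfolding bcont_Theta_def by blast
  obtain C1 where C1: "\<And>t y \<mu>. t \<in> {0..T} \<Longrightarrow> \<mu> \<in> P2 \<Longrightarrow> \<bar>pd (1, 0) (?D t) y \<mu>\<bar> \<le> C1" using d1 unfolding bcont_Theta_def by blast
  obtain C2 where C2: "\<And>t y \<mu>. t \<in> {0..T} \<Longrightarrow> \<mu> \<in> P2 \<Longrightarrow> \<bar>pd (0, 1) (?D t) y \<mu>\<bar> \<le> C2" using d2 unfolding bcont_Theta_def by blast
  show thesis
  proof (rule that[of "max C0 (max C1 C2)"])
    fix t assume t: "t \<in> {0..T}"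
    \<comment> \<open>Existence of a continuous version makes the choice in
      \<open>lions_deriv\<close> a genuine derivative.\<close>
    have "lions_version M (\<F> T) (U t y) (lions_deriv M (\<F> T) (U t y))" for y
      unfolding lions_deriv_def by (rule someI_ex[OF lv[OF t]])
    then have "is_lions_deriv M (\<F> T) (U t y) (\<lambda>\<mu> x'. ?D t (y, x') \<mu>)" for y
      by (simp add: lions_version_def dmu_def)
    moreover have "((\<lambda>y. ?D t (y, x') \<mu>) has_real_derivative pd (1, 0) (?D t) (y, x') \<mu>) (at y)" if "\<mu> \<in> P2" for \<mu> y x'
      unfolding pd_def by (rule pdiffable_fst) (use p1 t that in \<open>simp add: pd_exists_def\<close>)
    moreover have "((\<lambda>x'. ?D t (y, x') \<mu>) has_real_derivative pd (0, 1) (?D t) (y, x') \<mu>) (at x')" if "\<mu> \<in> P2" for \<mu> y x'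
      unfolding pd_def by (rule pdiffable_snd) (use p2 t that in \<open>simp add: pd_exists_def\<close>)
    moreover have "cont_P2 UNIV (?D t)" "cont_P2 UNIV (pd (1, 0) (?D t))" "cont_P2 UNIV (pd (0, 1) (?D t))"
      using cont_Theta_slice[OF _ t] d0 d1 d2 unfolding bcont_Theta_def by blast+
    moreover have "\<bar>?D t z \<mu>\<bar> \<le> max C0 (max C1 C2) \<and> \<bar>pd (1, 0) (?D t) z \<mu>\<bar> \<le> max C0 (max C1 C2) \<and> \<bar>pd (0, 1) (?D t) z \<mu>\<bar> \<le> max C0 (max C1 C2)" if "\<mu> \<in> P2" for z \<mu>
      using C0[OF t that, of z] C1[OF t that, of z] C2[OF t that, of z] by linarith
    ultimately show "regular (U t) (?D t) (pd (1, 0) (?D t)) (pd (0, 1) (?D t)) (max C0 (max C1 C2))"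
      unfolding regular_def by blast
  qed
qed

lemma C12b_space_time:
  fixes U :: "real \<Rightarrow> real \<Rightarrow> real measure \<Rightarrow> real"
  assumes "C12b M (\<F> T) T U"
  obtains C where "\<And>t \<mu> x. t \<in> {0..T} \<Longrightarrow> \<mu> \<in> P2 \<Longrightarrow> ((\<lambda>x. U t x \<mu>) has_real_derivative pd 1 (U t) x \<mu>) (at x)"
    "\<And>t \<mu> x. t \<in> {0..T} \<Longrightarrow> \<mu> \<in> P2 \<Longrightarrow> ((\<lambda>x. pd 1 (U t) x \<mu>) has_real_derivative pd 1 (pd 1 (U t)) x \<mu>) (at x)"
    "\<And>t \<mu> x. t \<in> {0..T} \<Longrightarrow> \<mu> \<in> P2 \<Longrightarrow> \<bar>pd 1 (U t) x \<mu>\<bar> \<le> C \<and> \<bar>pd 1 (pd 1 (U t)) x \<mu>\<bar> \<le> C \<and> \<bar>dt T U t x \<mu>\<bar> \<le> C"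
    "\<And>t. t \<in> {0..T} \<Longrightarrow> cont_P2 UNIV (pd 1 (pd 1 (U t)))"
    "\<And>t \<mu> x. t \<in> {0..T} \<Longrightarrow> \<mu> \<in> P2 \<Longrightarrow> ((\<lambda>t. U t x \<mu>) has_real_derivative dt T U t x \<mu>) (at t within {0..T})"
    "cont_Theta T U" "cont_Theta T (dt T U)"
proof -
  have B: "(1::real) \<in> Basis" by simp
  have c: "cont_Theta T U" and df: "\<And>t y \<mu>. t \<in> {0..T} \<Longrightarrow> \<mu> \<in> P2 \<Longrightarrow> (\<lambda>s. U s y \<mu>) differentiable (at t within {0..T})"
    and bt: "bcont_Theta T (dt T U)" using assms unfolding C12b_def by blast+
  have "\<forall>v\<in>Basis. pd_exists T v U \<and> bcont_Theta T (\<lambda>t. pd v (U t))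
        \<and> (\<forall>w\<in>Basis. pd_exists T w (\<lambda>t. pd v (U t)) \<and> bcont_Theta T (\<lambda>t. pd w (pd v (U t))))" using assms unfolding C12b_def by blast
  from this[rule_format, OF B] have p1: "pd_exists T 1 U" and b1: "bcont_Theta T (\<lambda>t. pd 1 (U t))"
    and p2: "pd_exists T 1 (\<lambda>t. pd 1 (U t))" and b2: "bcont_Theta T (\<lambda>t. pd 1 (pd 1 (U t)))" using B by blast+
  obtain C0 where C0: "\<And>t y \<mu>. t \<in> {0..T} \<Longrightarrow> \<mu> \<in> P2 \<Longrightarrow> \<bar>dt T U t y \<mu>\<bar> \<le> C0" using bt unfolding bcont_Theta_def by blast
  obtain C1 where C1: "\<And>t y \<mu>. t \<in> {0..T} \<Longrightarrow> \<mu> \<in> P2 \<Longrightarrow> \<bar>pd 1 (U t) y \<mu>\<bar> \<le> C1" using b1 unfolding bcont_Theta_def by blast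
  obtain C2 where C2: "\<And>t y \<mu>. t \<in> {0..T} \<Longrightarrow> \<mu> \<in> P2 \<Longrightarrow> \<bar>pd 1 (pd 1 (U t)) y \<mu>\<bar> \<le> C2" using b2 unfolding bcont_Theta_def by blast
  show thesis
  proof (rule that[of "max C0 (max C1 C2)"])
    fix t \<mu> x assume t: "t \<in> {0..T}" and mu: "\<mu> \<in> P2"
    show "((\<lambda>x. U t x \<mu>) has_real_derivative pd 1 (U t) x \<mu>) (at x)"
      unfolding pd_def by (rule pdiffable_real) (use p1 t mu in \<open>simp add: pd_exists_def\<close>)
    show "((\<lambda>x. pd 1 (U t) x \<mu>) has_real_derivative pd 1 (pd 1 (U t)) x \<mu>) (at x)"
      unfolding pd_def[of 1 "pd 1 (U t)"] by (rule pdiffable_real) (use p2 t mu in \<open>simp add: pd_exists_def\<close>)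
    show "\<bar>pd 1 (U t) x \<mu>\<bar> \<le> max C0 (max C1 C2) \<and> \<bar>pd 1 (pd 1 (U t)) x \<mu>\<bar> \<le> max C0 (max C1 C2) \<and> \<bar>dt T U t x \<mu>\<bar> \<le> max C0 (max C1 C2)"
      using C0[OF t mu, of x] C1[OF t mu, of x] C2[OF t mu, of x] by linarith
    show "((\<lambda>t. U t x \<mu>) has_real_derivative dt T U t x \<mu>) (at t within {0..T})"
      using df[OF t mu, of x] unfolding dt_def vector_derivative_works has_real_derivative_iff_has_vector_derivative .
  next
    fix t assume "t \<in> {0..T}"
    then show "cont_P2 UNIV (pd 1 (pd 1 (U t)))" using cont_Theta_slice b2 unfolding bcont_Theta_def by blast
  next
    show "cont_Theta T U" by (rule c)
    show "cont_Theta T (dt T U)" using bt unfolding bcont_Theta_def by blast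
  qed
qed

text \<open>The integrand \<open>g\<close> comes with its own measurability because the arguments
  \<open>z n \<omega>\<close> stem from mean value theorems and may depend on the sample point
  arbitrarily.\<close>

lemma integral_perturb_tendsto:
  fixes f :: "real \<times> real \<Rightarrow> real measure \<Rightarrow> real"
  assumes f: "cont_P2 UNIV f" "\<And>z \<mu>. \<mu> \<in> P2 \<Longrightarrow> \<bar>f z \<mu>\<bar> \<le> C"
    and xi: "\<xi> \<in> LF T" and eta: "\<eta> \<in> LF T" and th: "\<theta> \<longlonglongrightarrow> 0"
    and z: "\<And>\<omega>. (\<lambda>n. z n \<omega>) \<longlonglongrightarrow> x"
    and g: "\<And>n \<omega>. g n \<omega> = f (z n \<omega>, \<xi> \<omega> + \<theta> n * \<eta> \<omega>) (law M (\<lambda>\<omega>. \<xi> \<omega> + \<theta> n * \<eta> \<omega>))" "\<And>n. g n \<in> borel_measurable M"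
  shows "(\<lambda>n. \<integral>\<omega>. g n \<omega> * \<eta> \<omega> \<partial>M) \<longlonglongrightarrow> (\<integral>\<omega>. f (x, \<xi> \<omega>) (law M \<xi>) * \<eta> \<omega> \<partial>M)"
proof (rule integral_dominated_convergence[where w="\<lambda>\<omega>. C * \<bar>\<eta> \<omega>\<bar>"])
  have mP: "law M (\<lambda>\<omega>. \<xi> \<omega> + \<theta> n * \<eta> \<omega>) \<in> P2" for n by (rule LFD(5)[OF LF_add[OF xi LF_scale[OF eta]]])
  have W: "(\<lambda>n. W2 (law M \<xi>) (law M (\<lambda>\<omega>. \<xi> \<omega> + \<theta> n * \<eta> \<omega>))) \<longlonglongrightarrow> 0"
    by (rule W2_perturb_tendsto[where Y="\<lambda>\<omega>. \<bar>\<eta> \<omega>\<bar>", OF xi eta borel_measurable_abs[OF LFD(2)[OF eta]] _ _ th])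
       (simp_all add: LFD(3)[OF eta])
  show "AE \<omega> in M. (\<lambda>n. g n \<omega> * \<eta> \<omega>) \<longlonglongrightarrow> f (x, \<xi> \<omega>) (law M \<xi>) * \<eta> \<omega>"
  proof (rule AE_I2)
    fix \<omega>
    have "(\<lambda>n. \<xi> \<omega> + \<theta> n * \<eta> \<omega>) \<longlonglongrightarrow> \<xi> \<omega> + 0 * \<eta> \<omega>" by (intro tendsto_intros th)
    then have "(\<lambda>n. \<xi> \<omega> + \<theta> n * \<eta> \<omega>) \<longlonglongrightarrow> \<xi> \<omega>" by simp
    from cont_P2_tendsto[OF f(1) _ _ tendsto_Pair[OF z this] LFD(5)[OF xi] mP W]
    show "(\<lambda>n. g n \<omega> * \<eta> \<omega>) \<longlonglongrightarrow> f (x, \<xi> \<omega>) (law M \<xi>) * \<eta> \<omega>" unfolding g by (intro tendsto_intros) simp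
  qed
  show "AE \<omega> in M. norm (g n \<omega> * \<eta> \<omega>) \<le> C * \<bar>\<eta> \<omega>\<bar>" for n
    unfolding g real_norm_def abs_mult by (intro AE_I2 mult_right_mono f mP) simp
  show "integrable M (\<lambda>\<omega>. C * \<bar>\<eta> \<omega>\<bar>)" using LFD(4)[OF eta] by simp
  show "(\<lambda>\<omega>. g n \<omega> * \<eta> \<omega>) \<in> borel_measurable M" for n by (intro borel_measurable_times g LFD(2)[OF eta])
  have "(\<lambda>y. (x, y)) \<in> measurable borel (borel :: (real \<times> real) measure)" by (intro borel_measurable_continuous_onI continuous_intros)
  from measurable_compose[OF LFD(2)[OF xi] measurable_compose[OF this cont_P2_borel[OF f(1) LFD(5)[OF xi]]]]
  show "(\<lambda>\<omega>. f (x, \<xi> \<omega>) (law M \<xi>) * \<eta> \<omega>) \<in> borel_measurable M" by (intro borel_measurable_times LFD(2)[OF eta])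
qed

text \<open>Schwarz's theorem for one space variable and one measure variable. The double increment
  of \<open>U\<close> over \<open>h n\<close> in both is evaluated in two orders: starting with the
  measure it leads to \<open>D1\<close>, starting with space it leads to \<open>E\<close>.\<close>

lemma lions_deriv_commute_weak:
  assumes U: "regular U D D1 D2 C" and U': "regular U' E E1 E2 C'"
    and der: "\<And>\<mu> x. \<mu> \<in> P2 \<Longrightarrow> ((\<lambda>x. U x \<mu>) has_real_derivative U' x \<mu>) (at x)"
    and xi: "\<xi> \<in> LF T" and eta: "\<eta> \<in> LF T"
  shows "(\<integral>\<omega>. D1 (x, \<xi> \<omega>) (law M \<xi>) * \<eta> \<omega> \<partial>M) = (\<integral>\<omega>. E (x, \<xi> \<omega>) (law M \<xi>) * \<eta> \<omega> \<partial>M)"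
proof -
  note R = regularD[OF U] and R' = regularD[OF U']
  define h where "h n = inverse (real (Suc n))" for n
  have h: "h n > 0" "h \<longlonglongrightarrow> 0" for n unfolding h_def by (simp, rule LIMSEQ_inverse_real_of_nat)
  let ?X = "\<lambda>\<theta> \<omega>. \<xi> \<omega> + \<theta> * \<eta> \<omega>"
  let ?m = "\<lambda>\<theta>. law M (?X \<theta>)"
  have X: "?X \<theta> \<in> LF T" for \<theta> by (intro LF_add LF_scale xi eta)
  have m: "?m \<theta> \<in> P2" for \<theta> by (rule LFD(5)[OF X])
  define \<Delta> where "\<Delta> n = U (x + h n) (?m (h n)) - U x (?m (h n)) - (U (x + h n) (?m 0) - U x (?m 0))" for n
  have pm: "(\<lambda>\<omega>. f (c, ?X \<theta> \<omega>) (?m \<theta>)) \<in> borel_measurable M" if "cont_P2 UNIV f" for f \<theta> and c :: real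
  proof -
    have "(\<lambda>y. (c, y)) \<in> measurable borel (borel :: (real \<times> real) measure)" by (intro borel_measurable_continuous_onI continuous_intros)
    from measurable_compose[OF LFD(2)[OF X] measurable_compose[OF this cont_P2_borel[OF that m]]] show ?thesis .
  qed
  have iD: "integrable M (\<lambda>\<omega>. D (c, ?X \<theta> \<omega>) (?m \<theta>) * \<eta> \<omega>)" for c \<theta>
  proof (rule Bochner_Integration.integrable_bound)
    show "integrable M (\<lambda>\<omega>. C * \<eta> \<omega>)" using LFD(4)[OF eta] by simp
    show "AE \<omega> in M. norm (D (c, ?X \<theta> \<omega>) (?m \<theta>) * \<eta> \<omega>) \<le> norm (C * \<eta> \<omega>)"
      unfolding real_norm_def abs_mult by (intro AE_I2 mult_right_mono order_trans[OF R(7)[OF m] abs_ge_self]) simp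
  qed (intro borel_measurable_times pm R LFD(2)[OF eta])
  have 1: "(\<lambda>n. \<Delta> n / (h n)\<^sup>2) \<longlonglongrightarrow> (\<integral>\<omega>. D1 (x, \<xi> \<omega>) (law M \<xi>) * \<eta> \<omega> \<partial>M)"
  proof -
    let ?I = "\<lambda>c \<theta>. \<integral>\<omega>. D (c, ?X \<theta> \<omega>) (?m \<theta>) * \<eta> \<omega> \<partial>M"
    have "\<forall>n. \<exists>\<theta>. 0 < \<theta> \<and> \<theta> < h n \<and> \<Delta> n = h n * (?I (x + h n) \<theta> - ?I x \<theta>)"
    proof
      fix n
      from MVT2[OF h(1)[of n] DERIV_diff[OF lions_path[OF R(1) xi eta, of "x + h n"] lions_path[OF R(1) xi eta, of x]]]
      obtain \<theta> where "0 < \<theta>" "\<theta> < h n" "U (x + h n) (?m (h n)) - U x (?m (h n)) - (U (x + h n) (?m 0) - U x (?m 0)) = (h n - 0) * (?I (x + h n) \<theta> - ?I x \<theta>)" by blast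
      then show "\<exists>\<theta>. 0 < \<theta> \<and> \<theta> < h n \<and> \<Delta> n = h n * (?I (x + h n) \<theta> - ?I x \<theta>)" unfolding \<Delta>_def by (intro exI[of _ \<theta>]) simp
    qed
    from choice[OF this] obtain \<theta> where \<theta>: "\<forall>n. 0 < \<theta> n \<and> \<theta> n < h n \<and> \<Delta> n = h n * (?I (x + h n) (\<theta> n) - ?I x (\<theta> n))" ..
    have \<theta>l: "\<theta> \<longlonglongrightarrow> 0"
      by (rule tendsto_sandwich[OF _ _ tendsto_const h(2)]) (use \<theta> in \<open>auto intro!: always_eventually less_imp_le\<close>)
    define g where "g n \<omega> = (D (x + h n, ?X (\<theta> n) \<omega>) (?m (\<theta> n)) - D (x, ?X (\<theta> n) \<omega>) (?m (\<theta> n))) / h n" for n \<omega>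
    have "\<forall>n. \<forall>\<omega>. \<exists>z. \<bar>z - x\<bar> \<le> h n \<and> g n \<omega> = D1 (z, ?X (\<theta> n) \<omega>) (?m (\<theta> n))"
    proof (intro allI)
      fix n \<omega>
      obtain z where "\<bar>z - x\<bar> \<le> \<bar>x + h n - x\<bar>" "D (x + h n, ?X (\<theta> n) \<omega>) (?m (\<theta> n)) - D (x, ?X (\<theta> n) \<omega>) (?m (\<theta> n)) = D1 (z, ?X (\<theta> n) \<omega>) (?m (\<theta> n)) * (x + h n - x)"
        using mvt_real[OF R(2)[OF m], of x "x + h n"] by blast
      then show "\<exists>z. \<bar>z - x\<bar> \<le> h n \<and> g n \<omega> = D1 (z, ?X (\<theta> n) \<omega>) (?m (\<theta> n))" using h(1)[of n] by (intro exI[of _ z]) (simp add: g_def)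
    qed
    from choice[OF allI[OF choice[OF spec[OF this]]]] obtain z where z: "\<forall>n. \<forall>\<omega>. \<bar>z n \<omega> - x\<bar> \<le> h n \<and> g n \<omega> = D1 (z n \<omega>, ?X (\<theta> n) \<omega>) (?m (\<theta> n))" ..
    have zl: "(\<lambda>n. z n \<omega>) \<longlonglongrightarrow> x" for \<omega>
      by (rule LIM_zero_cancel, rule Lim_null_comparison[OF _ h(2)]) (use z in auto)
    have gm: "g n \<in> borel_measurable M" for n unfolding g_def by (intro borel_measurable_divide borel_measurable_diff borel_measurable_const pm[OF R(4)])
    have "\<Delta> n / (h n)\<^sup>2 = (\<integral>\<omega>. g n \<omega> * \<eta> \<omega> \<partial>M)" for n
    proof -
      have "(\<integral>\<omega>. g n \<omega> * \<eta> \<omega> \<partial>M) = (\<integral>\<omega>. (D (x + h n, ?X (\<theta> n) \<omega>) (?m (\<theta> n)) * \<eta> \<omega> - D (x, ?X (\<theta> n) \<omega>) (?m (\<theta> n)) * \<eta> \<omega>) / h n \<partial>M)"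
        by (simp add: g_def algebra_simps)
      also have "\<dots> = (?I (x + h n) (\<theta> n) - ?I x (\<theta> n)) / h n" using iD by simp
      also have "\<dots> = \<Delta> n / (h n)\<^sup>2" using \<theta>[rule_format, of n] h(1)[of n] by (simp add: power2_eq_square)
      finally show ?thesis by simp
    qed
    moreover have "(\<lambda>n. \<integral>\<omega>. g n \<omega> * \<eta> \<omega> \<partial>M) \<longlonglongrightarrow> (\<integral>\<omega>. D1 (x, \<xi> \<omega>) (law M \<xi>) * \<eta> \<omega> \<partial>M)"
      by (rule integral_perturb_tendsto[where z=z, OF R(5,8) xi eta \<theta>l zl _ gm], assumption) (rule conjunct2[OF z[rule_format]])
    ultimately show ?thesis by simp
  qed
  have 2: "(\<lambda>n. \<Delta> n / (h n)\<^sup>2) \<longlonglongrightarrow> (\<integral>\<omega>. E (x, \<xi> \<omega>) (law M \<xi>) * \<eta> \<omega> \<partial>M)"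
  proof -
    have "\<forall>n. \<exists>p. \<bar>fst p - x\<bar> \<le> h n \<and> \<bar>snd p\<bar> \<le> h n \<and> \<Delta> n / (h n)\<^sup>2 = (\<integral>\<omega>. E (fst p, ?X (snd p) \<omega>) (?m (snd p)) * \<eta> \<omega> \<partial>M)"
    proof
      fix n
      have "x < x + h n" using h(1) by simp
      from MVT2[OF this DERIV_diff[OF der[OF m[of "h n"]] der[OF m[of 0]]]]
      obtain z where z: "x < z" "z < x + h n" "U (x + h n) (?m (h n)) - U (x + h n) (?m 0) - (U x (?m (h n)) - U x (?m 0)) = (x + h n - x) * (U' z (?m (h n)) - U' z (?m 0))" by blast
      from MVT2[OF h(1)[of n] lions_path[OF R'(1) xi eta, of z]] obtain \<theta> where \<theta>: "0 < \<theta>" "\<theta> < h n" 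
        "U' z (?m (h n)) - U' z (?m 0) = (h n - 0) * (\<integral>\<omega>. E (z, ?X \<theta> \<omega>) (?m \<theta>) * \<eta> \<omega> \<partial>M)" by blast
      have "\<Delta> n = (h n)\<^sup>2 * (\<integral>\<omega>. E (z, ?X \<theta> \<omega>) (?m \<theta>) * \<eta> \<omega> \<partial>M)"
        using z(3) unfolding \<theta>(3) \<Delta>_def by (simp add: power2_eq_square algebra_simps)
      then show "\<exists>p. \<bar>fst p - x\<bar> \<le> h n \<and> \<bar>snd p\<bar> \<le> h n \<and> \<Delta> n / (h n)\<^sup>2 = (\<integral>\<omega>. E (fst p, ?X (snd p) \<omega>) (?m (snd p)) * \<eta> \<omega> \<partial>M)"
        using z \<theta> h(1)[of n] by (intro exI[of _ "(z, \<theta>)"]) simp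
    qed
    from choice[OF this] obtain p where p: "\<forall>n. \<bar>fst (p n) - x\<bar> \<le> h n \<and> \<bar>snd (p n)\<bar> \<le> h n \<and> \<Delta> n / (h n)\<^sup>2 = (\<integral>\<omega>. E (fst (p n), ?X (snd (p n)) \<omega>) (?m (snd (p n))) * \<eta> \<omega> \<partial>M)" ..
    have pl: "(\<lambda>n. fst (p n)) \<longlonglongrightarrow> x" by (rule LIM_zero_cancel, rule Lim_null_comparison[OF _ h(2)]) (use p in auto)
    have ql: "(\<lambda>n. snd (p n)) \<longlonglongrightarrow> 0" by (rule Lim_null_comparison[OF _ h(2)]) (use p in auto)
    have "(\<lambda>n. \<integral>\<omega>. E (fst (p n), ?X (snd (p n)) \<omega>) (?m (snd (p n))) * \<eta> \<omega> \<partial>M) \<longlonglongrightarrow> (\<integral>\<omega>. E (x, \<xi> \<omega>) (law M \<xi>) * \<eta> \<omega> \<partial>M)"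
      by (rule integral_perturb_tendsto[where z="\<lambda>n _. fst (p n)", OF R'(4,7) xi eta ql pl refl pm[OF R'(4)]])
    then show ?thesis using p by simp
  qed
  show ?thesis by (rule LIMSEQ_unique[OF 1 2])
qed

text \<open>The weak identity only gives equality almost everywhere for the measure. At an atom this
  means equality at the point itself; mixing \<open>\<mu>\<close> with a point mass at
  \<open>x'\<close> creates an atom, and both sides are continuous as its weight tends to 0.\<close>

lemma lions_deriv_commute:
  assumes U: "regular U D D1 D2 C" and U': "regular U' E E1 E2 C'"
    and der: "\<And>\<mu> x. \<mu> \<in> P2 \<Longrightarrow> ((\<lambda>x. U x \<mu>) has_real_derivative U' x \<mu>) (at x)"
    and mu: "\<mu> \<in> P2"
  shows "D1 (x, x') \<mu> = E (x, x') \<mu>"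
proof -
  note R = regularD[OF U] and R' = regularD[OF U']
  have atom: "D1 (x, x') m = E (x, x') m" if m: "m \<in> P2" and pos: "0 < measure m {x'}" for m
  proof -
    obtain \<xi> where xi: "law M \<xi> = m" "\<xi> \<in> LF T" using realize_P2[OF m] T_in(1) by metis
    define f where "f y = D1 (x, y) m - E (x, y) m" for y
    have "(\<lambda>y. (x, y)) \<in> measurable borel (borel :: (real \<times> real) measure)" by (intro borel_measurable_continuous_onI continuous_intros)
    then have fm: "f \<in> borel_measurable borel" unfolding f_def
      by (intro borel_measurable_diff measurable_compose[OF _ cont_P2_borel[OF R(5) m]] measurable_compose[OF _ cont_P2_borel[OF R'(4) m]])
    \<comment> \<open>The difference of the two sides, evaluated at the state, is itself the test
      direction; the weak identity then says that its second moment vanishes.\<close>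
    define \<eta> where "\<eta> \<omega> = f (\<xi> \<omega>)" for \<omega>
    have fb: "\<bar>f y\<bar> \<le> C + C'" for y
      unfolding f_def by (rule order_trans[OF abs_triangle_ineq4 add_mono[OF R(8)[OF m] R'(7)[OF m]]])
    have em: "\<eta> \<in> borel_measurable (\<F> T)" unfolding \<eta>_def by (rule measurable_compose[OF LFD(1)[OF xi(2)] fm])
    have eta: "\<eta> \<in> LF T" using LF_bounded_mult[OF T_in(1) LF_const[OF T_in(1), of 1] em, of "C + C'"] fb by (simp add: \<eta>_def[abs_def])
    have i: "integrable M (\<lambda>\<omega>. F (x, \<xi> \<omega>) m * \<eta> \<omega>)" if F: "cont_P2 UNIV F" "\<And>z. \<bar>F z m\<bar> \<le> c" for F c
    proof (rule integrable_const_bound[where B="c * (C + C')"])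
      have "0 \<le> c" using F(2)[of 0] by linarith
      then show "AE \<omega> in M. norm (F (x, \<xi> \<omega>) m * \<eta> \<omega>) \<le> c * (C + C')"
        unfolding real_norm_def abs_mult \<eta>_def by (intro AE_I2 mult_mono F fb) auto
      show "(\<lambda>\<omega>. F (x, \<xi> \<omega>) m * \<eta> \<omega>) \<in> borel_measurable M"
        by (intro borel_measurable_times LFD(2)[OF eta] measurable_compose[OF LFD(2)[OF xi(2)] measurable_compose[OF \<open>(\<lambda>y. (x, y)) \<in> _\<close> cont_P2_borel[OF F(1) m]]])
    qed
    have "(\<integral>\<omega>. (\<eta> \<omega>)\<^sup>2 \<partial>M) = (\<integral>\<omega>. D1 (x, \<xi> \<omega>) m * \<eta> \<omega> - E (x, \<xi> \<omega>) m * \<eta> \<omega> \<partial>M)"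
      by (intro Bochner_Integration.integral_cong) (auto simp: \<eta>_def f_def power2_eq_square algebra_simps)
    also have "\<dots> = 0"
      using i[OF R(5) R(8)[OF m]] i[OF R'(4) R'(7)[OF m]] lions_deriv_commute_weak[OF U U' der xi(2) eta, of x] by (simp add: xi(1))
    finally have "AE \<omega> in M. (\<eta> \<omega>)\<^sup>2 = 0" using integral_nonneg_eq_0_iff_AE[OF LFD(3)[OF eta]] by simp
    then have ae: "AE \<omega> in M. f (\<xi> \<omega>) = 0" by (simp add: \<eta>_def)
    have "f x' = 0"
    proof (rule ccontr)
      assume "f x' \<noteq> 0"
      with ae have "AE \<omega> in M. \<xi> \<omega> \<noteq> x'" by (auto elim: eventually_mono)
      then have "AE \<omega> in M. \<omega> \<notin> \<xi> -` {x'} \<inter> space M" by (rule eventually_mono) simp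
      moreover have "\<xi> -` {x'} \<inter> space M \<in> events" by (rule measurable_sets[OF LFD(2)[OF xi(2)]]) simp
      ultimately have "prob (\<xi> -` {x'} \<inter> space M) = 0" using prob_eq_0 by blast
      moreover have "measure m {x'} = prob (\<xi> -` {x'} \<inter> space M)"
        unfolding xi(1)[symmetric] law_def by (rule measure_distr[OF LFD(2)[OF xi(2)]]) simp
      ultimately show False using pos by simp
    qed
    then show ?thesis by (simp add: f_def)
  qed
  \<comment> \<open>The point mass at \<open>x'\<close>, obtained as the law of a constant.\<close>
  define \<delta> where "\<delta> = law \<mu> (\<lambda>_. x')"
  interpret \<mu>: prob_space \<mu> by (rule P2D(1)[OF mu])
  have dP: "\<delta> \<in> P2" unfolding \<delta>_def by (rule law_P2[OF P2D(1)[OF mu]]) auto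
  have d1: "measure \<delta> {x'} = 1" unfolding \<delta>_def law_def by (subst measure_distr) (auto simp: \<mu>.prob_space)
  define p where "p n = inverse (real (Suc n))" for n
  have p: "p n \<in> {0..1}" "0 < p n" for n by (auto simp: p_def inverse_le_1_iff)
  have pl: "p \<longlonglongrightarrow> 0" unfolding p_def by (rule LIMSEQ_inverse_real_of_nat)
  let ?m = "\<lambda>n. mix (p n) \<mu> \<delta>"
  have mP: "?m n \<in> P2" for n by (rule mix_P2[OF mu dP p(1)])
  have Wl: "(\<lambda>n. W2 \<mu> (?m n)) \<longlonglongrightarrow> 0"
  proof (rule tendsto_sandwich[OF _ _ tendsto_const])
    show "\<forall>\<^sub>F n in sequentially. 0 \<le> W2 \<mu> (?m n)"
      by (intro always_eventually allI W2_nonneg mu mP)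
    show "\<forall>\<^sub>F n in sequentially. W2 \<mu> (?m n) \<le> sqrt (p n * (\<integral>z. (fst z - snd z)\<^sup>2 \<partial>(\<mu> \<Otimes>\<^sub>M \<delta>)))"
      by (intro always_eventually allI W2_mix_le mu dP p)
    have "(\<lambda>n. sqrt (p n * (\<integral>z. (fst z - snd z)\<^sup>2 \<partial>(\<mu> \<Otimes>\<^sub>M \<delta>)))) \<longlonglongrightarrow> sqrt (0 * (\<integral>z. (fst z - snd z)\<^sup>2 \<partial>(\<mu> \<Otimes>\<^sub>M \<delta>)))"
      by (intro tendsto_intros pl)
    then show "(\<lambda>n. sqrt (p n * (\<integral>z. (fst z - snd z)\<^sup>2 \<partial>(\<mu> \<Otimes>\<^sub>M \<delta>)))) \<longlonglongrightarrow> 0" by simp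
  qed
  have "D1 (x, x') (?m n) = E (x, x') (?m n)" for n
  proof (rule atom[OF mP])
    have "measure (?m n) {x'} = (1 - p n) * measure \<mu> {x'} + p n * measure \<delta> {x'}" by (rule measure_mix[OF mu dP p(1)]) simp
    then show "0 < measure (?m n) {x'}" using p[of n] by (simp add: d1 add_nonneg_pos)
  qed
  moreover have "(\<lambda>n. D1 (x, x') (?m n)) \<longlonglongrightarrow> D1 (x, x') \<mu>"
    by (rule cont_P2_tendsto[OF R(5) _ _ tendsto_const mu mP Wl]) auto
  moreover have "(\<lambda>n. E (x, x') (?m n)) \<longlonglongrightarrow> E (x, x') \<mu>"
    by (rule cont_P2_tendsto[OF R'(4) _ _ tendsto_const mu mP Wl]) auto
  ultimately show ?thesis using LIMSEQ_unique by simp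
qed

end

section \<open>The second-order form\<close>

text \<open>Here \<open>g\<close> plays the role of the derivative of \<open>V\<close> in
  \<open>x\<close> and the measure, and \<open>y\<close> that of the new variable; \<open>g\<close>,
  \<open>gy\<close>, \<open>gx\<close>, \<open>gxy\<close> are the matrix entries read row by
  row.\<close>

locale second_order = mfg_space M \<G>0 B T
  for M :: "'w measure" and \<G>0 :: "'w measure" and B :: "real \<Rightarrow> 'w \<Rightarrow> real" and T :: real +
  fixes g gx gy gxy :: "real \<times> real \<Rightarrow> real measure \<Rightarrow> real" and C :: real
  assumes cont: "cont_P2 UNIV g" "cont_P2 UNIV gx" "cont_P2 UNIV gy" "cont_P2 UNIV gxy"
    and bound: "\<And>z \<mu>. \<mu> \<in> P2 \<Longrightarrow> \<bar>g z \<mu>\<bar> \<le> C" "\<And>z \<mu>. \<mu> \<in> P2 \<Longrightarrow> \<bar>gx z \<mu>\<bar> \<le> C"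
      "\<And>z \<mu>. \<mu> \<in> P2 \<Longrightarrow> \<bar>gy z \<mu>\<bar> \<le> C" "\<And>z \<mu>. \<mu> \<in> P2 \<Longrightarrow> \<bar>gxy z \<mu>\<bar> \<le> C"
    and der_x: "\<And>x y \<mu>. \<mu> \<in> P2 \<Longrightarrow> ((\<lambda>x. g (x, y) \<mu>) has_real_derivative gx (x, y) \<mu>) (at x)"
    and der_y: "\<And>x y \<mu>. \<mu> \<in> P2 \<Longrightarrow> ((\<lambda>y. g (x, y) \<mu>) has_real_derivative gy (x, y) \<mu>) (at y)"
    and der_xy: "\<And>x y \<mu>. \<mu> \<in> P2 \<Longrightarrow> ((\<lambda>y. gx (x, y) \<mu>) has_real_derivative gxy (x, y) \<mu>) (at y)"
    and LL: "\<And>\<xi> \<eta>. \<xi> \<in> LF T \<Longrightarrow> \<eta> \<in> LF T \<Longrightarrow>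
       0 \<le> (\<integral>p. g (\<xi> (fst p), \<xi> (snd p)) (law M \<xi>) * \<eta> (fst p) * \<eta> (snd p) \<partial>(M \<Otimes>\<^sub>M M))"
begin

text \<open>The bilinear form of the matrix, with \<open>(p1, p2)\<close> on the left and
  \<open>(q1, q2)\<close> on the right.\<close>

definition quad :: "real measure \<Rightarrow> real \<Rightarrow> real \<Rightarrow> real \<Rightarrow> real \<Rightarrow> real \<Rightarrow> real \<Rightarrow> real" where
  "quad \<mu> x y p1 p2 q1 q2 = g (x, y) \<mu> * (p1 * q1) + gy (x, y) \<mu> * (p1 * q2) + gx (x, y) \<mu> * (p2 * q1) + gxy (x, y) \<mu> * (p2 * q2)"

text \<open>The integrand of the first-order form for perturbed data, where \<open>c\<close> and
  \<open>d\<close> are the signs attached to the two independent copies.\<close>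

definition corner :: "real measure \<Rightarrow> real \<Rightarrow> real \<Rightarrow> real \<Rightarrow> real \<Rightarrow> real \<Rightarrow> real \<Rightarrow> real \<Rightarrow> real \<Rightarrow> real \<Rightarrow> real" where
  "corner \<mu> e x y p1 p2 q1 q2 c d = g (x + c * e, y + d * e) \<mu> * (p1 + c * p2 / e) * (q1 + d * q2 / e)"

definition corners :: "real measure \<Rightarrow> real \<Rightarrow> real \<Rightarrow> real \<Rightarrow> real \<Rightarrow> real \<Rightarrow> real \<Rightarrow> real \<Rightarrow> real" where
  "corners \<mu> e x y p1 p2 q1 q2 = (corner \<mu> e x y p1 p2 q1 q2 1 1 + corner \<mu> e x y p1 p2 q1 q2 1 (-1)
     + corner \<mu> e x y p1 p2 q1 q2 (-1) 1 + corner \<mu> e x y p1 p2 q1 q2 (-1) (-1)) / 4"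

text \<open>Averaging over the four sign pairs sorts the expression into sums and differences of
  \<open>g\<close> at the corners of a square of half-width \<open>e\<close>, and each power of
  \<open>1 / e\<close> is matched by a difference quotient. The mean points do not depend on the
  vectors; being within \<open>2 * e\<close> of a lower edge, they are within \<open>3 * e\<close>
  of the centre.\<close>

lemma corners_eq:
  assumes mu: "\<mu> \<in> P2" and e: "0 < e"
  obtains u u' v v' w w' where "\<bar>u - y\<bar> \<le> 3 * e" "\<bar>u' - y\<bar> \<le> 3 * e" "\<bar>v - x\<bar> \<le> 3 * e" "\<bar>v' - x\<bar> \<le> 3 * e" "\<bar>w - x\<bar> \<le> 3 * e" "\<bar>w' - y\<bar> \<le> 3 * e"
    "\<And>p1 p2 q1 q2. corners \<mu> e x y p1 p2 q1 q2 =
       (g (x + e, y + e) \<mu> + g (x + e, y - e) \<mu> + g (x - e, y + e) \<mu> + g (x - e, y - e) \<mu>) / 4 * (p1 * q1)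
     + (gy (x + e, u) \<mu> + gy (x - e, u') \<mu>) / 2 * (p1 * q2)
     + (gx (v, y + e) \<mu> + gx (v', y - e) \<mu>) / 2 * (p2 * q1)
     + gxy (w, w') \<mu> * (p2 * q2)"
proof -
  have near: "\<bar>z - c\<bar> \<le> 3 * e" if "\<bar>z - (c - e)\<bar> \<le> \<bar>c + e - (c - e)\<bar>" for z c :: real
    using that e by linarith
  obtain u where u: "\<bar>u - (y - e)\<bar> \<le> \<bar>y + e - (y - e)\<bar>" "g (x + e, y + e) \<mu> - g (x + e, y - e) \<mu> = gy (x + e, u) \<mu> * (y + e - (y - e))"
    using mvt_real[OF der_y[OF mu]] by blast
  obtain u' where u': "\<bar>u' - (y - e)\<bar> \<le> \<bar>y + e - (y - e)\<bar>" "g (x - e, y + e) \<mu> - g (x - e, y - e) \<mu> = gy (x - e, u') \<mu> * (y + e - (y - e))"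
    using mvt_real[OF der_y[OF mu]] by blast
  obtain v where v: "\<bar>v - (x - e)\<bar> \<le> \<bar>x + e - (x - e)\<bar>" "g (x + e, y + e) \<mu> - g (x - e, y + e) \<mu> = gx (v, y + e) \<mu> * (x + e - (x - e))"
    using mvt_real[OF der_x[OF mu]] by blast
  obtain v' where v': "\<bar>v' - (x - e)\<bar> \<le> \<bar>x + e - (x - e)\<bar>" "g (x + e, y - e) \<mu> - g (x - e, y - e) \<mu> = gx (v', y - e) \<mu> * (x + e - (x - e))"
    using mvt_real[OF der_x[OF mu]] by blast
  obtain w where w: "\<bar>w - (x - e)\<bar> \<le> \<bar>x + e - (x - e)\<bar>"
    "g (x + e, y + e) \<mu> - g (x + e, y - e) \<mu> - (g (x - e, y + e) \<mu> - g (x - e, y - e) \<mu>) = (gx (w, y + e) \<mu> - gx (w, y - e) \<mu>) * (x + e - (x - e))"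
    using mvt_real[OF DERIV_diff[OF der_x[OF mu, of "y + e"] der_x[OF mu, of "y - e"]]] by blast
  obtain w' where w': "\<bar>w' - (y - e)\<bar> \<le> \<bar>y + e - (y - e)\<bar>" "gx (w, y + e) \<mu> - gx (w, y - e) \<mu> = gxy (w, w') \<mu> * (y + e - (y - e))"
    using mvt_real[OF der_xy[OF mu]] by blast
  show thesis
  proof (rule that[OF near[OF u(1)] near[OF u'(1)] near[OF v(1)] near[OF v'(1)] near[OF w(1)] near[OF w'(1)]])
    fix p1 p2 q1 q2
    define a b c d where abcd: "a = g (x + e, y + e) \<mu>" "b = g (x + e, y - e) \<mu>" "c = g (x - e, y + e) \<mu>" "d = g (x - e, y - e) \<mu>"
    have 1: "(gy (x + e, u) \<mu> + gy (x - e, u') \<mu>) / 2 = (a - b + (c - d)) / (4 * e)"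
      using u(2) u'(2) e by (simp add: abcd field_simps)
    have 2: "(gx (v, y + e) \<mu> + gx (v', y - e) \<mu>) / 2 = (a - c + (b - d)) / (4 * e)"
      using v(2) v'(2) e by (simp add: abcd field_simps)
    have 3: "gxy (w, w') \<mu> = (a - b - (c - d)) / (4 * e\<^sup>2)"
      using w(2) e unfolding w'(2) by (simp add: abcd field_simps power2_eq_square)
    have "corners \<mu> e x y p1 p2 q1 q2 = (a * (p1 + p2 / e) * (q1 + q2 / e) + b * (p1 + p2 / e) * (q1 - q2 / e) + c * (p1 - p2 / e) * (q1 + q2 / e) + d * (p1 - p2 / e) * (q1 - q2 / e)) / 4"
      by (simp add: corners_def corner_def abcd)
    also have "\<dots> = (a + b + c + d) / 4 * (p1 * q1) + (a - b + (c - d)) / (4 * e) * (p1 * q2) + (a - c + (b - d)) / (4 * e) * (p2 * q1) + (a - b - (c - d)) / (4 * e\<^sup>2) * (p2 * q2)"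
      using e by (simp add: field_simps power2_eq_square)
    finally show "corners \<mu> e x y p1 p2 q1 q2 =
       (g (x + e, y + e) \<mu> + g (x + e, y - e) \<mu> + g (x - e, y + e) \<mu> + g (x - e, y - e) \<mu>) / 4 * (p1 * q1)
     + (gy (x + e, u) \<mu> + gy (x - e, u') \<mu>) / 2 * (p1 * q2)
     + (gx (v, y + e) \<mu> + gx (v', y - e) \<mu>) / 2 * (p2 * q1)
     + gxy (w, w') \<mu> * (p2 * q2)" unfolding 1 2 3 abcd .
  qed
qed

lemma form_bound:
  assumes "\<bar>a\<bar> \<le> C" "\<bar>b\<bar> \<le> C" "\<bar>c\<bar> \<le> C" "\<bar>d\<bar> \<le> C"
  shows "\<bar>a * (p1 * q1) + b * (p1 * q2) + c * (p2 * q1) + d * (p2 * q2)\<bar> \<le> C * (\<bar>p1\<bar> + \<bar>p2\<bar>) * (\<bar>q1\<bar> + \<bar>q2\<bar>)"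
proof -
  have "\<bar>a * (p1 * q1) + b * (p1 * q2) + c * (p2 * q1) + d * (p2 * q2)\<bar> \<le> \<bar>a * (p1 * q1)\<bar> + \<bar>b * (p1 * q2)\<bar> + \<bar>c * (p2 * q1)\<bar> + \<bar>d * (p2 * q2)\<bar>" by linarith
  also have "\<dots> \<le> C * \<bar>p1 * q1\<bar> + C * \<bar>p1 * q2\<bar> + C * \<bar>p2 * q1\<bar> + C * \<bar>p2 * q2\<bar>"
    using assms by (intro add_mono) (simp_all add: abs_mult[of a] abs_mult[of b] abs_mult[of c] abs_mult[of d] mult_right_mono)
  also have "\<dots> = C * (\<bar>p1\<bar> + \<bar>p2\<bar>) * (\<bar>q1\<bar> + \<bar>q2\<bar>)" by (simp add: abs_mult algebra_simps)
  finally show ?thesis .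
qed

text \<open>The bound is uniform in \<open>e\<close> although each corner contains factors
  \<open>1 / e\<close>; this is what dominates the limit.\<close>

lemma corners_bound:
  assumes mu: "\<mu> \<in> P2" and e: "0 < e"
  shows "\<bar>corners \<mu> e x y p1 p2 q1 q2\<bar> \<le> C * (\<bar>p1\<bar> + \<bar>p2\<bar>) * (\<bar>q1\<bar> + \<bar>q2\<bar>)"
proof -
  have 4: "\<bar>(a + b + c + d) / 4\<bar> \<le> C" if "\<bar>a\<bar> \<le> C" "\<bar>b\<bar> \<le> C" "\<bar>c\<bar> \<le> C" "\<bar>d\<bar> \<le> C" for a b c d using that by (simp add: abs_le_iff)
  have 2: "\<bar>(a + b) / 2\<bar> \<le> C" if "\<bar>a\<bar> \<le> C" "\<bar>b\<bar> \<le> C" for a b using that by (simp add: abs_le_iff)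
  show ?thesis
    by (rule corners_eq[OF mu e, of y x], simp only:) (intro form_bound 4 2 bound mu)
qed

lemma corners_tendsto:
  assumes mu: "\<mu> \<in> P2" "\<And>n. \<mu>n n \<in> P2" "(\<lambda>n. W2 \<mu> (\<mu>n n)) \<longlonglongrightarrow> 0" and e: "\<And>n. 0 < e n" "e \<longlonglongrightarrow> 0"
  shows "(\<lambda>n. corners (\<mu>n n) (e n) x y p1 p2 q1 q2) \<longlonglongrightarrow> quad \<mu> x y p1 p2 q1 q2"
proof -
  let ?P = "\<lambda>n z. \<bar>z 0 - y\<bar> \<le> 3 * e n \<and> \<bar>z 1 - y\<bar> \<le> 3 * e n \<and> \<bar>z 2 - x\<bar> \<le> 3 * e n \<and> \<bar>z 3 - x\<bar> \<le> 3 * e n \<and> \<bar>z 4 - x\<bar> \<le> 3 * e n \<and> \<bar>z 5 - y\<bar> \<le> 3 * e n \<and>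
     corners (\<mu>n n) (e n) x y p1 p2 q1 q2 =
       (g (x + e n, y + e n) (\<mu>n n) + g (x + e n, y - e n) (\<mu>n n) + g (x - e n, y + e n) (\<mu>n n) + g (x - e n, y - e n) (\<mu>n n)) / 4 * (p1 * q1)
     + (gy (x + e n, z 0) (\<mu>n n) + gy (x - e n, z 1) (\<mu>n n)) / 2 * (p1 * q2)
     + (gx (z 2, y + e n) (\<mu>n n) + gx (z 3, y - e n) (\<mu>n n)) / 2 * (p2 * q1)
     + gxy (z 4, z 5) (\<mu>n n) * (p2 * q2)"
  \<comment> \<open>The six mean points are packed into one function of an index, so that a single
    choice over \<open>n\<close> suffices.\<close>
  have "\<forall>n. \<exists>z :: nat \<Rightarrow> real. ?P n z"
  proof
    fix n
    obtain u u' v v' w w' where *: "\<bar>u - y\<bar> \<le> 3 * e n" "\<bar>u' - y\<bar> \<le> 3 * e n" "\<bar>v - x\<bar> \<le> 3 * e n" "\<bar>v' - x\<bar> \<le> 3 * e n" "\<bar>w - x\<bar> \<le> 3 * e n" "\<bar>w' - y\<bar> \<le> 3 * e n"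
    "\<And>p1 p2 q1 q2. corners (\<mu>n n) (e n) x y p1 p2 q1 q2 =
       (g (x + e n, y + e n) (\<mu>n n) + g (x + e n, y - e n) (\<mu>n n) + g (x - e n, y + e n) (\<mu>n n) + g (x - e n, y - e n) (\<mu>n n)) / 4 * (p1 * q1)
     + (gy (x + e n, u) (\<mu>n n) + gy (x - e n, u') (\<mu>n n)) / 2 * (p1 * q2)
     + (gx (v, y + e n) (\<mu>n n) + gx (v', y - e n) (\<mu>n n)) / 2 * (p2 * q1)
     + gxy (w, w') (\<mu>n n) * (p2 * q2)" by (rule corners_eq[OF mu(2)[of n] e(1)[of n], of y x]) (rule that; assumption)
    show "\<exists>z :: nat \<Rightarrow> real. ?P n z"
      by (intro exI[of _ "\<lambda>i. [u, u', v, v', w, w'] ! i"]) (simp add: *(1-6) *(7)[of p1 p2 q1 q2] numeral_nat)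
  qed
  from choice[OF this] obtain z :: "nat \<Rightarrow> nat \<Rightarrow> real" where z: "\<forall>n. ?P n (z n)" ..
  have e3: "(\<lambda>n. 3 * e n) \<longlonglongrightarrow> 0" using tendsto_mult_right_zero[OF e(2)] .
  have near: "(\<lambda>n. z n i) \<longlonglongrightarrow> c" if "\<And>n. \<bar>z n i - c\<bar> \<le> 3 * e n" for i c
    by (rule LIM_zero_cancel, rule Lim_null_comparison[OF _ e3]) (simp add: that)
  have zl: "(\<lambda>n. z n 0) \<longlonglongrightarrow> y" "(\<lambda>n. z n 1) \<longlonglongrightarrow> y" "(\<lambda>n. z n 2) \<longlonglongrightarrow> x" "(\<lambda>n. z n 3) \<longlonglongrightarrow> x" "(\<lambda>n. z n 4) \<longlonglongrightarrow> x" "(\<lambda>n. z n 5) \<longlonglongrightarrow> y"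
    by (rule near, use z in blast)+
  have pl: "(\<lambda>n. c + e n) \<longlonglongrightarrow> c" "(\<lambda>n. c - e n) \<longlonglongrightarrow> c" for c
    using tendsto_add[OF tendsto_const e(2), of c] tendsto_diff[OF tendsto_const e(2), of c] by simp_all
  have l: "(\<lambda>n. f (s n, t n) (\<mu>n n)) \<longlonglongrightarrow> f (x, y) \<mu>" if "cont_P2 UNIV f" "s \<longlonglongrightarrow> x" "t \<longlonglongrightarrow> y" for f s t
    using cont_P2_tendsto[OF that(1) _ _ tendsto_Pair[OF that(2,3)] mu] by simp
  have "(\<lambda>n. (g (x + e n, y + e n) (\<mu>n n) + g (x + e n, y - e n) (\<mu>n n) + g (x - e n, y + e n) (\<mu>n n) + g (x - e n, y - e n) (\<mu>n n)) / 4 * (p1 * q1)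
     + (gy (x + e n, z n 0) (\<mu>n n) + gy (x - e n, z n 1) (\<mu>n n)) / 2 * (p1 * q2)
     + (gx (z n 2, y + e n) (\<mu>n n) + gx (z n 3, y - e n) (\<mu>n n)) / 2 * (p2 * q1)
     + gxy (z n 4, z n 5) (\<mu>n n) * (p2 * q2))
    \<longlonglongrightarrow> (g (x, y) \<mu> + g (x, y) \<mu> + g (x, y) \<mu> + g (x, y) \<mu>) / 4 * (p1 * q1) + (gy (x, y) \<mu> + gy (x, y) \<mu>) / 2 * (p1 * q2)
      + (gx (x, y) \<mu> + gx (x, y) \<mu>) / 2 * (p2 * q1) + gxy (x, y) \<mu> * (p2 * q2)"
    by (intro tendsto_add tendsto_mult tendsto_divide tendsto_const l cont pl zl) simp_all
  then show ?thesis using z by (simp add: quad_def)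
qed

section \<open>An independent fair sign for countably valued data, and the passage to general
  data\<close>

lemma product_dominated:
  fixes F :: "'w \<times> 'w \<Rightarrow> real"
  assumes F: "F \<in> borel_measurable (M \<Otimes>\<^sub>M M)" and Y: "integrable M Y"
    and b: "\<And>\<omega> \<omega>'. \<bar>F (\<omega>, \<omega>')\<bar> \<le> c * Y \<omega> * Y \<omega>'"
  shows "integrable (M \<Otimes>\<^sub>M M) F" "(\<integral>p. F p \<partial>(M \<Otimes>\<^sub>M M)) = (\<integral>\<omega>. \<integral>\<omega>'. F (\<omega>, \<omega>') \<partial>M \<partial>M)" "integrable (M \<Otimes>\<^sub>M M) (\<lambda>p. c * Y (fst p) * Y (snd p))"
proof -
  interpret PP: pair_prob_space M M ..
  have Ym: "Y \<in> borel_measurable M" using Y by simp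
  have "(\<lambda>p. c * Y (fst p) * Y (snd p)) \<in> borel_measurable (M \<Otimes>\<^sub>M M)"
    by (intro borel_measurable_times borel_measurable_const measurable_compose[OF measurable_fst Ym] measurable_compose[OF measurable_snd Ym])
  then show iY: "integrable (M \<Otimes>\<^sub>M M) (\<lambda>p. c * Y (fst p) * Y (snd p))"
  proof (rule PP.Fubini_integrable)
    have "integrable M (\<lambda>x. \<bar>c\<bar> * \<bar>Y x\<bar> * (\<integral>y. \<bar>Y y\<bar> \<partial>M))" using Y by simp
    then show "integrable M (\<lambda>x. \<integral>y. norm (c * Y (fst (x, y)) * Y (snd (x, y))) \<partial>M)" by (simp add: abs_mult)
    show "AE x in M. integrable M (\<lambda>y. c * Y (fst (x, y)) * Y (snd (x, y)))" using Y by simp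
  qed
  show i: "integrable (M \<Otimes>\<^sub>M M) F"
  proof (rule Bochner_Integration.integrable_bound[OF iY F], rule AE_I2)
    fix p :: "'w \<times> 'w"
    show "norm (F p) \<le> norm (c * Y (fst p) * Y (snd p))" using b[of "fst p" "snd p"] order_trans[OF _ abs_ge_self] by simp
  qed
  show "(\<integral>p. F p \<partial>(M \<Otimes>\<^sub>M M)) = (\<integral>\<omega>. \<integral>\<omega>'. F (\<omega>, \<omega>') \<partial>M \<partial>M)" by (rule PP.integral_fst'[OF i, symmetric])
qed

text \<open>\<open>K\<close> and a coin on a product space are packed into the single number
  \<open>2 * K\<close> plus the coin, whose law is carried by the initial sigma-algebra. The
  resulting \<open>I\<close> reproduces the joint law without being related to \<open>K\<close>
  pointwise; halving and parity recover the components.\<close>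

lemma coin_copy:
  fixes K :: "'w \<Rightarrow> nat"
  assumes K: "K \<in> measurable M (count_space UNIV)"
  obtains I :: "'w \<Rightarrow> nat" where "I \<in> measurable \<G>0 (count_space UNIV)"
    "\<And>\<phi> :: nat \<Rightarrow> real. integrable M (\<lambda>\<omega>. \<phi> (2 * K \<omega> + 1)) \<Longrightarrow> integrable M (\<lambda>\<omega>. \<phi> (2 * K \<omega>)) \<Longrightarrow> integrable M (\<lambda>\<omega>. \<phi> (I \<omega>))"
    "\<And>\<phi> :: nat \<Rightarrow> real. integrable M (\<lambda>\<omega>. \<phi> (2 * K \<omega> + 1)) \<Longrightarrow> integrable M (\<lambda>\<omega>. \<phi> (2 * K \<omega>)) \<Longrightarrow>
       (\<integral>\<omega>. \<phi> (I \<omega>) \<partial>M) = ((\<integral>\<omega>. \<phi> (2 * K \<omega> + 1) \<partial>M) + (\<integral>\<omega>. \<phi> (2 * K \<omega>) \<partial>M)) / 2"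
proof -
  let ?N = "measure_pmf (bernoulli_pmf (1 / 2)) \<Otimes>\<^sub>M M"
  interpret N: pair_prob_space "measure_pmf (bernoulli_pmf (1 / 2))" M ..
  define S where "S z = real (2 * K (snd z) + (if fst z then 1 else 0))" for z :: "bool \<times> 'w"
  have "S \<in> borel_measurable (count_space UNIV \<Otimes>\<^sub>M M)"
  proof (rule measurable_pair_measure_countable1)
    fix c :: bool
    show "(\<lambda>\<omega>. S (c, \<omega>)) \<in> borel_measurable M"
    proof -
      have "(\<lambda>k. real (2 * k + (if c then 1 else 0))) \<in> borel_measurable (count_space UNIV)" by simp
      from measurable_compose[OF K this] show ?thesis by (simp only: S_def fst_conv snd_conv)
    qed
  qed simp
  also have "borel_measurable (count_space UNIV \<Otimes>\<^sub>M M) = borel_measurable ?N"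
    by (intro measurable_cong_sets sets_pair_measure_cong) auto
  finally have S: "S \<in> borel_measurable ?N" .
  have "prob_space (law ?N S)" unfolding law_def by (rule N.prob_space_distr[OF S])
  moreover have "\<forall>\<mu>::real measure. prob_space \<mu> \<and> sets \<mu> = sets borel \<longrightarrow> (\<exists>\<xi>\<in>borel_measurable \<G>0. law M \<xi> = \<mu>)"
    using filtered unfolding filtered_space_def by blast
  ultimately obtain J where J: "J \<in> borel_measurable \<G>0" "law M J = law ?N S"
    using sets_law by blast
  have JM: "J \<in> borel_measurable M" using J(1) by (rule measurable_from_subalg[OF subalgebra_G0])
  \<comment> \<open>\<open>J\<close> has natural values only almost surely; the floor and
    \<open>nat\<close> make \<open>I\<close> natural-valued everywhere.\<close>
  define I where "I \<omega> = nat \<lfloor>J \<omega>\<rfloor>" for \<omega>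
  have *: "integrable M (\<lambda>\<omega>. \<phi> (I \<omega>)) \<and> (\<integral>\<omega>. \<phi> (I \<omega>) \<partial>M) = ((\<integral>\<omega>. \<phi> (2 * K \<omega> + 1) \<partial>M) + (\<integral>\<omega>. \<phi> (2 * K \<omega>) \<partial>M)) / 2"
    if i: "integrable M (\<lambda>\<omega>. \<phi> (2 * K \<omega> + 1))" "integrable M (\<lambda>\<omega>. \<phi> (2 * K \<omega>))" for \<phi> :: "nat \<Rightarrow> real"
  proof -
    define \<psi> where "\<psi> y = \<phi> (nat \<lfloor>y\<rfloor>)" for y :: real
    have pm: "\<psi> \<in> borel_measurable borel" unfolding \<psi>_def by measurable
    have e: "\<psi> (S z) = (if fst z then \<phi> (2 * K (snd z) + 1) else \<phi> (2 * K (snd z)))" for z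
      unfolding \<psi>_def S_def floor_of_nat nat_int by simp
    have ii: "integrable M (if c then (\<lambda>\<omega>. \<phi> (2 * K \<omega> + 1)) else (\<lambda>\<omega>. \<phi> (2 * K \<omega>)))" for c
      using i by (cases c) auto
    have "integrable ?N (\<lambda>z. (if fst z then (\<lambda>\<omega>. \<phi> (2 * K \<omega> + 1)) else (\<lambda>\<omega>. \<phi> (2 * K \<omega>))) (snd z))"
      "(\<integral>z. (if fst z then (\<lambda>\<omega>. \<phi> (2 * K \<omega> + 1)) else (\<lambda>\<omega>. \<phi> (2 * K \<omega>))) (snd z) \<partial>?N) = ((\<integral>\<omega>. \<phi> (2 * K \<omega> + 1) \<partial>M) + (\<integral>\<omega>. \<phi> (2 * K \<omega>) \<partial>M)) / 2"
      using bernoulli_pair[where f="\<lambda>c. if c then (\<lambda>\<omega>. \<phi> (2 * K \<omega> + 1)) else (\<lambda>\<omega>. \<phi> (2 * K \<omega>))" and p="1 / 2", OF prob_space_axioms ii]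
      by (simp_all add: add_divide_distrib)
    moreover have "(\<lambda>z. (if fst z then (\<lambda>\<omega>. \<phi> (2 * K \<omega> + 1)) else (\<lambda>\<omega>. \<phi> (2 * K \<omega>))) (snd z)) = (\<lambda>z. \<psi> (S z))"
      by (auto simp: e)
    ultimately have "integrable ?N (\<lambda>z. \<psi> (S z))" "(\<integral>z. \<psi> (S z) \<partial>?N) = ((\<integral>\<omega>. \<phi> (2 * K \<omega> + 1) \<partial>M) + (\<integral>\<omega>. \<phi> (2 * K \<omega>) \<partial>M)) / 2" by simp_all
    then have "integrable M (\<lambda>\<omega>. \<psi> (J \<omega>))" "(\<integral>\<omega>. \<psi> (J \<omega>) \<partial>M) = ((\<integral>\<omega>. \<phi> (2 * K \<omega> + 1) \<partial>M) + (\<integral>\<omega>. \<phi> (2 * K \<omega>) \<partial>M)) / 2"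
      unfolding integrable_law_iff[OF S pm, symmetric] integral_law[OF S pm, symmetric] J(2)[symmetric]
      unfolding integrable_law_iff[OF JM pm] integral_law[OF JM pm] by simp_all
    then show ?thesis by (simp add: \<psi>_def I_def)
  qed
  show thesis
  proof (rule that[of I])
    show "I \<in> measurable \<G>0 (count_space UNIV)" unfolding I_def using J(1) by measurable
  qed (use * in blast)+
qed

lemma kernel_measurable:
  fixes f :: "real \<times> real \<Rightarrow> real measure \<Rightarrow> real"
  assumes X: "X \<in> borel_measurable M" and mu: "\<mu> \<in> P2" and f: "cont_P2 UNIV f"
  shows "(\<lambda>p. f (X (fst p), X (snd p)) \<mu>) \<in> borel_measurable (M \<Otimes>\<^sub>M M)"
proof -
  have "(\<lambda>p. (X (fst p), X (snd p))) \<in> borel_measurable (M \<Otimes>\<^sub>M M)"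
    unfolding borel_prod[symmetric] by (intro measurable_Pair measurable_compose[OF measurable_fst X] measurable_compose[OF measurable_snd X])
  from measurable_compose[OF this cont_P2_borel[OF f mu]] show ?thesis .
qed

lemma quad_measurable:
  assumes mu: "\<mu> \<in> P2" and X: "X \<in> borel_measurable M" and P: "p1 \<in> borel_measurable M" "p2 \<in> borel_measurable M"
  shows "(\<lambda>p. quad \<mu> (X (fst p)) (X (snd p)) (p1 (fst p)) (p2 (fst p)) (p1 (snd p)) (p2 (snd p))) \<in> borel_measurable (M \<Otimes>\<^sub>M M)"
  unfolding quad_def
  by (intro borel_measurable_add borel_measurable_times kernel_measurable[OF X mu] cont
        measurable_compose[OF measurable_fst P(1)] measurable_compose[OF measurable_fst P(2)] measurable_compose[OF measurable_snd P(1)] measurable_compose[OF measurable_snd P(2)])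

lemma quad_bound: "\<mu> \<in> P2 \<Longrightarrow> \<bar>quad \<mu> x y p1 p2 q1 q2\<bar> \<le> C * (\<bar>p1\<bar> + \<bar>p2\<bar>) * (\<bar>q1\<bar> + \<bar>q2\<bar>)"
  unfolding quad_def by (intro form_bound bound)

text \<open>Applying \<open>LL\<close> to \<open>\<xi> + \<epsilon> Z\<close> and \<open>\<eta>\<^sub>1 + Z \<eta>\<^sub>2 / \<epsilon>\<close> with an independent fair sign \<open>Z\<close> and averaging
  over the signs turns the first-order form into difference quotients of \<open>g\<close>. The sign requires extra
  randomness, which \<open>\<G>0\<close> provides for countably valued data.\<close>

lemma quad_nonneg_countable:
  fixes K :: "'w \<Rightarrow> nat" and a e1 e2 :: "nat \<Rightarrow> real"
  assumes K: "K \<in> measurable M (count_space UNIV)"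
    and sq: "integrable M (\<lambda>\<omega>. (a (K \<omega>))\<^sup>2)" "integrable M (\<lambda>\<omega>. (e1 (K \<omega>))\<^sup>2)" "integrable M (\<lambda>\<omega>. (e2 (K \<omega>))\<^sup>2)"
  shows "0 \<le> (\<integral>p. quad (law M (\<lambda>\<omega>. a (K \<omega>))) (a (K (fst p))) (a (K (snd p))) (e1 (K (fst p))) (e2 (K (fst p))) (e1 (K (snd p))) (e2 (K (snd p))) \<partial>(M \<Otimes>\<^sub>M M))"
proof -
  obtain I where I: "I \<in> measurable \<G>0 (count_space UNIV)"
    and copy_i: "\<And>\<phi> :: nat \<Rightarrow> real. integrable M (\<lambda>\<omega>. \<phi> (2 * K \<omega> + 1)) \<Longrightarrow> integrable M (\<lambda>\<omega>. \<phi> (2 * K \<omega>)) \<Longrightarrow> integrable M (\<lambda>\<omega>. \<phi> (I \<omega>))"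
    and copy: "\<And>\<phi> :: nat \<Rightarrow> real. integrable M (\<lambda>\<omega>. \<phi> (2 * K \<omega> + 1)) \<Longrightarrow> integrable M (\<lambda>\<omega>. \<phi> (2 * K \<omega>)) \<Longrightarrow>
       (\<integral>\<omega>. \<phi> (I \<omega>) \<partial>M) = ((\<integral>\<omega>. \<phi> (2 * K \<omega> + 1) \<partial>M) + (\<integral>\<omega>. \<phi> (2 * K \<omega>) \<partial>M)) / 2"
    by (rule coin_copy[OF K]) (rule that; assumption)
  have IM: "I \<in> measurable M (count_space UNIV)" by (rule measurable_from_subalg[OF subalgebra_G0 I])
  have Km: "(\<lambda>\<omega>. \<phi> (K \<omega>)) \<in> borel_measurable M" for \<phi> :: "nat \<Rightarrow> real" by (rule measurable_compose[OF K]) simp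
  have Im: "(\<lambda>\<omega>. \<phi> (I \<omega>)) \<in> borel_measurable M" for \<phi> :: "nat \<Rightarrow> real" by (rule measurable_compose[OF IM]) simp
  define \<mu> where "\<mu> = law M (\<lambda>\<omega>. a (K \<omega>))"
  have mu: "\<mu> \<in> P2" unfolding \<mu>_def by (rule law_P2[OF prob_space_axioms Km sq(1)])
  define \<epsilon> where "\<epsilon> n = inverse (real (Suc n))" for n
  have eps: "\<epsilon> n > 0" "\<epsilon> \<longlonglongrightarrow> 0" for n unfolding \<epsilon>_def by (simp, rule LIMSEQ_inverse_real_of_nat)
  \<comment> \<open>Parity of the code is the sign, and \<open>i div 2\<close> is the code of the
    original data.\<close>
  define \<sigma> where "\<sigma> i = (if odd i then 1 else -1 :: real)" for i :: nat
  define x where "x n i = a (i div 2) + \<sigma> i * \<epsilon> n" for n i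
  define \<eta> where "\<eta> n i = e1 (i div 2) + \<sigma> i * e2 (i div 2) / \<epsilon> n" for n i
  have sgn: "\<sigma> (2 * k + 1) = 1" "\<sigma> (2 * k) = -1" "\<sigma> (Suc (2 * k)) = 1" for k by (simp_all add: \<sigma>_def)
  have sum2: "integrable M (\<lambda>\<omega>. (\<phi> (K \<omega>) + \<psi> (K \<omega>))\<^sup>2)" if "integrable M (\<lambda>\<omega>. (\<phi> (K \<omega>))\<^sup>2)" "integrable M (\<lambda>\<omega>. (\<psi> (K \<omega>))\<^sup>2)" for \<phi> \<psi> :: "nat \<Rightarrow> real"
    by (rule integrable_square_add[OF Km Km that])
  have LFI: "(\<lambda>\<omega>. \<phi> (I \<omega>)) \<in> LF T" if "integrable M (\<lambda>\<omega>. (\<phi> (2 * K \<omega> + 1))\<^sup>2)" "integrable M (\<lambda>\<omega>. (\<phi> (2 * K \<omega>))\<^sup>2)" for \<phi> :: "nat \<Rightarrow> real"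
  proof -
    have "(\<lambda>\<omega>. \<phi> (I \<omega>)) \<in> borel_measurable (\<F> T)" by (rule measurable_compose[OF measurable_G0_filt[OF I]]) simp
    then show ?thesis unfolding LF_iff[OF T_in(1)] using copy_i[of "\<lambda>i. (\<phi> i)\<^sup>2"] that by blast
  qed
  have X: "(\<lambda>\<omega>. x n (I \<omega>)) \<in> LF T" for n
    by (rule LFI) (use sum2[OF sq(1), of "\<lambda>_. \<epsilon> n"] sum2[OF sq(1), of "\<lambda>_. - \<epsilon> n"] in \<open>simp_all add: x_def sgn\<close>)
  have sc: "integrable M (\<lambda>\<omega>. (c * e2 (K \<omega>))\<^sup>2)" for c using sq(3) by (simp add: power_mult_distrib)
  have E: "(\<lambda>\<omega>. \<eta> n (I \<omega>)) \<in> LF T" for n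
    by (rule LFI) (use sum2[OF sq(2) sc[of "1 / \<epsilon> n"]] sum2[OF sq(2) sc[of "- 1 / \<epsilon> n"]] in \<open>simp_all add: \<eta>_def sgn\<close>)
  have A0: "(\<lambda>\<omega>. a (I \<omega> div 2)) \<in> LF T" using LFI[of "\<lambda>i. a (i div 2)"] sq(1) by simp
  \<comment> \<open>A variable of law \<open>\<mu>\<close> on the same copy as the perturbed states,
    at distance exactly \<open>\<epsilon> n\<close> from them.\<close>
  have la: "law M (\<lambda>\<omega>. a (I \<omega> div 2)) = \<mu>"
  proof (rule measure_eqI)
    fix S assume "S \<in> sets (law M (\<lambda>\<omega>. a (I \<omega> div 2)))"
    then have S: "S \<in> sets borel" by simp
    interpret m1: prob_space "law M (\<lambda>\<omega>. a (I \<omega> div 2))" by (rule P2D(1)[OF LFD(5)[OF A0]])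
    interpret m2: prob_space \<mu> by (rule P2D(1)[OF mu])
    have ind: "integrable M (\<lambda>\<omega>. indicator S (a (K \<omega>)) :: real)"
      by (rule integrable_const_bound[where B=1, OF AE_I2 Km[of "\<lambda>k. indicator S (a k)"]]) (simp add: indicator_def)
    have "(\<integral>y. indicator S y \<partial>law M (\<lambda>\<omega>. a (I \<omega> div 2))) = (\<integral>\<omega>. (indicator S (a (I \<omega> div 2)) :: real) \<partial>M)"
      by (rule integral_law[OF LFD(2)[OF A0] borel_measurable_indicator[OF S]])
    also have "\<dots> = (\<integral>\<omega>. indicator S (a (K \<omega>)) \<partial>M)" using copy[of "\<lambda>i. indicator S (a (i div 2))"] ind by simp
    also have "\<dots> = (\<integral>y. indicator S y \<partial>\<mu>)" unfolding \<mu>_def by (rule integral_law[OF Km borel_measurable_indicator[OF S], symmetric])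
    finally have "measure (law M (\<lambda>\<omega>. a (I \<omega> div 2))) S = measure \<mu> S" using S by (simp add: \<mu>_def)
    then show "emeasure (law M (\<lambda>\<omega>. a (I \<omega> div 2))) S = emeasure \<mu> S" by (simp add: m1.emeasure_eq_measure m2.emeasure_eq_measure)
  qed (simp add: \<mu>_def)
  let ?m = "\<lambda>n. law M (\<lambda>\<omega>. x n (I \<omega>))"
  have mP: "?m n \<in> P2" for n by (rule LFD(5)[OF X])
  have Wl: "(\<lambda>n. W2 \<mu> (?m n)) \<longlonglongrightarrow> 0"
  proof -
    have "norm2 M (\<lambda>\<omega>. a (I \<omega> div 2) - x n (I \<omega>)) = \<epsilon> n" for n
    proof -
      have "(a (I \<omega> div 2) - x n (I \<omega>))\<^sup>2 = (\<epsilon> n)\<^sup>2" for \<omega> by (simp add: x_def \<sigma>_def)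
      then show ?thesis using eps(1)[of n] by (simp add: norm2_def prob_space)
    qed
    then show ?thesis unfolding la[symmetric]
      by (intro W2_law_tendsto[OF prob_space_axioms LFD(2)[OF A0] LFD(2)[OF X] LFD(3)[OF A0] LFD(3)[OF X]]) (simp add: eps(2))
  qed
  define G where "G n i j = g (x n i, x n j) (?m n) * \<eta> n i * \<eta> n j" for n i j
  define q where "q n \<omega> \<omega>' = corners (?m n) (\<epsilon> n) (a (K \<omega>)) (a (K \<omega>')) (e1 (K \<omega>)) (e2 (K \<omega>)) (e1 (K \<omega>')) (e2 (K \<omega>'))" for n \<omega> \<omega>'
  let ?Y = "\<lambda>\<omega>. \<bar>e1 (K \<omega>)\<bar> + \<bar>e2 (K \<omega>)\<bar>"
  have Yi: "integrable M ?Y" using integrable_of_square[OF Km sq(2)] integrable_of_square[OF Km sq(3)] by simp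
  have KKm: "(\<lambda>p. f (K (fst p)) (K (snd p))) \<in> borel_measurable (M \<Otimes>\<^sub>M M)" for f :: "nat \<Rightarrow> nat \<Rightarrow> real"
  proof -
    have "(\<lambda>p. (\<lambda>(i, j). f i j) (K (fst p), K (snd p))) \<in> borel_measurable (M \<Otimes>\<^sub>M M)"
    proof (rule measurable_compose[of _ _ "count_space UNIV \<Otimes>\<^sub>M count_space UNIV"])
      show "(\<lambda>p. (K (fst p), K (snd p))) \<in> M \<Otimes>\<^sub>M M \<rightarrow>\<^sub>M count_space UNIV \<Otimes>\<^sub>M count_space UNIV"
        by (intro measurable_Pair measurable_compose[OF measurable_fst K] measurable_compose[OF measurable_snd K])
      show "(\<lambda>(i, j). f i j) \<in> borel_measurable (count_space UNIV \<Otimes>\<^sub>M count_space UNIV)"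
        by (simp add: pair_measure_countable)
    qed
    then show ?thesis by (simp only: prod.case)
  qed
  have qm: "(\<lambda>p. q n (fst p) (snd p)) \<in> borel_measurable (M \<Otimes>\<^sub>M M)" for n
    unfolding q_def by (rule KKm[of "\<lambda>i j. corners (?m n) (\<epsilon> n) (a i) (a j) (e1 i) (e2 i) (e1 j) (e2 j)"])
  have qb: "\<bar>q n \<omega> \<omega>'\<bar> \<le> C * ?Y \<omega> * ?Y \<omega>'" for n \<omega> \<omega>' unfolding q_def by (rule corners_bound[OF mP eps(1)])
  have C0: "0 \<le> C" using bound(1)[OF mu, of 0] by linarith
  have iE: "integrable M (\<lambda>\<omega>. \<bar>\<eta> n (2 * K \<omega> + 1)\<bar>)" "integrable M (\<lambda>\<omega>. \<bar>\<eta> n (2 * K \<omega>)\<bar>)" for n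
    using integrable_of_square[OF Km sq(2)] integrable_of_square[OF Km sq(3)] by (simp_all add: \<eta>_def sgn)
  have Gb: "\<bar>G n i j\<bar> \<le> C * \<bar>\<eta> n i\<bar> * \<bar>\<eta> n j\<bar>" for n i j
    unfolding G_def abs_mult by (intro mult_right_mono bound(1)[OF mP]) auto
  have iG: "integrable M (\<lambda>\<omega>'. G n i (2 * K \<omega>' + 1))" "integrable M (\<lambda>\<omega>'. G n i (2 * K \<omega>'))" for n i
  proof -
    show "integrable M (\<lambda>\<omega>'. G n i (2 * K \<omega>' + 1))"
      by (rule Bochner_Integration.integrable_bound[OF integrable_mult_right[OF iE(1), of "C * \<bar>\<eta> n i\<bar>"] Km[of "\<lambda>k. G n i (2 * k + 1)"] AE_I2])
         (use Gb C0 in \<open>simp add: abs_mult\<close>)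
    show "integrable M (\<lambda>\<omega>'. G n i (2 * K \<omega>'))"
      by (rule Bochner_Integration.integrable_bound[OF integrable_mult_right[OF iE(2), of "C * \<bar>\<eta> n i\<bar>"] Km[of "\<lambda>k. G n i (2 * k)"] AE_I2])
         (use Gb C0 in \<open>simp add: abs_mult\<close>)
  qed
  have nonneg: "0 \<le> (\<integral>p. q n (fst p) (snd p) \<partial>(M \<Otimes>\<^sub>M M))" for n
  proof -
    define \<phi> where "\<phi> i = ((\<integral>\<omega>'. G n i (2 * K \<omega>' + 1) \<partial>M) + (\<integral>\<omega>'. G n i (2 * K \<omega>') \<partial>M)) / 2" for i
    have in1: "(\<integral>\<omega>'. G n i (I \<omega>') \<partial>M) = \<phi> i" for i unfolding \<phi>_def by (rule copy[OF iG])
    have phib: "\<bar>\<phi> i\<bar> \<le> \<bar>\<eta> n i\<bar> * (C * ((\<integral>\<omega>'. \<bar>\<eta> n (2 * K \<omega>' + 1)\<bar> \<partial>M) + (\<integral>\<omega>'. \<bar>\<eta> n (2 * K \<omega>')\<bar> \<partial>M)))" for i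
    proof -
      have "\<bar>\<integral>\<omega>'. G n i (2 * K \<omega>' + 1) \<partial>M\<bar> \<le> (\<integral>\<omega>'. C * \<bar>\<eta> n i\<bar> * \<bar>\<eta> n (2 * K \<omega>' + 1)\<bar> \<partial>M)"
        by (rule order_trans[OF integral_abs_bound integral_mono'[OF integrable_mult_right[OF iE(1)] Gb]]) (use C0 in simp)
      moreover have "\<bar>\<integral>\<omega>'. G n i (2 * K \<omega>') \<partial>M\<bar> \<le> (\<integral>\<omega>'. C * \<bar>\<eta> n i\<bar> * \<bar>\<eta> n (2 * K \<omega>')\<bar> \<partial>M)"
        by (rule order_trans[OF integral_abs_bound integral_mono'[OF integrable_mult_right[OF iE(2)] Gb]]) (use C0 in simp)
      moreover have "\<bar>(s + t) / 2\<bar> \<le> S + R" if "\<bar>s\<bar> \<le> S" "\<bar>t\<bar> \<le> R" for s t S R :: real using that by (simp add: abs_le_iff)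
      ultimately have "\<bar>\<phi> i\<bar> \<le> (\<integral>\<omega>'. C * \<bar>\<eta> n i\<bar> * \<bar>\<eta> n (2 * K \<omega>' + 1)\<bar> \<partial>M) + (\<integral>\<omega>'. C * \<bar>\<eta> n i\<bar> * \<bar>\<eta> n (2 * K \<omega>')\<bar> \<partial>M)"
        unfolding \<phi>_def by blast
      then show ?thesis by (simp add: algebra_simps)
    qed
    have iphi: "integrable M (\<lambda>\<omega>. \<phi> (2 * K \<omega> + 1))" "integrable M (\<lambda>\<omega>. \<phi> (2 * K \<omega>))"
    proof -
      show "integrable M (\<lambda>\<omega>. \<phi> (2 * K \<omega> + 1))"
        by (rule Bochner_Integration.integrable_bound[OF integrable_mult_left[OF iE(1)] Km[of "\<lambda>k. \<phi> (2 * k + 1)"] AE_I2])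
           (simp only: real_norm_def, rule order_trans[OF phib abs_ge_self])
      show "integrable M (\<lambda>\<omega>. \<phi> (2 * K \<omega>))"
        by (rule Bochner_Integration.integrable_bound[OF integrable_mult_left[OF iE(2)] Km[of "\<lambda>k. \<phi> (2 * k)"] AE_I2])
           (simp only: real_norm_def, rule order_trans[OF phib abs_ge_self])
    qed
    \<comment> \<open>Averaging both copies over their coins produces precisely the four-corner
      expression.\<close>
    have c4: "((G n (2 * K \<omega> + 1) (2 * K \<omega>' + 1) + G n (2 * K \<omega> + 1) (2 * K \<omega>')) + (G n (2 * K \<omega>) (2 * K \<omega>' + 1) + G n (2 * K \<omega>) (2 * K \<omega>'))) / 4 = q n \<omega> \<omega>'" for \<omega> \<omega>'
      by (simp add: G_def q_def corners_def corner_def x_def \<eta>_def sgn add.assoc)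
    have "0 \<le> (\<integral>p. g (x n (I (fst p)), x n (I (snd p))) (?m n) * \<eta> n (I (fst p)) * \<eta> n (I (snd p)) \<partial>(M \<Otimes>\<^sub>M M))"
      by (rule LL[OF X E])
    also have "\<dots> = (\<integral>\<omega>. \<integral>\<omega>'. G n (I \<omega>) (I \<omega>') \<partial>M \<partial>M)"
    proof -
      have "(\<lambda>p. g (x n (I (fst p)), x n (I (snd p))) (?m n) * \<eta> n (I (fst p)) * \<eta> n (I (snd p))) \<in> borel_measurable (M \<Otimes>\<^sub>M M)"
        by (intro borel_measurable_times kernel_measurable[OF LFD(2)[OF X] mP cont(1)] measurable_compose[OF measurable_fst LFD(2)[OF E]] measurable_compose[OF measurable_snd LFD(2)[OF E]])
      from product_dominated(2)[OF this integrable_abs[OF LFD(4)[OF E]], of C n] Gb[unfolded G_def] show ?thesis by (simp add: G_def)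
    qed
    also have "\<dots> = (\<integral>\<omega>. \<phi> (I \<omega>) \<partial>M)" by (simp add: in1)
    also have "\<dots> = ((\<integral>\<omega>. \<phi> (2 * K \<omega> + 1) \<partial>M) + (\<integral>\<omega>. \<phi> (2 * K \<omega>) \<partial>M)) / 2" by (rule copy[OF iphi])
    also have "\<dots> = (\<integral>\<omega>. (\<phi> (2 * K \<omega> + 1) + \<phi> (2 * K \<omega>)) / 2 \<partial>M)" using iphi by simp
    also have "\<dots> = (\<integral>\<omega>. \<integral>\<omega>'. q n \<omega> \<omega>' \<partial>M \<partial>M)"
    proof (rule Bochner_Integration.integral_cong[OF refl])
      fix \<omega>
      have "(\<phi> (2 * K \<omega> + 1) + \<phi> (2 * K \<omega>)) / 2 = (\<integral>\<omega>'. ((G n (2 * K \<omega> + 1) (2 * K \<omega>' + 1) + G n (2 * K \<omega> + 1) (2 * K \<omega>')) + (G n (2 * K \<omega>) (2 * K \<omega>' + 1) + G n (2 * K \<omega>) (2 * K \<omega>'))) / 4 \<partial>M)"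
        unfolding \<phi>_def using iG by (simp add: field_simps)
      then show "(\<phi> (2 * K \<omega> + 1) + \<phi> (2 * K \<omega>)) / 2 = (\<integral>\<omega>'. q n \<omega> \<omega>' \<partial>M)" unfolding c4 .
    qed
    also have "\<dots> = (\<integral>p. q n (fst p) (snd p) \<partial>(M \<Otimes>\<^sub>M M))"
      using product_dominated(2)[OF qm[of n] Yi, of C] qb by simp
    finally show ?thesis .
  qed
  have "(\<lambda>n. \<integral>p. q n (fst p) (snd p) \<partial>(M \<Otimes>\<^sub>M M)) \<longlonglongrightarrow>
    (\<integral>p. quad \<mu> (a (K (fst p))) (a (K (snd p))) (e1 (K (fst p))) (e2 (K (fst p))) (e1 (K (snd p))) (e2 (K (snd p))) \<partial>(M \<Otimes>\<^sub>M M))"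
  proof (rule integral_dominated_convergence[where w="\<lambda>p. C * ?Y (fst p) * ?Y (snd p)"])
    show "integrable (M \<Otimes>\<^sub>M M) (\<lambda>p. C * ?Y (fst p) * ?Y (snd p))"
      using product_dominated(3)[OF qm[of 0] Yi, of C] qb by simp
    show "AE p in M \<Otimes>\<^sub>M M. norm (q n (fst p) (snd p)) \<le> C * ?Y (fst p) * ?Y (snd p)" for n
      by (rule AE_I2) (simp only: real_norm_def qb)
    show "AE p in M \<Otimes>\<^sub>M M. (\<lambda>n. q n (fst p) (snd p)) \<longlonglongrightarrow> quad \<mu> (a (K (fst p))) (a (K (snd p))) (e1 (K (fst p))) (e2 (K (fst p))) (e1 (K (snd p))) (e2 (K (snd p)))"
      unfolding q_def by (rule AE_I2, rule corners_tendsto[OF mu mP Wl eps])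
  qed (intro quad_measurable[OF mu Km Km Km] qm)+
  then show ?thesis unfolding \<mu>_def[symmetric] by (rule LIMSEQ_le_const) (use nonneg in blast)
qed

text \<open>Rounding down to the grid of width \<open>1 / Suc n\<close> makes the triple of
  variables countably valued, and \<open>K n\<close> is its code. The rounding errors vanish
  uniformly, so laws and forms converge.\<close>

lemma quad_nonneg:
  assumes xi: "\<xi> \<in> LF T" and e1: "\<eta>1 \<in> LF T" and e2: "\<eta>2 \<in> LF T"
  shows "0 \<le> (\<integral>p. quad (law M \<xi>) (\<xi> (fst p)) (\<xi> (snd p)) (\<eta>1 (fst p)) (\<eta>2 (fst p)) (\<eta>1 (snd p)) (\<eta>2 (snd p)) \<partial>(M \<Otimes>\<^sub>M M))"
proof -
  define r where "r n y = real_of_int \<lfloor>real (Suc n) * y\<rfloor> / real (Suc n)" for n and y :: real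
  have r: "\<bar>y - r n y\<bar> \<le> inverse (real (Suc n))" for n y
  proof -
    have "y - r n y = (real (Suc n) * y - real_of_int \<lfloor>real (Suc n) * y\<rfloor>) / real (Suc n)" by (simp add: r_def field_simps)
    also have "\<bar>\<dots>\<bar> \<le> 1 / real (Suc n)"
    proof -
      have "\<bar>real (Suc n) * y - real_of_int \<lfloor>real (Suc n) * y\<rfloor>\<bar> \<le> 1" by linarith
      then have "\<bar>real (Suc n) * y - real_of_int \<lfloor>real (Suc n) * y\<rfloor>\<bar> / real (Suc n) \<le> 1 / real (Suc n)" by (rule divide_right_mono) simp
      then show ?thesis unfolding abs_divide abs_of_nat .
    qed
    finally show ?thesis by (simp add: inverse_eq_divide)
  qed
  have rm: "r n \<in> borel_measurable borel" for n unfolding r_def by measurable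
  have rlim: "(\<lambda>n. r n y) \<longlonglongrightarrow> y" for y
    by (rule LIM_zero_cancel, rule Lim_null_comparison[OF _ LIMSEQ_inverse_real_of_nat]) (use r in \<open>simp add: abs_minus_commute\<close>)
  define K where "K n \<omega> = to_nat (\<lfloor>real (Suc n) * \<xi> \<omega>\<rfloor>, \<lfloor>real (Suc n) * \<eta>1 \<omega>\<rfloor>, \<lfloor>real (Suc n) * \<eta>2 \<omega>\<rfloor>)" for n \<omega>
  define dec :: "nat \<Rightarrow> int \<times> int \<times> int" where "dec = from_nat"
  define a b c where "a n k = real_of_int (fst (dec k)) / real (Suc n)" and "b n k = real_of_int (fst (snd (dec k))) / real (Suc n)"
    and "c n k = real_of_int (snd (snd (dec k))) / real (Suc n)" for n k
  have abc: "a n (K n \<omega>) = r n (\<xi> \<omega>)" "b n (K n \<omega>) = r n (\<eta>1 \<omega>)" "c n (K n \<omega>) = r n (\<eta>2 \<omega>)" for n \<omega>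
    by (simp_all add: a_def b_def c_def dec_def K_def r_def)
  have Km: "K n \<in> measurable M (count_space UNIV)" for n
  proof -
    have fl: "(\<lambda>\<omega>. \<lfloor>real (Suc n) * X \<omega>\<rfloor>) \<in> measurable M (count_space UNIV)" if "X \<in> LF T" for X
    proof -
      have "(\<lambda>\<omega>. real (Suc n) * X \<omega>) \<in> borel_measurable M" by (intro borel_measurable_times borel_measurable_const LFD(2)[OF that])
      then show ?thesis by measurable
    qed
    have "(\<lambda>\<omega>. (\<lfloor>real (Suc n) * \<xi> \<omega>\<rfloor>, \<lfloor>real (Suc n) * \<eta>1 \<omega>\<rfloor>, \<lfloor>real (Suc n) * \<eta>2 \<omega>\<rfloor>)) \<in> measurable M (count_space UNIV \<Otimes>\<^sub>M (count_space UNIV \<Otimes>\<^sub>M count_space UNIV))"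
      by (intro measurable_Pair fl xi e1 e2)
    moreover have "count_space UNIV \<Otimes>\<^sub>M (count_space UNIV \<Otimes>\<^sub>M count_space UNIV) = (count_space UNIV :: (int \<times> int \<times> int) measure)"
      by (simp add: pair_measure_countable)
    ultimately have m: "(\<lambda>\<omega>. (\<lfloor>real (Suc n) * \<xi> \<omega>\<rfloor>, \<lfloor>real (Suc n) * \<eta>1 \<omega>\<rfloor>, \<lfloor>real (Suc n) * \<eta>2 \<omega>\<rfloor>)) \<in> measurable M (count_space UNIV)"
      by (simp only:)
    have "(to_nat :: int \<times> int \<times> int \<Rightarrow> nat) \<in> measurable (count_space UNIV) (count_space UNIV)" by simp
    from measurable_compose[OF m this] show ?thesis unfolding K_def .
  qed
  have rLF: "(\<lambda>\<omega>. r n (X \<omega>)) \<in> LF T" if X: "X \<in> LF T" for X n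
  proof -
    have dm: "(\<lambda>\<omega>. r n (X \<omega>) - X \<omega>) \<in> borel_measurable (\<F> T)"
      by (intro borel_measurable_diff measurable_compose[OF LFD(1)[OF X] rm] LFD(1)[OF X])
    have "(\<lambda>\<omega>. (r n (X \<omega>) - X \<omega>) * 1) \<in> LF T"
      by (rule LF_bounded_mult[OF T_in(1) LF_const[OF T_in(1)] dm, of "inverse (real (Suc n))"]) (use r in \<open>simp add: abs_minus_commute\<close>)
    from LF_add[OF this X] show ?thesis by simp
  qed
  let ?\<mu> = "law M \<xi>" and ?m = "\<lambda>n. law M (\<lambda>\<omega>. r n (\<xi> \<omega>))"
  note mu = LFD(5)[OF xi] and mP = LFD(5)[OF rLF[OF xi]]
  have Wl: "(\<lambda>n. W2 ?\<mu> (?m n)) \<longlonglongrightarrow> 0"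
  proof (rule W2_law_tendsto[OF prob_space_axioms LFD(2)[OF xi] LFD(2)[OF rLF[OF xi]] LFD(3)[OF xi] LFD(3)[OF rLF[OF xi]]])
    show "(\<lambda>n. norm2 M (\<lambda>\<omega>. \<xi> \<omega> - r n (\<xi> \<omega>))) \<longlonglongrightarrow> 0"
    proof (rule Lim_null_comparison[OF _ LIMSEQ_inverse_real_of_nat], intro always_eventually allI)
      fix n
      have "(\<integral>\<omega>. (\<xi> \<omega> - r n (\<xi> \<omega>))\<^sup>2 \<partial>M) \<le> (\<integral>\<omega>. (inverse (real (Suc n)))\<^sup>2 \<partial>M)"
      proof (rule integral_mono')
        show "(\<xi> \<omega> - r n (\<xi> \<omega>))\<^sup>2 \<le> (inverse (real (Suc n)))\<^sup>2" for \<omega>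
          using power_mono[OF r abs_ge_zero, of "\<xi> \<omega>" n 2] by simp
      qed auto
      then have "norm2 M (\<lambda>\<omega>. \<xi> \<omega> - r n (\<xi> \<omega>)) \<le> sqrt ((inverse (real (Suc n)))\<^sup>2)"
        unfolding norm2_def by (intro real_sqrt_le_mono) (simp add: prob_space)
      then show "norm (norm2 M (\<lambda>\<omega>. \<xi> \<omega> - r n (\<xi> \<omega>))) \<le> inverse (real (Suc n))" by simp
    qed
  qed
  \<comment> \<open>The summand 2 absorbs the rounding errors of \<open>\<eta>1\<close> and
    \<open>\<eta>2\<close>, each of which is at most 1.\<close>
  let ?Y = "\<lambda>\<omega>. \<bar>\<eta>1 \<omega>\<bar> + \<bar>\<eta>2 \<omega>\<bar> + 2"
  have Yi: "integrable M ?Y" using LFD(4)[OF e1] LFD(4)[OF e2] by simp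
  have C0: "0 \<le> C" using bound(1)[OF mu, of 0] by linarith
  define q where "q n p = quad (?m n) (r n (\<xi> (fst p))) (r n (\<xi> (snd p))) (r n (\<eta>1 (fst p))) (r n (\<eta>2 (fst p))) (r n (\<eta>1 (snd p))) (r n (\<eta>2 (snd p)))" for n p
  have rb: "\<bar>r n (\<eta>1 \<omega>)\<bar> + \<bar>r n (\<eta>2 \<omega>)\<bar> \<le> ?Y \<omega>" for n \<omega>
  proof -
    have "inverse (real (Suc n)) \<le> 1" by (simp add: inverse_le_1_iff)
    then show ?thesis using r[of "\<eta>1 \<omega>" n] r[of "\<eta>2 \<omega>" n] by linarith
  qed
  have qb: "\<bar>q n (\<omega>, \<omega>')\<bar> \<le> C * ?Y \<omega> * ?Y \<omega>'" for n \<omega> \<omega>'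
    unfolding q_def fst_conv snd_conv
    by (rule order_trans[OF quad_bound[OF mP]]) (intro mult_mono rb mult_nonneg_nonneg C0 order_refl; simp)
  have qm: "q n \<in> borel_measurable (M \<Otimes>\<^sub>M M)" for n
    unfolding q_def by (rule quad_measurable[OF mP LFD(2)[OF rLF[OF xi]] LFD(2)[OF rLF[OF e1]] LFD(2)[OF rLF[OF e2]]])
  have "0 \<le> (\<integral>p. q n p \<partial>(M \<Otimes>\<^sub>M M))" for n
    using quad_nonneg_countable[OF Km, of "a n" n "b n" "c n"] LFD(3)[OF rLF[OF xi]] LFD(3)[OF rLF[OF e1]] LFD(3)[OF rLF[OF e2]]
    by (simp add: abc q_def)
  moreover have "(\<lambda>n. \<integral>p. q n p \<partial>(M \<Otimes>\<^sub>M M)) \<longlonglongrightarrow>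
    (\<integral>p. quad ?\<mu> (\<xi> (fst p)) (\<xi> (snd p)) (\<eta>1 (fst p)) (\<eta>2 (fst p)) (\<eta>1 (snd p)) (\<eta>2 (snd p)) \<partial>(M \<Otimes>\<^sub>M M))"
  proof (rule integral_dominated_convergence[where w="\<lambda>p. C * ?Y (fst p) * ?Y (snd p)"])
    show "integrable (M \<Otimes>\<^sub>M M) (\<lambda>p. C * ?Y (fst p) * ?Y (snd p))"
      by (rule product_dominated(3)[OF qm Yi qb])
    show "AE p in M \<Otimes>\<^sub>M M. norm (q n p) \<le> C * ?Y (fst p) * ?Y (snd p)" for n
      using qb[of n] by (intro AE_I2) (metis prod.collapse real_norm_def)
    have l: "(\<lambda>n. f (r n x, r n y) (?m n)) \<longlonglongrightarrow> f (x, y) ?\<mu>" if "cont_P2 UNIV f" for f :: "real \<times> real \<Rightarrow> real measure \<Rightarrow> real" and x y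
      by (rule cont_P2_tendsto[OF that _ _ tendsto_Pair[OF rlim rlim] mu mP Wl]) auto
    show "AE p in M \<Otimes>\<^sub>M M. (\<lambda>n. q n p) \<longlonglongrightarrow> quad ?\<mu> (\<xi> (fst p)) (\<xi> (snd p)) (\<eta>1 (fst p)) (\<eta>2 (fst p)) (\<eta>1 (snd p)) (\<eta>2 (snd p))"
      unfolding q_def quad_def by (intro AE_I2 tendsto_add tendsto_mult l cont rlim)
  qed (intro quad_measurable[OF mu LFD(2)[OF xi] LFD(2)[OF e1] LFD(2)[OF e2]] qm)+
  ultimately show ?thesis using LIMSEQ_le_const by blast
qed

end

section \<open>Concavity of the Hamiltonian and conclusion\<close>

text \<open>Two partial derivatives are given, not joint differentiability. Concavity bridges the
  difference: the value at the point dominates an average of a value toward \<open>(z2, g2)\<close>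
  and of two values displaced backwards along the coordinate axes, where the partial derivatives
  apply.\<close>

lemma gradient_inequality:
  fixes f :: "real \<Rightarrow> real \<Rightarrow> real"
  assumes concave: "\<And>l z1 g1 z2 g2. 0 \<le> l \<Longrightarrow> l \<le> 1 \<Longrightarrow>
      l * f z1 g1 + (1 - l) * f z2 g2 \<le> f (l * z1 + (1 - l) * z2) (l * g1 + (1 - l) * g2)"
    and fz: "((\<lambda>z. f z g) has_real_derivative dz) (at z)" and fg: "((\<lambda>g. f z g) has_real_derivative dg) (at g)"
  shows "f z2 g2 \<le> f z g + dz * (z2 - z) + dg * (g2 - g)"
proof -
  define u v where "u = z2 - z" and "v = g2 - g"
  define t where "t n = inverse (real (Suc n))" for n
  have t: "0 < t n" "t n \<le> 1" "t \<longlonglongrightarrow> 0" for n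
    unfolding t_def by (simp, simp add: inverse_le_1_iff, rule LIMSEQ_inverse_real_of_nat)
  have tat: "filterlim t (at 0) sequentially"
    using t by (intro filterlim_atI) (auto simp: less_imp_neq[OF t(1), symmetric])
  have quot: "(\<lambda>n. (\<phi> 0 - \<phi> (t n)) / t n) \<longlonglongrightarrow> - d" if "(\<phi> has_real_derivative d) (at 0)" for \<phi> d
  proof -
    have "(\<lambda>n. (\<phi> (0 + t n) - \<phi> 0) / t n) \<longlonglongrightarrow> d" by (rule filterlim_compose[OF that[unfolded DERIV_def] tat])
    from tendsto_minus[OF this] show ?thesis by (simp add: minus_divide_left)
  qed
  have "((\<lambda>s. f (z - 2 * s * u) g) has_real_derivative (dz * (- 2 * u))) (at 0)"
    by (rule DERIV_chain2[where f="\<lambda>z. f z g"]) (auto intro!: derivative_eq_intros fz)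
  from quot[OF this] have q1: "(\<lambda>n. (f z g - f (z - 2 * t n * u) g) / t n) \<longlonglongrightarrow> 2 * dz * u" by (simp add: mult_ac)
  have "((\<lambda>s. f z (g - 2 * s * v)) has_real_derivative (dg * (- 2 * v))) (at 0)"
    by (rule DERIV_chain2[where f="\<lambda>g. f z g"]) (auto intro!: derivative_eq_intros fg)
  from quot[OF this] have q2: "(\<lambda>n. (f z g - f z (g - 2 * t n * v)) / t n) \<longlonglongrightarrow> 2 * dg * v" by (simp add: mult_ac)
  have "(\<lambda>n. ((f z g - f (z - 2 * t n * u) g) / t n + (f z g - f z (g - 2 * t n * v)) / t n) / 2) \<longlonglongrightarrow> (2 * dz * u + 2 * dg * v) / 2"
    by (intro tendsto_intros q1 q2) simp
  moreover have "f z2 g2 - f z g \<le> ((f z g - f (z - 2 * t n * u) g) / t n + (f z g - f z (g - 2 * t n * v)) / t n) / 2" for n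
  proof -
    let ?s = "t n"
    have 1: "?s * f z2 g2 + (1 - ?s) * f z g \<le> f (z + ?s * u) (g + ?s * v)"
      using concave[of ?s z2 g2 z g] t(1)[of n] t(2)[of n] by (simp add: u_def v_def algebra_simps)
    \<comment> \<open>The point is the midpoint of a forward and a backward displacement, and the
      backward one is in turn the midpoint of two axis displacements of double length; hence the
      factor 2.\<close>
    have 2: "1/2 * f (z + ?s * u) (g + ?s * v) + (1 - 1/2) * f (z - ?s * u) (g - ?s * v) \<le> f z g"
      using concave[of "1/2" "z + ?s * u" "g + ?s * v" "z - ?s * u" "g - ?s * v"] by (simp add: field_simps)
    have 3: "1/2 * f (z - 2 * ?s * u) g + (1 - 1/2) * f z (g - 2 * ?s * v) \<le> f (z - ?s * u) (g - ?s * v)"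
    proof -
      have "1/2 * (z - 2 * ?s * u) + (1 - 1/2) * z = z - ?s * u" "1/2 * g + (1 - 1/2) * (g - 2 * ?s * v) = g - ?s * v"
        by (simp_all add: field_simps)
      then show ?thesis using concave[of "1/2" "z - 2 * ?s * u" g z "g - 2 * ?s * v"] by simp
    qed
    have "?s * (f z2 g2 - f z g) \<le> ((f z g - f (z - 2 * ?s * u) g) + (f z g - f z (g - 2 * ?s * v))) / 2"
      using 1 2 3 by (simp add: algebra_simps)
    then have "f z2 g2 - f z g \<le> ((f z g - f (z - 2 * ?s * u) g) + (f z g - f z (g - 2 * ?s * v))) / 2 / ?s"
      using t(1)[of n] by (simp add: field_simps)
    moreover have "(p + q) / 2 / s = (p / s + q / s) / 2" for p q s :: real by (simp add: add_divide_distrib mult.commute)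
    ultimately show ?thesis by (simp only:)
  qed
  ultimately have "f z2 g2 - f z g \<le> (2 * dz * u + 2 * dg * v) / 2" using LIMSEQ_le_const by blast
  then show ?thesis by (simp add: u_def v_def)
qed

lemma hamiltonian_concave:
  assumes data: "admissible_data A b \<sigma> F G" and mu: "\<mu> \<in> P2" and l: "0 \<le> l" "l \<le> 1"
  shows "l * hamiltonian A b \<sigma> F x z1 g1 \<mu> + (1 - l) * hamiltonian A b \<sigma> F x z2 g2 \<mu>
    \<le> hamiltonian A b \<sigma> F x (l * z1 + (1 - l) * z2) (l * g1 + (1 - l) * g2) \<mu>"
proof -
  let ?f = "\<lambda>z g a. 1/2 * (\<sigma> x \<mu> a)\<^sup>2 * g + b x \<mu> a * z + F x \<mu> a"
  have A: "A \<noteq> {}" using data by (simp add: admissible_data_def)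
  note D = data[unfolded admissible_data_def bounded_lipschitz_def]
  obtain Cb where Cb: "\<And>a. a \<in> A \<Longrightarrow> \<bar>b x \<mu> a\<bar> \<le> Cb"
    using D[THEN conjunct2, THEN conjunct1, THEN conjunct1] mu by blast
  obtain Cs where Cs: "\<And>a. a \<in> A \<Longrightarrow> \<bar>\<sigma> x \<mu> a\<bar> \<le> Cs"
    using D[THEN conjunct2, THEN conjunct2, THEN conjunct1, THEN conjunct1] mu by blast
  obtain CF where CF: "\<And>a. a \<in> A \<Longrightarrow> \<bar>F x \<mu> a\<bar> \<le> CF"
    using D[THEN conjunct2, THEN conjunct2, THEN conjunct2, THEN conjunct2, THEN conjunct2, THEN conjunct1] mu by blast
  \<comment> \<open>Boundedness of the data in the control keeps the values bounded below, without
    which the infimum need not be a lower bound.\<close>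
  have bdd: "bdd_below (?f z g ` A)" for z g
  proof (rule bdd_belowI2)
    fix a assume a: "a \<in> A"
    have "\<bar>1/2 * (\<sigma> x \<mu> a)\<^sup>2 * g\<bar> \<le> 1/2 * Cs\<^sup>2 * \<bar>g\<bar>"
      using power_mono[OF Cs[OF a] abs_ge_zero, of 2] by (simp add: abs_mult mult_right_mono)
    moreover have "\<bar>b x \<mu> a * z\<bar> \<le> Cb * \<bar>z\<bar>" using Cb[OF a] by (simp add: abs_mult mult_right_mono)
    ultimately show "- (1/2 * Cs\<^sup>2 * \<bar>g\<bar>) - Cb * \<bar>z\<bar> - CF \<le> ?f z g a" using CF[OF a] by linarith
  qed
  show ?thesis unfolding hamiltonian_def
  proof (rule cINF_greatest[OF A])
    fix a assume a: "a \<in> A"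
    have "l * (INF a\<in>A. ?f z1 g1 a) + (1 - l) * (INF a\<in>A. ?f z2 g2 a) \<le> l * ?f z1 g1 a + (1 - l) * ?f z2 g2 a"
      using l by (intro add_mono mult_left_mono cINF_lower[OF bdd a]) auto
    also have "\<dots> = ?f (l * z1 + (1 - l) * z2) (l * g1 + (1 - l) * g2) a" by (simp add: algebra_simps diff_divide_distrib)
    finally show "l * (INF a\<in>A. ?f z1 g1 a) + (1 - l) * (INF a\<in>A. ?f z2 g2 a) \<le> ?f (l * z1 + (1 - l) * z2) (l * g1 + (1 - l) * g2) a" .
  qed
qed

text \<open>Connects two notions of partial derivative: derivatives of sections, which occur in the
  master equation, and directional derivatives along basis vectors, in which smoothness and bounds
  are stated.\<close>

lemma Ck_partials:
  assumes "Ck n (uncurry3 H0)" "0 < n"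
  shows "((\<lambda>z. H0 x z g) has_real_derivative Dz H0 x z g) (at z)" "((\<lambda>g. H0 x z g) has_real_derivative Dg H0 x z g) (at g)"
    "Dz H0 x z g = pdiffs [(0, 1, 0)] (uncurry3 H0) (x, z, g)" "Dg H0 x z g = pdiffs [(0, 0, 1)] (uncurry3 H0) (x, z, g)"
    "continuous_on UNIV (\<lambda>(x, z, g). Dz H0 x z g)" "continuous_on UNIV (\<lambda>(x, z, g). Dg H0 x z g)"
proof -
  have B: "(0, 1, 0) \<in> (Basis :: (real \<times> real \<times> real) set)" "(0, 0, 1) \<in> (Basis :: (real \<times> real \<times> real) set)" by (auto simp: Basis_prod_def)
  have d: "pdiffable v (uncurry3 H0) y" if v: "v \<in> Basis" for v y
    using assms(1)[unfolded Ck_def, rule_format, of "[]"] assms(2) v by (cases y) (simp add: pdiffs_def)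
  have c: "continuous_on UNIV (pdiffs [v] (uncurry3 H0))" if v: "v \<in> Basis" for v
    using assms(1)[unfolded Ck_def, rule_format, of "[v]"] assms(2) v by simp
  have 1: "((\<lambda>z. H0 x z g) has_real_derivative pdiffs [(0, 1, 0)] (uncurry3 H0) (x, z, g)) (at z)" for x z g
    using pdiffable_DERIV[OF d[OF B(1)], of "(x, z, g)"] DERIV_shift[of "\<lambda>z. H0 x z g" _ 0 z] by (simp add: add.commute pdiffs_def)
  have 2: "((\<lambda>g. H0 x z g) has_real_derivative pdiffs [(0, 0, 1)] (uncurry3 H0) (x, z, g)) (at g)" for x z g
    using pdiffable_DERIV[OF d[OF B(2)], of "(x, z, g)"] DERIV_shift[of "\<lambda>g. H0 x z g" _ 0 g] by (simp add: add.commute pdiffs_def)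
  show e1: "Dz H0 x z g = pdiffs [(0, 1, 0)] (uncurry3 H0) (x, z, g)" for x z g unfolding Dz_def by (rule DERIV_imp_deriv[OF 1])
  show e2: "Dg H0 x z g = pdiffs [(0, 0, 1)] (uncurry3 H0) (x, z, g)" for x z g unfolding Dg_def by (rule DERIV_imp_deriv[OF 2])
  show "((\<lambda>z. H0 x z g) has_real_derivative Dz H0 x z g) (at z)" unfolding e1 by (rule 1)
  show "((\<lambda>g. H0 x z g) has_real_derivative Dg H0 x z g) (at g)" unfolding e2 by (rule 2)
  show "continuous_on UNIV (\<lambda>(x, z, g). Dz H0 x z g)" unfolding e1 using c[OF B(1)] by (simp add: case_prod_eta)
  show "continuous_on UNIV (\<lambda>(x, z, g). Dg H0 x z g)" unfolding e2 using c[OF B(2)] by (simp add: case_prod_eta)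
qed

lemma cont_P2_cong:
  assumes "\<And>y \<mu>. \<mu> \<in> P2 \<Longrightarrow> f y \<mu> = h y \<mu>"
  shows "cont_P2 S f \<longleftrightarrow> cont_P2 S h"
  unfolding cont_P2_def by (simp add: assms)

context mfg_space
begin

lemma regular_mono: "regular U D D1 D2 C \<Longrightarrow> C \<le> C' \<Longrightarrow> regular U D D1 D2 C'"
  unfolding regular_def by (meson order_trans)

text \<open>\<open>U\<close> is regarded as a function constant in time, so that the facts about
  time-dependent functions apply at time \<open>T\<close>.\<close>

lemma mono_gap_of_lasry_lions:
  assumes reg: "C12b M (\<F> T) T (\<lambda>_. U)" and LL: "lasry_lions M (\<F> T) (\<F> T) U"
  obtains L where "\<And>m x y. m \<in> P2 \<Longrightarrow> \<bar>U x m - U y m\<bar> \<le> L * \<bar>x - y\<bar>"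
    "\<And>\<mu> \<nu>. \<mu> \<in> P2 \<Longrightarrow> \<nu> \<in> P2 \<Longrightarrow> 0 \<le> mono_gap U \<mu> \<nu>"
proof -
  obtain C where R: "\<And>t. t \<in> {0..T} \<Longrightarrow> regular U (dmu M (\<F> T) U) (pd (1, 0) (dmu M (\<F> T) U)) (pd (0, 1) (dmu M (\<F> T) U)) C"
    by (rule C12b_regular[OF reg]) blast
  obtain L where d: "\<And>t \<mu> x. t \<in> {0..T} \<Longrightarrow> \<mu> \<in> P2 \<Longrightarrow> ((\<lambda>x. U x \<mu>) has_real_derivative pd 1 U x \<mu>) (at x)"
    and b: "\<And>t \<mu> x. t \<in> {0..T} \<Longrightarrow> \<mu> \<in> P2 \<Longrightarrow> \<bar>pd 1 U x \<mu>\<bar> \<le> L \<and> \<bar>pd 1 (pd 1 U) x \<mu>\<bar> \<le> L \<and> \<bar>dt T (\<lambda>_. U) t x \<mu>\<bar> \<le> L"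
    and c: "cont_Theta T (\<lambda>_. U)"
    by (rule C12b_space_time[OF reg]) blast
  have lip: "\<bar>U x m - U y m\<bar> \<le> L * \<bar>x - y\<bar>" if m: "m \<in> P2" for m x y
  proof -
    obtain z where "U x m - U y m = pd 1 U z m * (x - y)" using mvt_real[OF d[OF T_in(1) m], of y x] by blast
    then show ?thesis using b[OF T_in(1) m, of z] by (simp add: abs_mult mult_right_mono)
  qed
  have "0 \<le> mono_gap U \<mu> \<nu>" if "\<mu> \<in> P2" "\<nu> \<in> P2" for \<mu> \<nu>
    by (rule lasry_lions_imp_mono_gap[OF R[OF T_in(1)] cont_Theta_slice[OF c T_in(1)] lip LL[unfolded lasry_lions_def, rule_format] that(2,1)])
  with lip show thesis by (rule that)
qed

end

theorem theorem5p1: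
  fixes M :: "'w measure" and \<G>0 :: "'w measure" and \<F> :: "real \<Rightarrow> 'w measure"
    and B :: "real \<Rightarrow> 'w \<Rightarrow> real" and T :: real
    and A :: "real set" and b \<sigma> F :: "real \<Rightarrow> real measure \<Rightarrow> real \<Rightarrow> real"
    and G F0 :: "real \<Rightarrow> real measure \<Rightarrow> real"
    and H0 :: "real \<Rightarrow> real \<Rightarrow> real \<Rightarrow> real"
    and V :: "real \<Rightarrow> real \<Rightarrow> real measure \<Rightarrow> real"
    and L_G L_T L_F0 c0 :: real and L_H0 c :: "real \<Rightarrow> real"
  assumes T: "T > 0"
    and space: "filtered_space M \<G>0 T B"
    and filtration: "\<F> = filt M \<G>0 B"
    and data: "admissible_data A b \<sigma> F G"
    and G_reg: "C26b M (\<F> T) T (\<lambda>_. G)" "L_G > 0" "deriv_bounds M (\<F> T) L_G G"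
    and hjb: "L_T > 0"
      "\<forall>\<xi>\<in>L2 M (\<F> 0). \<forall>\<alpha>\<in>controls T A. \<forall>X. state_solution M \<F> T B b \<sigma> \<xi> \<alpha> X \<longrightarrow>
         (\<exists>u. C16b T u
            \<and> hjb_solution T (hamiltonian A b \<sigma> F) G (\<lambda>t. law M (X t)) u
            \<and> (\<forall>u'. C16b T u' \<and> hjb_solution T (hamiltonian A b \<sigma> F) G (\<lambda>t. law M (X t)) u' \<longrightarrow>
                 (\<forall>t\<in>{0..T}. \<forall>x. u' t x = u t x))
            \<and> (\<forall>k\<in>{1..4}. \<forall>t\<in>{0..T}. \<forall>x. \<bar>(deriv ^^ k) (u t) x\<bar> \<le> L_T))"
    and separable: "\<forall>x z \<gamma>. \<forall>\<mu>\<in>P2. hamiltonian A b \<sigma> F x z \<gamma> \<mu> = H0 x z \<gamma> + F0 x \<mu>"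
    and F0_reg: "C26b M (\<F> T) T (\<lambda>_. F0)" "L_F0 > 0" "deriv_bounds M (\<F> T) L_F0 F0"
    and H0_reg: "Ck 6 (uncurry3 H0)"
      "\<forall>R>0. \<exists>C. \<forall>vs. set vs \<subseteq> Basis \<and> length vs \<in> {1..6} \<longrightarrow>
         (\<forall>x. \<forall>z\<in>{-R..R}. \<forall>\<gamma>\<in>{-R..R}. \<bar>pdiffs vs (uncurry3 H0) (x, z, \<gamma>)\<bar> \<le> C)"
      "\<forall>R>0. L_H0 R > 0 \<and> (\<forall>vs. set vs \<subseteq> Basis \<and> length vs \<in> {1..4} \<longrightarrow>
         (\<forall>x. \<forall>z\<in>{-R..R}. \<forall>\<gamma>\<in>{-R..R}. \<bar>pdiffs vs (uncurry3 H0) (x, z, \<gamma>)\<bar> \<le> L_H0 R))"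
    and H0_elliptic: "c0 > 0" "\<forall>x z \<gamma>. Dg H0 x z \<gamma> \<ge> c0"
    and H0_concave: "\<forall>R>0. c R > 0 \<and> (\<forall>x. \<forall>z\<in>{-R..R}. \<forall>\<gamma>\<in>{-R..R}.
         loewner_le (hessian_zg H0 x z \<gamma>) (- c R *\<^sub>R mat 1))"
    and monotone: "lasry_lions M (\<F> T) (\<F> T) G" "lasry_lions M (\<F> T) (\<F> T) F0"
    and V: "C14b M (\<F> T) T V" "master_solution M (\<F> T) T H0 F0 G V"
  shows "\<forall>t\<in>{0..T}. lasry_lions M (\<F> T) (\<F> t) (V t) \<and> lasry_lions2 M (\<F> T) (\<F> t) (V t)"
proof -
  interpret mfg_space M \<G>0 B T by unfold_locales (rule T, rule space)
  have FT: "\<F> = filt M \<G>0 B" by (rule filtration)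
  note V14 = V(1)[unfolded FT] and VM = V(2)[unfolded FT]
  have C12: "C12b M (filt M \<G>0 B T) T (\<lambda>t. pds vs (V t))" if "set vs \<subseteq> {1}" "length vs \<le> 2" for vs
    using V14 that unfolding C14b_def by simp
  have V0: "C12b M (filt M \<G>0 B T) T V" using C12[of "[]"] by (simp add: pds_def)
  have V1: "C12b M (filt M \<G>0 B T) T (\<lambda>t. pd 1 (V t))" using C12[of "[1]"] by (simp add: pds_def)
  have V2: "C12b M (filt M \<G>0 B T) T (\<lambda>t. pd 1 (pd 1 (V t)))" using C12[of "[1, 1]"] by (simp add: pds_def)
  have base: "C12b M (filt M \<G>0 B T) T (\<lambda>_. U)" if "C26b M (filt M \<G>0 B T) T (\<lambda>_. U)" for U :: "real \<Rightarrow> real measure \<Rightarrow> real"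
    using that unfolding C26b_def C14b_def by (metis empty_subsetI foldr.simps(1) id_apply le0 list.set(1) list.size(3) pds_def)
  obtain LG where Gm: "\<And>\<mu> \<nu>. \<mu> \<in> P2 \<Longrightarrow> \<nu> \<in> P2 \<Longrightarrow> 0 \<le> mono_gap G \<mu> \<nu>"
    by (rule mono_gap_of_lasry_lions[OF base[OF G_reg(1)[unfolded FT]] monotone(1)[unfolded FT]]) blast
  obtain LF where Fl: "\<And>m x y. m \<in> P2 \<Longrightarrow> \<bar>F0 x m - F0 y m\<bar> \<le> LF * \<bar>x - y\<bar>"
    and Fm: "\<And>\<mu> \<nu>. \<mu> \<in> P2 \<Longrightarrow> \<nu> \<in> P2 \<Longrightarrow> 0 \<le> mono_gap F0 \<mu> \<nu>"
    by (rule mono_gap_of_lasry_lions[OF base[OF F0_reg(1)[unfolded FT]] monotone(2)[unfolded FT]]) blast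
  let ?D = "\<lambda>t. dmu M (filt M \<G>0 B T) (V t)"
  obtain C0 where R0: "\<And>t. t \<in> {0..T} \<Longrightarrow> regular (V t) (?D t) (pd (1, 0) (?D t)) (pd (0, 1) (?D t)) C0"
    by (rule C12b_regular[OF V0]) blast
  let ?E = "\<lambda>t. dmu M (filt M \<G>0 B T) (pd 1 (V t))"
  obtain C1 where R1: "\<And>t. t \<in> {0..T} \<Longrightarrow> regular (pd 1 (V t)) (?E t) (pd (1, 0) (?E t)) (pd (0, 1) (?E t)) C1"
    by (rule C12b_regular[OF V1]) blast
  let ?K = "\<lambda>t. dmu M (filt M \<G>0 B T) (pd 1 (pd 1 (V t)))"
  obtain C2 where R2: "\<And>t. t \<in> {0..T} \<Longrightarrow> regular (pd 1 (pd 1 (V t))) (?K t) (pd (1, 0) (?K t)) (pd (0, 1) (?K t)) C2"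
    by (rule C12b_regular[OF V2]) blast
  obtain C3 where Vx: "\<And>t \<mu> x. t \<in> {0..T} \<Longrightarrow> \<mu> \<in> P2 \<Longrightarrow> ((\<lambda>x. V t x \<mu>) has_real_derivative pd 1 (V t) x \<mu>) (at x)"
    and Vxx: "\<And>t \<mu> x. t \<in> {0..T} \<Longrightarrow> \<mu> \<in> P2 \<Longrightarrow> ((\<lambda>x. pd 1 (V t) x \<mu>) has_real_derivative pd 1 (pd 1 (V t)) x \<mu>) (at x)"
    and Vb: "\<And>t \<mu> x. t \<in> {0..T} \<Longrightarrow> \<mu> \<in> P2 \<Longrightarrow> \<bar>pd 1 (V t) x \<mu>\<bar> \<le> C3 \<and> \<bar>pd 1 (pd 1 (V t)) x \<mu>\<bar> \<le> C3 \<and> \<bar>dt T V t x \<mu>\<bar> \<le> C3"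
    and Vc: "\<And>t. t \<in> {0..T} \<Longrightarrow> cont_P2 UNIV (pd 1 (pd 1 (V t)))"
    and Vt: "\<And>t \<mu> x. t \<in> {0..T} \<Longrightarrow> \<mu> \<in> P2 \<Longrightarrow> ((\<lambda>t. V t x \<mu>) has_real_derivative dt T V t x \<mu>) (at t within {0..T})"
    and Vcont: "cont_Theta T V" "cont_Theta T (dt T V)"
    by (rule C12b_space_time[OF V0]) blast
  \<comment> \<open>One radius bounds the Lions derivative of \<open>V\<close> with its first
    derivatives and the space and time derivatives of \<open>V\<close>; the slopes of
    \<open>H0\<close> are estimated on the square of this radius. The 1 makes it positive.\<close>
  define R where "R = max 1 (max C0 C3)"
  have R: "R > 0" "C0 \<le> R" "C3 \<le> R" by (auto simp: R_def)
  have P2_ne: "law M (\<lambda>_. 0) \<in> P2" by (rule law_P2[OF prob_space_axioms]) auto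
  note H = Ck_partials[OF H0_reg(1) zero_less_numeral]
  \<comment> \<open>The Hamiltonian is frozen at one measure, the point mass at 0; the summand
    \<open>F0\<close> is the same on both sides because the weights add up to 1.\<close>
  have concave: "l * H0 x z1 g1 + (1 - l) * H0 x z2 g2 \<le> H0 x (l * z1 + (1 - l) * z2) (l * g1 + (1 - l) * g2)"
    if "0 \<le> l" "l \<le> 1" for l x z1 g1 z2 g2
    using hamiltonian_concave[OF data P2_ne that, of x z1 g1 z2 g2] separable P2_ne by (simp add: algebra_simps)
  have VT: "V T x \<mu> = G x \<mu>" if "\<mu> \<in> P2" for x \<mu> using VM that by (simp add: master_solution_def)
  interpret flow: master_flow M \<G>0 B T V "\<lambda>t. pd 1 (V t)" "\<lambda>t. pd 1 (pd 1 (V t))" "dt T V"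
    ?D "\<lambda>t. pd (1, 0) (?D t)" "\<lambda>t. pd (0, 1) (?D t)" H0 "Dz H0" "Dg H0" F0 R "L_H0 R" LF
  proof unfold_locales
    fix t assume t: "t \<in> {0..T}"
    show "regular (V t) (?D t) (pd (1, 0) (?D t)) (pd (0, 1) (?D t)) R" by (rule regular_mono[OF R0[OF t] R(2)])
  next
    show "cont_P2 ({0..T} \<times> UNIV) (\<lambda>(t, x). V t x)" "cont_P2 ({0..T} \<times> UNIV) (\<lambda>(t, x). dt T V t x)"
      using Vcont by (simp_all add: cont_Theta_def)
  next
    fix t \<mu> x assume t: "t \<in> {0..T}" and mu: "\<mu> \<in> P2"
    show "((\<lambda>x. V t x \<mu>) has_real_derivative pd 1 (V t) x \<mu>) (at x)" by (rule Vx[OF t mu])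
    show "((\<lambda>x. pd 1 (V t) x \<mu>) has_real_derivative pd 1 (pd 1 (V t)) x \<mu>) (at x)" by (rule Vxx[OF t mu])
    show "\<bar>pd 1 (V t) x \<mu>\<bar> \<le> R \<and> \<bar>pd 1 (pd 1 (V t)) x \<mu>\<bar> \<le> R \<and> \<bar>dt T V t x \<mu>\<bar> \<le> R"
      using Vb[OF t mu, of x] R(3) by linarith
    show "((\<lambda>t. V t x \<mu>) has_real_derivative dt T V t x \<mu>) (at t within {0..T})" by (rule Vt[OF t mu])
    show "continuous_on UNIV (\<lambda>x. pd 1 (pd 1 (V t)) x \<mu>)" by (rule cont_P2_continuous_on[OF Vc[OF t] mu])
    show "dt T V t x \<mu> + H0 x (pd 1 (V t) x \<mu>) (pd 1 (pd 1 (V t)) x \<mu>) + F0 x \<mu>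
        + (\<integral>x'. ?D t (x, x') \<mu> * Dz H0 x' (pd 1 (V t) x' \<mu>) (pd 1 (pd 1 (V t)) x' \<mu>)
          + pd (0, 1) (?D t) (x, x') \<mu> * Dg H0 x' (pd 1 (V t) x' \<mu>) (pd 1 (pd 1 (V t)) x' \<mu>) \<partial>\<mu>) = 0"
      using VM t mu unfolding master_solution_def by blast
  next
    show "H0 x z2 g2 \<le> H0 x z1 g1 + Dz H0 x z1 g1 * (z2 - z1) + Dg H0 x z1 g1 * (g2 - g1)" for x z1 g1 z2 g2
      by (rule gradient_inequality[OF concave H(1,2)])
    show "continuous_on UNIV (\<lambda>(x, z, g). Dz H0 x z g)" "continuous_on UNIV (\<lambda>(x, z, g). Dg H0 x z g)" by (rule H(5), rule H(6))
  next
    fix x z g :: real assume zg: "\<bar>z\<bar> \<le> R" "\<bar>g\<bar> \<le> R"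
    have b: "\<bar>pdiffs vs (uncurry3 H0) (x, z, g)\<bar> \<le> L_H0 R" if "set vs \<subseteq> Basis \<and> length vs \<in> {1..4}" for vs
      using H0_reg(3)[rule_format, OF R(1), THEN conjunct2, rule_format, OF that, of z g x] zg by (simp add: abs_le_iff minus_le_iff)
    have B: "(0, 1, 0) \<in> (Basis :: (real \<times> real \<times> real) set)" "(0, 0, 1) \<in> (Basis :: (real \<times> real \<times> real) set)" by (auto simp: Basis_prod_def)
    have "\<bar>Dz H0 x z g\<bar> \<le> L_H0 R" "\<bar>Dg H0 x z g\<bar> \<le> L_H0 R" unfolding H(3,4) by (rule b, simp add: B)+
    moreover have "0 \<le> Dg H0 x z g" using H0_elliptic by (meson less_imp_le order_trans)
    ultimately show "\<bar>Dz H0 x z g\<bar> \<le> L_H0 R \<and> 0 \<le> Dg H0 x z g \<and> Dg H0 x z g \<le> L_H0 R" by simp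
  next
    fix \<mu> \<nu> assume P: "\<mu> \<in> P2" "\<nu> \<in> P2"
    show "0 \<le> mono_gap F0 \<mu> \<nu>" by (rule Fm[OF P])
    show "0 \<le> mono_gap (V T) \<mu> \<nu>" using Gm[OF P] by (simp add: mono_gap_def VT P)
  qed (rule Fl)
  show ?thesis unfolding FT
  proof (intro ballI conjI)
    fix t assume t: "t \<in> {0..T}"
    let ?g = "pd (1, 0) (?D t)"
    \<comment> \<open>The gap sees only laws, so the form is nonnegative for all variables known at
      \<open>T\<close>; those known at \<open>t\<close> are a special case, and the sign argument
      may use auxiliary variables.\<close>
    have LL: "0 \<le> (\<integral>p. ?g (\<xi> (fst p), \<xi> (snd p)) (law M \<xi>) * \<eta> (fst p) * \<eta> (snd p) \<partial>(M \<Otimes>\<^sub>M M))"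
      if "\<xi> \<in> L2 M (filt M \<G>0 B T)" "\<eta> \<in> L2 M (filt M \<G>0 B T)" for \<xi> \<eta>
      by (rule mono_gap_imp_lasry_lions[OF R0[OF t] flow.V_lipschitz[OF t] flow.mono_gap_V_nonneg[OF t] that])
    have mono: "X \<in> L2 M (filt M \<G>0 B t) \<Longrightarrow> X \<in> L2 M (filt M \<G>0 B T)" for X by (rule LF_mono[of t T X]) (use t in auto)
    show "lasry_lions M (filt M \<G>0 B T) (filt M \<G>0 B t) (V t)"
      unfolding lasry_lions_def using LL mono by blast
    \<comment> \<open>Exchange of derivatives identifies \<open>?g\<close> with the Lions derivative
      of the first space derivative, and its space derivative with that of the second one; their
      continuity, bounds and derivatives are known.\<close>
    have gE: "?g z \<mu> = ?E t z \<mu>" if "\<mu> \<in> P2" for z \<mu>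
      using lions_deriv_commute[OF R0[OF t] R1[OF t] Vx[OF t] that, of "fst z" "snd z"] by simp
    have EK: "pd (1, 0) (?E t) z \<mu> = ?K t z \<mu>" if "\<mu> \<in> P2" for z \<mu>
      using lions_deriv_commute[OF R1[OF t] R2[OF t] Vxx[OF t] that, of "fst z" "snd z"] by simp
    \<comment> \<open>The exchange holds at every point for a fixed measure, so it may be
      differentiated in space.\<close>
    have gx: "pd (1, 0) ?g z \<mu> = ?K t z \<mu>" if "\<mu> \<in> P2" for z \<mu>
      by (rule trans[OF pd_cong EK[OF that]], rule gE[OF that])
    have gy: "pd (0, 1) ?g z \<mu> = pd (0, 1) (?E t) z \<mu>" if "\<mu> \<in> P2" for z \<mu>
      by (rule pd_cong, rule gE[OF that])
    have gxy: "pd (0, 1) (pd (1, 0) ?g) z \<mu> = pd (0, 1) (?K t) z \<mu>" if "\<mu> \<in> P2" for z \<mu>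
      by (rule pd_cong, rule gx[OF that])
    note D0 = regularD[OF R0[OF t]] and D1 = regularD[OF R1[OF t]] and D2 = regularD[OF R2[OF t]]
    interpret so: second_order M \<G>0 B T ?g "pd (1, 0) ?g" "pd (0, 1) ?g" "pd (0, 1) (pd (1, 0) ?g)" "max C1 C2"
    proof unfold_locales
      show "cont_P2 UNIV ?g" by (rule D0(5))
      show "cont_P2 UNIV (pd (1, 0) ?g)" using cont_P2_cong[of "pd (1, 0) ?g" "?K t", OF gx] D2(4) by blast
      show "cont_P2 UNIV (pd (0, 1) ?g)" using cont_P2_cong[of "pd (0, 1) ?g" "pd (0, 1) (?E t)", OF gy] D1(6) by blast
      show "cont_P2 UNIV (pd (0, 1) (pd (1, 0) ?g))" using cont_P2_cong[of "pd (0, 1) (pd (1, 0) ?g)" "pd (0, 1) (?K t)", OF gxy] D2(6) by blast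
    next
      fix z :: "real \<times> real" and \<mu> assume mu: "\<mu> \<in> P2"
      show "\<bar>?g z \<mu>\<bar> \<le> max C1 C2" using D1(7)[OF mu, of z] by (simp add: gE[OF mu])
      show "\<bar>pd (1, 0) ?g z \<mu>\<bar> \<le> max C1 C2" using D2(7)[OF mu, of z] by (simp add: gx[OF mu])
      show "\<bar>pd (0, 1) ?g z \<mu>\<bar> \<le> max C1 C2" using D1(9)[OF mu, of z] by (simp add: gy[OF mu])
      show "\<bar>pd (0, 1) (pd (1, 0) ?g) z \<mu>\<bar> \<le> max C1 C2" using D2(9)[OF mu, of z] by (simp add: gxy[OF mu])
    next
      fix x y \<mu> assume mu: "\<mu> \<in> P2"
      show "((\<lambda>x. ?g (x, y) \<mu>) has_real_derivative pd (1, 0) ?g (x, y) \<mu>) (at x)"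
        unfolding gE[OF mu] gx[OF mu] EK[OF mu, symmetric] by (rule D1(2)[OF mu])
      show "((\<lambda>y. ?g (x, y) \<mu>) has_real_derivative pd (0, 1) ?g (x, y) \<mu>) (at y)"
        unfolding gE[OF mu] gy[OF mu] by (rule D1(3)[OF mu])
      show "((\<lambda>y. pd (1, 0) ?g (x, y) \<mu>) has_real_derivative pd (0, 1) (pd (1, 0) ?g) (x, y) \<mu>) (at y)"
        unfolding gx[OF mu] gxy[OF mu] by (rule D2(3)[OF mu])
    qed (rule LL)
    have form: "vector [p1, p2] \<bullet> (Dmat M (filt M \<G>0 B T) (V t) x \<mu> x' *v vector [q1, q2]) = so.quad \<mu> x x' p1 p2 q1 q2"
      for p1 p2 q1 q2 x x' :: real and \<mu>
      by (simp add: Dmat_def so.quad_def Let_def inner_vec_def matrix_vector_mult_def sum_2 algebra_simps)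
    show "lasry_lions2 M (filt M \<G>0 B T) (filt M \<G>0 B t) (V t)"
      unfolding lasry_lions2_def form by (intro ballI so.quad_nonneg mono)
  qed
qed

end
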